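(* Let $s\in(0,1)$, $N>2s$, $2^*=\frac{2N}{N-2s}$, $p\ge 2^*-1$ and $q>(p-1)\frac{N}{2s}-1$ (in particular $q>p$). If $u$ is a weak solution of $$(-\Delta)^s u=u^p-u^q\ \text{ in }\mathbb{R}^N,\quad u\in\dot H^s(\mathbb{R}^N)\cap L^{q+1}(\mathbb{R}^N),\quad u>0\ \text{ in }\mathbb{R}^N,$$ then there exist positive constants $C$ and $R'$ such that $$|\nabla u(x)|\le C|x|^{-(N-2s+1)}\quad\text{for } |x|>R'.$$
   Context: $c_{N,s}=\frac{2^{2s}s\,\Gamma(\frac N2+s)}{\pi^{N/2}\Gamma(1-s)}$. Set $\|u\|^2_{\dot H^s(\mathbb{R}^N)}=\frac{c_{N,s}}{2}\int_{\mathbb{R}^N}\int_{\mathbb{R}^N}\frac{|u(x)-u(y)|^2}{|x-y|^{N+2s}}\,dx\,dy$; $\dot H^s(\mathbb{R}^N)$ is the completion of $C_0^\infty(\mathbb{R}^N)$ with respect to $\|u\|_{\dot H^s(\mathbb{R}^N)}+|u|_{L^{2^*}(\mathbb{R}^N)}$. A weak solution of the problem is a function $u\in\dot H^s(\mathbb{R}^N)\cap L^{q+1}(\mathbb{R}^N)$ with $u>0$ in $\mathbb{R}^N$ such that for every $\varphi\in\dot H^s(\mathbb{R}^N)$ $$\frac{c_{N,s}}{2}\int_{\mathbb{R}^N}\int_{\mathbb{R}^N}\frac{(u(x)-u(y))(\varphi(x)-\varphi(y))}{|x-y|^{N+2s}}\,dx\,dy=\int_{\mathbb{R}^N}u^p\varphi\,dx-\int_{\mathbb{R}^N}u^q\varphi\,dx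 .$$ *)

theory Defs
  imports "HOL-Analysis.Analysis"
begin

definition frac_const :: "real \<Rightarrow> real \<Rightarrow> real" where
  "frac_const N s = 2 powr (2 * s) * s * Gamma (N / 2 + s) / (pi powr (N / 2) * Gamma (1 - s))"

definition crit_exp :: "real \<Rightarrow> real \<Rightarrow> real" where
  "crit_exp N s = 2 * N / (N - 2 * s)"

text \<open>Real powers of extended nonnegative reals, only meant for a positive exponent.\<close>

definition ennpowr :: "ennreal \<Rightarrow> real \<Rightarrow> ennreal" where
  "ennpowr a r = (if a = \<infinity> then \<infinity> else ennreal (enn2real a powr r))"

definition Lp_norm :: "real \<Rightarrow> (real^'n \<Rightarrow> real) \<Rightarrow> ennreal" where
  "Lp_norm r u = ennpowr (\<integral>\<^sup>+x. ennreal (\<bar>u x\<bar> powr r) \<partial>lebesgue) (1 / r)"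

definition Lp_space :: "real \<Rightarrow> (real^'n \<Rightarrow> real) set" where
  "Lp_space r = {u \<in> borel_measurable lebesgue. Lp_norm r u < \<infinity>}"

text \<open>The diagonal contributes nothing to the integrals below, since division by zero yields zero.\<close>

definition Hs_seminorm :: "real \<Rightarrow> (real^'n \<Rightarrow> real) \<Rightarrow> ennreal" where
  "Hs_seminorm s u = ennpowr
     (ennreal (frac_const (real CARD('n)) s / 2) *
      (\<integral>\<^sup>+x. (\<integral>\<^sup>+y. ennreal (\<bar>u x - u y\<bar>\<^sup>2 / norm (x - y) powr (real CARD('n) + 2 * s))
         \<partial>lebesgue) \<partial>lebesgue)) (1 / 2)"

definition Hs_form :: "real \<Rightarrow> (real^'n \<Rightarrow> real) \<Rightarrow> (real^'n \<Rightarrow> real) \<Rightarrow> real" where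
  "Hs_form s u \<phi> = frac_const (real CARD('n)) s / 2 *
     (LINT x|lebesgue. (LINT y|lebesgue.
        (u x - u y) * (\<phi> x - \<phi> y) / norm (x - y) powr (real CARD('n) + 2 * s)))"

primrec Ck :: "nat \<Rightarrow> (real^'n \<Rightarrow> real) \<Rightarrow> bool" where
  "Ck 0 f \<longleftrightarrow> continuous_on UNIV f"
| "Ck (Suc k) f \<longleftrightarrow> (\<forall>x. f differentiable (at x)) \<and>
     (\<forall>i. Ck k (\<lambda>x. frechet_derivative f (at x) (axis i 1)))"

definition test_functions :: "(real^'n \<Rightarrow> real) set" where
  "test_functions = {f. (\<forall>k. Ck k f) \<and> compact (closure {x. f x \<noteq> 0})}"

text \<open>The completion of the test functions with respect to the sum of the two norms, realised as
  a space of functions: a Cauchy sequence converges in the Lebesgue space of critical exponent,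
  the limit determines its class (by Fatou's lemma for the seminorm), and the sequence converges
  to the limit in the full norm. As usual, functions that agree almost everywhere stand for the
  same element.\<close>

definition Hs_dot :: "real \<Rightarrow> (real^'n \<Rightarrow> real) set" where
  "Hs_dot s = {u \<in> borel_measurable lebesgue.
     \<exists>\<phi>. (\<forall>k::nat. \<phi> k \<in> test_functions) \<and>
       (\<lambda>k. Hs_seminorm s (\<lambda>x. u x - \<phi> k x) +
            Lp_norm (crit_exp (real CARD('n)) s) (\<lambda>x. u x - \<phi> k x)) \<longlonglongrightarrow> 0}"

text \<open>The integrability conditions say that the right-hand side of the weak formulation is
  meaningful for every admissible test function; without them a divergent integral would
  silently count as zero.\<close>

definition weak_solution :: "real \<Rightarrow> real \<Rightarrow> real \<Rightarrow> (real^'n \<Rightarrow> real) \<Rightarrow> bool" where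
  "weak_solution s p q u \<longleftrightarrow>
     u \<in> Hs_dot s \<and> u \<in> Lp_space (q + 1) \<and> (AE x in lebesgue. u x > 0) \<and>
     (\<forall>\<phi>\<in>Hs_dot s.
        integrable lebesgue (\<lambda>x. u x powr p * \<phi> x) \<and>
        integrable lebesgue (\<lambda>x. u x powr q * \<phi> x) \<and>
        Hs_form s u \<phi> = (LINT x|lebesgue. u x powr p * \<phi> x) - (LINT x|lebesgue. u x powr q * \<phi> x))"

end

theory Submission
  imports Defs
begin

text \<open>
  Testing the weak formulation with Gaussians, which are limits of test functions, and writing
  \<open>|z| powr (-N - 2 s)\<close> as a superposition of heat kernels, turns it into an Abel integral equation
  for the heat flow of \<open>u\<close>. Inverting it shows that \<open>c u\<close> plus the Riesz potential of order \<open>2 s\<close> of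
  \<open>u\<^sup>q\<close> equals the potential of \<open>u\<^sup>p\<close>. As \<open>u\<^sup>p \<le> u\<^sup>q + min 1 u powr (2\<^sup>* - 1)\<close>, this bounds \<open>c u\<close> by the potential
  of \<open>min 1 u powr (2\<^sup>* - 1)\<close>, which is bounded because \<open>u\<close> lies in the critical Lebesgue space.
  For bounded \<open>u\<close> the nonlinearity is dominated by the critical power, and a scale invariant splitting
  of the potential into a near and a far part gives first \<open>u(x) = o(|x| powr (-(N - 2 s)/2))\<close> and then, the critical
  power now being a small perturbation, \<open>u(x) = O(|x| powr (-(N - 2 s)))\<close>. Finally the finite differences of
  \<open>u\<close> satisfy an estimate in which the singular part of the kernel is absorbed; at scale \<open>|x|\<close> this gains
  one more power of \<open>|x|\<close>, and the same estimate with vanishing truncation gives differentiability.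
\<close>

section \<open>Integrals of powers of the norm\<close>

text \<open>The obstacle is that \<open>u\<close> is known only up to null sets and that the
  potentials of \<open>u powr p\<close> and \<open>u powr q\<close> are at first not known to
  converge anywhere. Everything before boundedness is therefore paired with \<open>heat e\<close> at
  a time \<open>e > 0\<close>: the space variable disappears, the fractional Laplacian becomes the
  weight \<open>t powr (- 1 - s)\<close> on increments \<open>U r - U (r + t)\<close> of a scalar
  function, and its inverse becomes Abel's kernel \<open>(r - e) powr (s - 1)\<close>. Fubini's
  theorem is then available. As heat transforms at all positive times determine a nonnegative
  function up to a null set, the equation comes back almost everywhere, as an equality of sums in
  \<open>ennreal\<close>, so that no infinite terms are subtracted. Bounds at every point are stated
  for the representative \<open>v\<close> that the potential itself defines. Scaling ties the
  exponents together: for \<open>A = N - 2 * s\<close> and \<open>al = 2 * N / A\<close> one has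
  \<open>A * (al - 1) = N + 2 * s\<close> and \<open>A * (al - 2) = 4 * s\<close>, which is why
  every splitting radius can be balanced exactly. The condition on \<open>q\<close> enters as
  \<open>p < q\<close>.\<close>

text \<open>One estimate serves both ends: \<open>th = 1/2\<close> exhausts a punctured ball,
  \<open>th = 2\<close> the exterior of one. On each shell the power is comparable to its value at
  the outer radius, so the integral is dominated by a geometric series of ratio
  \<open>th powr (N - a)\<close>, where \<open>N\<close> is the dimension. The shells may overlap,
  since only an upper bound is wanted.\<close>

lemma nn_integral_shells_le:
  fixes S :: "'a::euclidean_space set"
  assumes th: "th > 0" "th powr (real DIM('a) - a) < 1" and r0: "r0 > 0"
    and S: "\<And>x. x \<in> S \<Longrightarrow> x \<noteq> 0 \<Longrightarrow> \<exists>j::nat. r0 * th ^ j / 2 \<le> norm x \<and> norm x < r0 * th ^ j"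
  shows "(\<integral>\<^sup>+x. ennreal (norm x powr (-a)) * indicator S x \<partial>lborel)
    \<le> ennreal (2 powr \<bar>a\<bar> * unit_ball_vol (real DIM('a)) / (1 - th powr (real DIM('a) - a)) * r0 powr (real DIM('a) - a))"
proof -
  define q where "q = th powr (real DIM('a) - a)"
  define V where "V = unit_ball_vol (real DIM('a))"
  have V: "V \<ge> 0" unfolding V_def by simp
  define rh where "rh j = r0 * th ^ j" for j :: nat
  have rh: "rh j > 0" for j unfolding rh_def using th r0 by simp
  define g where "g j x = ennreal (2 powr \<bar>a\<bar> * rh j powr (-a)) * indicator (ball 0 (rh j)) x" for j and x :: 'a
  have [measurable]: "g j \<in> borel_measurable lborel" for j
    unfolding g_def[abs_def]
    by (intro borel_measurable_times_ennreal borel_measurable_const borel_measurable_indicator) simp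
  have ptw: "ennreal (norm x powr (-a)) * indicator S x \<le> (\<Sum>j. g j x)" for x
  proof (cases "x \<in> S \<and> x \<noteq> 0")
    case False
    then show ?thesis by auto
  next
    case True
    then obtain j where "r0 * th ^ j / 2 \<le> norm x" "norm x < r0 * th ^ j" using S[of x] by blast
    then have j: "rh j / 2 \<le> norm x" "norm x < rh j" unfolding rh_def .
    have "norm x powr (-a) \<le> 2 powr \<bar>a\<bar> * rh j powr (-a)"
    proof (cases "a \<ge> 0")
      case True
      have "norm x powr (-a) \<le> (rh j / 2) powr (-a)"
        using j rh[of j] True by (intro powr_mono2') auto
      also have "\<dots> = 2 powr \<bar>a\<bar> * rh j powr (-a)"
        using rh[of j] True by (simp add: powr_divide powr_minus divide_simps)
      finally show ?thesis .
    next
      case False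
      have "norm x powr (-a) \<le> rh j powr (-a)"
        using j rh[of j] False by (intro powr_mono2) auto
      also have "\<dots> \<le> 2 powr \<bar>a\<bar> * rh j powr (-a)"
        using ge_one_powr_ge_zero[of 2 "\<bar>a\<bar>"] by (simp add: mult_le_cancel_right1)
      finally show ?thesis .
    qed
    then have "ennreal (norm x powr (-a)) * indicator S x \<le> g j x"
      unfolding g_def using j True by (simp add: ennreal_leI)
    also have "\<dots> = (\<Sum>i\<in>{j}. g i x)" by simp
    also have "\<dots> \<le> (\<Sum>i. g i x)" by (intro sum_le_suminf) auto
    finally show ?thesis .
  qed
  have gi: "(\<integral>\<^sup>+x. g j x \<partial>lborel) = ennreal (2 powr \<bar>a\<bar> * V * r0 powr (real DIM('a) - a) * q ^ j)" for j
  proof -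
    have "(\<integral>\<^sup>+x. g j x \<partial>lborel) = ennreal (2 powr \<bar>a\<bar> * rh j powr (-a)) * emeasure lborel (ball (0::'a) (rh j))"
      unfolding g_def by (subst nn_integral_cmult_indicator) auto
    also have "\<dots> = ennreal (2 powr \<bar>a\<bar> * rh j powr (-a) * (V * rh j ^ DIM('a)))"
      using rh[of j] V unfolding V_def by (subst emeasure_ball) (auto simp: ennreal_mult)
    also have "2 powr \<bar>a\<bar> * rh j powr (-a) * (V * rh j ^ DIM('a)) = 2 powr \<bar>a\<bar> * V * rh j powr (real DIM('a) - a)"
    proof -
      have "rh j powr (-a) * rh j ^ DIM('a) = rh j powr (real DIM('a) - a)"
        using rh[of j] powr_realpow[of "rh j" "DIM('a)"] powr_add[of "rh j" "-a" "real DIM('a)"] by simp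
      then show ?thesis by (simp add: algebra_simps)
    qed
    also have "rh j powr (real DIM('a) - a) = r0 powr (real DIM('a) - a) * q ^ j"
    proof -
      have "(th ^ j) powr (real DIM('a) - a) = (th powr (real DIM('a) - a)) ^ j"
        using th by (simp add: powr_realpow[symmetric] powr_powr mult.commute)
      then show ?thesis unfolding rh_def q_def using r0 th by (simp add: powr_mult)
    qed
    finally show ?thesis by (simp add: mult.assoc)
  qed
  have q: "0 \<le> q" "q < 1" unfolding q_def using th by auto
  have "(\<integral>\<^sup>+x. ennreal (norm x powr (-a)) * indicator S x \<partial>lborel) \<le> (\<integral>\<^sup>+x. (\<Sum>j. g j x) \<partial>lborel)"
    by (intro nn_integral_mono ptw)
  also have "\<dots> = (\<Sum>j. \<integral>\<^sup>+x. g j x \<partial>lborel)"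
    by (rule nn_integral_suminf) fact
  also have "\<dots> = (\<Sum>j. ennreal (2 powr \<bar>a\<bar> * V * r0 powr (real DIM('a) - a) * q ^ j))" by (simp only: gi)
  also have "\<dots> = ennreal (2 powr \<bar>a\<bar> * V * r0 powr (real DIM('a) - a) * (1 / (1 - q)))"
  proof (rule suminf_ennreal_eq)
    show "0 \<le> 2 powr \<bar>a\<bar> * V * r0 powr (real DIM('a) - a) * q ^ j" for j
      using q V by (intro mult_nonneg_nonneg) auto
    have "(\<lambda>j. q ^ j) sums (1 / (1 - q))" using q by (intro geometric_sums) auto
    then show "(\<lambda>j. 2 powr \<bar>a\<bar> * V * r0 powr (real DIM('a) - a) * q ^ j) sums
      (2 powr \<bar>a\<bar> * V * r0 powr (real DIM('a) - a) * (1 / (1 - q)))" by (rule sums_mult)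
  qed
  finally show ?thesis unfolding q_def V_def by (simp add: mult_ac)
qed

lemma nn_integral_ball_powr:
  assumes "a < real DIM('a::euclidean_space)"
  obtains C where "C > 0"
    "\<And>r. r > 0 \<Longrightarrow> (\<integral>\<^sup>+(x::'a). ennreal (norm x powr (-a)) * indicator {x. norm x < r} x \<partial>lborel)
      \<le> ennreal (C * r powr (real DIM('a) - a))"
proof -
  define q where "q = (1/2::real) powr (real DIM('a) - a)"
  have q: "q > 0" unfolding q_def by simp
  have q1: "q < 1" unfolding q_def using assms powr01_less_one[of "1/2" "real DIM('a) - a"] by simp
  note q = q1 q
  define C where "C = 2 powr \<bar>a\<bar> * unit_ball_vol (real DIM('a)) / (1 - q)"
  have "(\<integral>\<^sup>+(x::'a). ennreal (norm x powr (-a)) * indicator {x. norm x < r} x \<partial>lborel)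
      \<le> ennreal (C * r powr (real DIM('a) - a))" if r: "r > 0" for r
    unfolding C_def q_def
  proof (rule nn_integral_shells_le)
    fix x :: 'a assume x: "x \<in> {x. norm x < r}" "x \<noteq> 0"
    have "\<exists>n. r * (1/2)^n \<le> norm x"
    proof -
      obtain n where "(1/2::real)^n < norm x / r"
        using x r real_arch_pow_inv[of "norm x / r" "1/2"] by auto
      then show ?thesis using r by (auto simp: field_simps intro!: exI[of _ n])
    qed
    then obtain n where n: "r * (1/2)^n \<le> norm x" "\<And>m. m < n \<Longrightarrow> \<not> r * (1/2)^m \<le> norm x"
      using exists_least_iff[of "\<lambda>n. r * (1/2)^n \<le> norm x"] by auto
    have "n \<noteq> 0" using n(1) x by (cases n) auto
    then obtain m where m: "n = Suc m" by (cases n) auto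
    show "\<exists>j. r * (1/2)^j / 2 \<le> norm x \<and> norm x < r * (1/2)^j"
      using n(1) n(2)[of m] by (intro exI[of _ m]) (auto simp: m)
  qed (use q r q_def in auto)
  moreover have "C > 0" unfolding C_def using q by (simp add: unit_ball_vol_pos)
  ultimately show ?thesis using that by blast
qed

lemma nn_integral_outside_ball_powr:
  assumes "real DIM('a::euclidean_space) < a"
  obtains C where "C > 0"
    "\<And>r. r > 0 \<Longrightarrow> (\<integral>\<^sup>+(x::'a). ennreal (norm x powr (-a)) * indicator {x. norm x \<ge> r} x \<partial>lborel)
      \<le> ennreal (C * r powr (real DIM('a) - a))"
proof -
  define q where "q = (2::real) powr (real DIM('a) - a)"
  have q: "q < 1" "q > 0" unfolding q_def using assms by (auto simp: powr_less_one)
  define C where "C = 2 powr \<bar>a\<bar> * unit_ball_vol (real DIM('a)) / (1 - q) * 2 powr (real DIM('a) - a)"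
  have "(\<integral>\<^sup>+(x::'a). ennreal (norm x powr (-a)) * indicator {x. norm x \<ge> r} x \<partial>lborel)
      \<le> ennreal (C * r powr (real DIM('a) - a))" if r: "r > 0" for r
  proof -
    have "(\<integral>\<^sup>+(x::'a). ennreal (norm x powr (-a)) * indicator {x. norm x \<ge> r} x \<partial>lborel)
      \<le> ennreal (2 powr \<bar>a\<bar> * unit_ball_vol (real DIM('a)) / (1 - 2 powr (real DIM('a) - a)) * (2 * r) powr (real DIM('a) - a))"
    proof (rule nn_integral_shells_le)
      fix x :: 'a assume x: "x \<in> {x. norm x \<ge> r}" "x \<noteq> 0"
      have "\<exists>n. norm x < 2 * r * 2^n"
      proof -
        obtain n where "norm x / (2*r) < 2^n"
          using real_arch_pow[of 2 "norm x / (2*r)"] by auto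
        then show ?thesis using r by (auto simp: field_simps intro!: exI[of _ n])
      qed
      then obtain n where n: "norm x < 2 * r * 2^n" "\<And>m. m < n \<Longrightarrow> \<not> norm x < 2 * r * 2^m"
        using exists_least_iff[of "\<lambda>n. norm x < 2 * r * 2^n"] by auto
      show "\<exists>j. 2 * r * 2^j / 2 \<le> norm x \<and> norm x < 2 * r * 2^j"
        using n(1) n(2)[of "n - 1"] x by (intro exI[of _ n]) (cases n, auto)
    qed (use q r q_def in auto)
    also have "\<dots> = ennreal (C * r powr (real DIM('a) - a))"
      unfolding C_def q_def using r by (simp add: powr_mult mult.assoc)
    finally show ?thesis .
  qed
  moreover have "C > 0" unfolding C_def using q by (simp add: unit_ball_vol_pos)
  ultimately show ?thesis using that by blast
qed

section \<open>Changes of variables, and Riesz kernels with an arbitrary centre\<close>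

lemma nn_integral_lborel_translate:
  fixes f :: "'a::euclidean_space \<Rightarrow> ennreal"
  assumes [measurable]: "f \<in> borel_measurable borel"
  shows "(\<integral>\<^sup>+y. f (y + a) \<partial>lborel) = (\<integral>\<^sup>+y. f y \<partial>lborel)"
  by (subst (2) lborel_affine[of 1 a]) (auto simp: nn_integral_density nn_integral_distr add.commute)

lemma nn_integral_lborel_reflect:
  fixes f :: "'a::euclidean_space \<Rightarrow> ennreal"
  assumes [measurable]: "f \<in> borel_measurable borel"
  shows "(\<integral>\<^sup>+y. f (x - y) \<partial>lborel) = (\<integral>\<^sup>+y. f y \<partial>lborel)"
  by (subst (2) lborel_affine[of "-1" x]) (auto simp: nn_integral_density nn_integral_distr add.commute)

lemma nn_integral_lborel_scale:
  fixes f :: "'a::euclidean_space \<Rightarrow> ennreal"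
  assumes [measurable]: "f \<in> borel_measurable borel" and c: "c > 0"
  shows "(\<integral>\<^sup>+y. f (c *\<^sub>R y) \<partial>lborel) = ennreal (c powr (- real DIM('a))) * (\<integral>\<^sup>+y. f y \<partial>lborel)"
proof -
  have "(\<integral>\<^sup>+y. f y \<partial>lborel) = ennreal (c ^ DIM('a)) * (\<integral>\<^sup>+y. f (c *\<^sub>R y) \<partial>lborel)"
    using c by (subst lborel_affine[of c 0]) (auto simp: nn_integral_density nn_integral_distr nn_integral_cmult)
  then have "ennreal (c powr (- real DIM('a))) * (\<integral>\<^sup>+y. f y \<partial>lborel) =
     (ennreal (c powr (- real DIM('a))) * ennreal (c ^ DIM('a))) * (\<integral>\<^sup>+y. f (c *\<^sub>R y) \<partial>lborel)"
    by (simp add: mult.assoc)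
  also have "ennreal (c powr (- real DIM('a))) * ennreal (c ^ DIM('a)) = 1"
    using c powr_realpow[of c "DIM('a)"] powr_add[of c "- real DIM('a)" "real DIM('a)"]
    by (simp add: ennreal_mult[symmetric])
  finally show ?thesis by simp
qed

lemma nn_integral_near_powr:
  assumes "a < real DIM('a::euclidean_space)"
  obtains C where "C > 0"
    "\<And>r (x::'a). r > 0 \<Longrightarrow> (\<integral>\<^sup>+y. ennreal (norm (x - y) powr (-a)) * indicator {y. norm (x - y) < r} y \<partial>lborel)
      \<le> ennreal (C * r powr (real DIM('a) - a))"
proof -
  obtain C where C: "C > 0"
    "\<And>r. r > 0 \<Longrightarrow> (\<integral>\<^sup>+(x::'a). ennreal (norm x powr (-a)) * indicator {x. norm x < r} x \<partial>lborel)
      \<le> ennreal (C * r powr (real DIM('a) - a))"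
    using nn_integral_ball_powr[OF assms] by blast
  have "(\<integral>\<^sup>+y. ennreal (norm (x - y) powr (-a)) * indicator {y. norm (x - y) < r} y \<partial>lborel)
     = (\<integral>\<^sup>+(x::'a). ennreal (norm x powr (-a)) * indicator {x. norm x < r} x \<partial>lborel)" for r and x :: 'a
    by (subst nn_integral_lborel_reflect[of _ x, symmetric])
       (auto intro!: nn_integral_cong simp: indicator_def)
  then show ?thesis using C that by simp
qed

lemma nn_integral_far_powr:
  assumes "real DIM('a::euclidean_space) < a"
  obtains C where "C > 0"
    "\<And>r (x::'a). r > 0 \<Longrightarrow> (\<integral>\<^sup>+y. ennreal (norm (x - y) powr (-a)) * indicator {y. norm (x - y) \<ge> r} y \<partial>lborel)
      \<le> ennreal (C * r powr (real DIM('a) - a))"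
proof -
  obtain C where C: "C > 0"
    "\<And>r. r > 0 \<Longrightarrow> (\<integral>\<^sup>+(x::'a). ennreal (norm x powr (-a)) * indicator {x. norm x \<ge> r} x \<partial>lborel)
      \<le> ennreal (C * r powr (real DIM('a) - a))"
    using nn_integral_outside_ball_powr[OF assms] by blast
  have "(\<integral>\<^sup>+y. ennreal (norm (x - y) powr (-a)) * indicator {y. norm (x - y) \<ge> r} y \<partial>lborel)
     = (\<integral>\<^sup>+(x::'a). ennreal (norm x powr (-a)) * indicator {x. norm x \<ge> r} x \<partial>lborel)" for r and x :: 'a
    by (subst nn_integral_lborel_reflect[of _ x, symmetric])
       (auto intro!: nn_integral_cong simp: indicator_def)
  then show ?thesis using C that by simp
qed

text \<open>Splitting at \<open>r = norm x / 2\<close>: near the origin the first kernel is at most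
  \<open>r powr (-a)\<close>, near \<open>x\<close> the second is at most
  \<open>r powr (-g)\<close>, and elsewhere \<open>norm y \<le> 3 * norm (x - y)\<close>, so the
  product is controlled by \<open>norm y powr (-(a+g))\<close>, which is integrable at infinity
  because \<open>a + g\<close> exceeds the dimension. All three pieces scale with the same power of
  \<open>r\<close>.\<close>

lemma riesz_convolution_le:
  fixes a g :: real
  assumes a: "0 < a" "a < real DIM('a::euclidean_space)" and g: "0 < g" "g < real DIM('a)"
    and ag: "a + g > real DIM('a)"
  obtains C where "C > 0"
    "\<And>x::'a. x \<noteq> 0 \<Longrightarrow> (\<integral>\<^sup>+y. ennreal (norm (x - y) powr (-a) * norm y powr (-g)) \<partial>lborel)
      \<le> ennreal (C * norm x powr (real DIM('a) - a - g))"
proof -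
  obtain C1 where C1: "C1 > 0"
    "\<And>r. r > 0 \<Longrightarrow> (\<integral>\<^sup>+(x::'a). ennreal (norm x powr (-g)) * indicator {x. norm x < r} x \<partial>lborel)
      \<le> ennreal (C1 * r powr (real DIM('a) - g))"
    using nn_integral_ball_powr[OF g(2)] by blast
  obtain C2 where C2: "C2 > 0"
    "\<And>r (x::'a). r > 0 \<Longrightarrow> (\<integral>\<^sup>+y. ennreal (norm (x - y) powr (-a)) * indicator {y. norm (x - y) < r} y \<partial>lborel)
      \<le> ennreal (C2 * r powr (real DIM('a) - a))"
    using nn_integral_near_powr[OF a(2)] by blast
  obtain C3 where C3: "C3 > 0"
    "\<And>r. r > 0 \<Longrightarrow> (\<integral>\<^sup>+(x::'a). ennreal (norm x powr (-(a+g))) * indicator {x. norm x \<ge> r} x \<partial>lborel)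
      \<le> ennreal (C3 * r powr (real DIM('a) - (a+g)))"
    using nn_integral_outside_ball_powr[OF ag] by blast
  define e where "e = real DIM('a) - a - g"
  define C where "C = (C1 + C2 + 3 powr a * C3) * (1/2) powr e"
  have "(\<integral>\<^sup>+y. ennreal (norm (x - y) powr (-a) * norm y powr (-g)) \<partial>lborel) \<le> ennreal (C * norm x powr e)"
    if x: "x \<noteq> 0" for x :: 'a
  proof -
    define r where "r = norm x / 2"
    have r: "r > 0" "norm x = 2 * r" using x by (auto simp: r_def)
    define f1 where "f1 y = ennreal (r powr (-a)) * (ennreal (norm y powr (-g)) * indicator {y. norm y < r} y)" for y :: 'a
    define f2 where "f2 y = ennreal (r powr (-g)) * (ennreal (norm (x - y) powr (-a)) * indicator {y. norm (x - y) < r} y)" for y :: 'a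
    define f3 where "f3 y = ennreal (3 powr a) * (ennreal (norm y powr (-(a+g))) * indicator {y. norm y \<ge> r} y)" for y :: 'a
    have [measurable]: "f1 \<in> borel_measurable borel" "f2 \<in> borel_measurable borel" "f3 \<in> borel_measurable borel"
      unfolding f1_def[abs_def] f2_def[abs_def] f3_def[abs_def] by measurable
    have ptw: "ennreal (norm (x - y) powr (-a) * norm y powr (-g)) \<le> f1 y + (f2 y + f3 y)" for y
    proof -
      consider "norm y < r" | "norm (x - y) < r" "norm y \<ge> r" | "norm (x - y) \<ge> r" "norm y \<ge> r" by linarith
      then show ?thesis
      proof cases
        case 1
        have "norm x \<le> norm (x - y) + norm y" using norm_triangle_ineq[of "x - y" y] by simp
        then have "norm (x - y) \<ge> r" using 1 r by simp
        then have "norm (x - y) powr (-a) \<le> r powr (-a)" using r a by (intro powr_mono2') auto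
        then have "norm (x - y) powr (-a) * norm y powr (-g) \<le> r powr (-a) * norm y powr (-g)"
          by (intro mult_right_mono) auto
        then have "ennreal (norm (x - y) powr (-a) * norm y powr (-g)) \<le> f1 y"
          unfolding f1_def using 1 by (simp add: ennreal_mult[symmetric] ennreal_leI)
        then show ?thesis by (rule order_trans) simp
      next
        case 2
        then have "norm y powr (-g) \<le> r powr (-g)" using r g by (intro powr_mono2') auto
        then have "norm (x - y) powr (-a) * norm y powr (-g) \<le> r powr (-g) * norm (x - y) powr (-a)"
          by (subst mult.commute, intro mult_right_mono) auto
        then have "ennreal (norm (x - y) powr (-a) * norm y powr (-g)) \<le> f2 y"
          unfolding f2_def using 2 by (simp add: ennreal_mult[symmetric] ennreal_leI)
        then show ?thesis by (rule order_trans) (simp add: add_increasing)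
      next
        case 3
        have "norm y \<le> norm x + norm (x - y)" using norm_triangle_ineq4[of x "x - y"] by simp
        then have n: "norm y / 3 \<le> norm (x - y)" using 3 r by simp
        have "norm (x - y) powr (-a) \<le> (norm y / 3) powr (-a)" using n 3 r a by (intro powr_mono2') auto
        also have "\<dots> = 3 powr a * norm y powr (-a)" using 3 r by (simp add: powr_divide powr_minus divide_simps)
        finally have "norm (x - y) powr (-a) * norm y powr (-g) \<le> 3 powr a * norm y powr (-a) * norm y powr (-g)"
          by (intro mult_right_mono) auto
        also have "\<dots> = 3 powr a * norm y powr (-(a+g))" by (simp add: powr_add[symmetric] mult.assoc)
        finally have "ennreal (norm (x - y) powr (-a) * norm y powr (-g)) \<le> f3 y"
          unfolding f3_def using 3 by (simp add: ennreal_mult[symmetric] ennreal_leI)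
        then show ?thesis by (rule order_trans) (simp add: add_increasing)
      qed
    qed
    have "(\<integral>\<^sup>+y. ennreal (norm (x - y) powr (-a) * norm y powr (-g)) \<partial>lborel) \<le> (\<integral>\<^sup>+y. f1 y + (f2 y + f3 y) \<partial>lborel)"
      by (intro nn_integral_mono ptw)
    also have "\<dots> = (\<integral>\<^sup>+y. f1 y \<partial>lborel) + ((\<integral>\<^sup>+y. f2 y \<partial>lborel) + (\<integral>\<^sup>+y. f3 y \<partial>lborel))"
      by (simp add: nn_integral_add)
    also have "(\<integral>\<^sup>+y. f1 y \<partial>lborel) \<le> ennreal (r powr (-a)) * ennreal (C1 * r powr (real DIM('a) - g))"
      unfolding f1_def using C1(2)[OF r(1)] by (subst nn_integral_cmult) (auto intro: mult_left_mono)
    also have "ennreal (r powr (-a)) * ennreal (C1 * r powr (real DIM('a) - g)) = ennreal (C1 * r powr e)"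
      unfolding e_def using r C1 by (simp add: ennreal_mult[symmetric] powr_add[symmetric] algebra_simps)
    also have "(\<integral>\<^sup>+y. f2 y \<partial>lborel) \<le> ennreal (r powr (-g)) * ennreal (C2 * r powr (real DIM('a) - a))"
      unfolding f2_def using C2(2)[OF r(1)] by (subst nn_integral_cmult) (auto intro: mult_left_mono)
    also have "ennreal (r powr (-g)) * ennreal (C2 * r powr (real DIM('a) - a)) = ennreal (C2 * r powr e)"
      unfolding e_def using r C2 by (simp add: ennreal_mult[symmetric] powr_add[symmetric] algebra_simps)
    also have "(\<integral>\<^sup>+y. f3 y \<partial>lborel) \<le> ennreal (3 powr a) * ennreal (C3 * r powr (real DIM('a) - (a+g)))"
      unfolding f3_def using C3(2)[OF r(1)] by (subst nn_integral_cmult) (auto intro: mult_left_mono)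
    also have "ennreal (3 powr a) * ennreal (C3 * r powr (real DIM('a) - (a+g))) = ennreal (3 powr a * C3 * r powr e)"
      unfolding e_def using r C3 by (simp add: ennreal_mult[symmetric] algebra_simps)
    also have "ennreal (C1 * r powr e) + (ennreal (C2 * r powr e) + ennreal (3 powr a * C3 * r powr e))
        = ennreal (C * norm x powr e)"
      unfolding C_def r(2) using C1 C2 C3 r
      by (simp add: ennreal_plus[symmetric] powr_mult powr_divide algebra_simps del: ennreal_plus)
    finally show ?thesis by (simp add: add_mono)
  qed
  moreover have "C > 0" unfolding C_def using C1 C2 C3 by (intro mult_pos_pos add_pos_pos) auto
  ultimately show ?thesis using that unfolding e_def by blast
qed

section \<open>Decay of bounded solutions of the integral inequality\<close>

text \<open>Young's inequality without optimal constants: according to whether \<open>b\<close> is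
  below or above \<open>c * a powr (al - 1)\<close>, the first or the second term alone dominates.
  The free weight \<open>c\<close> is chosen later so that both terms scale alike.\<close>

lemma weighted_young:
  fixes a b c al :: real
  assumes "a \<ge> 0" "b \<ge> 0" "c > 0" "al > 1"
  shows "a * b \<le> c * a powr al + c powr (-(1/(al-1))) * b powr (al/(al-1))"
proof (cases "b \<le> c * a powr (al - 1)")
  case True
  have "a * b \<le> a * (c * a powr (al - 1))" using True assms by (intro mult_left_mono) auto
  also have "\<dots> = c * a powr al"
    using assms by (cases "a = 0") (auto simp: powr_mult_base)
  finally show ?thesis by (simp add: add_increasing2)
next
  case False
  then have b: "b > 0" and "a powr (al - 1) < b / c" using assms
    by (auto simp: field_simps not_le intro: le_less_trans[rotated])
  then have "(a powr (al - 1)) powr (1/(al-1)) \<le> (b / c) powr (1/(al-1))"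
    using assms by (intro powr_mono2) auto
  then have "a \<le> (b / c) powr (1/(al-1))" using assms by (simp add: powr_powr)
  then have "a * b \<le> (b / c) powr (1/(al-1)) * b" using b by (intro mult_right_mono) auto
  also have "\<dots> = c powr (-(1/(al-1))) * (b powr (1/(al-1)) * b powr 1)"
    using b assms by (simp add: powr_divide powr_minus divide_simps)
  also have "b powr (1/(al-1)) * b powr 1 = b powr (al/(al-1))"
    unfolding powr_add[symmetric] using assms by (simp add: field_simps)
  finally show ?thesis using assms by (simp add: add_increasing)
qed

text \<open>The step is applied with the supremum of \<open>g\<close> over the exterior of half the radius in the role
  of \<open>m\<close>; since \<open>g\<close> is only known to be bounded, one inducts over the dyadic annuli.\<close>

lemma dyadic_absorb:
  fixes g :: "'a::real_normed_vector \<Rightarrow> real"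
  assumes "b > 0" "r0 > 0" and D: "D > 0" "M * r0 powr b \<le> D" "2 * B \<le> D"
    and M: "\<And>x. g x \<le> M"
    and step: "\<And>x m. norm x \<ge> r0 \<Longrightarrow> m > 0 \<Longrightarrow> (\<And>y. norm y \<ge> norm x / 2 \<Longrightarrow> g y \<le> m) \<Longrightarrow>
       g x \<le> 2 powr (-b-1) * m + B * norm x powr (-b)"
    and x: "norm x \<ge> r0"
  shows "g x \<le> D * norm x powr (-b)"
proof -
  have base: "g x \<le> D * r powr (-b)" if "0 < r" "r \<le> r0" for r x
  proof -
    have "M \<le> D * r0 powr (-b)" using D(2) assms(2) by (simp add: powr_minus field_simps)
    also have "\<dots> \<le> D * r powr (-b)" using that D assms by (intro mult_left_mono powr_mono2') auto
    finally show ?thesis using M[of x] by simp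
  qed
  \<comment> \<open>The radius \<open>r\<close> is decoupled from \<open>norm x\<close> because
    \<open>step\<close> asks for a single bound at all points beyond half the radius, arbitrarily
    distant ones included.\<close>
  have ind: "\<forall>r x. 0 < r \<and> r \<le> 2^n * r0 \<and> r \<le> norm x \<longrightarrow> g x \<le> D * r powr (-b)" for n
  proof (induction n)
    case 0
    then show ?case using base by auto
  next
    case (Suc n)
    show ?case
    proof (intro allI impI, elim conjE)
      fix r :: real and x :: 'a assume r: "0 < r" "r \<le> 2 ^ Suc n * r0" "r \<le> norm x"
      show "g x \<le> D * r powr (-b)"
      proof (cases "r \<le> r0")
        case True then show ?thesis using base r by blast
      next
        case False
        have "g x \<le> 2 powr (-b-1) * (D * (r/2) powr (-b)) + B * norm x powr (-b)"
        proof (rule step)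
          fix y :: 'a assume "norm y \<ge> norm x / 2"
          then show "g y \<le> D * (r/2) powr (-b)" using r by (intro Suc.IH[rule_format]) auto
        qed (use False r D in auto)
        \<comment> \<open>Halving the radius costs a factor \<open>2 powr b\<close>, so the
          contraction factor leaves half of the bound; \<open>2 * B \<le> D\<close> lets the source
          term fit into the other half.\<close>
        also have "2 powr (-b-1) * (D * (r/2) powr (-b)) = (D / 2) * r powr (-b)"
          using r by (simp add: powr_divide powr_minus powr_diff divide_simps)
        also have "B * norm x powr (-b) \<le> (D/2) * norm x powr (-b)"
          using D by (intro mult_right_mono) auto
        also have "\<dots> \<le> (D/2) * r powr (-b)" using r D assms(1) by (intro mult_left_mono powr_mono2') auto
        finally show ?thesis by simp
      qed
    qed
  qed
  obtain n where "norm x / r0 < 2^n" using real_arch_pow[of 2] by auto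
  then have "norm x \<le> 2^n * r0" using assms by (simp add: field_simps)
  moreover have "norm x > 0" using x assms(2) by linarith
  ultimately show ?thesis using ind[of n] by auto
qed

text \<open>In terms of \<open>N\<close>: \<open>A = N - 2s\<close>, \<open>al = 2\<^sup>*\<close> and \<open>p0 = 2\<^sup>* - 1\<close>.\<close>

locale riesz_subsolution =
  fixes v :: "'a::euclidean_space \<Rightarrow> real" and s K M A al p0 :: real
  assumes s: "0 < s" "2 * s < real DIM('a)"
    and A: "A = real DIM('a) - 2 * s" and al: "al = 2 * real DIM('a) / A" and p0: "p0 = al - 1"
    and K: "K > 0" and M: "M > 0" and v[measurable]: "v \<in> borel_measurable borel"
    and vM: "\<And>x. \<bar>v x\<bar> \<le> M"
    and vL: "(\<integral>\<^sup>+x. ennreal (\<bar>v x\<bar> powr al) \<partial>lborel) < \<infinity>"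
    and vI: "\<And>x. ennreal \<bar>v x\<bar> \<le> ennreal K * (\<integral>\<^sup>+y. ennreal (norm (x - y) powr (-A) * \<bar>v y\<bar> powr p0) \<partial>lborel)"
begin

lemma exps: "A > 0" "A < real DIM('a)" "al > 2" "p0 > 1" "A * al = 2 * real DIM('a)" "A * (p0 - 1) = 4 * s" "A * p0 = real DIM('a) + 2 * s"
proof -
  show A0: "A > 0" and "A < real DIM('a)" using s A by auto
  show e: "A * al = 2 * real DIM('a)" using A0 al by simp
  have "A * al > A * 2" unfolding e using A s by simp
  then show "al > 2" using A0 by simp
  then show "p0 > 1" using p0 by simp
  have "A * (p0 - 1) = A * al - 2 * A" unfolding p0 by (simp add: algebra_simps)
  then show "A * (p0 - 1) = 4 * s" using e A by linarith
  have "A * p0 = A * al - A" unfolding p0 by (simp add: algebra_simps)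
  then show "A * p0 = real DIM('a) + 2 * s" using e A by linarith
qed

text \<open>Young's inequality with the exponent \<open>al\<close> and its conjugate turns the
  kernel into \<open>norm (x - y) powr (- 2 N)\<close>, integrable away from \<open>x\<close>, and
  the source into \<open>\<bar>v y\<bar> powr al\<close>. The weight
  \<open>k = c * d powr (N - A/2)\<close> is the one for which both terms carry the factor
  \<open>d powr (-A/2)\<close>; this uses \<open>N - A/2 = A * p0 / 2\<close>. The remaining
  parameter \<open>c\<close> allows both terms to be made small.\<close>

lemma integral_away:
  obtains C where "C > 0"
    "\<And>x d c Y. d > 0 \<Longrightarrow> c > 0 \<Longrightarrow> Y \<in> sets borel \<Longrightarrow>
      (\<integral>\<^sup>+y. ennreal (norm (x - y) powr (-A) * \<bar>v y\<bar> powr p0) * indicator {y. norm (x - y) \<ge> d} y * indicator Y y \<partial>lborel)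
      \<le> ennreal (d powr (-A/2)) * (ennreal (c * C) +
          ennreal (c powr (-(1/p0))) * (\<integral>\<^sup>+y. ennreal (\<bar>v y\<bar> powr al) * indicator Y y \<partial>lborel))"
proof -
  have "real DIM('a) < 2 * real DIM('a)" by simp
  then obtain C where C: "C > 0"
    "\<And>r (x::'a). r > 0 \<Longrightarrow> (\<integral>\<^sup>+y. ennreal (norm (x - y) powr (-(2*real DIM('a)))) * indicator {y. norm (x - y) \<ge> r} y \<partial>lborel)
      \<le> ennreal (C * r powr (real DIM('a) - 2*real DIM('a)))"
    using nn_integral_far_powr[of "2*real DIM('a)"] by blast
  have "(\<integral>\<^sup>+y. ennreal (norm (x - y) powr (-A) * \<bar>v y\<bar> powr p0) * indicator {y. norm (x - y) \<ge> d} y * indicator Y y \<partial>lborel)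
      \<le> ennreal (d powr (-A/2)) * (ennreal (c * C) +
          ennreal (c powr (-(1/p0))) * (\<integral>\<^sup>+y. ennreal (\<bar>v y\<bar> powr al) * indicator Y y \<partial>lborel))"
    if d: "d > 0" "c > 0" and [measurable]: "Y \<in> sets borel" for x d c Y
  proof -
    define k where "k = c * d powr (real DIM('a) - A/2)"
    have k: "k > 0" using d by (simp add: k_def)
    have ptw: "ennreal (norm (x - y) powr (-A) * \<bar>v y\<bar> powr p0) * indicator {y. norm (x - y) \<ge> d} y * indicator Y y
       \<le> ennreal k * (ennreal (norm (x - y) powr (-(2*real DIM('a)))) * indicator {y. norm (x - y) \<ge> d} y)
        + ennreal (k powr (-(1/p0))) * (ennreal (\<bar>v y\<bar> powr al) * indicator Y y)" for y
    proof (cases "norm (x - y) \<ge> d \<and> y \<in> Y")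
      case True
      have "norm (x - y) powr (-A) * \<bar>v y\<bar> powr p0 \<le> k * (norm (x - y) powr (-A)) powr al
         + k powr (-(1/(al-1))) * (\<bar>v y\<bar> powr p0) powr (al/(al-1))"
        using k exps by (intro weighted_young) auto
      also have "(norm (x - y) powr (-A)) powr al = norm (x - y) powr (-(2*real DIM('a)))"
        using exps by (simp add: powr_powr)
      also have "(\<bar>v y\<bar> powr p0) powr (al/(al-1)) = \<bar>v y\<bar> powr al"
        using exps p0 by (simp add: powr_powr)
      finally have "norm (x - y) powr (-A) * \<bar>v y\<bar> powr p0 \<le> k * norm (x - y) powr (-(2*real DIM('a)))
         + k powr (-(1/p0)) * \<bar>v y\<bar> powr al" by (simp add: p0)
      then have "ennreal (norm (x - y) powr (-A) * \<bar>v y\<bar> powr p0) \<le> ennreal (k * norm (x - y) powr (-(2*real DIM('a)))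
         + k powr (-(1/p0)) * \<bar>v y\<bar> powr al)" by (rule ennreal_leI)
      then show ?thesis using True k by (simp add: ennreal_mult[symmetric])
    qed auto
    have e1: "k * d powr (real DIM('a) - 2*real DIM('a)) = d powr (-A/2) * c"
      unfolding k_def using d by (simp add: powr_add[symmetric])
    have e2: "k powr (-(1/p0)) = d powr (-A/2) * c powr (-(1/p0))"
    proof -
      have "(real DIM('a) - A/2) * (1/p0) = A/2"
      proof -
        have "real DIM('a) - A/2 = A * p0 / 2" using exps A by linarith
        then have "(real DIM('a) - A/2) * (1/p0) = A * p0 / 2 * (1/p0)" by simp
        also have "\<dots> = A / 2" using exps(4) by simp
        finally show ?thesis .
      qed
      then have "(real DIM('a) - A/2) * (-(1/p0)) = -A/2" by simp
      then have "(d powr (real DIM('a) - A/2)) powr (-(1/p0)) = d powr (-A/2)" by (simp only: powr_powr)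
      then show ?thesis unfolding k_def using d by (simp add: powr_mult)
    qed
    have "(\<integral>\<^sup>+y. ennreal (norm (x - y) powr (-A) * \<bar>v y\<bar> powr p0) * indicator {y. norm (x - y) \<ge> d} y * indicator Y y \<partial>lborel)
      \<le> (\<integral>\<^sup>+y. ennreal k * (ennreal (norm (x - y) powr (-(2*real DIM('a)))) * indicator {y. norm (x - y) \<ge> d} y)
        + ennreal (k powr (-(1/p0))) * (ennreal (\<bar>v y\<bar> powr al) * indicator Y y) \<partial>lborel)"
      by (intro nn_integral_mono ptw)
    also have "\<dots> = ennreal k * (\<integral>\<^sup>+y. ennreal (norm (x - y) powr (-(2*real DIM('a)))) * indicator {y. norm (x - y) \<ge> d} y \<partial>lborel)
       + ennreal (k powr (-(1/p0))) * (\<integral>\<^sup>+y. ennreal (\<bar>v y\<bar> powr al) * indicator Y y \<partial>lborel)"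
      by (simp add: nn_integral_add nn_integral_cmult)
    also have "\<dots> \<le> ennreal k * ennreal (C * d powr (real DIM('a) - 2*real DIM('a)))
       + ennreal (k powr (-(1/p0))) * (\<integral>\<^sup>+y. ennreal (\<bar>v y\<bar> powr al) * indicator Y y \<partial>lborel)"
      using C(2)[OF d(1)] by (intro add_mono mult_left_mono) auto
    also have "ennreal k * ennreal (C * d powr (real DIM('a) - 2*real DIM('a))) = ennreal (d powr (-A/2)) * ennreal (c * C)"
    proof -
      have "k * (C * d powr (real DIM('a) - 2*real DIM('a))) = d powr (-A/2) * (c * C)"
        using e1 by (metis mult.assoc mult.commute)
      then show ?thesis using k C d by (simp add: ennreal_mult[symmetric])
    qed
    finally show ?thesis unfolding e2 using d by (simp add: ennreal_mult distrib_left mult.assoc)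
  qed
  then show ?thesis by (rule that[OF C(1)])
qed

lemma tail_small:
  assumes e: "e > 0"
  obtains R where "R > 0" "(\<integral>\<^sup>+y. ennreal (\<bar>v y\<bar> powr al) * indicator {y. norm y \<ge> R} y \<partial>lborel) \<le> ennreal e"
proof -
  define m where "m = density lborel (\<lambda>y. ennreal (\<bar>v y\<bar> powr al))"
  define T where "T n = {y::'a. norm y \<ge> real n}" for n
  have [measurable]: "T n \<in> sets borel" for n unfolding T_def by measurable
  have Tm: "T n \<in> sets m" for n unfolding m_def by simp
  have em: "emeasure m (T n) = (\<integral>\<^sup>+y. ennreal (\<bar>v y\<bar> powr al) * indicator (T n) y \<partial>lborel)" for n
    unfolding m_def by (subst emeasure_density) auto
  have "(\<lambda>n. emeasure m (T n)) \<longlonglongrightarrow> emeasure m (\<Inter>n. T n)"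
  proof (rule Lim_emeasure_decseq)
    show "range T \<subseteq> sets m" using Tm by auto
    show "decseq T" unfolding decseq_def T_def by auto
    fix n
    have "emeasure m (T n) \<le> (\<integral>\<^sup>+y. ennreal (\<bar>v y\<bar> powr al) \<partial>lborel)"
      unfolding em by (intro nn_integral_mono) (auto simp: indicator_def)
    then show "emeasure m (T n) \<noteq> \<infinity>" using vL by (auto simp: top_unique)
  qed
  moreover have "(\<Inter>n. T n) = {}"
  proof -
    have False if "\<And>n. y \<in> T n" for y
      using that[of "nat \<lceil>norm y\<rceil> + 1"] unfolding T_def by simp linarith
    then show ?thesis by blast
  qed
  ultimately have "(\<lambda>n. emeasure m (T n)) \<longlonglongrightarrow> 0" by simp
  then have "eventually (\<lambda>n. emeasure m (T n) < ennreal e) sequentially"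
    by (rule order_tendstoD) (use e in auto)
  then have "eventually (\<lambda>n. emeasure m (T n) < ennreal e \<and> n > 0) sequentially"
    using eventually_gt_at_top[of "0::nat"] by (rule eventually_conj)
  then obtain n where n: "emeasure m (T n) < ennreal e" "n > 0"
    by (auto simp: eventually_sequentially)
  show ?thesis
    by (rule that[of "real n"]) (use n em[of n] in \<open>auto simp: T_def\<close>)
qed

text \<open>The source is split into the points near \<open>x\<close>, where it is at most
  \<open>m powr p0\<close>, the points of large norm away from \<open>x\<close>, controlled by the
  tail of the critical integral, and a fixed ball about the origin, which is far from
  \<open>x\<close>. The first two contribute multiples of \<open>m\<close> and the tail and the ball
  multiples of \<open>norm x powr (-A/2)\<close>, all with small constants.\<close>

lemma decay_step:
  assumes th: "th > 0"
  obtains r0 where "r0 > 0"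
   "\<And>x m. norm x \<ge> r0 \<Longrightarrow> m > 0 \<Longrightarrow> (\<And>y. norm y \<ge> norm x / 2 \<Longrightarrow> \<bar>v y\<bar> \<le> m) \<Longrightarrow>
       \<bar>v x\<bar> \<le> th * m + th * norm x powr (-A/2)"
proof -
  obtain C1 where C1: "C1 > 0"
    "\<And>r (x::'a). r > 0 \<Longrightarrow> (\<integral>\<^sup>+y. ennreal (norm (x - y) powr (-A)) * indicator {y. norm (x - y) < r} y \<partial>lborel)
      \<le> ennreal (C1 * r powr (real DIM('a) - A))"
    using nn_integral_near_powr[OF exps(2)] by blast
  obtain C2 where C2: "C2 > 0"
    "\<And>x d c Y. d > 0 \<Longrightarrow> c > 0 \<Longrightarrow> Y \<in> sets borel \<Longrightarrow>
      (\<integral>\<^sup>+y. ennreal (norm (x - y) powr (-A) * \<bar>v y\<bar> powr p0) * indicator {y. norm (x - y) \<ge> d} y * indicator Y y \<partial>lborel)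
      \<le> ennreal (d powr (-A/2)) * (ennreal (c * C2) +
          ennreal (c powr (-(1/p0))) * (\<integral>\<^sup>+y. ennreal (\<bar>v y\<bar> powr al) * indicator Y y \<partial>lborel))"
    using integral_away by blast
  define eta where "eta = (th / (2 * K * C1)) powr (1 / (2 * s))"
  have eta: "eta > 0" "K * C1 * eta powr (2 * s) = th / 2"
    unfolding eta_def using th K C1 s by (auto simp: powr_powr)
  \<comment> \<open>The smallness demanded of the part away from \<open>x\<close>. The minimum
    serves the two distances at which that part is estimated: \<open>d\<close>, proportional to
    \<open>eta\<close>, and half of \<open>norm x\<close>.\<close>
  define xi where "xi = th / (4 * K) * min (eta powr (A/2)) (2 powr (-A/2))"
  have xi: "xi > 0" unfolding xi_def using th K eta by simp
  have xi1: "K * eta powr (-A/2) * xi \<le> th / 2"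
  proof -
    have "K * eta powr (-A/2) * xi \<le> K * eta powr (-A/2) * (th / (4 * K) * eta powr (A/2))"
      unfolding xi_def using K eta th by (intro mult_left_mono) auto
    also have "\<dots> = th / 4" using eta K by (simp add: powr_minus field_simps)
    finally show ?thesis using th by simp
  qed
  have xi2: "K * 2 powr (A/2) * xi \<le> th / 4"
  proof -
    have "K * 2 powr (A/2) * xi \<le> K * 2 powr (A/2) * (th / (4 * K) * 2 powr (-A/2))"
      unfolding xi_def using K eta th by (intro mult_left_mono) auto
    also have "\<dots> = th / 4" using eta K by (simp add: powr_minus field_simps)
    finally show ?thesis using th by simp
  qed
  define c where "c = xi / (2 * C2)"
  have c: "c > 0" "c * C2 = xi / 2" unfolding c_def using xi C2 by auto
  obtain R where R: "R > 0"
    "(\<integral>\<^sup>+y. ennreal (\<bar>v y\<bar> powr al) * indicator {y. norm y \<ge> R} y \<partial>lborel) \<le> ennreal (xi / 2 * c powr (1/p0))"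
    using tail_small[of "xi / 2 * c powr (1/p0)"] xi c by auto
  define Y where "Y = {y::'a. norm y \<ge> R}"
  have [measurable]: "Y \<in> sets borel" unfolding Y_def by measurable
  have away: "(\<integral>\<^sup>+y. ennreal (norm (x - y) powr (-A) * \<bar>v y\<bar> powr p0) * indicator {y. norm (x - y) \<ge> d} y * indicator Y y \<partial>lborel)
      \<le> ennreal (d powr (-A/2) * xi)" if d: "d > 0" for x d
  proof -
    have "(\<integral>\<^sup>+y. ennreal (norm (x - y) powr (-A) * \<bar>v y\<bar> powr p0) * indicator {y. norm (x - y) \<ge> d} y * indicator Y y \<partial>lborel)
      \<le> ennreal (d powr (-A/2)) * (ennreal (c * C2) +
          ennreal (c powr (-(1/p0))) * (\<integral>\<^sup>+y. ennreal (\<bar>v y\<bar> powr al) * indicator Y y \<partial>lborel))"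
      using d c by (intro C2) auto
    also have "\<dots> \<le> ennreal (d powr (-A/2)) * (ennreal (c * C2) +
          ennreal (c powr (-(1/p0))) * ennreal (xi / 2 * c powr (1/p0)))"
      using R(2) unfolding Y_def by (intro mult_left_mono add_mono) auto
    also have "\<dots> = ennreal (d powr (-A/2) * (xi/2 + c powr (-(1/p0)) * (xi / 2 * c powr (1/p0))))"
      unfolding c(2) using xi c d by (simp add: ennreal_mult[symmetric] ennreal_plus[symmetric] del: ennreal_plus)
    also have "xi/2 + c powr (-(1/p0)) * (xi / 2 * c powr (1/p0)) = xi"
      using c by (simp add: powr_minus field_simps)
    finally show ?thesis .
  qed
  define VR where "VR = measure lborel (cball (0::'a) R)"
  \<comment> \<open>The ball of radius \<open>R\<close> contributes a multiple of
    \<open>r powr (-A)\<close>; beyond \<open>r0\<close> one factor \<open>r powr (-A/2)\<close> of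
    it is small enough to leave \<open>th / 4\<close>.\<close>
  define r0 where "r0 = max (2 * R) ((K * 2 powr A * M powr p0 * VR * 4 / th + 1) powr (2/A))"
  have r0: "r0 > 0" "r0 \<ge> 2 * R" unfolding r0_def using R by auto
  have VR: "VR \<ge> 0" unfolding VR_def by simp
  have r0A: "K * 2 powr A * M powr p0 * VR * r powr (-A/2) \<le> th / 4" if r: "r \<ge> r0" for r
  proof -
    define Z where "Z = K * 2 powr A * M powr p0 * VR * 4 / th + 1"
    have Z: "Z > 0" unfolding Z_def using K VR th by (intro add_nonneg_pos) auto
    have "Z powr (2/A) \<le> r" using r unfolding r0_def Z_def by simp
    then have "(Z powr (2/A)) powr (A/2) \<le> r powr (A/2)" using exps by (intro powr_mono2) auto
    then have "Z \<le> r powr (A/2)" using exps Z by (simp add: powr_powr)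
    then have "K * 2 powr A * M powr p0 * VR * 4 / th \<le> r powr (A/2)" unfolding Z_def by simp
    then show ?thesis using th r r0 by (simp add: powr_minus field_simps)
  qed
  have "\<bar>v x\<bar> \<le> th * m + th * norm x powr (-A/2)"
    if x: "norm x \<ge> r0" and m: "m > 0" "\<And>y. norm y \<ge> norm x / 2 \<Longrightarrow> \<bar>v y\<bar> \<le> m" for x m
  proof -
    define r where "r = norm x"
    have r: "r > 0" "r \<ge> r0" "r / 2 \<ge> R" using x r0 by (auto simp: r_def)
    \<comment> \<open>The critical splitting radius: with it the near part
      \<open>m powr p0 * d powr (2 * s)\<close> and the far part \<open>d powr (-A/2)\<close> are
      both linear in \<open>m\<close>, because \<open>A * (p0 - 1) = 4 * s\<close>.\<close>
    define d where "d = eta * m powr (-2/A)"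
    have d: "d > 0" unfolding d_def using eta m by simp
    let ?k = "\<lambda>y. ennreal (norm (x - y) powr (-A) * \<bar>v y\<bar> powr p0)"
    define f1 where "f1 y = ennreal (m powr p0) * (ennreal (norm (x - y) powr (-A)) * indicator {y. norm (x - y) < d} y)" for y
    define f2 where "f2 y = ?k y * indicator {y. norm (x - y) \<ge> d} y * indicator Y y" for y
    define f3 where "f3 y = ?k y * indicator {y. norm (x - y) \<ge> r/2} y * indicator Y y" for y
    define f4 where "f4 y = ennreal ((r/2) powr (-A) * M powr p0) * indicator (cball (0::'a) R) y" for y
    have [measurable]: "f1 \<in> borel_measurable borel" "f2 \<in> borel_measurable borel" "f3 \<in> borel_measurable borel"
      unfolding f1_def[abs_def] f2_def[abs_def] f3_def[abs_def] by measurable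
    have [measurable]: "f4 \<in> borel_measurable borel" unfolding f4_def[abs_def]
      by (intro borel_measurable_times_ennreal borel_measurable_const borel_measurable_indicator) simp
    have ptw: "?k y \<le> f1 y + (f2 y + (f3 y + f4 y))" for y
    proof -
      have tri: "r \<le> norm (x - y) + norm y" using norm_triangle_ineq[of "x - y" y] by (simp add: r_def)
      consider "norm (x - y) < d" "norm y \<ge> r/2" | "norm (x - y) \<ge> d" "norm y \<ge> r/2"
        | "norm (x - y) \<ge> r/2" "norm y \<ge> R" | "norm (x - y) \<ge> r/2" "norm y < R"
        using tri by linarith
      then show ?thesis
      proof cases
        case 1
        have "\<bar>v y\<bar> powr p0 \<le> m powr p0" using 1 m exps by (intro powr_mono2) (auto simp: r_def)
        then have "norm (x - y) powr (-A) * \<bar>v y\<bar> powr p0 \<le> m powr p0 * norm (x - y) powr (-A)"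
          by (subst mult.commute, intro mult_right_mono) auto
        then have "?k y \<le> f1 y" unfolding f1_def using 1 by (simp add: ennreal_mult[symmetric] ennreal_leI)
        then show ?thesis by (rule order_trans) simp
      next
        case 2
        then have "?k y = f2 y" unfolding f2_def Y_def using r by simp
        then show ?thesis by (simp add: add_increasing add_increasing2)
      next
        case 3
        then have "?k y = f3 y" unfolding f3_def Y_def by simp
        then show ?thesis by (simp add: add_increasing add_increasing2)
      next
        case 4
        have "norm (x - y) powr (-A) \<le> (r/2) powr (-A)" using 4 r exps by (intro powr_mono2') auto
        moreover have "\<bar>v y\<bar> powr p0 \<le> M powr p0" using vM exps by (intro powr_mono2) auto
        ultimately have "norm (x - y) powr (-A) * \<bar>v y\<bar> powr p0 \<le> (r/2) powr (-A) * M powr p0"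
          by (intro mult_mono) auto
        then have "?k y \<le> f4 y" unfolding f4_def using 4 by (simp add: ennreal_leI)
        then show ?thesis by (rule order_trans) (simp add: add_increasing)
      qed
    qed
    have i1: "(\<integral>\<^sup>+y. f1 y \<partial>lborel) \<le> ennreal (m powr p0 * (C1 * d powr (real DIM('a) - A)))"
    proof -
      have "(\<integral>\<^sup>+y. f1 y \<partial>lborel) \<le> ennreal (m powr p0) * ennreal (C1 * d powr (real DIM('a) - A))"
        unfolding f1_def using C1(2)[OF d] by (subst nn_integral_cmult) (auto intro: mult_left_mono)
      then show ?thesis using C1 by (simp add: ennreal_mult[symmetric])
    qed
    have i4: "(\<integral>\<^sup>+y. f4 y \<partial>lborel) = ennreal ((r/2) powr (-A) * M powr p0 * VR)"
    proof -
      have "emeasure lborel (cball (0::'a) R) = ennreal VR"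
        unfolding VR_def by (rule emeasure_eq_ennreal_measure) (use emeasure_lborel_cball_finite[of "0::'a" R] in auto)
      then show ?thesis unfolding f4_def by (subst nn_integral_cmult_indicator) (auto simp: ennreal_mult VR)
    qed
    have "ennreal \<bar>v x\<bar> \<le> ennreal K * (\<integral>\<^sup>+y. ?k y \<partial>lborel)" by (rule vI)
    also have "(\<integral>\<^sup>+y. ?k y \<partial>lborel) \<le> (\<integral>\<^sup>+y. f1 y + (f2 y + (f3 y + f4 y)) \<partial>lborel)"
      by (intro nn_integral_mono ptw)
    also have "\<dots> = (\<integral>\<^sup>+y. f1 y \<partial>lborel) + ((\<integral>\<^sup>+y. f2 y \<partial>lborel) + ((\<integral>\<^sup>+y. f3 y \<partial>lborel) + (\<integral>\<^sup>+y. f4 y \<partial>lborel)))"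
      by (simp add: nn_integral_add)
    also have "\<dots> \<le> ennreal (m powr p0 * (C1 * d powr (real DIM('a) - A))) + (ennreal (d powr (-A/2) * xi)
        + (ennreal ((r/2) powr (-A/2) * xi) + ennreal ((r/2) powr (-A) * M powr p0 * VR)))"
      using away[OF d, of x] away[of "r/2" x] r i1 i4 unfolding f2_def f3_def by (intro add_mono) auto
    also have "\<dots> = ennreal (m powr p0 * (C1 * d powr (real DIM('a) - A)) + (d powr (-A/2) * xi
        + ((r/2) powr (-A/2) * xi + (r/2) powr (-A) * M powr p0 * VR)))"
      using C1 xi VR by (simp add: ennreal_plus[symmetric] del: ennreal_plus)
    finally have "ennreal \<bar>v x\<bar> \<le> ennreal (K * (m powr p0 * (C1 * d powr (real DIM('a) - A)) + (d powr (-A/2) * xi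
        + ((r/2) powr (-A/2) * xi + (r/2) powr (-A) * M powr p0 * VR))))"
      using K C1 xi VR by (simp add: ennreal_mult mult_left_mono)
    then have "\<bar>v x\<bar> \<le> K * (m powr p0 * (C1 * d powr (real DIM('a) - A)) + (d powr (-A/2) * xi
        + ((r/2) powr (-A/2) * xi + (r/2) powr (-A) * M powr p0 * VR)))"
      by (subst (asm) ennreal_le_iff) (use K C1 xi VR in auto)
    also have "\<dots> = K * C1 * (m powr p0 * d powr (2 * s)) + K * d powr (-A/2) * xi
        + K * (r/2) powr (-A/2) * xi + K * (r/2) powr (-A) * M powr p0 * VR"
    proof -
      have NA: "real DIM('a) - A = 2 * s" using A by simp
      show ?thesis unfolding NA by (simp add: algebra_simps)
    qed
    also have "m powr p0 * d powr (2 * s) = eta powr (2 * s) * m"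
    proof -
      have e: "p0 + (-2/A) * (2 * s) = 1" using exps(1,6) by (simp add: field_simps)
      have "d powr (2 * s) = eta powr (2 * s) * m powr ((-2/A) * (2 * s))"
        unfolding d_def using m eta by (simp add: powr_mult powr_powr)
      then have "m powr p0 * d powr (2 * s) = eta powr (2 * s) * m powr (p0 + (-2/A) * (2 * s))"
        by (simp only: powr_add mult_ac)
      then show ?thesis unfolding e using m by simp
    qed
    also have "K * C1 * (eta powr (2 * s) * m) = th / 2 * m" using eta(2) by (metis mult.assoc)
    also have "d powr (-A/2) = eta powr (-A/2) * m"
      unfolding d_def using m eta exps(1) by (simp add: powr_mult powr_powr)
    also have "K * (eta powr (-A/2) * m) * xi \<le> th / 2 * m"
      using mult_right_mono[OF xi1, of m] m by (simp add: mult_ac)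
    also have "K * (r/2) powr (-A/2) * xi = (K * 2 powr (A/2) * xi) * r powr (-A/2)"
      using r by (simp add: powr_divide powr_minus field_simps)
    also have "\<dots> \<le> th / 4 * r powr (-A/2)" by (intro mult_right_mono xi2) auto
    also have "K * (r/2) powr (-A) * M powr p0 * VR = (K * 2 powr A * M powr p0 * VR * r powr (-A/2)) * r powr (-A/2)"
    proof -
      have "r powr (-A) = r powr (-A/2) * r powr (-A/2)" by (simp add: powr_add[symmetric])
      moreover have "(r/2) powr (-A) = 2 powr A * r powr (-A)" using r by (simp add: powr_divide powr_minus field_simps)
      ultimately show ?thesis by (simp add: mult_ac)
    qed
    also have "\<dots> \<le> th / 4 * r powr (-A/2)" by (intro mult_right_mono r0A r) auto
    finally have "\<bar>v x\<bar> \<le> th * m + th / 2 * r powr (-A/2)" by (simp add: algebra_simps)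
    also have "\<dots> \<le> th * m + th * r powr (-A/2)" using th by (intro add_left_mono mult_right_mono) auto
    finally show ?thesis by (simp add: r_def)
  qed
  then show ?thesis by (rule that[OF r0(1)])
qed

text \<open>The choice of \<open>th\<close> makes \<open>decay_step\<close> an instance of the
  contraction that \<open>dyadic_absorb\<close> requires at the rate \<open>A/2\<close>.\<close>

lemma decay_half_bounded:
  obtains r0 D where "r0 > 0" "D > 0" "\<And>x. norm x \<ge> r0 \<Longrightarrow> \<bar>v x\<bar> \<le> D * norm x powr (-A/2)"
proof -
  define th where "th = (2::real) powr (-(A/2)-1)"
  have th: "th > 0" by (simp add: th_def)
  obtain r0 where r0: "r0 > 0"
   "\<And>x m. norm x \<ge> r0 \<Longrightarrow> m > 0 \<Longrightarrow> (\<And>y. norm y \<ge> norm x / 2 \<Longrightarrow> \<bar>v y\<bar> \<le> m) \<Longrightarrow>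
       \<bar>v x\<bar> \<le> th * m + th * norm x powr (-A/2)"
    using decay_step[OF th] by blast
  define D where "D = max (M * r0 powr (A/2)) (2 * th)"
  have D: "D > 0" unfolding D_def using th by simp
  have "\<bar>v x\<bar> \<le> D * norm x powr (-(A/2))" if x: "norm x \<ge> r0" for x
  proof (rule dyadic_absorb[where g = "\<lambda>x. \<bar>v x\<bar>" and M = M and ?r0.0 = r0 and B = th])
    show "A / 2 > 0" using exps by simp
    fix x :: 'a and m :: real
    assume "norm x \<ge> r0" "m > 0" "\<And>y. norm y \<ge> norm x / 2 \<Longrightarrow> \<bar>v y\<bar> \<le> m"
    from r0(2)[OF this] show "\<bar>v x\<bar> \<le> 2 powr (-(A/2)-1) * m + th * norm x powr (-(A/2))"
      by (simp add: th_def)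
  qed (use x r0 D vM in \<open>auto simp: D_def\<close>)
  then show ?thesis using r0 D that by simp
qed

text \<open>Once the rate \<open>A/2\<close> is known with some constant \<open>D\<close>, it can be
  fed back as the bound \<open>m\<close> in \<open>decay_step\<close>, whose factor
  \<open>th\<close> is arbitrarily small.\<close>

lemma decay_half_small:
  assumes e: "e > 0"
  obtains R where "R > 0" "\<And>x. norm x \<ge> R \<Longrightarrow> \<bar>v x\<bar> \<le> e * norm x powr (-A/2)"
proof -
  obtain r0 D where D: "r0 > 0" "D > 0" "\<And>x. norm x \<ge> r0 \<Longrightarrow> \<bar>v x\<bar> \<le> D * norm x powr (-A/2)"
    using decay_half_bounded by blast
  define th where "th = e / (2 powr (A/2) * D + 1)"
  have pos: "2 powr (A/2) * D + 1 > 0" using D by (intro add_pos_pos mult_pos_pos) auto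
  have "th * (2 powr (A/2) * D + 1) = e" unfolding th_def using pos by simp
  then have th: "th > 0" "th * (2 powr (A/2) * D) + th = e"
    using pos e by (auto simp: th_def distrib_left)
  obtain r1 where r1: "r1 > 0"
   "\<And>x m. norm x \<ge> r1 \<Longrightarrow> m > 0 \<Longrightarrow> (\<And>y. norm y \<ge> norm x / 2 \<Longrightarrow> \<bar>v y\<bar> \<le> m) \<Longrightarrow>
       \<bar>v x\<bar> \<le> th * m + th * norm x powr (-A/2)"
    using decay_step[OF th(1)] by blast
  show ?thesis
  proof (rule that[of "max r1 (2 * r0)"])
    fix x :: 'a assume x: "norm x \<ge> max r1 (2 * r0)"
    then have x0: "norm x > 0" using r1 by linarith
    have "\<bar>v x\<bar> \<le> th * (D * (norm x / 2) powr (-A/2)) + th * norm x powr (-A/2)"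
    proof (rule r1(2))
      fix y :: 'a assume y: "norm y \<ge> norm x / 2"
      then have "\<bar>v y\<bar> \<le> D * norm y powr (-A/2)" using x by (intro D(3)) auto
      also have "\<dots> \<le> D * (norm x / 2) powr (-A/2)"
        using x0 y D exps by (intro mult_left_mono powr_mono2') auto
      finally show "\<bar>v y\<bar> \<le> D * (norm x / 2) powr (-A/2)" .
    qed (use x x0 D in auto)
    also have "\<dots> = (th * (2 powr (A/2) * D) + th) * norm x powr (-A/2)"
      using x0 by (simp add: powr_divide powr_minus field_simps)
    finally show "\<bar>v x\<bar> \<le> e * norm x powr (-A/2)" unfolding th(2) .
  qed (use r1 in auto)
qed

text \<open>By the smallness at the rate \<open>A/2\<close> the inequality becomes linear with the Hardy weight
  \<open>|y| powr (-2 s)\<close> and a small constant. Iterating it improves the rate of an upper bound of the form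
  \<open>D |x| powr (-b) + E_n |x| powr (-A/2)\<close>, where \<open>E_n\<close> tends to \<open>0\<close>.\<close>

lemma decay_almost:
  assumes b: "A / 2 < b" "b < A"
  obtains C R where "C > 0" "R > 0" "\<And>x. norm x \<ge> R \<Longrightarrow> \<bar>v x\<bar> \<le> C * norm x powr (-b)"
proof -
  \<comment> \<open>The Hardy weight costs exactly the \<open>2 * s\<close> powers that the
    potential gains, so the decay rate \<open>g\<close> is reproduced. The limitation
    \<open>g < A\<close> is what keeps this argument from reaching the rate \<open>A\<close>
    itself.\<close>
  have ex: "\<exists>L>0. \<forall>x::'a. x \<noteq> 0 \<longrightarrow> (\<integral>\<^sup>+y. ennreal (norm (x - y) powr (-A) * norm y powr (-(2 * s + g))) \<partial>lborel)
      \<le> ennreal (L * norm x powr (-g))" if g: "0 < g" "g < A" for g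
  proof -
    have "0 < 2 * s + g" "2 * s + g < real DIM('a)" "A + (2 * s + g) > real DIM('a)" using g A s by auto
    then obtain L where "L > 0" "\<And>x::'a. x \<noteq> 0 \<Longrightarrow>
      (\<integral>\<^sup>+y. ennreal (norm (x - y) powr (-A) * norm y powr (-(2 * s + g))) \<partial>lborel)
      \<le> ennreal (L * norm x powr (real DIM('a) - A - (2 * s + g)))"
      using riesz_convolution_le[OF exps(1,2), of "2 * s + g"] by blast
    moreover have "real DIM('a) - A - (2 * s + g) = -g" using A by simp
    ultimately show ?thesis by auto
  qed
  obtain L1 where L1: "L1 > 0" "\<And>x::'a. x \<noteq> 0 \<Longrightarrow> (\<integral>\<^sup>+y. ennreal (norm (x - y) powr (-A) * norm y powr (-(2 * s + b))) \<partial>lborel)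
      \<le> ennreal (L1 * norm x powr (-b))"
    using ex[of b] b exps by auto
  obtain L2 where L2: "L2 > 0" "\<And>x::'a. x \<noteq> 0 \<Longrightarrow> (\<integral>\<^sup>+y. ennreal (norm (x - y) powr (-A) * norm y powr (-(2 * s + A/2))) \<partial>lborel)
      \<le> ennreal (L2 * norm x powr (-(A/2)))"
    using ex[of "A/2"] b exps by auto
  \<comment> \<open>The constant for which the linearised operator reduces the coefficients at both
    rates, \<open>b\<close> and \<open>A/2\<close>, by one half.\<close>
  define th where "th = 1 / (2 * K * max L1 L2)"
  have th: "th > 0" "K * th * L1 \<le> 1/2" "K * th * L2 \<le> 1/2"
    unfolding th_def using K L1 L2 by (auto simp: field_simps max_def)
  obtain r0 D where D: "r0 > 0" "D > 0" "\<And>x. norm x \<ge> r0 \<Longrightarrow> \<bar>v x\<bar> \<le> D * norm x powr (-A/2)"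
    using decay_half_bounded by blast
  \<comment> \<open>The exponent of \<open>th\<close> is the reciprocal of \<open>p0 - 1\<close>:
    raising this bound to the power \<open>p0 - 1\<close> yields \<open>th\<close> times the Hardy
    weight.\<close>
  obtain r1 where r1: "r1 > 0" "\<And>x. norm x \<ge> r1 \<Longrightarrow> \<bar>v x\<bar> \<le> th powr (A / (4 * s)) * norm x powr (-A/2)"
    using decay_half_small[of "th powr (A / (4 * s))"] th by auto
  define R where "R = max 1 (max r0 r1)"
  have R: "R \<ge> 1" "R \<ge> r0" "R \<ge> r1" unfolding R_def by auto
  have small: "\<bar>v y\<bar> powr p0 \<le> th * norm y powr (-2 * s) * \<bar>v y\<bar>" if y: "norm y \<ge> R" for y
  proof -
    have e: "A / (4 * s) * (p0 - 1) = 1" "(-A/2) * (p0 - 1) = -2 * s" using exps(6) s by auto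
    have "\<bar>v y\<bar> powr (p0 - 1) \<le> (th powr (A / (4 * s)) * norm y powr (-A/2)) powr (p0 - 1)"
      using r1(2)[of y] y R exps by (intro powr_mono2) auto
    also have "\<dots> = th powr (A / (4 * s) * (p0 - 1)) * norm y powr ((-A/2) * (p0 - 1))"
      using th by (simp add: powr_mult powr_powr)
    also have "\<dots> = th * norm y powr (-2 * s)" unfolding e using th by simp
    finally have "\<bar>v y\<bar> powr (p0 - 1) * \<bar>v y\<bar> \<le> th * norm y powr (-2 * s) * \<bar>v y\<bar>"
      by (intro mult_right_mono) auto
    moreover have "\<bar>v y\<bar> powr (p0 - 1) * \<bar>v y\<bar> = \<bar>v y\<bar> powr p0"
      using powr_add[of "\<bar>v y\<bar>" "p0 - 1" 1] by (cases "v y = 0") auto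
    ultimately show ?thesis by simp
  qed
  define VR where "VR = measure lborel (cball (0::'a) R)"
  have VR: "VR \<ge> 0" "emeasure lborel (cball (0::'a) R) = ennreal VR" unfolding VR_def
    by (simp, rule emeasure_eq_ennreal_measure) (use emeasure_lborel_cball_finite[of "0::'a" R] in auto)
  define C1 where "C1 = max (M * (2 * R) powr b) (K * 2 powr A * M powr p0 * VR)"
  have C1: "C1 \<ge> M * (2 * R) powr b" "C1 \<ge> K * 2 powr A * M powr p0 * VR" unfolding C1_def by auto
  have "0 < M * (2 * R) powr b" using M R by (intro mult_pos_pos) auto
  then have C10: "C1 > 0" using C1(1) by linarith
  \<comment> \<open>Coefficients \<open>(c, d)\<close> of an upper bound are improved to
    \<open>(C1 + c / 2, d / 2)\<close>. The value \<open>c = 2 * C1\<close> is fixed under this map,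
    while \<open>d\<close> tends to zero.\<close>
  have main: "\<bar>v x\<bar> \<le> C1 * norm x powr (-b) + c / 2 * norm x powr (-b) + d / 2 * norm x powr (-(A/2))"
    if x: "norm x \<ge> R" and c: "c \<ge> 0" "d \<ge> 0"
      and bd: "\<And>y. norm y \<ge> R \<Longrightarrow> \<bar>v y\<bar> \<le> c * norm y powr (-b) + d * norm y powr (-(A/2))" for x c d
  proof (cases "norm x \<le> 2 * R")
    case True
    have "M \<le> C1 * (2 * R) powr (-b)" using C1(1) R by (simp add: powr_minus field_simps)
    also have "\<dots> \<le> C1 * norm x powr (-b)" using True x R C10 b exps by (intro mult_left_mono powr_mono2') auto
    finally show ?thesis using vM[of x] c by (simp add: add_increasing2)
  next
    case False
    have x0: "norm x > 0" "x \<noteq> 0" using x R by auto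
    let ?k = "\<lambda>y. ennreal (norm (x - y) powr (-A) * \<bar>v y\<bar> powr p0)"
    define f1 where "f1 y = ennreal ((norm x/2) powr (-A) * M powr p0) * indicator (cball (0::'a) R) y" for y
    define f2 where "f2 y = ennreal (th * c) * ennreal (norm (x - y) powr (-A) * norm y powr (-(2 * s + b)))" for y
    define f3 where "f3 y = ennreal (th * d) * ennreal (norm (x - y) powr (-A) * norm y powr (-(2 * s + A/2)))" for y
    have [measurable]: "f2 \<in> borel_measurable borel" "f3 \<in> borel_measurable borel"
      unfolding f2_def[abs_def] f3_def[abs_def] by measurable
    have [measurable]: "f1 \<in> borel_measurable borel" unfolding f1_def[abs_def]
      by (intro borel_measurable_times_ennreal borel_measurable_const borel_measurable_indicator) simp
    have ptw: "?k y \<le> f1 y + (f2 y + f3 y)" for y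
    proof (cases "norm y \<le> R")
      case True
      have "norm x \<le> norm (x - y) + norm y" using norm_triangle_ineq[of "x - y" y] by simp
      then have "norm (x - y) \<ge> norm x / 2" using True False by simp
      then have "norm (x - y) powr (-A) \<le> (norm x / 2) powr (-A)" using x0 exps by (intro powr_mono2') auto
      moreover have "\<bar>v y\<bar> powr p0 \<le> M powr p0" using vM exps by (intro powr_mono2) auto
      ultimately have "norm (x - y) powr (-A) * \<bar>v y\<bar> powr p0 \<le> (norm x / 2) powr (-A) * M powr p0"
        by (intro mult_mono) auto
      then have "?k y \<le> f1 y" unfolding f1_def using True by (simp add: ennreal_leI)
      then show ?thesis by (rule order_trans) simp
    next
      case False
      then have y: "norm y \<ge> R" by simp
      have "\<bar>v y\<bar> powr p0 \<le> th * norm y powr (-2 * s) * (c * norm y powr (-b) + d * norm y powr (-(A/2)))"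
        using th by (intro order_trans[OF small[OF y]] mult_left_mono bd y) auto
      also have "\<dots> = th * c * norm y powr (-(2 * s + b)) + th * d * norm y powr (-(2 * s + A/2))"
      proof -
        have e1: "norm y powr (-2 * s) * norm y powr (-b) = norm y powr (-(2 * s + b))"
          and e2: "norm y powr (-2 * s) * norm y powr (-(A/2)) = norm y powr (-(2 * s + A/2))"
          by (simp_all add: powr_add[symmetric])
        show ?thesis unfolding e1[symmetric] e2[symmetric] by (simp add: algebra_simps)
      qed
      finally have "norm (x - y) powr (-A) * \<bar>v y\<bar> powr p0 \<le> norm (x - y) powr (-A) *
         (th * c * norm y powr (-(2 * s + b)) + th * d * norm y powr (-(2 * s + A/2)))"
        by (intro mult_left_mono) auto
      then have "?k y \<le> ennreal (th * c * (norm (x - y) powr (-A) * norm y powr (-(2 * s + b)))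
          + th * d * (norm (x - y) powr (-A) * norm y powr (-(2 * s + A/2))))"
        by (intro ennreal_leI) (simp add: algebra_simps)
      also have "\<dots> = f2 y + f3 y"
        unfolding f2_def f3_def using th c by (simp add: ennreal_mult ennreal_plus)
      finally show ?thesis by (simp add: add_increasing)
    qed
    have "ennreal \<bar>v x\<bar> \<le> ennreal K * (\<integral>\<^sup>+y. ?k y \<partial>lborel)" by (rule vI)
    also have "(\<integral>\<^sup>+y. ?k y \<partial>lborel) \<le> (\<integral>\<^sup>+y. f1 y + (f2 y + f3 y) \<partial>lborel)"
      by (intro nn_integral_mono ptw)
    also have "\<dots> = (\<integral>\<^sup>+y. f1 y \<partial>lborel) + ((\<integral>\<^sup>+y. f2 y \<partial>lborel) + (\<integral>\<^sup>+y. f3 y \<partial>lborel))"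
      by (simp add: nn_integral_add)
    also have "(\<integral>\<^sup>+y. f1 y \<partial>lborel) = ennreal ((norm x/2) powr (-A) * M powr p0 * VR)"
      unfolding f1_def using VR by (subst nn_integral_cmult_indicator) (auto simp: ennreal_mult)
    also have "(\<integral>\<^sup>+y. f2 y \<partial>lborel) \<le> ennreal (th * c) * ennreal (L1 * norm x powr (-b))"
      unfolding f2_def using L1(2)[OF x0(2)] by (subst nn_integral_cmult) (auto intro: mult_left_mono)
    also have "(\<integral>\<^sup>+y. f3 y \<partial>lborel) \<le> ennreal (th * d) * ennreal (L2 * norm x powr (-(A/2)))"
      unfolding f3_def using L2(2)[OF x0(2)] by (subst nn_integral_cmult) (auto intro: mult_left_mono)
    also have "ennreal K * (ennreal ((norm x/2) powr (-A) * M powr p0 * VR) +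
        (ennreal (th * c) * ennreal (L1 * norm x powr (-b)) + ennreal (th * d) * ennreal (L2 * norm x powr (-(A/2)))))
      = ennreal (K * ((norm x/2) powr (-A) * M powr p0 * VR + (th * c * (L1 * norm x powr (-b)) + th * d * (L2 * norm x powr (-(A/2))))))"
      using K VR th c L1 L2 by (simp add: ennreal_mult[symmetric] ennreal_plus[symmetric] del: ennreal_plus)
    finally have "ennreal \<bar>v x\<bar> \<le> ennreal (K * ((norm x/2) powr (-A) * M powr p0 * VR + (th * c * (L1 * norm x powr (-b)) + th * d * (L2 * norm x powr (-(A/2))))))"
      by (simp add: mult_left_mono add_mono)
    then have "\<bar>v x\<bar> \<le> K * ((norm x/2) powr (-A) * M powr p0 * VR + (th * c * (L1 * norm x powr (-b)) + th * d * (L2 * norm x powr (-(A/2)))))"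
      by (subst (asm) ennreal_le_iff) (use K VR th c L1 L2 in auto)
    also have "\<dots> = K * 2 powr A * M powr p0 * VR * norm x powr (-A)
         + (K * th * L1) * (c * norm x powr (-b)) + (K * th * L2) * (d * norm x powr (-(A/2)))"
      using x0 by (simp add: powr_divide powr_minus field_simps)
    also have "K * 2 powr A * M powr p0 * VR * norm x powr (-A) \<le> C1 * norm x powr (-b)"
      using C1 C10 b x R by (intro mult_mono powr_mono) auto
    also have "(K * th * L1) * (c * norm x powr (-b)) \<le> 1/2 * (c * norm x powr (-b))"
      using th c by (intro mult_right_mono) auto
    also have "(K * th * L2) * (d * norm x powr (-(A/2))) \<le> 1/2 * (d * norm x powr (-(A/2)))"
      using th c by (intro mult_right_mono) auto
    finally show ?thesis by simp
  qed
  have it: "\<forall>x. norm x \<ge> R \<longrightarrow> \<bar>v x\<bar> \<le> (2 * C1) * norm x powr (-b) + (D / 2^n) * norm x powr (-(A/2))" for n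
  proof (induction n)
    case 0
    show ?case
    proof (intro allI impI)
      fix x :: 'a assume "norm x \<ge> R"
      then have "\<bar>v x\<bar> \<le> D * norm x powr (-(A/2))" using D(3)[of x] R by simp
      then show "\<bar>v x\<bar> \<le> (2 * C1) * norm x powr (-b) + (D / 2^0) * norm x powr (-(A/2))"
        using C10 by (simp add: add_increasing)
    qed
  next
    case (Suc n)
    show ?case
    proof (intro allI impI)
      fix x :: 'a assume x: "norm x \<ge> R"
      show "\<bar>v x\<bar> \<le> (2 * C1) * norm x powr (-b) + (D / 2^Suc n) * norm x powr (-(A/2))"
        using main[OF x, of "2 * C1" "D / 2^n"] Suc.IH C10 D(2) by simp
    qed
  qed
  have "\<bar>v x\<bar> \<le> 2 * C1 * norm x powr (-b)" if x: "norm x \<ge> R" for x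
  proof (rule LIMSEQ_le_const)
    have "(\<lambda>n. D * norm x powr (-(A/2)) * (1/2)^n) \<longlonglongrightarrow> D * norm x powr (-(A/2)) * 0"
      by (intro tendsto_mult tendsto_const LIMSEQ_realpow_zero) auto
    then have "(\<lambda>n. 2 * C1 * norm x powr (-b) + D * norm x powr (-(A/2)) * (1/2)^n) \<longlonglongrightarrow> 2 * C1 * norm x powr (-b) + D * norm x powr (-(A/2)) * 0"
      by (intro tendsto_add tendsto_const)
    then show "(\<lambda>n. (2 * C1) * norm x powr (-b) + (D / 2^n) * norm x powr (-(A/2))) \<longlonglongrightarrow> 2 * C1 * norm x powr (-b)"
      by (simp add: power_divide mult_ac)
  qed (use it x in auto)
  then show ?thesis using that[of "2 * C1" R] C10 R by auto
qed

text \<open>Since \<open>A * p0 = N + 2 * s\<close>, a rate \<open>b < A\<close> with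
  \<open>b * p0 > N\<close> exists, and \<open>decay_almost\<close> at that rate makes
  \<open>\<bar>v y\<bar> powr p0\<close> integrable. In the potential, the points far from
  \<open>x\<close> then see a kernel of size \<open>norm x powr (-A)\<close> against a finite mass,
  and the points near \<open>x\<close> contribute \<open>norm x powr (2 * s - b * p0)\<close>, which
  decays faster. This reaches the endpoint \<open>A\<close>.\<close>

lemma source_summable_and_decay:
  obtains C R where "C > 0" "R > 0" "(\<integral>\<^sup>+y. ennreal (\<bar>v y\<bar> powr p0) \<partial>lborel) < \<infinity>"
    "\<And>x. norm x \<ge> R \<Longrightarrow> \<bar>v x\<bar> \<le> C * norm x powr (-A)"
proof -
  define b0 where "b0 = max (A/2) (real DIM('a) / p0)"
  have "real DIM('a) < A * p0" using exps s by simp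
  then have b0: "b0 < A" unfolding b0_def using exps by (simp add: field_simps)
  define b where "b = (b0 + A) / 2"
  have b: "b0 < b" "b < A" unfolding b_def using b0 by auto
  then have bA: "A/2 < b" "b > 0" using exps unfolding b0_def by auto
  have "real DIM('a) / p0 < b" using b(1) unfolding b0_def by simp
  then have bp: "real DIM('a) < b * p0" using exps by (simp add: field_simps)
  obtain C R where CR: "C > 0" "R > 0" "\<And>x. norm x \<ge> R \<Longrightarrow> \<bar>v x\<bar> \<le> C * norm x powr (-b)"
    using decay_almost[OF bA(1) b(2)] by blast
  have pb: "\<bar>v y\<bar> powr p0 \<le> C powr p0 * norm y powr (-(b * p0))" if "norm y \<ge> R" for y
  proof -
    have "\<bar>v y\<bar> powr p0 \<le> (C * norm y powr (-b)) powr p0" using CR(3)[OF that] exps by (intro powr_mono2) auto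
    then show ?thesis using CR by (simp add: powr_mult powr_powr)
  qed
  obtain C2 where C2: "C2 > 0"
    "\<And>r. r > 0 \<Longrightarrow> (\<integral>\<^sup>+(x::'a). ennreal (norm x powr (-(b * p0))) * indicator {x. norm x \<ge> r} x \<partial>lborel)
      \<le> ennreal (C2 * r powr (real DIM('a) - b * p0))"
    using nn_integral_outside_ball_powr[OF bp] by blast
  define VR where "VR = measure lborel (cball (0::'a) R)"
  have VR: "VR \<ge> 0" "emeasure lborel (cball (0::'a) R) = ennreal VR" unfolding VR_def
    by (simp, rule emeasure_eq_ennreal_measure) (use emeasure_lborel_cball_finite[of "0::'a" R] in auto)
  define I where "I = M powr p0 * VR + C powr p0 * (C2 * R powr (real DIM('a) - b * p0))"
  have I: "I \<ge> 0" unfolding I_def using VR CR C2 by auto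
  have vint: "(\<integral>\<^sup>+y. ennreal (\<bar>v y\<bar> powr p0) \<partial>lborel) \<le> ennreal I"
  proof -
    define f1 where "f1 y = ennreal (M powr p0) * indicator (cball (0::'a) R) y" for y
    define f2 where "f2 y = ennreal (C powr p0) * (ennreal (norm y powr (-(b * p0))) * indicator {y. norm y \<ge> R} y)" for y :: 'a
    have [measurable]: "f2 \<in> borel_measurable borel" unfolding f2_def[abs_def] by measurable
    have [measurable]: "f1 \<in> borel_measurable borel" unfolding f1_def[abs_def]
      by (intro borel_measurable_times_ennreal borel_measurable_const borel_measurable_indicator) simp
    have "ennreal (\<bar>v y\<bar> powr p0) \<le> f1 y + f2 y" for y
    proof (cases "norm y \<ge> R")
      case True
      then have "ennreal (\<bar>v y\<bar> powr p0) \<le> f2 y" unfolding f2_def using pb[OF True] CR(1)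
        by (simp add: ennreal_mult[symmetric] ennreal_leI)
      then show ?thesis by (simp add: add_increasing)
    next
      case False
      have "\<bar>v y\<bar> powr p0 \<le> M powr p0" using vM exps by (intro powr_mono2) auto
      then have "ennreal (\<bar>v y\<bar> powr p0) \<le> f1 y" unfolding f1_def using False by (simp add: ennreal_leI)
      then show ?thesis by (simp add: add_increasing2)
    qed
    then have "(\<integral>\<^sup>+y. ennreal (\<bar>v y\<bar> powr p0) \<partial>lborel) \<le> (\<integral>\<^sup>+y. f1 y + f2 y \<partial>lborel)"
      by (intro nn_integral_mono)
    also have "\<dots> = (\<integral>\<^sup>+y. f1 y \<partial>lborel) + (\<integral>\<^sup>+y. f2 y \<partial>lborel)" by (simp add: nn_integral_add)
    also have "(\<integral>\<^sup>+y. f1 y \<partial>lborel) = ennreal (M powr p0 * VR)"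
      unfolding f1_def using VR by (subst nn_integral_cmult_indicator) (auto simp: ennreal_mult)
    also have "(\<integral>\<^sup>+y. f2 y \<partial>lborel) \<le> ennreal (C powr p0) * ennreal (C2 * R powr (real DIM('a) - b * p0))"
      unfolding f2_def using C2(2)[OF CR(2)] by (subst nn_integral_cmult) (auto intro: mult_left_mono)
    also have "ennreal (M powr p0 * VR) + ennreal (C powr p0) * ennreal (C2 * R powr (real DIM('a) - b * p0)) = ennreal I"
      unfolding I_def using VR C2 by (simp add: ennreal_mult[symmetric] ennreal_plus[symmetric] del: ennreal_plus)
    finally show ?thesis by (simp add: add_mono)
  qed
  obtain C1 where C1: "C1 > 0"
    "\<And>r (x::'a). r > 0 \<Longrightarrow> (\<integral>\<^sup>+y. ennreal (norm (x - y) powr (-A)) * indicator {y. norm (x - y) < r} y \<partial>lborel)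
      \<le> ennreal (C1 * r powr (real DIM('a) - A))"
    using nn_integral_near_powr[OF exps(2)] by blast
  define R1 where "R1 = max 1 (2 * R)"
  define C' where "C' = K * 2 powr A * I + K * C powr p0 * 2 powr (b * p0) * C1 * (1/2) powr (2 * s) + 1"
  have "K * 2 powr A * I \<ge> 0" "K * C powr p0 * 2 powr (b * p0) * C1 * (1/2) powr (2 * s) \<ge> 0" using K I C1 by auto
  then have C': "C' > 0" unfolding C'_def by linarith
  have "\<bar>v x\<bar> \<le> C' * norm x powr (-A)" if x: "norm x \<ge> R1" for x
  proof -
    define r where "r = norm x / 2"
    have r: "r > 0" "r \<ge> R" "norm x = 2 * r" "norm x \<ge> 1" using x unfolding r_def R1_def by auto
    let ?k = "\<lambda>y. ennreal (norm (x - y) powr (-A) * \<bar>v y\<bar> powr p0)"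
    define f1 where "f1 y = ennreal (r powr (-A)) * ennreal (\<bar>v y\<bar> powr p0)" for y
    define f2 where "f2 y = ennreal (C powr p0 * r powr (-(b * p0))) * (ennreal (norm (x - y) powr (-A)) * indicator {y. norm (x - y) < r} y)" for y
    have [measurable]: "f1 \<in> borel_measurable borel" "f2 \<in> borel_measurable borel"
      unfolding f1_def[abs_def] f2_def[abs_def] by measurable
    have ptw: "?k y \<le> f1 y + f2 y" for y
    proof (cases "norm (x - y) < r")
      case False
      then have "norm (x - y) powr (-A) \<le> r powr (-A)" using r exps by (intro powr_mono2') auto
      then have "?k y \<le> f1 y" unfolding f1_def
        by (simp add: ennreal_mult[symmetric] ennreal_leI mult_right_mono)
      then show ?thesis by (simp add: add_increasing2)
    next
      case True
      have "norm x \<le> norm (x - y) + norm y" using norm_triangle_ineq[of "x - y" y] by simp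
      then have y: "norm y \<ge> r" using True r by simp
      have "\<bar>v y\<bar> powr p0 \<le> C powr p0 * norm y powr (-(b * p0))" using pb y r by simp
      also have "\<dots> \<le> C powr p0 * r powr (-(b * p0))"
        using y r bA exps by (intro mult_left_mono powr_mono2') auto
      finally have "norm (x - y) powr (-A) * \<bar>v y\<bar> powr p0 \<le> C powr p0 * r powr (-(b * p0)) * norm (x - y) powr (-A)"
        by (subst mult.commute, intro mult_right_mono) auto
      then have "?k y \<le> f2 y" unfolding f2_def using True by (simp add: ennreal_mult[symmetric] ennreal_leI)
      then show ?thesis by (simp add: add_increasing)
    qed
    have "ennreal \<bar>v x\<bar> \<le> ennreal K * (\<integral>\<^sup>+y. ?k y \<partial>lborel)" by (rule vI)
    also have "(\<integral>\<^sup>+y. ?k y \<partial>lborel) \<le> (\<integral>\<^sup>+y. f1 y + f2 y \<partial>lborel)"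
      by (intro nn_integral_mono ptw)
    also have "\<dots> = (\<integral>\<^sup>+y. f1 y \<partial>lborel) + (\<integral>\<^sup>+y. f2 y \<partial>lborel)"
      by (simp add: nn_integral_add)
    also have "(\<integral>\<^sup>+y. f1 y \<partial>lborel) \<le> ennreal (r powr (-A)) * ennreal I"
      unfolding f1_def using vint by (subst nn_integral_cmult) (auto intro: mult_left_mono)
    also have "(\<integral>\<^sup>+y. f2 y \<partial>lborel) \<le> ennreal (C powr p0 * r powr (-(b * p0))) * ennreal (C1 * r powr (real DIM('a) - A))"
      unfolding f2_def using C1(2)[OF r(1)] by (subst nn_integral_cmult) (auto intro: mult_left_mono)
    also have "ennreal K * (ennreal (r powr (-A)) * ennreal I + ennreal (C powr p0 * r powr (-(b * p0))) * ennreal (C1 * r powr (real DIM('a) - A)))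
      = ennreal (K * (r powr (-A) * I + C powr p0 * r powr (-(b * p0)) * (C1 * r powr (real DIM('a) - A))))"
      using K I C1 by (simp add: ennreal_mult[symmetric] ennreal_plus[symmetric] del: ennreal_plus)
    finally have "ennreal \<bar>v x\<bar> \<le> ennreal (K * (r powr (-A) * I + C powr p0 * r powr (-(b * p0)) * (C1 * r powr (real DIM('a) - A))))"
      by (simp add: mult_left_mono add_mono)
    then have "\<bar>v x\<bar> \<le> K * (r powr (-A) * I + C powr p0 * r powr (-(b * p0)) * (C1 * r powr (real DIM('a) - A)))"
      by (subst (asm) ennreal_le_iff) (use K I C1 in auto)
    also have "\<dots> = K * I * r powr (-A) + K * C powr p0 * C1 * (r powr (-(b * p0)) * r powr (2 * s))"
    proof -
      have NA: "real DIM('a) - A = 2 * s" using A by simp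
      show ?thesis unfolding NA by (simp add: algebra_simps)
    qed
    also have "r powr (-A) = 2 powr A * norm x powr (-A)"
      unfolding r(3) using r(1) by (simp add: powr_mult powr_divide powr_minus field_simps)
    also have "r powr (-(b * p0)) * r powr (2 * s) = 2 powr (b * p0) * (1/2) powr (2 * s) * (norm x powr (-(b * p0)) * norm x powr (2 * s))"
      unfolding r(3) using r(1) by (simp add: powr_mult powr_divide powr_minus field_simps)
    also have "norm x powr (-(b * p0)) * norm x powr (2 * s) \<le> norm x powr (-A)"
      unfolding powr_add[symmetric] using r bp A by (intro powr_mono) auto
    finally have "\<bar>v x\<bar> \<le> K * I * (2 powr A * norm x powr (-A)) +
       K * C powr p0 * C1 * (2 powr (b * p0) * (1/2) powr (2 * s) * norm x powr (-A))"
      using K C1 by (simp add: mult_left_mono)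
    also have "\<dots> \<le> C' * norm x powr (-A)" unfolding C'_def by (simp add: algebra_simps)
    finally show ?thesis .
  qed
  moreover have "(\<integral>\<^sup>+y. ennreal (\<bar>v y\<bar> powr p0) \<partial>lborel) < \<infinity>"
    using vint by (rule le_less_trans) simp
  moreover have "R1 > 0" unfolding R1_def by simp
  ultimately show ?thesis using that C' by blast
qed

end

section \<open>Decay of the gradient\<close>

lemma norm_le_if_inner_le:
  fixes w :: "'a::real_inner"
  assumes "d > 0" "c \<ge> 0" "\<And>h::'a. norm h < d \<Longrightarrow> \<bar>inner h w\<bar> \<le> c * norm h"
  shows "norm w \<le> c"
proof (cases "w = 0")
  case False
  define t where "t = d / 2 / norm w"
  have t: "t > 0" "t * norm w = d / 2" using False assms by (auto simp: t_def)
  have nt: "norm (t *\<^sub>R w) = d / 2" using t by simp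
  have "\<bar>inner (t *\<^sub>R w) w\<bar> \<le> c * norm (t *\<^sub>R w)" using nt assms by (intro assms) auto
  moreover have "inner (t *\<^sub>R w) w = d / 2 * norm w"
    using t(2) by (simp add: power2_norm_eq_inner[symmetric] power2_eq_square mult.assoc[symmetric])
  ultimately have "\<bar>d / 2 * norm w\<bar> \<le> c * (d / 2)" unfolding nt by simp
  then have "norm w * (d / 2) \<le> c * (d / 2)" using assms(1) by (simp add: abs_mult mult.commute)
  then show ?thesis using assms(1) by simp
qed (use assms in auto)

lemma GDERIV_norm_le:
  fixes v :: "'a::real_inner \<Rightarrow> real"
  assumes D: "GDERIV v x :> D" and d: "d > 0" and B: "B \<ge> 0"
    and L: "\<And>h. norm h \<le> d \<Longrightarrow> \<bar>v (x + h) - v x\<bar> \<le> B * norm h"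
  shows "norm D \<le> B"
proof (rule field_le_epsilon)
  fix e :: real assume e: "e > 0"
  obtain d1 where d1: "d1 > 0" "\<And>y. norm (y - x) < d1 \<Longrightarrow> norm (v y - v x - inner (y - x) D) \<le> e * norm (y - x)"
    using D e unfolding gderiv_def has_derivative_at_alt by blast
  show "norm D \<le> B + e"
  proof (rule norm_le_if_inner_le)
    fix h :: 'a assume h: "norm h < min d d1"
    have "\<bar>v (x + h) - v x - inner h D\<bar> \<le> e * norm h" using d1(2)[of "x + h"] h by simp
    moreover have "\<bar>v (x + h) - v x\<bar> \<le> B * norm h" using L h by simp
    ultimately show "\<bar>inner h D\<bar> \<le> (B + e) * norm h" by (simp add: algebra_simps)
  qed (use d d1 B e in auto)
qed

text \<open>Two approximate gradients with relative errors \<open>e\<close> and \<open>e'\<close>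
  differ by at most \<open>e + e'\<close>. Those for the errors \<open>1 / (n + 1)\<close> thus form
  a Cauchy sequence, whose limit is the gradient. This lets the singular part of a potential be
  discarded up to arbitrarily small error without differentiating it.\<close>

lemma GDERIV_exists_if_approx:
  fixes v :: "'a::euclidean_space \<Rightarrow> real"
  assumes ap: "\<And>e. e > 0 \<Longrightarrow> \<exists>D d. d > 0 \<and> (\<forall>h. norm h < d \<longrightarrow> \<bar>v (x + h) - v x - inner h D\<bar> \<le> e * norm h)"
  shows "\<exists>D. GDERIV v x :> D"
proof -
  have "\<forall>n::nat. \<exists>D::'a. \<exists>d>0. \<forall>h::'a. norm h < d \<longrightarrow> \<bar>v (x + h) - v x - inner h D\<bar> \<le> (1 / real (Suc n)) * norm h"
    using ap by (metis of_nat_0_less_iff zero_less_Suc zero_less_divide_1_iff)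
  then obtain D :: "nat \<Rightarrow> 'a" where D: "\<And>n. \<exists>d>0. \<forall>h::'a. norm h < d \<longrightarrow> \<bar>v (x + h) - v x - inner h (D n)\<bar> \<le> (1 / real (Suc n)) * norm h"
    by metis
  have DD: "norm (D n - D m) \<le> 1 / real (Suc n) + 1 / real (Suc m)" for n m
  proof -
    obtain d1 where d1: "d1 > 0" "\<And>h::'a. norm h < d1 \<Longrightarrow> \<bar>v (x + h) - v x - inner h (D n)\<bar> \<le> (1 / real (Suc n)) * norm h"
      using D by blast
    obtain d2 where d2: "d2 > 0" "\<And>h::'a. norm h < d2 \<Longrightarrow> \<bar>v (x + h) - v x - inner h (D m)\<bar> \<le> (1 / real (Suc m)) * norm h"
      using D by blast
    show ?thesis
    proof (rule norm_le_if_inner_le)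
      fix h :: 'a assume "norm h < min d1 d2"
      then have "norm h < d1" "norm h < d2" by auto
      from d1(2)[OF this(1)] d2(2)[OF this(2)]
      show "\<bar>inner h (D n - D m)\<bar> \<le> (1 / real (Suc n) + 1 / real (Suc m)) * norm h"
        by (simp only: inner_diff_right distrib_right)
    qed (use d1 d2 in auto)
  qed
  have "Cauchy D"
  proof (rule metric_CauchyI)
    fix e :: real assume "e > 0"
    then obtain k :: nat where k: "1 / real (Suc k) < e / 2"
      using nat_approx_posE[of "e/2"] by auto
    have "dist (D m) (D n) < e" if "m \<ge> k" "n \<ge> k" for m n
    proof -
      have "1 / real (Suc m) \<le> 1 / real (Suc k)" "1 / real (Suc n) \<le> 1 / real (Suc k)"
        using that by (auto intro!: divide_left_mono)
      then show ?thesis using DD[of m n] k unfolding dist_norm by linarith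
    qed
    then show "\<exists>M. \<forall>m\<ge>M. \<forall>n\<ge>M. dist (D m) (D n) < e" by blast
  qed
  then obtain G where G: "D \<longlonglongrightarrow> G" using Cauchy_convergent_iff convergent_def by blast
  have "GDERIV v x :> G"
    unfolding gderiv_def has_derivative_at_alt
  proof (intro conjI allI impI)
    show "bounded_linear (\<lambda>h. inner h G)" by (rule bounded_linear_inner_left)
    fix e :: real assume e: "e > 0"
    obtain k :: nat where k: "1 / real (Suc k) < e / 2"
      using nat_approx_posE[of "e/2"] e by auto
    have "eventually (\<lambda>n. dist (D n) G < e / 2) sequentially" using G e by (intro tendstoD) auto
    then obtain k' where k': "\<And>n. n \<ge> k' \<Longrightarrow> dist (D n) G < e / 2" by (auto simp: eventually_sequentially)
    define n where "n = max k k'"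
    have "1 / real (Suc n) \<le> 1 / real (Suc k)" unfolding n_def by (auto intro!: divide_left_mono)
    then have n: "1 / real (Suc n) < e / 2" "norm (D n - G) < e / 2"
      using k k'[of n] by (auto simp: n_def dist_norm)
    obtain d where d: "d > 0" "\<And>h::'a. norm h < d \<Longrightarrow> \<bar>v (x + h) - v x - inner h (D n)\<bar> \<le> (1 / real (Suc n)) * norm h"
      using D by blast
    have "norm (v y - v x - inner (y - x) G) \<le> e * norm (y - x)" if y: "norm (y - x) < d" for y
    proof -
      have 1: "\<bar>v y - v x - inner (y - x) (D n)\<bar> \<le> (1 / real (Suc n)) * norm (y - x)"
        using d(2)[OF y] by simp
      have 2: "\<bar>inner (y - x) (D n - G)\<bar> \<le> norm (y - x) * norm (D n - G)" by (rule Cauchy_Schwarz_ineq2)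
      have 3: "(1 / real (Suc n)) * norm (y - x) \<le> e / 2 * norm (y - x)" using n by (intro mult_right_mono) auto
      have 4: "norm (y - x) * norm (D n - G) \<le> norm (y - x) * (e/2)" using n by (intro mult_left_mono) auto
      have 5: "inner (y - x) (D n - G) = inner (y - x) (D n) - inner (y - x) G" by (rule inner_diff_right)
      have 6: "norm (y - x) * (e/2) + e / 2 * norm (y - x) = e * norm (y - x)" by (simp add: algebra_simps)
      show ?thesis using 1 2[unfolded 5] 3 4 6 unfolding real_norm_def by linarith
    qed
    then show "\<exists>d>0. \<forall>y. norm (y - x) < d \<longrightarrow> norm (v y - v x - inner (y - x) G) \<le> e * norm (y - x)"
      using d(1) by blast
  qed
  then show ?thesis by blast
qed

section \<open>The Riesz kernel truncated near its singularity\<close>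

lemma powr_neg_lipschitz:
  fixes A a :: real
  assumes A: "A > 0" and a: "a > 0" and t: "t \<ge> a" "t' \<ge> a"
  shows "\<bar>t powr (-A) - t' powr (-A)\<bar> \<le> A * a powr (-A-1) * \<bar>t - t'\<bar>"
proof -
  have *: "\<bar>t powr (-A) - t' powr (-A)\<bar> \<le> A * a powr (-A-1) * \<bar>t - t'\<bar>" if t: "a \<le> t'" "t' < t" for t t'
  proof -
    have "\<exists>z. t' < z \<and> z < t \<and> t powr (-A) - t' powr (-A) = (t - t') * ((-A) * z powr (-A - 1))"
      using t a by (intro MVT2) (auto intro!: derivative_eq_intros)
    then obtain z where z: "t' < z" "z < t" "t powr (-A) - t' powr (-A) = (t - t') * ((-A) * z powr (-A - 1))" by blast
    have "\<bar>t powr (-A) - t' powr (-A)\<bar> = (t - t') * (A * z powr (-A - 1))"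
      unfolding z(3) using t A by (simp add: abs_mult)
    also have "\<dots> \<le> (t - t') * (A * a powr (-A - 1))"
      using t z a A by (intro mult_left_mono powr_mono2') auto
    finally show ?thesis using t by (simp add: mult_ac)
  qed
  show ?thesis
    using *[of t' t] *[of t t'] t by (cases t t' rule: linorder_cases) (auto simp: abs_minus_commute)
qed

text \<open>The kernel is frozen at radius \<open>a\<close> instead of being cut to zero inside: it
  stays Lipschitz, is differentiable off one sphere, and agrees with the Riesz kernel outside the
  ball of radius \<open>a\<close>.\<close>

definition trunc_kernel :: "real \<Rightarrow> real \<Rightarrow> 'a::euclidean_space \<Rightarrow> real" where
  "trunc_kernel A a z = max (norm z) a powr (-A)"

lemma trunc_kernel_lipschitz:
  assumes "A > 0" "a > 0"
  shows "\<bar>trunc_kernel A a z - trunc_kernel A a w\<bar> \<le> A * a powr (-A-1) * norm (z - w)"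
proof -
  have "\<bar>trunc_kernel A a z - trunc_kernel A a w\<bar> \<le> A * a powr (-A-1) * \<bar>max (norm z) a - max (norm w) a\<bar>"
    unfolding trunc_kernel_def using assms by (intro powr_neg_lipschitz) auto
  also have "\<dots> \<le> A * a powr (-A-1) * norm (z - w)"
    using assms norm_triangle_ineq3[of z w] by (intro mult_left_mono) auto
  finally show ?thesis .
qed

definition trunc_kernel_grad :: "real \<Rightarrow> real \<Rightarrow> 'a::euclidean_space \<Rightarrow> 'a" where
  "trunc_kernel_grad A a z = (if norm z > a then (-A * norm z powr (-A-1)) *\<^sub>R sgn z else 0)"

lemma trunc_kernel_grad_le:
  assumes "A > 0" "a > 0"
  shows "norm (trunc_kernel_grad A a z) \<le> A * a powr (-A-1)"
proof (cases "norm z > a")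
  case True
  then have "z \<noteq> 0" using assms by auto
  then have "norm (trunc_kernel_grad A a z) = A * norm z powr (-A-1)"
    using True assms by (simp add: trunc_kernel_grad_def norm_sgn)
  also have "\<dots> \<le> A * a powr (-A-1)" using True assms by (intro mult_left_mono powr_mono2') auto
  finally show ?thesis .
qed (use assms in \<open>auto simp: trunc_kernel_grad_def\<close>)

lemma trunc_kernel_GDERIV:
  assumes a: "a > 0" and z: "norm z \<noteq> a"
  shows "GDERIV (trunc_kernel A a) z :> trunc_kernel_grad A a z"
proof (cases "norm z > a")
  case True
  then have z0: "z \<noteq> 0" "norm z > 0" using a by auto
  have "DERIV (\<lambda>t. t powr (-A)) (norm z) :> (-A * norm z powr (-A-1))"
    using z0 by (auto intro!: derivative_eq_intros)
  then have "GDERIV (\<lambda>x. norm x powr (-A)) z :> (-A * norm z powr (-A-1)) *\<^sub>R sgn z"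
    by (rule GDERIV_DERIV_compose[OF GDERIV_norm[OF z0(1)]])
  moreover have "open {x::'a. norm x > a}" by (intro open_Collect_less continuous_intros)
  ultimately have "GDERIV (trunc_kernel A a) z :> (-A * norm z powr (-A-1)) *\<^sub>R sgn z"
    unfolding gderiv_def
    by (rule has_derivative_transform_within_open) (use True in \<open>auto simp: trunc_kernel_def max_def\<close>)
  then show ?thesis using True by (simp add: trunc_kernel_grad_def)
next
  case False
  have "GDERIV (\<lambda>x::'a. a powr (-A)) z :> 0" unfolding gderiv_def by simp
  moreover have "open {x::'a. norm x < a}" by (intro open_Collect_less continuous_intros)
  ultimately have "GDERIV (trunc_kernel A a) z :> 0"
    unfolding gderiv_def
    by (rule has_derivative_transform_within_open) (use False z in \<open>auto simp: trunc_kernel_def max_def\<close>)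
  then show ?thesis using False by (simp add: trunc_kernel_grad_def)
qed

lemma measurable_trunc_kernel[measurable]: "trunc_kernel A a \<in> borel_measurable borel"
  unfolding trunc_kernel_def[abs_def] by measurable

lemma measurable_trunc_kernel_grad[measurable]: "trunc_kernel_grad A a \<in> borel_measurable borel"
  unfolding trunc_kernel_grad_def[abs_def] sgn_div_norm by measurable

text \<open>The remainders of the linearised kernel, divided by \<open>norm h\<close>, are bounded
  uniformly by twice the Lipschitz constant and tend to zero whenever \<open>x - y\<close> is off
  the sphere of radius \<open>a\<close>. That sphere is a null set, so dominated convergence along
  sequences of increments applies.\<close>

lemma trunc_convolution_GDERIV:
  fixes f :: "'a::euclidean_space \<Rightarrow> real"
  assumes f: "integrable lborel f" and A: "A > 0" and a: "a > 0"
  shows "GDERIV (\<lambda>x. \<integral>y. trunc_kernel A a (x - y) * f y \<partial>lborel) x :>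
    (\<integral>y. f y *\<^sub>R trunc_kernel_grad A a (x - y) \<partial>lborel)"
proof -
  define E where "E = A * a powr (-A-1)"
  have E: "E \<ge> 0" unfolding E_def using A by simp
  have [measurable]: "f \<in> borel_measurable borel" using f by (auto simp: integrable_iff_bounded)
  have i1: "integrable lborel (\<lambda>y. trunc_kernel A a (x - y) * f y)" for x
  proof (rule Bochner_Integration.integrable_bound)
    show "integrable lborel (\<lambda>y. a powr (-A) * f y)" using f by simp
    have "trunc_kernel A a z \<le> a powr (-A)" for z :: 'a
      unfolding trunc_kernel_def using A a by (intro powr_mono2') auto
    then show "AE y in lborel. norm (trunc_kernel A a (x - y) * f y) \<le> norm (a powr (-A) * f y)"
      by (auto simp: abs_mult trunc_kernel_def intro!: mult_right_mono)
  qed measurable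
  have i2: "integrable lborel (\<lambda>y. f y *\<^sub>R trunc_kernel_grad A a (x - y))"
  proof (rule Bochner_Integration.integrable_bound)
    show "integrable lborel (\<lambda>y. E * f y)" using f by simp
    show "AE y in lborel. norm (f y *\<^sub>R trunc_kernel_grad A a (x - y)) \<le> norm (E * f y)"
    proof (rule AE_I2)
      fix y
      have "\<bar>f y\<bar> * norm (trunc_kernel_grad A a (x - y)) \<le> \<bar>f y\<bar> * E"
        using trunc_kernel_grad_le[OF A a] unfolding E_def by (intro mult_left_mono) auto
      then show "norm (f y *\<^sub>R trunc_kernel_grad A a (x - y)) \<le> norm (E * f y)"
        using E by (simp add: abs_mult mult.commute)
    qed
  qed measurable
  define G where "G = (\<integral>y. f y *\<^sub>R trunc_kernel_grad A a (x - y) \<partial>lborel)"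
  define V where "V x = (\<integral>y. trunc_kernel A a (x - y) * f y \<partial>lborel)" for x
  define q where "q h y = (trunc_kernel A a (x + h - y) - trunc_kernel A a (x - y) - inner h (trunc_kernel_grad A a (x - y))) / norm h" for h y
  have [measurable]: "q h \<in> borel_measurable borel" for h unfolding q_def[abs_def] by measurable
  have qb: "\<bar>q h y\<bar> \<le> 2 * E" for h y
  proof (cases "h = 0")
    case False
    have "\<bar>trunc_kernel A a (x + h - y) - trunc_kernel A a (x - y)\<bar> \<le> E * norm h"
      using trunc_kernel_lipschitz[OF A a, of "x + h - y" "x - y"] by (simp add: E_def)
    moreover have "\<bar>inner h (trunc_kernel_grad A a (x - y))\<bar> \<le> norm h * E"
      using Cauchy_Schwarz_ineq2[of h "trunc_kernel_grad A a (x - y)"] trunc_kernel_grad_le[OF A a, of "x - y"]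
      unfolding E_def by (meson mult_left_mono norm_ge_zero order_trans)
    ultimately show ?thesis unfolding q_def using False by (simp add: field_simps)
  qed (use E in \<open>simp add: q_def\<close>)
  have i3: "integrable lborel (\<lambda>y. f y * inner h (trunc_kernel_grad A a (x - y)))" for h
    using integrable_inner_right[of h, OF i2] by simp
  have eq: "(V (x + h) - V x - inner h G) / norm h = (\<integral>y. q h y * f y \<partial>lborel)" for h
  proof -
    have "inner h G = (\<integral>y. inner h (f y *\<^sub>R trunc_kernel_grad A a (x - y)) \<partial>lborel)"
      unfolding G_def by (rule integral_inner_right[symmetric]) (rule i2)
    then have "V (x + h) - V x - inner h G = (\<integral>y. trunc_kernel A a (x + h - y) * f y - trunc_kernel A a (x - y) * f y
        - inner h (f y *\<^sub>R trunc_kernel_grad A a (x - y)) \<partial>lborel)"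
      unfolding V_def using i1 i3 by simp
    then have "(V (x + h) - V x - inner h G) / norm h = (\<integral>y. (trunc_kernel A a (x + h - y) * f y - trunc_kernel A a (x - y) * f y
        - inner h (f y *\<^sub>R trunc_kernel_grad A a (x - y))) / norm h \<partial>lborel)"
      by simp
    also have "\<dots> = (\<integral>y. q h y * f y \<partial>lborel)"
      unfolding q_def by (intro Bochner_Integration.integral_cong) (auto simp: algebra_simps diff_divide_distrib)
    finally show ?thesis .
  qed
  have AEy: "AE y in lborel. norm (x - y) \<noteq> a"
  proof -
    have "sphere x a \<in> null_sets lborel"
      using negligible_sphere[of x a] by (simp add: negligible_iff_null_sets null_sets_completion_iff)
    then show ?thesis by (rule AE_I'[of "sphere x a"]) (auto simp: dist_norm)
  qed
  have lim: "((\<lambda>h. (V (x + h) - V x - inner h G) / norm h) \<longlongrightarrow> 0) (at 0)"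
    unfolding tendsto_at_iff_sequentially comp_def eq
  proof (intro allI impI)
    fix h :: "nat \<Rightarrow> 'a" assume h: "\<forall>i. h i \<in> UNIV - {0}" "h \<longlonglongrightarrow> 0"
    have "(\<lambda>i. (\<integral>y. q (h i) y * f y \<partial>lborel)) \<longlonglongrightarrow> (\<integral>y. 0 \<partial>(lborel :: 'a measure))"
    proof (rule integral_dominated_convergence)
      show "integrable lborel (\<lambda>y. 2 * E * \<bar>f y\<bar>)" using f by simp
      show "AE y in lborel. norm (q (h i) y * f y) \<le> 2 * E * \<bar>f y\<bar>" for i
        using qb by (auto simp: abs_mult intro!: mult_right_mono)
      show "AE y in lborel. (\<lambda>i. q (h i) y * f y) \<longlonglongrightarrow> 0"
        using AEy
      proof eventually_elim
        case (elim y)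
        have "((\<lambda>k. (trunc_kernel A a (x - y + k) - trunc_kernel A a (x - y) - inner k (trunc_kernel_grad A a (x - y))) / norm k) \<longlongrightarrow> 0) (at 0)"
        proof (rule tendsto_norm_zero_cancel)
          show "((\<lambda>k. norm ((trunc_kernel A a (x - y + k) - trunc_kernel A a (x - y) - inner k (trunc_kernel_grad A a (x - y))) / norm k)) \<longlongrightarrow> 0) (at 0)"
            using trunc_kernel_GDERIV[OF a elim, of A] unfolding gderiv_def has_derivative_at by simp
        qed
        then have "((\<lambda>k. q k y) \<longlongrightarrow> 0) (at 0)" unfolding q_def by (simp add: algebra_simps)
        then have "(\<lambda>i. q (h i) y) \<longlonglongrightarrow> 0"
          using h unfolding tendsto_at_iff_sequentially comp_def by blast
        then show ?case by (rule tendsto_mult_left_zero)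
      qed
    qed measurable
    then show "(\<lambda>i. (\<integral>y. q (h i) y * f y \<partial>lborel)) \<longlonglongrightarrow> 0" by simp
  qed
  have "GDERIV V x :> G"
    unfolding gderiv_def has_derivative_at
  proof
    show "bounded_linear (\<lambda>h. inner h G)" by (rule bounded_linear_inner_left)
    have "((\<lambda>h. norm ((V (x + h) - V x - inner h G) / norm h)) \<longlongrightarrow> 0) (at 0)"
      using lim by (rule tendsto_norm_zero)
    then show "((\<lambda>h. norm (V (x + h) - V x - inner h G) / norm h) \<longlongrightarrow> 0) (at 0)" by simp
  qed
  then show ?thesis unfolding V_def[abs_def] G_def .
qed

lemma integral_lborel_translate:
  fixes f :: "'a::euclidean_space \<Rightarrow> real"
  assumes [measurable]: "f \<in> borel_measurable borel"
  shows "(\<integral>y. f (y + h) \<partial>lborel) = (\<integral>y. f y \<partial>lborel)"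
proof -
  have "(\<integral>y. f y \<partial>lborel) = (\<integral>y. f y \<partial>(distr lborel borel ((+) h)))" by (simp only: lborel_distr_plus)
  also have "\<dots> = (\<integral>y. f (y + h) \<partial>lborel)" by (subst integral_distr) (auto simp: add.commute)
  finally show ?thesis by simp
qed

section \<open>Lipschitz bounds and differentiability for the integral equation\<close>

lemma integral_near_powr:
  assumes "a < real DIM('a::euclidean_space)"
  obtains C where "C > 0"
    "\<And>r (x::'a). r > 0 \<Longrightarrow> integrable lborel (\<lambda>y. norm (x - y) powr (-a) * indicator {y. norm (x - y) < r} y)"
    "\<And>r (x::'a). r > 0 \<Longrightarrow> (\<integral>y. norm (x - y) powr (-a) * indicator {y. norm (x - y) < r} y \<partial>lborel)
      \<le> C * r powr (real DIM('a) - a)"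
proof -
  obtain C where C: "C > 0"
    "\<And>r (x::'a). r > 0 \<Longrightarrow> (\<integral>\<^sup>+y. ennreal (norm (x - y) powr (-a)) * indicator {y. norm (x - y) < r} y \<partial>lborel)
      \<le> ennreal (C * r powr (real DIM('a) - a))"
    using nn_integral_near_powr[OF assms] by blast
  have b: "(\<integral>\<^sup>+y. ennreal (norm (x - y) powr (-a) * indicator {y. norm (x - y) < r} y) \<partial>lborel)
      \<le> ennreal (C * r powr (real DIM('a) - a))" if "r > 0" for r and x :: 'a
    using C(2)[OF that, of x] by (simp add: ennreal_mult ennreal_indicator)
  have i: "integrable lborel (\<lambda>y. norm (x - y) powr (-a) * indicator {y. norm (x - y) < r} y)"
    if "r > 0" for r and x :: 'a
  proof (rule integrableI_bounded)
    show "(\<integral>\<^sup>+y. ennreal (norm (norm (x - y) powr (-a) * indicator {y. norm (x - y) < r} y)) \<partial>lborel) < \<infinity>"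
      using b[OF that, of x] by (simp add: le_less_trans)
  qed measurable
  have j: "(\<integral>y. norm (x - y) powr (-a) * indicator {y. norm (x - y) < r} y \<partial>lborel)
      \<le> C * r powr (real DIM('a) - a)" if "r > 0" for r and x :: 'a
  proof -
    have "ennreal (\<integral>y. norm (x - y) powr (-a) * indicator {y. norm (x - y) < r} y \<partial>lborel) =
      (\<integral>\<^sup>+y. ennreal (norm (x - y) powr (-a) * indicator {y. norm (x - y) < r} y) \<partial>lborel)"
      by (rule nn_integral_eq_integral[symmetric, OF i[OF that]]) auto
    also have "\<dots> \<le> ennreal (C * r powr (real DIM('a) - a))" by (rule b[OF that])
    finally show ?thesis using C(1) by (subst (asm) ennreal_le_iff) auto
  qed
  show ?thesis by (rule that[OF C(1)]) (erule i, erule j)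
qed

lemma riesz_integrable:
  fixes g :: "'a::euclidean_space \<Rightarrow> real"
  assumes g: "integrable lborel g" and B: "\<And>y. \<bar>g y\<bar> \<le> B" and A: "0 < A" "A < real DIM('a)"
  shows "integrable lborel (\<lambda>y. norm (x - y) powr (-A) * g y)"
proof (rule Bochner_Integration.integrable_bound)
  have [measurable]: "g \<in> borel_measurable borel" using g by (auto simp: integrable_iff_bounded)
  show "(\<lambda>y. norm (x - y) powr (-A) * g y) \<in> borel_measurable lborel" by measurable
  have "integrable lborel (\<lambda>y. norm (x - y) powr (-A) * indicator {y. norm (x - y) < 1} y)"
    by (rule integral_near_powr[OF A(2)]) (meson zero_less_one)
  then show "integrable lborel (\<lambda>y. B * (norm (x - y) powr (-A) * indicator {y. norm (x - y) < 1} y) + \<bar>g y\<bar>)"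
    using g by (intro Bochner_Integration.integrable_add integrable_mult_right integrable_abs)
  have B0: "B \<ge> 0" using B[of 0] by linarith
  show "AE y in lborel. norm (norm (x - y) powr (-A) * g y) \<le>
    norm (B * (norm (x - y) powr (-A) * indicator {y. norm (x - y) < 1} y) + \<bar>g y\<bar>)"
  proof (rule AE_I2)
    fix y
    show "norm (norm (x - y) powr (-A) * g y) \<le>
      norm (B * (norm (x - y) powr (-A) * indicator {y. norm (x - y) < 1} y) + \<bar>g y\<bar>)"
    proof (cases "norm (x - y) < 1")
      case True
      have "norm (x - y) powr (-A) * \<bar>g y\<bar> \<le> norm (x - y) powr (-A) * B" by (intro mult_left_mono B) auto
      then show ?thesis using True B0 by (simp add: abs_mult mult.commute add_increasing2)
    next
      case False
      then have "norm (x - y) powr (-A) \<le> 1 powr (-A)" using A by (intro powr_mono2') auto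
      then have "norm (x - y) powr (-A) * \<bar>g y\<bar> \<le> 1 * \<bar>g y\<bar>" by (intro mult_right_mono) auto
      then show ?thesis using False by (simp add: abs_mult)
    qed
  qed
qed

text \<open>The equation to which the decay theory is applied has
  \<open>F t = \<bar>t\<bar> powr p - \<bar>t\<bar> powr q\<close>. On the bounded range of
  \<open>v\<close> the increments of such an \<open>F\<close> are controlled by the critical power,
  and only this control is recorded. \<open>K\<close> is the constant of the integral inequality,
  \<open>K'\<close> that of the equation.\<close>

locale riesz_fixpoint = riesz_subsolution v s K M A al p0
  for v :: "'a::euclidean_space \<Rightarrow> real" and s K M A al p0 :: real +
  fixes F :: "real \<Rightarrow> real" and K' L :: real
  assumes F[measurable]: "F \<in> borel_measurable borel" and F0: "F 0 = 0" and L: "L > 0" and K': "K' > 0"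
    and FL: "\<And>a b. \<bar>a\<bar> \<le> M \<Longrightarrow> \<bar>b\<bar> \<le> M \<Longrightarrow> \<bar>F a - F b\<bar> \<le> L * (\<bar>a\<bar> powr (p0 - 1) + \<bar>b\<bar> powr (p0 - 1)) * \<bar>a - b\<bar>"
    and eq: "\<And>x. v x = K' * (\<integral>y. norm (x - y) powr (-A) * F (v y) \<partial>lborel)"
begin

definition f where "f y = F (v y)"

lemma measurable_f[measurable]: "f \<in> borel_measurable borel"
  unfolding f_def[abs_def] by measurable

lemma f_le: "\<bar>f y\<bar> \<le> L * \<bar>v y\<bar> powr p0"
proof -
  have "\<bar>F (v y) - F 0\<bar> \<le> L * (\<bar>v y\<bar> powr (p0 - 1) + \<bar>0\<bar> powr (p0 - 1)) * \<bar>v y - 0\<bar>"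
    using vM M by (intro FL) auto
  also have "\<dots> = L * (\<bar>v y\<bar> powr (p0 - 1) * \<bar>v y\<bar>)" by simp
  also have "\<bar>v y\<bar> powr (p0 - 1) * \<bar>v y\<bar> = \<bar>v y\<bar> powr p0"
    using powr_add[of "\<bar>v y\<bar>" "p0 - 1" 1] by (cases "v y = 0") auto
  finally show ?thesis by (simp add: f_def F0)
qed

lemma f_bdd: "\<bar>f y\<bar> \<le> L * M powr p0"
  by (rule order_trans[OF f_le]) (use vM L exps in \<open>auto intro!: mult_left_mono powr_mono2\<close>)

lemma f_integrable: "integrable lborel f"
proof (rule integrableI_bounded)
  have "(\<integral>\<^sup>+y. ennreal (norm (f y)) \<partial>lborel) \<le> (\<integral>\<^sup>+y. ennreal L * ennreal (\<bar>v y\<bar> powr p0) \<partial>lborel)"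
    using f_le L by (intro nn_integral_mono) (auto simp: ennreal_mult[symmetric] intro!: ennreal_leI)
  also have "\<dots> = ennreal L * (\<integral>\<^sup>+y. ennreal (\<bar>v y\<bar> powr p0) \<partial>lborel)" by (rule nn_integral_cmult) measurable
  also have "\<dots> < \<infinity>"
  proof (rule source_summable_and_decay)
    assume "(\<integral>\<^sup>+y. ennreal (\<bar>v y\<bar> powr p0) \<partial>lborel) < \<infinity>"
    then show "ennreal L * (\<integral>\<^sup>+y. ennreal (\<bar>v y\<bar> powr p0) \<partial>lborel) < \<infinity>"
      by (simp add: ennreal_mult_less_top)
  qed
  finally show "(\<integral>\<^sup>+y. ennreal (norm (f y)) \<partial>lborel) < \<infinity>" .
qed measurable

definition T where "T a x = (\<integral>y. trunc_kernel A a (x - y) * f y \<partial>lborel)"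

lemma trunc_integrable:
  assumes a: "a > 0"
  shows "integrable lborel (\<lambda>y. trunc_kernel A a (x - y) * f y)"
proof (rule Bochner_Integration.integrable_bound)
  show "integrable lborel (\<lambda>y. a powr (-A) * f y)" using f_integrable by simp
  have "trunc_kernel A a z \<le> a powr (-A)" for z :: 'a
    unfolding trunc_kernel_def using exps a by (intro powr_mono2') auto
  then show "AE y in lborel. norm (trunc_kernel A a (x - y) * f y) \<le> norm (a powr (-A) * f y)"
    by (auto simp: abs_mult trunc_kernel_def intro!: mult_right_mono)
qed measurable

lemma T_diff:
  assumes a: "a > 0"
  shows "\<bar>T a (x + h) - T a x\<bar> \<le> A * a powr (-A-1) * norm h * (\<integral>y. \<bar>f y\<bar> \<partial>lborel)"
proof -
  have e: "T a (x + h) - T a x = (\<integral>y. trunc_kernel A a (x + h - y) * f y - trunc_kernel A a (x - y) * f y \<partial>lborel)"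
    unfolding T_def using trunc_integrable[OF a] by simp
  have "\<bar>\<integral>y. trunc_kernel A a (x + h - y) * f y - trunc_kernel A a (x - y) * f y \<partial>lborel\<bar> \<le> (\<integral>y. \<bar>trunc_kernel A a (x + h - y) * f y - trunc_kernel A a (x - y) * f y\<bar> \<partial>lborel)"
    by (rule integral_abs_bound)
  also have "\<dots> \<le> (\<integral>y. A * a powr (-A-1) * norm h * \<bar>f y\<bar> \<partial>lborel)"
  proof (rule integral_mono)
    show "integrable lborel (\<lambda>y. A * a powr (-A-1) * norm h * \<bar>f y\<bar>)" using f_integrable by simp
    fix y
    have "\<bar>trunc_kernel A a (x + h - y) - trunc_kernel A a (x - y)\<bar> * \<bar>f y\<bar> \<le> A * a powr (-A-1) * norm h * \<bar>f y\<bar>"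
      using trunc_kernel_lipschitz[of A a "x + h - y" "x - y"] exps a by (intro mult_right_mono) auto
    then show "\<bar>trunc_kernel A a (x + h - y) * f y - trunc_kernel A a (x - y) * f y\<bar> \<le> A * a powr (-A-1) * norm h * \<bar>f y\<bar>"
      by (simp add: abs_mult[symmetric] left_diff_distrib)
  qed (use trunc_integrable[OF a] in auto)
  finally show ?thesis unfolding e by simp
qed

text \<open>The singular part of the kernel, of mass \<open>a powr (2 s)\<close>, is integrated against differences of
  \<open>f\<close>, so that it can later be absorbed; only the truncated kernel is differentiated.\<close>

lemma difference_estimate:
  obtains C where "C > 0"
    "\<And>a x h B. a > 0 \<Longrightarrow> (\<And>y. norm (x - y) < a \<Longrightarrow> \<bar>f (y + h) - f y\<bar> \<le> B) \<Longrightarrow>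
      \<bar>v (x + h) - v x - K' * (T a (x + h) - T a x)\<bar> \<le> C * a powr (2 * s) * B"
proof -
  obtain C where C: "C > 0"
    "\<And>r (x::'a). r > 0 \<Longrightarrow> integrable lborel (\<lambda>y. norm (x - y) powr (-A) * indicator {y. norm (x - y) < r} y)"
    "\<And>r (x::'a). r > 0 \<Longrightarrow> (\<integral>y. norm (x - y) powr (-A) * indicator {y. norm (x - y) < r} y \<partial>lborel)
      \<le> C * r powr (real DIM('a) - A)"
    using integral_near_powr[OF exps(2)] by blast
  have NA: "real DIM('a) - A = 2 * s" using A by simp
  have "\<bar>v (x + h) - v x - K' * (T a (x + h) - T a x)\<bar> \<le> K' * C * a powr (2 * s) * B"
    if a: "a > 0" and B: "\<And>y. norm (x - y) < a \<Longrightarrow> \<bar>f (y + h) - f y\<bar> \<le> B" for a x h B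
  proof -
    have B0: "B \<ge> 0" using B[of x] a by force
    define ka where "ka z = norm z powr (-A) - trunc_kernel A a z" for z :: 'a
    have [measurable]: "ka \<in> borel_measurable borel" unfolding ka_def[abs_def] by measurable
    have ki: "integrable lborel (\<lambda>y. norm (x - y) powr (-A) * f y)" for x
      by (rule riesz_integrable[OF f_integrable f_bdd exps(1,2)])
    have kai: "integrable lborel (\<lambda>y. ka (x - y) * f y)" for x
      unfolding ka_def left_diff_distrib by (intro Bochner_Integration.integrable_diff ki trunc_integrable a)
    have vx: "v x = K' * ((\<integral>y. ka (x - y) * f y \<partial>lborel) + T a x)" for x
      unfolding eq[of x] f_def[symmetric] T_def ka_def left_diff_distrib
      using ki trunc_integrable[OF a] by simp
    \<comment> \<open>Translation moves the increment \<open>h\<close> from the singular kernel onto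
      the source, so that no derivative ever falls on the singularity.\<close>
    have sh: "(\<integral>y. ka (x + h - y) * f y \<partial>lborel) = (\<integral>y. ka (x - y) * f (y + h) \<partial>lborel)"
      by (subst integral_lborel_translate[symmetric, of _ h]) (auto simp: algebra_simps)
    have fh: "integrable lborel (\<lambda>y. ka (x - y) * f (y + h))"
    proof -
      have "integrable (distr lborel borel ((+) h)) (\<lambda>y. ka (x + h - y) * f y)"
        using kai[of "x + h"] by (simp only: lborel_distr_plus)
      then show ?thesis by (subst (asm) integrable_distr_eq) (auto simp: algebra_simps)
    qed
    have "v (x + h) - v x - K' * (T a (x + h) - T a x) = K' * (\<integral>y. ka (x - y) * f (y + h) - ka (x - y) * f y \<partial>lborel)"
      unfolding vx[of x] vx[of "x + h"] sh using fh kai[of x] by (simp add: algebra_simps)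
    then have e: "\<bar>v (x + h) - v x - K' * (T a (x + h) - T a x)\<bar> = K' * \<bar>\<integral>y. ka (x - y) * f (y + h) - ka (x - y) * f y \<partial>lborel\<bar>"
      using K' by (simp add: abs_mult)
    have "\<bar>\<integral>y. ka (x - y) * f (y + h) - ka (x - y) * f y \<partial>lborel\<bar> \<le>
      (\<integral>y. \<bar>ka (x - y) * f (y + h) - ka (x - y) * f y\<bar> \<partial>lborel)" by (rule integral_abs_bound)
    also have "\<dots> \<le> (\<integral>y. B * (norm (x - y) powr (-A) * indicator {y. norm (x - y) < a} y) \<partial>lborel)"
    proof (rule integral_mono_AE)
      show "integrable lborel (\<lambda>y. \<bar>ka (x - y) * f (y + h) - ka (x - y) * f y\<bar>)"
        using fh kai by (intro integrable_abs Bochner_Integration.integrable_diff)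
      show "integrable lborel (\<lambda>y. B * (norm (x - y) powr (-A) * indicator {y. norm (x - y) < a} y))"
        using C(2)[OF a] by simp
      \<comment> \<open>At \<open>y = x\<close> the convention \<open>0 powr (-A) = 0\<close> breaks
        the comparison of the kernels; this single point is discarded.\<close>
      have "AE y in lborel. y \<noteq> x" by (rule AE_lborel_singleton)
      then show "AE y in lborel. \<bar>ka (x - y) * f (y + h) - ka (x - y) * f y\<bar> \<le> B * (norm (x - y) powr (-A) * indicator {y. norm (x - y) < a} y)"
      proof eventually_elim
        case (elim y)
        show ?case
        proof (cases "norm (x - y) < a")
          case True
          have "a powr (-A) \<le> norm (x - y) powr (-A)" using True elim exps by (intro powr_mono2') auto
          then have k: "\<bar>ka (x - y)\<bar> \<le> norm (x - y) powr (-A)" using True unfolding ka_def trunc_kernel_def by (simp add: max_def)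
          have "\<bar>ka (x - y) * f (y + h) - ka (x - y) * f y\<bar> = \<bar>ka (x - y)\<bar> * \<bar>f (y + h) - f y\<bar>"
            by (simp add: abs_mult[symmetric] right_diff_distrib)
          also have "\<dots> \<le> norm (x - y) powr (-A) * B" using k B True by (intro mult_mono) auto
          finally show ?thesis using True by (simp add: mult.commute)
        next
          case False
          then have "ka (x - y) = 0" unfolding ka_def trunc_kernel_def by (simp add: max_def)
          then show ?thesis using B0 by simp
        qed
      qed
    qed
    also have "\<dots> = B * (\<integral>y. norm (x - y) powr (-A) * indicator {y. norm (x - y) < a} y \<partial>lborel)" by simp
    also have "\<dots> \<le> B * (C * a powr (real DIM('a) - A))" using C(3)[OF a] B0 by (intro mult_left_mono) auto
    finally have "K' * \<bar>\<integral>y. ka (x - y) * f (y + h) - ka (x - y) * f y \<partial>lborel\<bar> \<le> K' * (B * (C * a powr (2 * s)))"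
      using K' unfolding NA by (intro mult_left_mono) auto
    then show ?thesis unfolding e by (simp only: mult_ac)
  qed
  moreover have "K' * C > 0" using K' C by simp
  ultimately show ?thesis using that by blast
qed

end

context riesz_fixpoint
begin

lemma f_diff_le:
  assumes "\<bar>v y\<bar> \<le> m" "\<bar>v z\<bar> \<le> m"
  shows "\<bar>f y - f z\<bar> \<le> L * (2 * m powr (p0 - 1)) * \<bar>v y - v z\<bar>"
proof -
  have "\<bar>f y - f z\<bar> \<le> L * (\<bar>v y\<bar> powr (p0 - 1) + \<bar>v z\<bar> powr (p0 - 1)) * \<bar>v y - v z\<bar>"
    unfolding f_def by (intro FL vM)
  also have "\<dots> \<le> L * (m powr (p0 - 1) + m powr (p0 - 1)) * \<bar>v y - v z\<bar>"
    using assms L exps by (intro mult_right_mono mult_left_mono add_mono powr_mono2) auto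
  finally show ?thesis by simp
qed

text \<open>For a small truncation radius the singular part returns at most half of the supremum of
  the increment, while the truncated kernel contributes a multiple of \<open>norm h\<close>. The
  increment is bounded by \<open>2 * M\<close> to begin with, so iterating the estimate halves this
  crude bound until only the multiple of \<open>norm h\<close> remains.\<close>

lemma lipschitz:
  obtains D where "D > 0" "\<And>x h. \<bar>v (x + h) - v x\<bar> \<le> D * norm h"
proof -
  obtain C where C: "C > 0"
    "\<And>a x h B. a > 0 \<Longrightarrow> (\<And>y. norm (x - y) < a \<Longrightarrow> \<bar>f (y + h) - f y\<bar> \<le> B) \<Longrightarrow>
      \<bar>v (x + h) - v x - K' * (T a (x + h) - T a x)\<bar> \<le> C * a powr (2 * s) * B"
    using difference_estimate by blast
  define La where "La = L * (2 * M powr (p0 - 1))"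
  have La: "La > 0" unfolding La_def using L M by simp
  \<comment> \<open>Solves \<open>C * a powr (2 * s) * La = 1 / 2\<close>, the condition for
    absorption.\<close>
  define a where "a = (1 / (2 * C * La)) powr (1 / (2 * s))"
  have a: "a > 0" "C * a powr (2 * s) * La = 1 / 2"
    unfolding a_def using C La s by (auto simp: powr_powr)
  define E where "E = K' * (A * a powr (-A-1) * (\<integral>y. \<bar>f y\<bar> \<partial>lborel))"
  have E: "E \<ge> 0" unfolding E_def using K' exps by (intro mult_nonneg_nonneg) auto
  have it: "\<forall>x. \<bar>v (x + h) - v x\<bar> \<le> 2 * M / 2 ^ n + 2 * E * norm h" for n h
  proof (induction n)
    case 0
    show ?case
    proof
      fix x
      have "\<bar>v (x + h) - v x\<bar> \<le> 2 * M" using vM[of x] vM[of "x + h"] by linarith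
      then show "\<bar>v (x + h) - v x\<bar> \<le> 2 * M / 2 ^ 0 + 2 * E * norm h" using E by (simp add: add_increasing2)
    qed
  next
    case (Suc n)
    show ?case
    proof
      fix x
      define B where "B = 2 * M / 2 ^ n + 2 * E * norm h"
      have "\<bar>v (x + h) - v x - K' * (T a (x + h) - T a x)\<bar> \<le> C * a powr (2 * s) * (La * B)"
      proof (rule C(2)[OF a(1)])
        fix y
        have "\<bar>f (y + h) - f y\<bar> \<le> La * \<bar>v (y + h) - v y\<bar>"
          unfolding La_def by (intro f_diff_le vM)
        also have "\<dots> \<le> La * B" using Suc.IH La unfolding B_def by (intro mult_left_mono) auto
        finally show "\<bar>f (y + h) - f y\<bar> \<le> La * B" .
      qed
      also have "\<dots> = (C * a powr (2 * s) * La) * B" by simp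
      also have "\<dots> = B / 2" unfolding a(2) by simp
      finally have 1: "\<bar>v (x + h) - v x - K' * (T a (x + h) - T a x)\<bar> \<le> B / 2" .
      have "K' * \<bar>T a (x + h) - T a x\<bar> \<le> K' * (A * a powr (-A-1) * norm h * (\<integral>y. \<bar>f y\<bar> \<partial>lborel))"
        using T_diff[OF a(1)] K' by (intro mult_left_mono) auto
      then have 2: "\<bar>K' * (T a (x + h) - T a x)\<bar> \<le> E * norm h"
        unfolding E_def using K' by (simp add: abs_mult mult_ac)
      have "B / 2 + E * norm h = 2 * M / 2 ^ Suc n + 2 * E * norm h" unfolding B_def by (simp add: field_simps)
      then show "\<bar>v (x + h) - v x\<bar> \<le> 2 * M / 2 ^ Suc n + 2 * E * norm h" using 1 2 by linarith
    qed
  qed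
  have "\<bar>v (x + h) - v x\<bar> \<le> 2 * E * norm h" for x h
  proof (rule LIMSEQ_le_const)
    have "(\<lambda>n. 2 * M * (1/2)^n) \<longlonglongrightarrow> 2 * M * 0"
      by (intro tendsto_mult tendsto_const LIMSEQ_realpow_zero) auto
    then have "(\<lambda>n. 2 * M * (1/2)^n + 2 * E * norm h) \<longlonglongrightarrow> 2 * M * 0 + 2 * E * norm h"
      by (intro tendsto_add tendsto_const)
    then show "(\<lambda>n. 2 * M / 2 ^ n + 2 * E * norm h) \<longlonglongrightarrow> 2 * E * norm h"
      by (simp add: power_divide)
  qed (use it in auto)
  moreover have "2 * E * norm h \<le> (2 * E + 1) * norm h" for h :: 'a by (simp add: mult_right_mono)
  ultimately have "\<bar>v (x + h) - v x\<bar> \<le> (2 * E + 1) * norm h" for x h using order_trans by blast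
  then show ?thesis using that[of "2 * E + 1"] E by auto
qed

text \<open>Truncation at the scale \<open>a = norm x / 4\<close>: the singular part has mass of
  order \<open>norm x powr (2 * s)\<close>, and by the decay of \<open>v\<close> and
  \<open>A * (p0 - 1) = 4 * s\<close> the nonlinearity has Lipschitz constant of order
  \<open>norm x powr (-4 * s)\<close> there. The product tends to zero, so
  \<open>dyadic_absorb\<close> applies to the increments at the rate \<open>A + 1\<close>, which is
  the rate of the truncated kernel's Lipschitz constant. The global Lipschitz bound starts the
  argument and makes all constants proportional to \<open>norm h\<close>.\<close>

lemma weighted_lipschitz:
  obtains D R where "D > 0" "R > 0"
    "\<And>x h. norm x \<ge> R \<Longrightarrow> norm h \<le> 1 \<Longrightarrow> \<bar>v (x + h) - v x\<bar> \<le> D * norm x powr (-(A + 1)) * norm h"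
proof -
  obtain C where C: "C > 0"
    "\<And>a x h B. a > 0 \<Longrightarrow> (\<And>y. norm (x - y) < a \<Longrightarrow> \<bar>f (y + h) - f y\<bar> \<le> B) \<Longrightarrow>
      \<bar>v (x + h) - v x - K' * (T a (x + h) - T a x)\<bar> \<le> C * a powr (2 * s) * B"
    using difference_estimate by blast
  obtain D0 where D0: "D0 > 0" "\<And>x h. \<bar>v (x + h) - v x\<bar> \<le> D0 * norm h" using lipschitz by blast
  obtain Cd R0 where Cd: "Cd > 0" "R0 > 0" "\<And>x. norm x \<ge> R0 \<Longrightarrow> \<bar>v x\<bar> \<le> Cd * norm x powr (-A)"
    using source_summable_and_decay by blast
  define Q where "Q = C * (1/4) powr (2 * s) * (L * (2 * Cd powr (p0 - 1))) * 2 powr (4 * s)"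
  have Q: "Q > 0" unfolding Q_def using C L Cd by simp
  \<comment> \<open>The bound \<open>4\<close> lets an increment of norm at most one stay within
    \<open>norm x / 4\<close>, so that \<open>y + h\<close> keeps norm at least
    \<open>norm x / 2\<close>; \<open>2 * R0\<close> makes the decay of \<open>v\<close> available
    there; the last term makes the absorption factor small.\<close>
  define r0 where "r0 = max (max 4 (2 * R0)) ((Q * 2 powr (A + 2)) powr (1 / (2 * s)))"
  have r0: "r0 \<ge> 4" "r0 \<ge> 2 * R0" "r0 \<ge> (Q * 2 powr (A + 2)) powr (1 / (2 * s))" unfolding r0_def by auto
  have Qsmall: "Q * r powr (-2 * s) \<le> 2 powr (-(A+1)-1)" if "r \<ge> r0" for r
  proof -
    have r: "r > 0" using that r0 by linarith
    have "((Q * 2 powr (A + 2)) powr (1 / (2 * s))) powr (2 * s) \<le> r powr (2 * s)"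
      using that r0 s by (intro powr_mono2) auto
    then have "Q * 2 powr (A + 2) \<le> r powr (2 * s)" using Q s by (simp add: powr_powr)
    then have 1: "Q * 2 powr (A + 2) * (r powr (-2 * s) * 2 powr (-(A+1)-1)) \<le> r powr (2 * s) * (r powr (-2 * s) * 2 powr (-(A+1)-1))"
      by (intro mult_right_mono) auto
    have 2: "r powr (2 * s) * r powr (-2 * s) = 1" using r by (simp add: powr_minus)
    have 3: "2 powr (A + 2) * 2 powr (-(A+1)-1) = (1::real)" by (simp add: powr_add[symmetric])
    have "Q * r powr (-2 * s) = Q * r powr (-2 * s) * (2 powr (A + 2) * 2 powr (-(A+1)-1))" unfolding 3 by simp
    also have "\<dots> = Q * 2 powr (A + 2) * (r powr (-2 * s) * 2 powr (-(A+1)-1))" by (simp only: mult_ac)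
    also note 1
    also have "r powr (2 * s) * (r powr (-2 * s) * 2 powr (-(A+1)-1)) = 2 powr (-(A+1)-1)"
      unfolding mult.assoc[symmetric] 2 by simp
    finally show ?thesis .
  qed
  define B' where "B' = K' * (A * 4 powr (A + 1) * (\<integral>y. \<bar>f y\<bar> \<partial>lborel))"
  have B': "B' \<ge> 0" unfolding B'_def using K' exps by (intro mult_nonneg_nonneg) auto
  define D where "D = max (D0 * r0 powr (A + 1)) (2 * B')"
  have D: "D > 0" unfolding D_def using D0 r0 by (simp add: less_max_iff_disj)
  have "\<bar>v (x + h) - v x\<bar> \<le> (D * norm h) * norm x powr (-(A + 1))" if x: "norm x \<ge> r0" and h: "norm h \<le> 1" "h \<noteq> 0" for x h
  proof (rule dyadic_absorb[where g = "\<lambda>x. \<bar>v (x + h) - v x\<bar>" and M = "D0 * norm h" and ?r0.0 = r0 and B = "B' * norm h"])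
    show "A + 1 > 0" "r0 > 0" using exps r0 by auto
    show "D * norm h > 0" using D h by simp
    show "D0 * norm h * r0 powr (A + 1) \<le> D * norm h" unfolding D_def
      using mult_right_mono[of "D0 * r0 powr (A + 1)" "max (D0 * r0 powr (A + 1)) (2 * B')" "norm h"] by (simp add: mult_ac)
    show "2 * (B' * norm h) \<le> D * norm h" unfolding D_def
      using mult_right_mono[of "2 * B'" "max (D0 * r0 powr (A + 1)) (2 * B')" "norm h"] by (simp add: mult_ac)
    show "\<bar>v (x + h) - v x\<bar> \<le> D0 * norm h" for x by (rule D0)
    show "norm x \<ge> r0" by (rule x)
    fix x :: 'a and m :: real
    assume x: "norm x \<ge> r0" and m: "m > 0" "\<And>y. norm y \<ge> norm x / 2 \<Longrightarrow> \<bar>v (y + h) - v y\<bar> \<le> m"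
    have x0: "norm x > 0" using x r0 by linarith
    define a where "a = norm x / 4"
    have a: "a > 0" using x0 by (simp add: a_def)
    define w where "w = Cd * (norm x / 2) powr (-A)"
    have w: "\<bar>v z\<bar> \<le> w" if "norm z \<ge> norm x / 2" for z
    proof -
      have "\<bar>v z\<bar> \<le> Cd * norm z powr (-A)" using that x r0 by (intro Cd(3)) auto
      also have "\<dots> \<le> w" unfolding w_def using that x0 Cd exps by (intro mult_left_mono powr_mono2') auto
      finally show ?thesis .
    qed
    have "\<bar>v (x + h) - v x - K' * (T a (x + h) - T a x)\<bar> \<le> C * a powr (2 * s) * (L * (2 * w powr (p0 - 1)) * m)"
    proof (rule C(2)[OF a])
      fix y assume y: "norm (x - y) < a"
      have y1: "norm y \<ge> 3 * a" using norm_triangle_ineq[of "x - y" y] y by (simp add: a_def)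
      have y2: "norm y \<ge> norm x / 2" using y1 x0 unfolding a_def by linarith
      have "norm y \<le> norm (y + h) + norm h" using norm_triangle_ineq4[of "y + h" h] by simp
      then have y3: "norm (y + h) \<ge> norm x / 2" using y1 h x r0 unfolding a_def by linarith
      have "\<bar>f (y + h) - f y\<bar> \<le> L * (2 * w powr (p0 - 1)) * \<bar>v (y + h) - v y\<bar>"
        by (intro f_diff_le w y2 y3)
      also have "\<dots> \<le> L * (2 * w powr (p0 - 1)) * m" using L by (intro mult_left_mono m y2) auto
      finally show "\<bar>f (y + h) - f y\<bar> \<le> L * (2 * w powr (p0 - 1)) * m" .
    qed
    also have "\<dots> = Q * norm x powr (-2 * s) * m"
    proof -
      have "w powr (p0 - 1) = Cd powr (p0 - 1) * (norm x / 2) powr (-(A * (p0 - 1)))"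
        unfolding w_def using Cd by (simp add: powr_mult powr_powr)
      also have "\<dots> = Cd powr (p0 - 1) * (2 powr (4 * s) * norm x powr (-4 * s))"
        unfolding exps(6) using x0 by (simp add: powr_divide powr_minus field_simps)
      finally have e1: "w powr (p0 - 1) = Cd powr (p0 - 1) * (2 powr (4 * s) * norm x powr (-4 * s))" .
      have e2: "a powr (2 * s) = (1/4) powr (2 * s) * norm x powr (2 * s)"
        unfolding a_def using x0 by (simp add: powr_divide)
      have e3: "norm x powr (2 * s) * norm x powr (-4 * s) = norm x powr (-2 * s)" by (simp add: powr_add[symmetric])
      show ?thesis unfolding Q_def e1 e2 e3[symmetric] by (simp only: mult_ac)
    qed
    also have "\<dots> \<le> 2 powr (-(A+1)-1) * m" using Qsmall[OF x] m by (intro mult_right_mono) auto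
    finally have 1: "\<bar>v (x + h) - v x - K' * (T a (x + h) - T a x)\<bar> \<le> 2 powr (-(A+1)-1) * m" .
    have "K' * \<bar>T a (x + h) - T a x\<bar> \<le> K' * (A * a powr (-A-1) * norm h * (\<integral>y. \<bar>f y\<bar> \<partial>lborel))"
      using T_diff[OF a(1)] K' by (intro mult_left_mono) auto
    also have "a powr (-A-1) = 4 powr (A + 1) * norm x powr (-(A+1))"
    proof -
      have e: "-A-1 = -(A+1)" by simp
      show ?thesis unfolding a_def e using x0 by (simp only: powr_divide powr_minus) (simp add: powr_divide field_simps)
    qed
    finally have 2: "\<bar>K' * (T a (x + h) - T a x)\<bar> \<le> B' * norm h * norm x powr (-(A+1))"
      unfolding B'_def using K' by (simp add: abs_mult mult_ac)
    show "\<bar>v (x + h) - v x\<bar> \<le> 2 powr (-(A+1)-1) * m + B' * norm h * norm x powr (-(A+1))"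
      using 1 2 by linarith
  qed
  then have "\<bar>v (x + h) - v x\<bar> \<le> D * norm x powr (-(A + 1)) * norm h" if "norm x \<ge> r0" "norm h \<le> 1" for x h
    using that by (cases "h = 0") (auto simp: mult_ac)
  moreover have "r0 > 0" using r0 by linarith
  ultimately show ?thesis using that D by blast
qed

text \<open>By the Lipschitz bound, the singular part of the increment is at most
  \<open>e / 2 * norm h\<close> once the truncation radius is small. The truncated potential is
  differentiable for that fixed radius, and its gradient serves as an approximate gradient of
  \<open>v\<close>.\<close>

lemma differentiable: "\<exists>D. GDERIV v x :> D"
proof (rule GDERIV_exists_if_approx)
  fix e :: real assume e: "e > 0"
  obtain C where C: "C > 0"
    "\<And>a x h B. a > 0 \<Longrightarrow> (\<And>y. norm (x - y) < a \<Longrightarrow> \<bar>f (y + h) - f y\<bar> \<le> B) \<Longrightarrow>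
      \<bar>v (x + h) - v x - K' * (T a (x + h) - T a x)\<bar> \<le> C * a powr (2 * s) * B"
    using difference_estimate by blast
  obtain D0 where D0: "D0 > 0" "\<And>x h. \<bar>v (x + h) - v x\<bar> \<le> D0 * norm h" using lipschitz by blast
  define La where "La = L * (2 * M powr (p0 - 1)) * D0"
  have La: "La > 0" unfolding La_def using L M D0 by simp
  define a where "a = (e / (2 * C * La)) powr (1 / (2 * s))"
  have a: "a > 0" "C * a powr (2 * s) * La = e / 2"
    unfolding a_def using C La s e by (auto simp: powr_powr)
  obtain G where G: "GDERIV (T a) x :> G"
    using trunc_convolution_GDERIV[OF f_integrable exps(1) a(1), of x] unfolding T_def[abs_def] by blast
  have "e / (2 * K') > 0" using e K' by simp
  then obtain d where d: "d > 0" "\<And>y. norm (y - x) < d \<Longrightarrow> norm (T a y - T a x - inner (y - x) G) \<le> e / (2 * K') * norm (y - x)"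
    using G unfolding gderiv_def has_derivative_at_alt by blast
  have "\<bar>v (x + h) - v x - inner h (K' *\<^sub>R G)\<bar> \<le> e * norm h" if h: "norm h < d" for h
  proof -
    have "\<bar>v (x + h) - v x - K' * (T a (x + h) - T a x)\<bar> \<le> C * a powr (2 * s) * (La * norm h)"
    proof (rule C(2)[OF a(1)])
      fix y
      have "\<bar>f (y + h) - f y\<bar> \<le> L * (2 * M powr (p0 - 1)) * \<bar>v (y + h) - v y\<bar>"
        by (intro f_diff_le vM)
      also have "\<dots> \<le> L * (2 * M powr (p0 - 1)) * (D0 * norm h)" using D0 L by (intro mult_left_mono) auto
      finally show "\<bar>f (y + h) - f y\<bar> \<le> La * norm h" unfolding La_def by (simp only: mult_ac)
    qed
    also have "\<dots> = (C * a powr (2 * s) * La) * norm h" by simp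
    finally have 1: "\<bar>v (x + h) - v x - K' * (T a (x + h) - T a x)\<bar> \<le> e / 2 * norm h" unfolding a(2) .
    have "\<bar>T a (x + h) - T a x - inner h G\<bar> \<le> e / (2 * K') * norm h" using d(2)[of "x + h"] h by simp
    then have "K' * \<bar>T a (x + h) - T a x - inner h G\<bar> \<le> K' * (e / (2 * K') * norm h)"
      using K' by (intro mult_left_mono) auto
    also have "K' * (e / (2 * K') * norm h) = e / 2 * norm h" using K' by simp
    also have "K' * \<bar>T a (x + h) - T a x - inner h G\<bar> = \<bar>K' * (T a (x + h) - T a x) - inner h (K' *\<^sub>R G)\<bar>"
      using K' by (subst abs_of_pos[OF K', symmetric], subst abs_mult[symmetric]) (simp add: right_diff_distrib)
    finally have 2: "\<bar>K' * (T a (x + h) - T a x) - inner h (K' *\<^sub>R G)\<bar> \<le> e / 2 * norm h" .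
    have "e / 2 * norm h + e / 2 * norm h = e * norm h" by simp
    then show ?thesis using 1 2 by linarith
  qed
  then show "\<exists>D d. d > 0 \<and> (\<forall>h. norm h < d \<longrightarrow> \<bar>v (x + h) - v x - inner h D\<bar> \<le> e * norm h)"
    using d(1) by blast
qed

lemma gradient_decay:
  "\<exists>C>0. \<exists>R>0. \<forall>x. norm x > R \<longrightarrow> (\<exists>D. GDERIV v x :> D \<and> norm D \<le> C * norm x powr (-(A + 1)))"
proof -
  obtain C R where C: "C > 0" "R > 0"
    "\<And>x h. norm x \<ge> R \<Longrightarrow> norm h \<le> 1 \<Longrightarrow> \<bar>v (x + h) - v x\<bar> \<le> C * norm x powr (-(A + 1)) * norm h"
    using weighted_lipschitz by blast
  have "\<exists>D. GDERIV v x :> D \<and> norm D \<le> C * norm x powr (-(A + 1))" if x: "norm x > R" for x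
  proof -
    obtain D where D: "GDERIV v x :> D" using differentiable by blast
    have "norm D \<le> C * norm x powr (-(A + 1))"
      by (rule GDERIV_norm_le[OF D, of 1]) (use C x in auto)
    then show ?thesis using D by blast
  qed
  then show ?thesis using C by blast
qed

end

section \<open>The heat kernel\<close>

lemma powr_le_exp_bound:
  assumes "m \<ge> 0"
  obtains C where "C > 0" "\<And>x::real. x \<ge> 1 \<Longrightarrow> x powr m \<le> C * exp x"
proof -
  define n where "n = nat \<lceil>m\<rceil> + 1"
  have n: "n > 0" "m \<le> real n" unfolding n_def by linarith+
  have "x powr m \<le> real n ^ n * exp x" if x: "x \<ge> 1" for x :: real
  proof -
    have "x powr m \<le> x powr real n" using x n by (intro powr_mono) auto
    also have "\<dots> = real n ^ n * (x / real n) ^ n" using x n by (simp add: powr_realpow power_divide)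
    also have "(x / real n) ^ n \<le> (1 + x / real n) ^ n" using x n by (intro power_mono) auto
    also have "\<dots> \<le> exp x" using x n by (intro exp_ge_one_plus_x_over_n_power_n) auto
    finally show ?thesis using n by (simp add: mult_left_mono)
  qed
  moreover have "real n ^ n > 0" using n(1) by (intro zero_less_power) simp
  ultimately show ?thesis using that by blast
qed

lemma nn_integral_pos_on:
  assumes [measurable]: "f \<in> borel_measurable M" "S \<in> sets M" and S: "emeasure M S > 0"
    and f: "\<And>x. x \<in> S \<Longrightarrow> f x > 0"
  shows "(\<integral>\<^sup>+x. f x \<partial>M) > 0"
proof (rule ccontr)
  assume "\<not> ?thesis"
  then have "AE x in M. f x = 0" by (simp add: nn_integral_0_iff_AE)
  then have "AE x in M. x \<notin> S" by eventually_elim (use f in force)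
  then have "emeasure M S = 0" by (simp add: AE_iff_measurable[OF assms(2)] AE_iff_null_sets null_setsD1)
  then show False using S by simp
qed

lemma gauss_finite: "(\<integral>\<^sup>+y. ennreal (exp (- (norm (y::'a::euclidean_space))\<^sup>2)) \<partial>lborel) < \<infinity>"
proof -
  have "real DIM('a) + 1 \<ge> 0" by simp
  then obtain C where C: "C > 0" "\<And>x::real. x \<ge> 1 \<Longrightarrow> x powr (real DIM('a) + 1) \<le> C * exp x"
    using powr_le_exp_bound by blast
  obtain C1 where C1: "C1 > 0"
    "\<And>r. r > 0 \<Longrightarrow> (\<integral>\<^sup>+(x::'a). ennreal (norm x powr (-0)) * indicator {x. norm x < r} x \<partial>lborel)
      \<le> ennreal (C1 * r powr (real DIM('a) - 0))"
    using nn_integral_ball_powr[of 0] by auto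
  have "real DIM('a) < real DIM('a) + 1" by simp
  then obtain C2 where C2: "C2 > 0"
    "\<And>r. r > 0 \<Longrightarrow> (\<integral>\<^sup>+(x::'a). ennreal (norm x powr (-(real DIM('a) + 1))) * indicator {x. norm x \<ge> r} x \<partial>lborel)
      \<le> ennreal (C2 * r powr (real DIM('a) - (real DIM('a) + 1)))"
    using nn_integral_outside_ball_powr by blast
  have "(\<integral>\<^sup>+y. ennreal (exp (- (norm (y::'a))\<^sup>2)) \<partial>lborel) \<le> (\<integral>\<^sup>+(y::'a). ennreal (norm y powr (-0)) * indicator {x. norm x < 1} y
      + ennreal C * (ennreal (norm y powr (-(real DIM('a) + 1))) * indicator {x. norm x \<ge> 1} y) \<partial>lborel)"
  proof (rule nn_integral_mono_AE)
    have "AE y in lborel. y \<noteq> (0::'a)" by (rule AE_lborel_singleton)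
    then show "AE y in lborel. ennreal (exp (- (norm (y::'a))\<^sup>2)) \<le> ennreal (norm y powr (-0)) * indicator {x. norm x < 1} y
      + ennreal C * (ennreal (norm y powr (-(real DIM('a) + 1))) * indicator {x. norm x \<ge> 1} y)"
    proof eventually_elim
      case (elim y)
      show ?case
      proof (cases "norm y < 1")
        case True
        have "ennreal (exp (- (norm y)\<^sup>2)) \<le> 1" by (simp add: ennreal_le_1)
        then show ?thesis using True elim by simp
      next
        case False
        have "norm y > 0" using False by linarith
        then have p: "norm y powr (1 + real DIM('a)) > 0" by simp
        have "norm y \<le> (norm y)\<^sup>2" using False by (simp add: power2_eq_square mult_le_cancel_left1)
        then have "exp (- (norm y)\<^sup>2) \<le> exp (- norm y)" by simp
        also have "\<dots> \<le> C * norm y powr (-(real DIM('a) + 1))"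
          unfolding powr_minus exp_minus using C(2)[of "norm y"] False p by (simp add: field_simps)
        finally show ?thesis using False C by (simp add: ennreal_mult[symmetric] ennreal_leI)
      qed
    qed
  qed
  also have "\<dots> = (\<integral>\<^sup>+(x::'a). ennreal (norm x powr (-0)) * indicator {x. norm x < 1} x \<partial>lborel)
     + ennreal C * (\<integral>\<^sup>+(x::'a). ennreal (norm x powr (-(real DIM('a) + 1))) * indicator {x. norm x \<ge> 1} x \<partial>lborel)"
    by (subst nn_integral_add) (auto simp: nn_integral_cmult)
  also have "\<dots> \<le> ennreal (C1 * 1 powr (real DIM('a) - 0)) + ennreal C * ennreal (C2 * 1 powr (real DIM('a) - (real DIM('a) + 1)))"
    using C1(2)[of 1] C2(2)[of 1] by (intro add_mono mult_left_mono) auto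
  also have "\<dots> < \<infinity>" by (simp add: ennreal_mult_less_top)
  finally show ?thesis .
qed

text \<open>Its value is \<open>pi powr (N / 2)\<close> in dimension \<open>N\<close>. It is left
  unevaluated, as finiteness and positivity suffice to normalise the heat kernel.\<close>

definition gauss_mass :: "'a::euclidean_space itself \<Rightarrow> real" where
  "gauss_mass _ = (\<integral>y. exp (- (norm (y::'a))\<^sup>2) \<partial>lborel)"

lemma gauss_mass:
  shows nn_gauss_mass: "(\<integral>\<^sup>+y. ennreal (exp (- (norm (y::'a::euclidean_space))\<^sup>2)) \<partial>lborel) = ennreal (gauss_mass TYPE('a))"
    and gauss_mass_pos: "gauss_mass TYPE('a) > 0"
proof -
  have i: "integrable lborel (\<lambda>y::'a. exp (- (norm y)\<^sup>2))"
    by (rule integrableI_bounded) (use gauss_finite in auto)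
  show e: "(\<integral>\<^sup>+y. ennreal (exp (- (norm (y::'a))\<^sup>2)) \<partial>lborel) = ennreal (gauss_mass TYPE('a))"
    unfolding gauss_mass_def by (rule nn_integral_eq_integral[OF i]) simp
  have "(\<integral>\<^sup>+y. ennreal (exp (- (norm (y::'a))\<^sup>2)) \<partial>lborel) > 0"
    by (rule nn_integral_pos_on[where S = UNIV]) auto
  then show "gauss_mass TYPE('a) > 0" unfolding e by simp
qed

lemma nn_integral_gauss:
  fixes m :: "'a::euclidean_space"
  assumes l: "l > 0"
  shows "(\<integral>\<^sup>+y. ennreal (exp (- l * (norm (m - y))\<^sup>2)) \<partial>lborel) = ennreal (l powr (- real DIM('a) / 2) * gauss_mass TYPE('a))"
proof -
  have "(\<integral>\<^sup>+y. ennreal (exp (- l * (norm (m - y))\<^sup>2)) \<partial>lborel) = (\<integral>\<^sup>+y. ennreal (exp (- l * (norm (y::'a))\<^sup>2)) \<partial>lborel)"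
    by (rule nn_integral_lborel_reflect[of "\<lambda>y. ennreal (exp (- l * (norm y)\<^sup>2))" m]) measurable
  also have "\<dots> = (\<integral>\<^sup>+y. ennreal (exp (- (norm (sqrt l *\<^sub>R (y::'a)))\<^sup>2)) \<partial>lborel)"
    using l by (simp add: power_mult_distrib)
  also have "\<dots> = ennreal (sqrt l powr (- real DIM('a))) * (\<integral>\<^sup>+y. ennreal (exp (- (norm (y::'a))\<^sup>2)) \<partial>lborel)"
    using l by (intro nn_integral_lborel_scale) auto
  also have "sqrt l powr (- real DIM('a)) = l powr (- real DIM('a) / 2)"
    using l by (simp add: powr_half_sqrt[symmetric] powr_powr)
  finally show ?thesis using gauss_mass_pos[where 'a='a] by (simp add: nn_gauss_mass ennreal_mult)
qed

text \<open>The Gauss-Weierstrass kernel of the Laplacian; the usual power of \<open>pi\<close> is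
  supplied by \<open>gauss_mass\<close>.\<close>

definition heat :: "real \<Rightarrow> 'a::euclidean_space \<Rightarrow> real" where
  "heat t z = (4 * t) powr (- real DIM('a) / 2) * exp (- (norm z)\<^sup>2 / (4 * t)) / gauss_mass TYPE('a)"

lemma heat_pos: "t > 0 \<Longrightarrow> heat t z > 0"
  unfolding heat_def using gauss_mass_pos[where 'a='a] by simp

lemma heat_nonneg[simp]: "heat t z \<ge> 0"
  unfolding heat_def using gauss_mass_pos[where 'a='a] by simp

lemma heat_commute: "heat t (x - y) = heat t (y - x)"
  by (simp add: heat_def norm_minus_commute)

lemma measurable_heat[measurable]: "heat t \<in> borel_measurable borel"
  unfolding heat_def[abs_def] by measurable

lemma measurable_heat_pair[measurable]: "(\<lambda>(t, z). heat t z) \<in> borel_measurable (borel \<Otimes>\<^sub>M borel)"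
  unfolding heat_def[abs_def] by measurable

lemma measurable_heat_comp[measurable (raw)]:
  "f \<in> borel_measurable M \<Longrightarrow> g \<in> borel_measurable M \<Longrightarrow> (\<lambda>x. heat (f x) (g x)) \<in> borel_measurable M"
  using measurable_compose[OF measurable_Pair measurable_heat_pair, of f M g] by simp

lemma heat_mass:
  assumes "t > 0"
  shows "(\<integral>\<^sup>+y. ennreal (heat t (x - y)) \<partial>lborel) = 1"
proof -
  let ?c = "(4 * t) powr (- real DIM('a) / 2) / gauss_mass TYPE('a)"
  have c: "?c > 0" using assms gauss_mass_pos[where 'a='a] by simp
  have "(\<integral>\<^sup>+y. ennreal (heat t (x - y)) \<partial>lborel) = (\<integral>\<^sup>+y. ennreal ?c * ennreal (exp (- (1 / (4 * t)) * (norm (x - y))\<^sup>2)) \<partial>lborel)"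
    using c by (intro nn_integral_cong) (simp add: heat_def ennreal_mult[symmetric])
  also have "\<dots> = ennreal ?c * ennreal ((1 / (4 * t)) powr (- real DIM('a) / 2) * gauss_mass TYPE('a))"
    using assms nn_integral_gauss[of "1 / (4 * t)" x] by (subst nn_integral_cmult) auto
  also have "\<dots> = ennreal (?c * ((1 / (4 * t)) powr (- real DIM('a) / 2) * gauss_mass TYPE('a)))"
    using c gauss_mass_pos[where 'a='a] by (simp add: ennreal_mult[symmetric])
  also have "?c * ((1 / (4 * t)) powr (- real DIM('a) / 2) * gauss_mass TYPE('a)) = 1"
    using assms gauss_mass_pos[where 'a='a] by (simp add: powr_divide powr_minus field_simps)
  finally show ?thesis by simp
qed

text \<open>Completing the square in \<open>y\<close>: the two exponents add up to the exponent at
  time \<open>t + r\<close> plus that of a Gaussian centred at the weighted mean \<open>m\<close>,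
  whose total mass provides the missing normalisation.\<close>

lemma heat_semigroup:
  fixes x z :: "'a::euclidean_space"
  assumes t: "t > 0" "r > 0"
  shows "(\<integral>\<^sup>+y. ennreal (heat t (x - y) * heat r (y - z)) \<partial>lborel) = ennreal (heat (t + r) (x - z))"
proof -
  define m where "m = (1 / (t + r)) *\<^sub>R (r *\<^sub>R x + t *\<^sub>R z)"
  define l where "l = (t + r) / (4 * t * r)"
  have l: "l > 0" unfolding l_def using t by simp
  have sq: "(norm (x - y))\<^sup>2 / (4 * t) + (norm (y - z))\<^sup>2 / (4 * r) = (norm (x - z))\<^sup>2 / (4 * (t + r)) + l * (norm (m - y))\<^sup>2" for y
  proof -
    define p where "p = x - y" define q where "q = y - z"
    have xz: "x - z = p + q" by (simp add: p_def q_def)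
    have "(t + r) *\<^sub>R (m - y) = r *\<^sub>R p - t *\<^sub>R q"
    proof -
      have "(t + r) *\<^sub>R (m - y) = r *\<^sub>R x + t *\<^sub>R z - (t + r) *\<^sub>R y"
        unfolding m_def using t by (simp add: scaleR_diff_right)
      then show ?thesis unfolding p_def q_def by (simp add: algebra_simps)
    qed
    then have "(norm ((t + r) *\<^sub>R (m - y)))\<^sup>2 = (norm (r *\<^sub>R p - t *\<^sub>R q))\<^sup>2" by simp
    moreover have "(norm ((t + r) *\<^sub>R (m - y)))\<^sup>2 = (t + r)\<^sup>2 * (norm (m - y))\<^sup>2"
      unfolding norm_scaleR power_mult_distrib by simp
    moreover have "(norm (r *\<^sub>R p - t *\<^sub>R q))\<^sup>2 = r\<^sup>2 * (norm p)\<^sup>2 + t\<^sup>2 * (norm q)\<^sup>2 - 2 * r * t * inner p q"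
      unfolding power2_norm_eq_inner by (simp add: inner_diff_left inner_diff_right inner_commute algebra_simps power2_eq_square)
    ultimately have my: "(t + r)\<^sup>2 * (norm (m - y))\<^sup>2 = r\<^sup>2 * (norm p)\<^sup>2 + t\<^sup>2 * (norm q)\<^sup>2 - 2 * r * t * inner p q"
      by simp
    have pq: "(norm (x - z))\<^sup>2 = (norm p)\<^sup>2 + (norm q)\<^sup>2 + 2 * inner p q"
      unfolding xz power2_norm_eq_inner by (simp add: inner_add_left inner_add_right inner_commute)
    have n2: "(norm (m - y))\<^sup>2 = (r\<^sup>2 * (norm p)\<^sup>2 + t\<^sup>2 * (norm q)\<^sup>2 - 2 * r * t * inner p q) / (t + r)\<^sup>2"
      using my t by (simp add: eq_divide_eq mult.commute)
    have "(P / (4 * t) + Q / (4 * r)) = (P + Q + 2 * I) / (4 * (t + r)) + (t + r) / (4 * t * r) * ((r\<^sup>2 * P + t\<^sup>2 * Q - 2 * r * t * I) / (t + r)\<^sup>2)" for P Q I :: real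
    proof -
      have "(t + r) / (4 * t * r) * ((r\<^sup>2 * P + t\<^sup>2 * Q - 2 * r * t * I) / (t + r)\<^sup>2) = (r\<^sup>2 * P + t\<^sup>2 * Q - 2 * r * t * I) / (4 * t * r * (t + r))"
        using t by (simp add: power2_eq_square)
      moreover have "(P + Q + 2 * I) / (4 * (t + r)) = (t * r * (P + Q + 2 * I)) / (4 * t * r * (t + r))" using t by simp
      ultimately have "(P + Q + 2 * I) / (4 * (t + r)) + (t + r) / (4 * t * r) * ((r\<^sup>2 * P + t\<^sup>2 * Q - 2 * r * t * I) / (t + r)\<^sup>2)
         = (t * r * (P + Q + 2 * I) + (r\<^sup>2 * P + t\<^sup>2 * Q - 2 * r * t * I)) / (4 * t * r * (t + r))"
        by (simp only: add_divide_distrib)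
      also have "t * r * (P + Q + 2 * I) + (r\<^sup>2 * P + t\<^sup>2 * Q - 2 * r * t * I) = (r * P + t * Q) * (t + r)"
        by (simp add: algebra_simps power2_eq_square)
      also have "(r * P + t * Q) * (t + r) / (4 * t * r * (t + r)) = (r * P + t * Q) / (4 * t * r)" using t by simp
      also have "\<dots> = P / (4 * t) + Q / (4 * r)" using t by (simp add: add_divide_distrib)
      finally show ?thesis by simp
    qed
    then show ?thesis unfolding n2 pq l_def p_def[symmetric] q_def[symmetric] by blast
  qed
  let ?g = "gauss_mass TYPE('a)"
  have g: "?g > 0" by (rule gauss_mass_pos)
  define c where "c = (4 * t) powr (- real DIM('a) / 2) * (4 * r) powr (- real DIM('a) / 2) / ?g\<^sup>2 * exp (- ((norm (x - z))\<^sup>2 / (4 * (t + r))))"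
  have c: "c \<ge> 0" unfolding c_def using g by simp
  have "heat t (x - y) * heat r (y - z) = c * exp (- l * (norm (m - y))\<^sup>2)" for y
  proof -
    have "exp (- (norm (x - y))\<^sup>2 / (4 * t)) * exp (- (norm (y - z))\<^sup>2 / (4 * r)) =
      exp (- ((norm (x - y))\<^sup>2 / (4 * t) + (norm (y - z))\<^sup>2 / (4 * r)))"
      by (simp add: exp_add[symmetric])
    also have "\<dots> = exp (- ((norm (x - z))\<^sup>2 / (4 * (t + r)))) * exp (- l * (norm (m - y))\<^sup>2)"
      unfolding sq by (simp add: exp_add[symmetric])
    finally have e: "exp (- (norm (x - y))\<^sup>2 / (4 * t)) * exp (- (norm (y - z))\<^sup>2 / (4 * r)) =
      exp (- ((norm (x - z))\<^sup>2 / (4 * (t + r)))) * exp (- l * (norm (m - y))\<^sup>2)" .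
    have "heat t (x - y) * heat r (y - z) = (4 * t) powr (- real DIM('a) / 2) * (4 * r) powr (- real DIM('a) / 2) / ?g\<^sup>2 *
      (exp (- (norm (x - y))\<^sup>2 / (4 * t)) * exp (- (norm (y - z))\<^sup>2 / (4 * r)))"
      unfolding heat_def by (simp add: power2_eq_square)
    then show ?thesis unfolding e c_def by (simp only: mult_ac)
  qed
  then have "(\<integral>\<^sup>+y. ennreal (heat t (x - y) * heat r (y - z)) \<partial>lborel) = (\<integral>\<^sup>+y. ennreal c * ennreal (exp (- l * (norm (m - y))\<^sup>2)) \<partial>lborel)"
    using c by (simp add: ennreal_mult)
  also have "\<dots> = ennreal (c * (l powr (- real DIM('a) / 2) * ?g))"
    using c g l nn_integral_gauss[OF l, of m] by (subst nn_integral_cmult) (auto simp: ennreal_mult)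
  also have "c * (l powr (- real DIM('a) / 2) * ?g) = heat (t + r) (x - z)"
  proof -
    have "(4 * t) powr (- real DIM('a) / 2) * (4 * r) powr (- real DIM('a) / 2) * l powr (- real DIM('a) / 2) =
      (4 * t * (4 * r) * l) powr (- real DIM('a) / 2)"
      using t l powr_mult[of "4 * t" "4 * r"] powr_mult[of "4 * t * (4 * r)" l] by simp
    also have "4 * t * (4 * r) * l = 4 * (t + r)" unfolding l_def using t by simp
    finally have e: "(4 * t) powr (- real DIM('a) / 2) * (4 * r) powr (- real DIM('a) / 2) * l powr (- real DIM('a) / 2) = (4 * (t + r)) powr (- real DIM('a) / 2)" .
    have "c * (l powr (- real DIM('a) / 2) * ?g) = ((4 * t) powr (- real DIM('a) / 2) * (4 * r) powr (- real DIM('a) / 2) * l powr (- real DIM('a) / 2)) *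
       exp (- ((norm (x - z))\<^sup>2 / (4 * (t + r)))) * (?g / ?g\<^sup>2)" unfolding c_def by simp
    also have "?g / ?g\<^sup>2 = 1 / ?g" using g by (simp add: power2_eq_square)
    finally show ?thesis unfolding e heat_def by simp
  qed
  finally show ?thesis .
qed

section \<open>Powers of the norm as superpositions of heat kernels, and decay of heat
  pairings\<close>

lemma nn_integral_real_far_powr:
  fixes a :: real
  assumes a: "a > 1" and r: "r > 0"
  shows "(\<integral>\<^sup>+t. ennreal (t powr (-a)) * indicator {r<..} t \<partial>lborel) < \<infinity>"
proof -
  have a': "real DIM(real) < a" using a by simp
  obtain C where C: "\<And>r. r > 0 \<Longrightarrow> (\<integral>\<^sup>+(x::real). ennreal (norm x powr (-a)) * indicator {x. norm x \<ge> r} x \<partial>lborel)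
      \<le> ennreal (C * r powr (real DIM(real) - a))"
    using nn_integral_outside_ball_powr[OF a'] by blast
  have "(\<integral>\<^sup>+t. ennreal (t powr (-a)) * indicator {r<..} t \<partial>lborel) \<le>
    (\<integral>\<^sup>+(x::real). ennreal (norm x powr (-a)) * indicator {x. norm x \<ge> r} x \<partial>lborel)"
    using r by (intro nn_integral_mono) (auto simp: indicator_def)
  also have "\<dots> \<le> ennreal (C * r powr (real DIM(real) - a))" by (rule C[OF r])
  finally show ?thesis by (rule le_less_trans) simp
qed

lemma nn_integral_real_near_powr:
  fixes a :: real
  assumes a: "a < 1" and r: "r > 0"
  shows "(\<integral>\<^sup>+t. ennreal (t powr (-a)) * indicator {0<..<r} t \<partial>lborel) < \<infinity>"
proof -
  have a': "a < real DIM(real)" using a by simp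
  obtain C where C: "\<And>r. r > 0 \<Longrightarrow> (\<integral>\<^sup>+(x::real). ennreal (norm x powr (-a)) * indicator {x. norm x < r} x \<partial>lborel)
      \<le> ennreal (C * r powr (real DIM(real) - a))"
    using nn_integral_ball_powr[OF a'] by blast
  have "(\<integral>\<^sup>+t. ennreal (t powr (-a)) * indicator {0<..<r} t \<partial>lborel) \<le>
    (\<integral>\<^sup>+(x::real). ennreal (norm x powr (-a)) * indicator {x. norm x < r} x \<partial>lborel)"
    using r by (intro nn_integral_mono) (auto simp: indicator_def)
  also have "\<dots> \<le> ennreal (C * r powr (real DIM(real) - a))" by (rule C[OF r])
  finally show ?thesis by (rule le_less_trans) simp
qed

lemma nn_integral_real_scale:
  fixes f :: "real \<Rightarrow> ennreal"
  assumes f: "f \<in> borel_measurable borel" and c: "c > 0"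
  shows "(\<integral>\<^sup>+t. f t \<partial>lborel) = ennreal c * (\<integral>\<^sup>+t. f (c * t) \<partial>lborel)"
proof -
  have "(\<integral>\<^sup>+t. f (c * t) \<partial>lborel) = ennreal (c powr (-1)) * (\<integral>\<^sup>+t. f t \<partial>lborel)"
    using nn_integral_lborel_scale[OF f c] by simp
  then have "ennreal c * (\<integral>\<^sup>+t. f (c * t) \<partial>lborel) = (ennreal c * ennreal (c powr (-1))) * (\<integral>\<^sup>+t. f t \<partial>lborel)"
    by (simp add: mult.assoc)
  also have "ennreal c * ennreal (c powr (-1)) = 1"
    using c by (simp add: ennreal_mult[symmetric] powr_minus)
  finally show ?thesis by simp
qed

text \<open>Substituting \<open>(norm z)\<^sup>2 * t\<close> for the time shows that the integral is
  homogeneous in \<open>z\<close>, so only its value \<open>J\<close> for a unit vector has to be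
  finite: near time zero by the Gaussian factor, at infinity because \<open>e < N / 2\<close>. It is
  used with \<open>e = s\<close> for the Riesz kernel and with \<open>e = - s\<close> for the kernel
  of the fractional Laplacian.\<close>

lemma heat_subordination:
  assumes e: "e < real DIM('a::euclidean_space) / 2"
  obtains k where "k > 0" "\<And>z::'a. z \<noteq> 0 \<Longrightarrow>
     (\<integral>\<^sup>+t. ennreal (t powr (e - 1) * heat t z) * indicator {0<..} t \<partial>lborel) = ennreal (k * norm z powr (2 * e - real DIM('a)))"
proof -
  let ?N = "real DIM('a)" let ?g = "gauss_mass TYPE('a)"
  have g: "?g > 0" by (rule gauss_mass_pos)
  define j where "j t = ennreal (t powr (e - 1) * ((4 * t) powr (- ?N / 2) * exp (- 1 / (4 * t)) / ?g)) * indicator {0<..} t" for t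
  have [measurable]: "j \<in> borel_measurable borel" unfolding j_def[abs_def] by measurable
  define J where "J = (\<integral>\<^sup>+t. j t \<partial>lborel)"
  have "J < \<infinity>"
  proof -
    define m where "m = 1 + ?N / 2 - e"
    have m: "m > 1" using e by (simp add: m_def)
    then obtain C where C: "C > 0" "\<And>x::real. x \<ge> 1 \<Longrightarrow> x powr m \<le> C * exp x" using powr_le_exp_bound[of m] by auto
    define c where "c = 4 powr (- ?N / 2) / ?g"
    have c: "c > 0" unfolding c_def using g by simp
    define D where "D = c * (4 powr m * max C 1)"
    have D: "D \<ge> 0" unfolding D_def using c by (intro mult_nonneg_nonneg) (auto simp: le_max_iff_disj)
    have bd: "j t \<le> ennreal D * (ennreal (t powr (-0)) * indicator {0<..<2} t) + ennreal c * (ennreal (t powr (-m)) * indicator {1<..} t)" for t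
    proof (cases "t > 0")
      case False then show ?thesis by (simp add: j_def)
    next
      case True
      have "t powr (e - 1) * ((4 * t) powr (- ?N / 2) * exp (- 1 / (4 * t)) / ?g) = c * (t powr (e - 1) * t powr (- ?N / 2)) * exp (- 1 / (4 * t))"
        unfolding c_def powr_mult by simp
      also have "t powr (e - 1) * t powr (- ?N / 2) = t powr (-m)"
      proof -
        have "e - 1 + - ?N / 2 = -m" unfolding m_def by simp
        then show ?thesis by (simp only: powr_add[symmetric])
      qed
      finally have jt: "j t = ennreal (c * t powr (-m) * exp (- 1 / (4 * t)))" using True by (simp add: j_def)
      show ?thesis
      proof (cases "t > 1")
        case t1: True
        have "exp (- 1 / (4 * t)) \<le> 1" using True by simp
        then have "c * t powr (-m) * exp (- 1 / (4 * t)) \<le> c * t powr (-m) * 1" using c by (intro mult_left_mono) auto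
        then have "j t \<le> ennreal c * (ennreal (t powr (-m)) * indicator {1<..} t)"
          unfolding jt using t1 c by (simp add: ennreal_mult[symmetric] ennreal_leI)
        then show ?thesis by (simp add: add_increasing)
      next
        case False
        \<comment> \<open>In this variable the singularity at time zero becomes
          \<open>x powr m\<close> against \<open>exp x\<close>.\<close>
        define x where "x = 1 / (4 * t)"
        have x: "x > 0" "t = 1 / (4 * x)" unfolding x_def using True by auto
        have "t powr (-m) = 4 powr m * x powr m" unfolding x(2) using x(1) by (simp add: powr_divide powr_minus powr_mult)
        then have "t powr (-m) * exp (- x) = 4 powr m * (x powr m / exp x)" by (simp add: exp_minus divide_inverse)
        also have "x powr m / exp x \<le> max C 1"
        proof (cases "x \<ge> 1")
          case True then show ?thesis using C(2)[OF True] by (simp add: field_simps le_max_iff_disj)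
        next
          case False
          then have "x powr m \<le> 1" using x m by (simp add: powr_le1)
          also have "1 \<le> exp x" using x by simp
          finally show ?thesis by (simp add: field_simps le_max_iff_disj)
        qed
        finally have "c * (t powr (-m) * exp (- x)) \<le> c * (4 powr m * max C 1)" using c by (simp add: mult_left_mono)
        also have "\<dots> = D" unfolding D_def ..
        finally have "j t \<le> ennreal D" unfolding jt x_def by (simp add: mult.assoc ennreal_leI)
        then show ?thesis using True False by (simp add: add_increasing2)
      qed
    qed
    have "J \<le> (\<integral>\<^sup>+t. ennreal D * (ennreal (t powr (-0)) * indicator {0<..<2} t) + ennreal c * (ennreal (t powr (-m)) * indicator {1<..} t) \<partial>lborel)"
      unfolding J_def by (intro nn_integral_mono bd)
    also have "\<dots> = ennreal D * (\<integral>\<^sup>+(t::real). ennreal (t powr (-0)) * indicator {0<..<2} t \<partial>lborel) + ennreal c * (\<integral>\<^sup>+t. ennreal (t powr (-m)) * indicator {1<..} t \<partial>lborel)"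
      by (subst nn_integral_add) (auto simp: nn_integral_cmult)
    also have "\<dots> < \<infinity>"
      using nn_integral_real_near_powr[of 0 2] nn_integral_real_far_powr[OF m, of 1] by (simp add: ennreal_mult_less_top)
    finally show ?thesis .
  qed
  moreover have "J > 0" unfolding J_def
    by (rule nn_integral_pos_on[where S = "{0<..<1}"]) (use g in \<open>auto simp: j_def\<close>)
  ultimately obtain k where k: "J = ennreal k" "k > 0" by (cases J) auto
  have "(\<integral>\<^sup>+t. ennreal (t powr (e - 1) * heat t z) * indicator {0<..} t \<partial>lborel) = ennreal (k * norm z powr (2 * e - ?N))"
    if z: "z \<noteq> 0" for z :: 'a
  proof -
    define r where "r = norm z"
    have r: "r > 0" using z by (simp add: r_def)
    have sc: "ennreal ((r\<^sup>2 * t) powr (e - 1) * heat (r\<^sup>2 * t) z) * indicator {0<..} (r\<^sup>2 * t) = ennreal (r powr (2 * e - 2 - ?N)) * j t" for t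
    proof (cases "t > 0")
      case True
      have "(r\<^sup>2 * t) powr (e - 1) * heat (r\<^sup>2 * t) z = ((r\<^sup>2) powr (e - 1) * (r\<^sup>2) powr (- ?N / 2)) * (t powr (e - 1) * ((4 * t) powr (- ?N / 2) * exp (- 1 / (4 * t)) / ?g))"
        unfolding heat_def r_def[symmetric] using r True by (simp add: powr_mult field_simps)
      also have "(r\<^sup>2) powr (e - 1) * (r\<^sup>2) powr (- ?N / 2) = r powr (2 * e - 2 - ?N)"
      proof -
        have "r\<^sup>2 = r powr 2" using r by simp
        then have "(r\<^sup>2) powr (e - 1) * (r\<^sup>2) powr (- ?N / 2) = r powr (2 * (e - 1) + 2 * (- ?N / 2))"
          by (simp only: powr_powr powr_add)
        also have "2 * (e - 1) + 2 * (- ?N / 2) = 2 * e - 2 - ?N" by simp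
        finally show ?thesis .
      qed
      finally show ?thesis using True r g by (simp add: j_def ennreal_mult[symmetric] zero_less_mult_iff)
    qed (use r in \<open>simp add: j_def zero_less_mult_iff\<close>)
    have "(\<integral>\<^sup>+t. ennreal (t powr (e - 1) * heat t z) * indicator {0<..} t \<partial>lborel) =
       ennreal (r\<^sup>2) * (\<integral>\<^sup>+t. ennreal ((r\<^sup>2 * t) powr (e - 1) * heat (r\<^sup>2 * t) z) * indicator {0<..} (r\<^sup>2 * t) \<partial>lborel)"
      using r by (intro nn_integral_real_scale) auto
    also have "\<dots> = ennreal (r\<^sup>2) * (ennreal (r powr (2 * e - 2 - ?N)) * J)"
      unfolding sc J_def by (subst nn_integral_cmult) auto
    also have "\<dots> = ennreal (r\<^sup>2 * (r powr (2 * e - 2 - ?N) * k))" unfolding k(1) using k(2) r by (simp add: ennreal_mult[symmetric])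
    also have "r\<^sup>2 * (r powr (2 * e - 2 - ?N) * k) = k * r powr (2 * e - ?N)"
    proof -
      have "r\<^sup>2 = r powr 2" using r by simp
      then have "r\<^sup>2 * r powr (2 * e - 2 - ?N) = r powr (2 + (2 * e - 2 - ?N))" by (simp only: powr_add)
      also have "2 + (2 * e - 2 - ?N) = 2 * e - ?N" by simp
      finally show ?thesis by (simp add: mult_ac)
    qed
    finally show ?thesis by (simp add: r_def)
  qed
  then show ?thesis by (rule that[OF k(2)])
qed

text \<open>Young's inequality pairs the integral of \<open>g powr r\<close> with that of the heat
  kernel to the conjugate power \<open>r'\<close>, a Gaussian integral computed explicitly. With the
  weight \<open>c = t powr (- (N / (2 * r)))\<close> both terms scale like \<open>c\<close>,
  uniformly in the centre.\<close>

lemma heat_pairing_decay: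
  fixes g :: "'a::euclidean_space \<Rightarrow> real"
  assumes [measurable]: "g \<in> borel_measurable borel" and g: "\<And>x. g x \<ge> 0"
    and r: "r > 1" and I: "(\<integral>\<^sup>+x. ennreal (g x powr r) \<partial>lborel) < \<infinity>"
  obtains C where "C > 0" "\<And>t a. t > 0 \<Longrightarrow> (\<integral>\<^sup>+x. ennreal (g x * heat t (x - a)) \<partial>lborel) \<le> ennreal (C * t powr (- (real DIM('a) / (2 * r))))"
proof -
  let ?N = "real DIM('a)" let ?gm = "gauss_mass TYPE('a)"
  have gm: "?gm > 0" by (rule gauss_mass_pos)
  define I0 where "I0 = enn2real (\<integral>\<^sup>+x. ennreal (g x powr r) \<partial>lborel)"
  have I0: "(\<integral>\<^sup>+x. ennreal (g x powr r) \<partial>lborel) = ennreal I0" "I0 \<ge> 0" using I by (auto simp: I0_def)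
  define r' where "r' = r / (r - 1)"
  have r': "r' > 1" "r' - 1 = 1 / (r - 1)" unfolding r'_def using r by (auto simp: field_simps)
  define c0 where "c0 = 4 powr (- (?N / 2) * (r' - 1)) * r' powr (- ?N / 2) * ?gm powr (- r') * ?gm"
  have c0: "c0 > 0" unfolding c0_def using gm r' by simp
  have hp: "(\<integral>\<^sup>+x. ennreal (heat t (x - a) powr r') \<partial>lborel) = ennreal (c0 * t powr (- (?N / 2) * (r' - 1)))" if t: "t > 0" for t and a :: 'a
  proof -
    define c where "c = (4 * t) powr (- ?N / 2 * r') * ?gm powr (- r')"
    have c: "c > 0" unfolding c_def using t gm by simp
    have l: "r' / (4 * t) > 0" using r' t by simp
    have "heat t (x - a) powr r' = c * exp (- (r' / (4 * t)) * (norm (a - x))\<^sup>2)" for x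
    proof -
      have "exp (- (norm (x - a))\<^sup>2 / (4 * t)) powr r' = exp (- (r' / (4 * t)) * (norm (a - x))\<^sup>2)"
        by (simp add: exp_powr_real norm_minus_commute mult.commute)
      then show ?thesis unfolding heat_def c_def powr_divide[OF] powr_mult powr_powr
        using gm by (simp add: powr_divide powr_mult powr_powr powr_minus field_simps)
    qed
    then have "(\<integral>\<^sup>+x. ennreal (heat t (x - a) powr r') \<partial>lborel) = (\<integral>\<^sup>+x. ennreal c * ennreal (exp (- (r' / (4 * t)) * (norm (a - x))\<^sup>2)) \<partial>lborel)"
      using c by (simp add: ennreal_mult)
    also have "\<dots> = ennreal (c * ((r' / (4 * t)) powr (- ?N / 2) * ?gm))"
      using nn_integral_gauss[OF l, of a] c gm by (subst nn_integral_cmult) (auto simp: ennreal_mult)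
    also have "c * ((r' / (4 * t)) powr (- ?N / 2) * ?gm) = c0 * t powr (- (?N / 2) * (r' - 1))"
    proof -
      have e: "x powr (- ?N / 2 * r') * (1 / x) powr (- ?N / 2) = x powr (- (?N / 2) * (r' - 1))" if "x > 0" for x :: real
      proof -
        have "(1 / x) powr (- ?N / 2) = x powr (?N / 2)" using that by (simp add: powr_divide powr_minus)
        moreover have "- ?N / 2 * r' + ?N / 2 = - (?N / 2) * (r' - 1)" by (simp add: field_simps)
        ultimately show ?thesis by (simp only: powr_add[symmetric])
      qed
      have "(r' / (4 * t)) powr (- ?N / 2) = r' powr (- ?N / 2) * ((1 / 4) powr (- ?N / 2) * (1 / t) powr (- ?N / 2))"
        by (simp add: powr_mult[symmetric])
      then have "c * ((r' / (4 * t)) powr (- ?N / 2) * ?gm) = (4 powr (- ?N / 2 * r') * (1 / 4) powr (- ?N / 2)) * (t powr (- ?N / 2 * r') * (1 / t) powr (- ?N / 2)) * r' powr (- ?N / 2) * ?gm powr (- r') * ?gm"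
        unfolding c_def powr_mult by (simp only: mult_ac)
      moreover have "4 powr (- ?N / 2 * r') * (1 / 4) powr (- ?N / 2) = (4::real) powr (- (?N / 2) * (r' - 1))" by (rule e) simp
      ultimately show ?thesis unfolding e[OF t] c0_def by (simp only: mult_ac)
    qed
    finally show ?thesis .
  qed
  define C where "C = I0 + c0"
  have C: "C > 0" unfolding C_def using I0 c0 by simp
  have "(\<integral>\<^sup>+x. ennreal (g x * heat t (x - a)) \<partial>lborel) \<le> ennreal (C * t powr (- (?N / (2 * r))))" if t: "t > 0" for t and a :: 'a
  proof -
    define c where "c = t powr (- (?N / (2 * r)))"
    have c: "c > 0" unfolding c_def using t by simp
    have "(\<integral>\<^sup>+x. ennreal (g x * heat t (x - a)) \<partial>lborel) \<le> (\<integral>\<^sup>+x. ennreal c * ennreal (g x powr r) + ennreal (c powr (- (1/(r-1)))) * ennreal (heat t (x - a) powr r') \<partial>lborel)"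
    proof (rule nn_integral_mono)
      fix x
      have "g x * heat t (x - a) \<le> c * g x powr r + c powr (- (1/(r-1))) * heat t (x - a) powr r'"
        unfolding r'_def using g c r by (intro weighted_young) auto
      then have "ennreal (g x * heat t (x - a)) \<le> ennreal (c * g x powr r + c powr (- (1/(r-1))) * heat t (x - a) powr r')"
        by (rule ennreal_leI)
      then show "ennreal (g x * heat t (x - a)) \<le> ennreal c * ennreal (g x powr r) + ennreal (c powr (- (1/(r-1)))) * ennreal (heat t (x - a) powr r')"
        using c by (simp add: ennreal_mult)
    qed
    also have "\<dots> = ennreal c * ennreal I0 + ennreal (c powr (- (1/(r-1)))) * ennreal (c0 * t powr (- (?N / 2) * (r' - 1)))"
      by (subst nn_integral_add) (auto simp: nn_integral_cmult hp[OF t] I0(1))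
    also have "\<dots> = ennreal (c * I0 + c0 * (c powr (- (1/(r-1))) * t powr (- (?N / 2) * (r' - 1))))"
      using c I0 c0 by (simp add: ennreal_mult[symmetric] ennreal_plus[symmetric] mult_ac del: ennreal_plus)
    also have "c powr (- (1/(r-1))) * t powr (- (?N / 2) * (r' - 1)) = c"
    proof -
      define w where "w = ?N / (2 * r)"
      have w: "?N / 2 = w * r" unfolding w_def using r by simp
      have "(1 - r) / (r - 1) = -1" using r by (simp add: divide_eq_eq)
      moreover have "- w * (- (1/(r-1))) + (- (w * r) * (1/(r-1))) = w * ((1 - r) / (r - 1))"
        by (simp add: diff_divide_distrib algebra_simps)
      ultimately have "- (?N / (2 * r)) * (- (1/(r-1))) + (- (?N / 2) * (1/(r-1))) = - (?N / (2 * r))"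
        unfolding w w_def[symmetric] by simp
      then show ?thesis unfolding c_def r'(2) powr_powr powr_add[symmetric] by simp
    qed
    also have "c * I0 + c0 * c = C * t powr (- (?N / (2 * r)))" unfolding C_def c_def by (simp add: algebra_simps)
    finally show ?thesis .
  qed
  then show ?thesis by (rule that[OF C])
qed

section \<open>Inversion by Abel's integral equation\<close>

text \<open>Abel's kernel \<open>(r - e) powr (s - 1)\<close> inverts, up to a constant, the
  fractional difference with weight \<open>t powr (- 1 - s)\<close>. Both are kept in one
  nonnegative weight so that the iterated integral can be treated on a product space.\<close>

definition abel_weight :: "real \<Rightarrow> real \<Rightarrow> real \<Rightarrow> real \<Rightarrow> real" where
  "abel_weight s e r t = (if e < r \<and> 0 < t then (r - e) powr (s - 1) * t powr (- 1 - s) else 0)"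

lemma abel_weight_nonneg[simp]: "abel_weight s e r t \<ge> 0"
  by (simp add: abel_weight_def)

lemma measurable_abel_weight[measurable (raw)]:
  assumes [measurable]: "f \<in> borel_measurable M" "g \<in> borel_measurable M"
  shows "(\<lambda>x. abel_weight s e (f x) (g x)) \<in> borel_measurable M"
  unfolding abel_weight_def by measurable

text \<open>For fixed \<open>r\<close> the times \<open>t\<close> with \<open>x < r + t\<close>
  contribute a multiple of \<open>(x - r) powr (-s)\<close>. What remains is the Beta integral of
  \<open>y powr (s - 1) * (1 - y) powr (-s)\<close>, whose exponents add up to \<open>-1\<close>;
  the length \<open>x - e\<close> therefore scales out and the value is a constant.\<close>

lemma abel_weight_integral:
  assumes s: "0 < s" "s < 1"
  obtains k where "k > 0" "\<And>e x. e < x \<Longrightarrow>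
    (\<integral>\<^sup>+r. (\<integral>\<^sup>+t. ennreal (abel_weight s e r t * indicator {r<..<r + t} x) \<partial>lborel) \<partial>lborel) = ennreal k"
proof -
  define j where "j t = ennreal (t powr (-(1+s))) * indicator {1<..} t" for t :: real
  have [measurable]: "j \<in> borel_measurable borel" unfolding j_def[abs_def] by measurable
  have "(\<integral>\<^sup>+t. j t \<partial>lborel) < \<infinity>" unfolding j_def using s by (intro nn_integral_real_far_powr) auto
  moreover have "(\<integral>\<^sup>+t. j t \<partial>lborel) > 0"
    by (rule nn_integral_pos_on[where S = "{1<..<2}"]) (auto simp: j_def)
  ultimately obtain k1 where k1: "(\<integral>\<^sup>+t. j t \<partial>lborel) = ennreal k1" "k1 > 0" by (cases "\<integral>\<^sup>+t. j t \<partial>lborel") auto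
  have inner: "(\<integral>\<^sup>+t. ennreal (t powr (-1-s)) * indicator {a<..} t \<partial>lborel) = ennreal (k1 * a powr (-s))" if a: "a > 0" for a :: real
  proof -
    have "(\<integral>\<^sup>+t. ennreal (t powr (-1-s)) * indicator {a<..} t \<partial>lborel) =
      ennreal a * (\<integral>\<^sup>+t. ennreal ((a * t) powr (-1-s)) * indicator {a<..} (a * t) \<partial>lborel)"
      using a by (intro nn_integral_real_scale) auto
    also have "(\<integral>\<^sup>+t. ennreal ((a * t) powr (-1-s)) * indicator {a<..} (a * t) \<partial>lborel) =
       (\<integral>\<^sup>+t. ennreal (a powr (-1-s)) * j t \<partial>lborel)"
      using a by (intro nn_integral_cong) (auto simp: j_def powr_mult indicator_def ennreal_mult)
    also have "\<dots> = ennreal (a powr (-1-s)) * ennreal k1" by (subst nn_integral_cmult) (auto simp: k1)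
    also have "ennreal a * (ennreal (a powr (-1-s)) * ennreal k1) = ennreal (a * (a powr (-1-s) * k1))"
      using a k1 by (simp add: ennreal_mult[symmetric])
    also have "a * (a powr (-1-s) * k1) = k1 * a powr (-s)"
      using powr_mult_base[of a "-1-s"] a by (simp add: mult_ac)
    finally show ?thesis .
  qed
  define b where "b y = ennreal (y powr (s - 1) * (1 - y) powr (-s)) * indicator {0<..<1} y" for y :: real
  have [measurable]: "b \<in> borel_measurable borel" unfolding b_def[abs_def] by measurable
  have "(\<integral>\<^sup>+y. b y \<partial>lborel) < \<infinity>"
  proof -
    define p where "p y = ennreal (y powr (-(1-s))) * indicator {0<..<1} y" for y :: real
    define q where "q y = ennreal (y powr (-s)) * indicator {0<..<1} y" for y :: real
    have [measurable]: "p \<in> borel_measurable borel" "q \<in> borel_measurable borel" unfolding p_def[abs_def] q_def[abs_def] by measurable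
    have "b y \<le> ennreal (2 powr s) * p y + ennreal (2 powr (1-s)) * q (1 - y)" for y
    proof (cases "0 < y \<and> y < 1")
      case False then show ?thesis by (auto simp: b_def)
    next
      case True
      show ?thesis
      proof (cases "y \<le> 1/2")
        case h: True
        have "(1 - y) powr (-s) \<le> (1/2) powr (-s)" using h True s by (intro powr_mono2') auto
        also have "\<dots> = 2 powr s" by (simp add: powr_divide powr_minus)
        finally have "y powr (s - 1) * (1 - y) powr (-s) \<le> y powr (s - 1) * 2 powr s" by (intro mult_left_mono) auto
        then have "b y \<le> ennreal (2 powr s) * p y" using True by (simp add: b_def p_def ennreal_mult[symmetric] mult.commute ennreal_leI)
        then show ?thesis by (simp add: add_increasing2)
      next
        case h: False
        have "y powr (s - 1) \<le> (1/2) powr (s - 1)" using h True s by (intro powr_mono2') auto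
        also have "\<dots> = 2 powr (1 - s)" by (simp add: powr_divide powr_diff)
        finally have "y powr (s - 1) * (1 - y) powr (-s) \<le> 2 powr (1 - s) * (1 - y) powr (-s)" by (intro mult_right_mono) auto
        then have "b y \<le> ennreal (2 powr (1-s)) * q (1 - y)" using True by (simp add: b_def q_def ennreal_mult[symmetric] ennreal_leI)
        then show ?thesis by (simp add: add_increasing)
      qed
    qed
    then have "(\<integral>\<^sup>+y. b y \<partial>lborel) \<le> (\<integral>\<^sup>+y. ennreal (2 powr s) * p y + ennreal (2 powr (1-s)) * q (1 - y) \<partial>lborel)"
      by (intro nn_integral_mono)
    also have "\<dots> = ennreal (2 powr s) * (\<integral>\<^sup>+y. p y \<partial>lborel) + ennreal (2 powr (1-s)) * (\<integral>\<^sup>+y. q (1 - y) \<partial>lborel)"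
      by (simp add: nn_integral_add nn_integral_cmult)
    also have "(\<integral>\<^sup>+y. q (1 - y) \<partial>lborel) = (\<integral>\<^sup>+y. q y \<partial>lborel)" by (rule nn_integral_lborel_reflect) measurable
    also have "ennreal (2 powr s) * (\<integral>\<^sup>+y. p y \<partial>lborel) + ennreal (2 powr (1-s)) * (\<integral>\<^sup>+y. q y \<partial>lborel) < \<infinity>"
      using nn_integral_real_near_powr[of "1-s" 1] nn_integral_real_near_powr[of s 1] s
      unfolding p_def q_def by (simp add: ennreal_mult_less_top)
    finally show ?thesis .
  qed
  moreover have "(\<integral>\<^sup>+y. b y \<partial>lborel) > 0"
    by (rule nn_integral_pos_on[where S = "{0<..<1}"]) (auto simp: b_def)
  ultimately obtain k2 where k2: "(\<integral>\<^sup>+y. b y \<partial>lborel) = ennreal k2" "k2 > 0" by (cases "\<integral>\<^sup>+y. b y \<partial>lborel") auto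
  have "(\<integral>\<^sup>+r. (\<integral>\<^sup>+t. ennreal (abel_weight s e r t * indicator {r<..<r + t} x) \<partial>lborel) \<partial>lborel) = ennreal (k1 * k2)"
    if ex: "e < x" for e x :: real
  proof -
    define d where "d = x - e"
    have d: "d > 0" using ex by (simp add: d_def)
    define h where "h r = ennreal (k1 * (r powr (s - 1) * (d - r) powr (-s))) * indicator {0<..<d} r" for r
    have [measurable]: "h \<in> borel_measurable borel" unfolding h_def[abs_def] by measurable
    have "(\<integral>\<^sup>+t. ennreal (abel_weight s e r t * indicator {r<..<r + t} x) \<partial>lborel) = h (r + (-e))" for r
    proof (cases "e < r \<and> r < x")
      case True
      have "(\<integral>\<^sup>+t. ennreal (abel_weight s e r t * indicator {r<..<r + t} x) \<partial>lborel) =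
        (\<integral>\<^sup>+t. ennreal ((r - e) powr (s - 1)) * (ennreal (t powr (-1-s)) * indicator {x - r<..} t) \<partial>lborel)"
        using True by (intro nn_integral_cong) (auto simp: abel_weight_def indicator_def ennreal_mult)
      also have "\<dots> = ennreal ((r - e) powr (s - 1)) * ennreal (k1 * (x - r) powr (-s))"
        using True by (subst nn_integral_cmult) (auto simp: inner)
      also have "\<dots> = h (r + (-e))" using True k1 by (auto simp: h_def d_def ennreal_mult[symmetric] mult_ac)
      finally show ?thesis .
    next
      case False
      then have z: "abel_weight s e r t * indicator {r<..<r + t} x = 0" for t by (auto simp: abel_weight_def)
      show ?thesis unfolding z using False by (auto simp: h_def d_def)
    qed
    then have "(\<integral>\<^sup>+r. (\<integral>\<^sup>+t. ennreal (abel_weight s e r t * indicator {r<..<r + t} x) \<partial>lborel) \<partial>lborel) = (\<integral>\<^sup>+r. h (r + (-e)) \<partial>lborel)"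
      by simp
    also have "\<dots> = (\<integral>\<^sup>+r. h r \<partial>lborel)" by (rule nn_integral_lborel_translate) measurable
    also have "\<dots> = ennreal d * (\<integral>\<^sup>+r. h (d * r) \<partial>lborel)" using d by (intro nn_integral_real_scale) auto
    also have "(\<integral>\<^sup>+r. h (d * r) \<partial>lborel) = (\<integral>\<^sup>+r. ennreal (k1 / d) * b r \<partial>lborel)"
    proof (rule nn_integral_cong)
      fix r
      show "h (d * r) = ennreal (k1 / d) * b r"
      proof (cases "0 < r \<and> r < 1")
        case True
        have "(d * r) powr (s - 1) * (d - d * r) powr (-s) = (d powr (s - 1) * d powr (-s)) * (r powr (s - 1) * (1 - r) powr (-s))"
        proof -
          have "d - d * r = d * (1 - r)" by (simp add: algebra_simps)
          then show ?thesis by (simp only: powr_mult mult_ac)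
        qed
        also have "d powr (s - 1) * d powr (-s) = 1 / d"
          using d powr_minus_divide[of d 1] by (simp add: powr_add[symmetric])
        finally have "h (d * r) = ennreal (k1 * (1 / d * (r powr (s - 1) * (1 - r) powr (-s))))"
          using True d by (simp add: h_def)
        then show ?thesis using True d k1 by (simp add: b_def ennreal_mult[symmetric])
      qed (use d in \<open>auto simp: h_def b_def zero_less_mult_iff\<close>)
    qed
    also have "\<dots> = ennreal (k1 / d) * ennreal k2" by (subst nn_integral_cmult) (auto simp: k2)
    also have "ennreal d * (ennreal (k1 / d) * ennreal k2) = ennreal (k1 * k2)"
      using d k1 k2 by (simp add: ennreal_mult[symmetric])
    finally show ?thesis .
  qed
  moreover have "k1 * k2 > 0" using k1 k2 by simp
  ultimately show ?thesis using that by blast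
qed

text \<open>Applied to \<open>U t = \<integral> u * heat t\<close>: the inner integral is the pairing of \<open>u\<close> with the fractional
  Laplacian of the heat kernel at time \<open>r\<close>, and the outer one applies the Riesz potential.\<close>

lemma abel_inversion:
  fixes U H :: "real \<Rightarrow> real"
  assumes k: "k > 0" "\<And>e x. e < x \<Longrightarrow>
      (\<integral>\<^sup>+r. (\<integral>\<^sup>+t. ennreal (abel_weight s e r t * indicator {r<..<r + t} x) \<partial>lborel) \<partial>lborel) = ennreal k"
    and [measurable]: "H \<in> borel_measurable borel"
    and H: "(\<integral>\<^sup>+x. ennreal (\<bar>H x\<bar> * indicator {e<..} x) \<partial>lborel) < \<infinity>"
    and UH: "\<And>r T. e \<le> r \<Longrightarrow> r < T \<Longrightarrow> U r - U T = - (\<integral>x. H x * indicator {r<..<T} x \<partial>lborel)"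
    and lim: "(U \<longlongrightarrow> 0) at_top"
  shows "(\<integral>r. (\<integral>t. abel_weight s e r t * (U r - U (r + t)) \<partial>lborel) \<partial>lborel) = k * U e"
proof -
  have "sigma_finite_measure (lborel \<Otimes>\<^sub>M lborel :: (real \<times> real) measure)"
    by (simp add: lborel_prod lborel.sigma_finite_measure_axioms)
  then interpret P3: pair_sigma_finite "lborel \<Otimes>\<^sub>M lborel :: (real \<times> real) measure" "lborel :: real measure"
    by (intro pair_sigma_finite.intro lborel.sigma_finite_measure_axioms)
  \<comment> \<open>The increment \<open>U r - U (r + t)\<close> is minus the integral of
    \<open>H\<close> over \<open>r < x < r + t\<close>. With this crossing condition inside the
    weight, integrating over \<open>(r, t)\<close> first gives the constant \<open>k\<close> for
    every \<open>x > e\<close>, which both justifies Fubini's theorem and leaves only the integral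
    of \<open>H\<close> beyond \<open>e\<close>.\<close>
  define W where "W z x = abel_weight s e (fst z) (snd z) * indicator {fst z<..<fst z + snd z} x" for z :: "real \<times> real" and x :: real
  have [measurable]: "(\<lambda>p. W (fst p) (snd p)) \<in> borel_measurable ((lborel \<Otimes>\<^sub>M lborel) \<Otimes>\<^sub>M lborel)"
    unfolding W_def indicator_def greaterThanLessThan_iff by measurable
  have Wm: "(\<lambda>z. ennreal (W z x)) \<in> borel_measurable (lborel \<Otimes>\<^sub>M lborel)" for x
    unfolding W_def indicator_def greaterThanLessThan_iff by measurable
  have W0: "W z x \<ge> 0" for z x unfolding W_def by simp
  have Wx: "(\<integral>\<^sup>+z. ennreal (W z x) \<partial>(lborel \<Otimes>\<^sub>M lborel)) = ennreal (k * indicator {e<..} x)" for x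
  proof -
    have "(\<integral>\<^sup>+z. ennreal (W z x) \<partial>(lborel \<Otimes>\<^sub>M lborel)) = (\<integral>\<^sup>+r. (\<integral>\<^sup>+t. ennreal (W (r, t) x) \<partial>lborel) \<partial>lborel)"
      by (rule lborel.nn_integral_fst[symmetric]) (unfold W_def indicator_def greaterThanLessThan_iff, measurable)
    also have "\<dots> = ennreal (k * indicator {e<..} x)"
    proof (cases "e < x")
      case True then show ?thesis using k(2)[OF True] by (simp add: W_def)
    next
      case False
      then have "W (r, t) x = 0" for r t by (auto simp: W_def abel_weight_def indicator_def)
      then show ?thesis using False by simp
    qed
    finally show ?thesis .
  qed
  have int: "integrable ((lborel \<Otimes>\<^sub>M lborel) \<Otimes>\<^sub>M lborel) (case_prod (\<lambda>z x. W z x * H x))"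
  proof (rule integrableI_bounded)
    show "case_prod (\<lambda>z x. W z x * H x) \<in> borel_measurable ((lborel \<Otimes>\<^sub>M lborel) \<Otimes>\<^sub>M lborel)"
      unfolding case_prod_beta by measurable
    have "(\<integral>\<^sup>+p. ennreal (norm (case p of (z, x) \<Rightarrow> W z x * H x)) \<partial>((lborel \<Otimes>\<^sub>M lborel) \<Otimes>\<^sub>M lborel)) =
      (\<integral>\<^sup>+p. (\<lambda>p. ennreal (W (fst p) (snd p)) * ennreal \<bar>H (snd p)\<bar>) p \<partial>((lborel \<Otimes>\<^sub>M lborel) \<Otimes>\<^sub>M lborel))"
      using W0 by (intro nn_integral_cong) (simp add: abs_mult ennreal_mult split: prod.split)
    also have "\<dots> = (\<integral>\<^sup>+x. (\<integral>\<^sup>+z. ennreal (W z x) * ennreal \<bar>H x\<bar> \<partial>(lborel \<Otimes>\<^sub>M lborel)) \<partial>lborel)"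
    proof -
      have "(\<lambda>p. ennreal (W (fst p) (snd p)) * ennreal \<bar>H (snd p)\<bar>) \<in> borel_measurable ((lborel \<Otimes>\<^sub>M lborel) \<Otimes>\<^sub>M lborel)"
        unfolding W_def indicator_def greaterThanLessThan_iff by measurable
      from P3.nn_integral_snd[OF this] show ?thesis by simp
    qed
    also have "\<dots> = (\<integral>\<^sup>+x. ennreal (k * indicator {e<..} x) * ennreal \<bar>H x\<bar> \<partial>lborel)"
    proof (rule nn_integral_cong)
      fix x
      show "(\<integral>\<^sup>+z. ennreal (W z x) * ennreal \<bar>H x\<bar> \<partial>(lborel \<Otimes>\<^sub>M lborel)) = ennreal (k * indicator {e<..} x) * ennreal \<bar>H x\<bar>"
        by (subst nn_integral_multc[OF Wm]) (simp only: Wx)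
    qed
    also have "\<dots> = (\<integral>\<^sup>+x. ennreal k * ennreal (\<bar>H x\<bar> * indicator {e<..} x) \<partial>lborel)"
      using k by (intro nn_integral_cong) (auto simp: indicator_def ennreal_mult)
    also have "\<dots> = ennreal k * (\<integral>\<^sup>+x. ennreal (\<bar>H x\<bar> * indicator {e<..} x) \<partial>lborel)" by (rule nn_integral_cmult) measurable
    also have "\<dots> < \<infinity>" using H by (simp add: ennreal_mult_less_top)
    finally show "(\<integral>\<^sup>+p. ennreal (norm (case p of (z, x) \<Rightarrow> W z x * H x)) \<partial>((lborel \<Otimes>\<^sub>M lborel) \<Otimes>\<^sub>M lborel)) < \<infinity>" .
  qed
  have Ui: "(\<integral>x. W z x * H x \<partial>lborel) = - (abel_weight s e (fst z) (snd z) * (U (fst z) - U (fst z + snd z)))" for z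
  proof (cases "e < fst z \<and> 0 < snd z")
    case True
    have "(\<integral>x. W z x * H x \<partial>lborel) = (\<integral>x. abel_weight s e (fst z) (snd z) * (H x * indicator {fst z<..<fst z + snd z} x) \<partial>lborel)"
      unfolding W_def by (simp only: mult_ac)
    also have "\<dots> = abel_weight s e (fst z) (snd z) * (\<integral>x. H x * indicator {fst z<..<fst z + snd z} x \<partial>lborel)" by simp
    also have "(\<integral>x. H x * indicator {fst z<..<fst z + snd z} x \<partial>lborel) = - (U (fst z) - U (fst z + snd z))"
      using UH[of "fst z" "fst z + snd z"] True by simp
    finally show ?thesis by (simp only: mult_minus_right)
  next
    case False
    then have "abel_weight s e (fst z) (snd z) = 0" by (auto simp: abel_weight_def)
    then show ?thesis by (simp add: W_def)
  qed
  have Zi: "(\<integral>z. W z x * H x \<partial>(lborel \<Otimes>\<^sub>M lborel)) = k * (H x * indicator {e<..} x)" for x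
  proof -
    have "(\<integral>z. W z x \<partial>(lborel \<Otimes>\<^sub>M lborel)) = k * indicator {e<..} x"
    proof -
      have "(\<integral>z. W z x \<partial>(lborel \<Otimes>\<^sub>M lborel)) = enn2real (\<integral>\<^sup>+z. ennreal (W z x) \<partial>(lborel \<Otimes>\<^sub>M lborel))"
      proof (rule integral_eq_nn_integral)
        show "(\<lambda>z. W z x) \<in> borel_measurable (lborel \<Otimes>\<^sub>M lborel)"
          unfolding W_def indicator_def greaterThanLessThan_iff by measurable
      qed (simp add: W0)
      then show ?thesis unfolding Wx using k by simp
    qed
    then show ?thesis by (simp add: mult_ac)
  qed
  have "(\<integral>x. (\<integral>z. W z x * H x \<partial>(lborel \<Otimes>\<^sub>M lborel)) \<partial>lborel) = (\<integral>z. (\<integral>x. W z x * H x \<partial>lborel) \<partial>(lborel \<Otimes>\<^sub>M lborel))"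
    by (rule P3.Fubini_integral[OF int])
  then have eq: "k * (\<integral>x. H x * indicator {e<..} x \<partial>lborel) = - (\<integral>z. abel_weight s e (fst z) (snd z) * (U (fst z) - U (fst z + snd z)) \<partial>(lborel \<Otimes>\<^sub>M lborel))"
    unfolding Zi Ui by simp
  have int2: "integrable (lborel \<Otimes>\<^sub>M lborel) (\<lambda>z. abel_weight s e (fst z) (snd z) * (U (fst z) - U (fst z + snd z)))"
    using P3.integrable_fst[OF int] unfolding Ui by simp
  have "(\<integral>r. (\<integral>t. abel_weight s e r t * (U r - U (r + t)) \<partial>lborel) \<partial>lborel) =
    (\<integral>z. abel_weight s e (fst z) (snd z) * (U (fst z) - U (fst z + snd z)) \<partial>(lborel \<Otimes>\<^sub>M lborel))"
    using lborel_pair.integral_fst[of "\<lambda>r t. abel_weight s e r t * (U r - U (r + t))"] int2 by (simp add: case_prod_beta')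
  also have "\<dots> = - (k * (\<integral>x. H x * indicator {e<..} x \<partial>lborel))" using eq by simp
  also have "(\<integral>x. H x * indicator {e<..} x \<partial>lborel) = - U e"
  proof (rule LIMSEQ_unique)
    have Hi: "integrable lborel (\<lambda>x. H x * indicator {e<..} x)"
      by (rule integrableI_bounded) (use H in \<open>auto simp: abs_mult indicator_def if_distrib cong: if_cong\<close>)
    have "((\<lambda>y. \<integral>x. indicator {..y} x *\<^sub>R (H x * indicator {e<..} x) \<partial>lborel) \<longlongrightarrow> (\<integral>x. H x * indicator {e<..} x \<partial>lborel)) at_top"
      by (rule tendsto_integral_at_top) (use Hi in auto)
    then show "(\<lambda>n. \<integral>x. indicator {..real n} x *\<^sub>R (H x * indicator {e<..} x) \<partial>lborel) \<longlonglongrightarrow> (\<integral>x. H x * indicator {e<..} x \<partial>lborel)"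
      by (rule filterlim_compose) (rule filterlim_real_sequentially)
    have "(\<lambda>n. U (real n) - U e) \<longlonglongrightarrow> 0 - U e"
      by (intro tendsto_diff tendsto_const filterlim_compose[OF lim] filterlim_real_sequentially)
    moreover have "eventually (\<lambda>n. U (real n) - U e = (\<integral>x. indicator {..real n} x *\<^sub>R (H x * indicator {e<..} x) \<partial>lborel)) sequentially"
      using eventually_gt_at_top[of "nat \<lceil>e\<rceil>"]
    proof eventually_elim
      case (elim n)
      then have n: "e < real n" by linarith
      have "(\<integral>x. indicator {..real n} x *\<^sub>R (H x * indicator {e<..} x) \<partial>lborel) = (\<integral>x. H x * indicator {e<..<real n} x \<partial>lborel)"
      proof (rule integral_cong_AE)
        have "AE x in lborel. x \<noteq> real n" by (rule AE_lborel_singleton)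
        then show "AE x in lborel. indicator {..real n} x *\<^sub>R (H x * indicator {e<..} x) = H x * indicator {e<..<real n} x"
          by eventually_elim (auto simp: indicator_def)
      qed measurable
      then show ?case using UH[of e "real n"] n by simp
    qed
    ultimately show "(\<lambda>n. \<integral>x. indicator {..real n} x *\<^sub>R (H x * indicator {e<..} x) \<partial>lborel) \<longlonglongrightarrow> - U e"
      by (simp add: filterlim_cong)
  qed
  finally show ?thesis by simp
qed

section \<open>The time derivative of the heat flow\<close>

text \<open>Passing to twice the time leaves over a Gaussian factor. It absorbs the polynomial of
  the time derivative in \<open>heat_dt_le\<close> and yields smallness away from the centre in
  \<open>heat_outside_small\<close>.\<close>

lemma heat_eq_double:
  fixes z :: "'a::euclidean_space"
  assumes t: "t > 0"
  shows "heat t z = 2 powr (real DIM('a) / 2) * heat (2 * t) z * exp (- ((norm z)\<^sup>2 / (8 * t)))"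
proof -
  have "- (norm z)\<^sup>2 / (4 * t) = - (norm z)\<^sup>2 / (4 * (2 * t)) + - ((norm z)\<^sup>2 / (8 * t))" using t by (simp add: field_simps)
  then have "exp (- (norm z)\<^sup>2 / (4 * t)) = exp (- (norm z)\<^sup>2 / (4 * (2 * t))) * exp (- ((norm z)\<^sup>2 / (8 * t)))" by (simp only: exp_add)
  moreover have "(4 * (2 * t)) powr (- real DIM('a) / 2) = (4 * t) powr (- real DIM('a) / 2) * 2 powr (- real DIM('a) / 2)"
    using powr_mult[of "4 * t" 2 "- real DIM('a) / 2"] by (simp add: mult_ac)
  moreover have "2 powr (real DIM('a) / 2) * 2 powr (- real DIM('a) / 2) = (1::real)" by (simp add: powr_add[symmetric])
  ultimately show ?thesis unfolding heat_def by (simp add: mult_ac)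
qed

definition heat_dt :: "real \<Rightarrow> 'a::euclidean_space \<Rightarrow> real" where
  "heat_dt t z = heat t z * ((norm z)\<^sup>2 / (4 * t\<^sup>2) - real DIM('a) / (2 * t))"

lemma measurable_heat_dt[measurable (raw)]:
  assumes [measurable]: "f \<in> borel_measurable M" "g \<in> borel_measurable M"
  shows "(\<lambda>x. heat_dt (f x) (g x)) \<in> borel_measurable M"
  unfolding heat_dt_def by measurable

lemma heat_has_derivative:
  assumes t: "t > 0"
  shows "((\<lambda>t. heat t z) has_field_derivative heat_dt t z) (at t)"
proof -
  let ?N = "real DIM('a)" let ?g = "gauss_mass TYPE('a)"
  have "((\<lambda>t. (4 * t) powr (- ?N / 2) * exp (- (norm z)\<^sup>2 / (4 * t)) / ?g) has_field_derivative
     ((4 * ((- ?N / 2) * (4 * t) powr (- ?N / 2 - 1))) * exp (- (norm z)\<^sup>2 / (4 * t))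
       + (4 * t) powr (- ?N / 2) * (exp (- (norm z)\<^sup>2 / (4 * t)) * ((norm z)\<^sup>2 * 4 / (4 * t)\<^sup>2))) / ?g) (at t)"
    using t gauss_mass_pos[where 'a='a] by (auto intro!: derivative_eq_intros simp: power2_eq_square)
  moreover have "(4 * t) powr (- ?N / 2 - 1) = (4 * t) powr (- ?N / 2) / (4 * t)"
    using t by (simp add: powr_diff)
  ultimately show ?thesis
    unfolding heat_dt_def heat_def using t
    by (elim DERIV_cong) (simp add: power2_eq_square field_simps)
qed

lemma heat_dt_le:
  obtains C where "C > 0" "\<And>t (z::'a::euclidean_space). t > 0 \<Longrightarrow> \<bar>heat_dt t z\<bar> \<le> C / t * heat (2 * t) z"
proof -
  let ?N = "real DIM('a)"
  define C where "C = 2 powr (?N / 2) * (2 + ?N / 2)"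
  have "\<bar>heat_dt t z\<bar> \<le> C / t * heat (2 * t) z" if t: "t > 0" for t and z :: 'a
  proof -
    define w where "w = (norm z)\<^sup>2 / (8 * t)"
    have w: "w \<ge> 0" unfolding w_def using t by simp
    have e1: "heat t z = 2 powr (?N / 2) * heat (2 * t) z * exp (- w)"
      unfolding w_def by (rule heat_eq_double[OF t])
    have "\<bar>(norm z)\<^sup>2 / (4 * t\<^sup>2) - ?N / (2 * t)\<bar> \<le> (norm z)\<^sup>2 / (4 * t\<^sup>2) + ?N / (2 * t)"
      using t by (simp add: abs_if)
    also have "\<dots> = (2 * w + ?N / 2) / t" unfolding w_def using t by (simp add: field_simps power2_eq_square)
    finally have e2: "\<bar>(norm z)\<^sup>2 / (4 * t\<^sup>2) - ?N / (2 * t)\<bar> \<le> (2 * w + ?N / 2) / t" .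
    have "\<bar>heat_dt t z\<bar> = heat t z * \<bar>(norm z)\<^sup>2 / (4 * t\<^sup>2) - ?N / (2 * t)\<bar>"
      unfolding heat_dt_def by (simp add: abs_mult)
    also have "\<dots> \<le> heat t z * ((2 * w + ?N / 2) / t)" using e2 by (intro mult_left_mono) auto
    also have "\<dots> = 2 powr (?N / 2) * heat (2 * t) z / t * (exp (- w) * (2 * w + ?N / 2))" unfolding e1 by simp
    also have "\<dots> \<le> 2 powr (?N / 2) * heat (2 * t) z / t * (2 + ?N / 2)"
    proof (rule mult_left_mono)
      have "w \<le> exp w" using exp_ge_add_one_self[of w] by linarith
      then have "exp (- w) * w \<le> 1" by (simp add: exp_minus field_simps)
      moreover have "exp (- w) * (?N / 2) \<le> 1 * (?N / 2)" using w by (intro mult_right_mono) auto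
      moreover have "exp (- w) * (2 * w + ?N / 2) = 2 * (exp (- w) * w) + exp (- w) * (?N / 2)" by (simp add: distrib_left)
      ultimately show "exp (- w) * (2 * w + ?N / 2) \<le> 2 + ?N / 2" by linarith
    qed (use t in auto)
    finally show ?thesis unfolding C_def by (simp add: mult_ac)
  qed
  moreover have "C > 0" unfolding C_def by (simp add: add_pos_nonneg)
  ultimately show ?thesis using that by blast
qed

text \<open>Supplies the hypotheses of \<open>abel_inversion\<close>. Comparing
  \<open>heat_dt t\<close> with the heat kernel at time \<open>2 * t\<close> gives
  \<open>H t\<close> of order \<open>t powr (-(1 + d))\<close>, integrable at infinity; the
  increments of \<open>U\<close> follow from the fundamental theorem of calculus at each
  \<open>x\<close> and Fubini's theorem.\<close>

lemma heat_pairing_time_derivative: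
  fixes u :: "'a::euclidean_space \<Rightarrow> real"
  assumes [measurable]: "u \<in> borel_measurable borel" and u: "\<And>x. u x \<ge> 0"
    and C: "\<And>t. t > 0 \<Longrightarrow> (\<integral>\<^sup>+x. ennreal (u x * heat t (x - a)) \<partial>lborel) \<le> ennreal (C * t powr (-d))"
    and C0: "C \<ge> 0" and d: "d > 0" and e: "e > 0"
  defines "U \<equiv> \<lambda>t. \<integral>x. u x * heat t (x - a) \<partial>lborel"
    and "H \<equiv> \<lambda>t. \<integral>x. u x * heat_dt t (x - a) \<partial>lborel"
  shows "H \<in> borel_measurable borel"
    and "(\<integral>\<^sup>+x. ennreal (\<bar>H x\<bar> * indicator {e<..} x) \<partial>lborel) < \<infinity>"
    and "\<And>r T. e \<le> r \<Longrightarrow> r < T \<Longrightarrow> U r - U T = - (\<integral>x. H x * indicator {r<..<T} x \<partial>lborel)"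
    and "(U \<longlongrightarrow> 0) at_top"
proof -
  obtain C1 where C1: "C1 > 0" "\<And>t (z::'a). t > 0 \<Longrightarrow> \<bar>heat_dt t z\<bar> \<le> C1 / t * heat (2 * t) z"
    using heat_dt_le by blast
  show Hm: "H \<in> borel_measurable borel"
    unfolding H_def by measurable
  have abs_bd: "(\<integral>\<^sup>+x. ennreal (\<bar>u x * heat_dt t (x - a)\<bar>) \<partial>lborel) \<le> ennreal (C1 * C * 2 powr (-d) * t powr (-(1 + d)))" if t: "t > 0" for t
  proof -
    have "(\<integral>\<^sup>+x. ennreal (\<bar>u x * heat_dt t (x - a)\<bar>) \<partial>lborel) \<le> (\<integral>\<^sup>+x. ennreal (C1 / t) * ennreal (u x * heat (2 * t) (x - a)) \<partial>lborel)"
    proof (rule nn_integral_mono)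
      fix x
      have "\<bar>u x * heat_dt t (x - a)\<bar> \<le> u x * (C1 / t * heat (2 * t) (x - a))"
        unfolding abs_mult abs_of_nonneg[OF u] by (intro mult_left_mono C1(2) t u)
      then show "ennreal (\<bar>u x * heat_dt t (x - a)\<bar>) \<le> ennreal (C1 / t) * ennreal (u x * heat (2 * t) (x - a))"
        using C1(1) t u by (simp add: ennreal_mult[symmetric] mult_ac ennreal_leI)
    qed
    also have "\<dots> = ennreal (C1 / t) * (\<integral>\<^sup>+x. ennreal (u x * heat (2 * t) (x - a)) \<partial>lborel)"
      by (rule nn_integral_cmult) measurable
    also have "\<dots> \<le> ennreal (C1 / t) * ennreal (C * (2 * t) powr (-d))"
      using C[of "2 * t"] t by (intro mult_left_mono) auto
    also have "\<dots> = ennreal (C1 / t * (C * (2 * t) powr (-d)))" using C1 t C0 by (simp add: ennreal_mult[symmetric])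
    also have "C1 / t * (C * (2 * t) powr (-d)) = C1 * C * 2 powr (-d) * t powr (-(1 + d))"
      using t by (simp add: powr_mult powr_diff powr_minus field_simps powr_add)
    finally show ?thesis .
  qed
  have fin: "(\<integral>\<^sup>+t. (\<integral>\<^sup>+x. ennreal (\<bar>u x * heat_dt t (x - a)\<bar>) \<partial>lborel) * indicator {r<..} t \<partial>lborel) < \<infinity>" if r: "r > 0" for r
  proof -
    have "(\<integral>\<^sup>+t. (\<integral>\<^sup>+x. ennreal (\<bar>u x * heat_dt t (x - a)\<bar>) \<partial>lborel) * indicator {r<..} t \<partial>lborel) \<le>
      (\<integral>\<^sup>+t. ennreal (C1 * C * 2 powr (-d)) * (ennreal (t powr (-(1 + d))) * indicator {r<..} t) \<partial>lborel)"
    proof (rule nn_integral_mono)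
      fix t
      show "(\<integral>\<^sup>+x. ennreal (\<bar>u x * heat_dt t (x - a)\<bar>) \<partial>lborel) * indicator {r<..} t
        \<le> ennreal (C1 * C * 2 powr (-d)) * (ennreal (t powr (-(1 + d))) * indicator {r<..} t)"
        using abs_bd[of t] r C1 C0 by (cases "r < t") (auto simp: ennreal_mult[symmetric])
    qed
    also have "\<dots> = ennreal (C1 * C * 2 powr (-d)) * (\<integral>\<^sup>+t. ennreal (t powr (-(1 + d))) * indicator {r<..} t \<partial>lborel)"
      by (rule nn_integral_cmult) measurable
    also have "\<dots> < \<infinity>" using nn_integral_real_far_powr[of "1 + d" r] d r by (simp add: ennreal_mult_less_top)
    finally show ?thesis .
  qed
  have ui: "integrable lborel (\<lambda>x. u x * heat t (x - a))" if "t > 0" for t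
    by (rule integrableI_bounded) (use C[OF that] u in \<open>auto simp: abs_mult le_less_trans\<close>)
  have U_le: "0 \<le> U t" "U t \<le> C * t powr (-d)" if "t > 0" for t
  proof -
    show U0: "0 \<le> U t" unfolding U_def using u by (intro integral_nonneg_AE) auto
    have "ennreal (U t) = (\<integral>\<^sup>+x. ennreal (u x * heat t (x - a)) \<partial>lborel)"
      unfolding U_def by (rule nn_integral_eq_integral[symmetric, OF ui[OF that]]) (use u in auto)
    also have "\<dots> \<le> ennreal (C * t powr (-d))" by (rule C[OF that])
    finally show "U t \<le> C * t powr (-d)" using C0 by (subst (asm) ennreal_le_iff) auto
  qed
  show "(U \<longlongrightarrow> 0) at_top"
  proof (rule tendsto_sandwich[of "\<lambda>_. 0" U at_top "\<lambda>t. C * t powr (-d)"])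
    show "eventually (\<lambda>t. 0 \<le> U t) at_top" "eventually (\<lambda>t. U t \<le> C * t powr (-d)) at_top"
      by (rule eventually_mono[OF eventually_gt_at_top[of 0]], erule U_le)+
    have "((\<lambda>t. t powr (-d)) \<longlongrightarrow> 0) at_top" using d by (intro tendsto_neg_powr filterlim_ident) auto
    then show "((\<lambda>t. C * t powr (-d)) \<longlongrightarrow> 0) at_top" by (rule tendsto_mult_right_zero)
  qed auto
  show "(\<integral>\<^sup>+x. ennreal (\<bar>H x\<bar> * indicator {e<..} x) \<partial>lborel) < \<infinity>"
  proof (rule le_less_trans[OF _ fin[OF e]], rule nn_integral_mono)
    fix t
    have "ennreal \<bar>H t\<bar> \<le> (\<integral>\<^sup>+x. ennreal (\<bar>u x * heat_dt t (x - a)\<bar>) \<partial>lborel)"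
    proof (cases "integrable lborel (\<lambda>x. u x * heat_dt t (x - a))")
      case True
      show ?thesis unfolding H_def using integral_norm_bound_ennreal[OF True] by simp
    next
      \<comment> \<open>The Bochner integral of a non-integrable function is zero by convention, so
        the bound is trivial.\<close>
      case False
      then show ?thesis unfolding H_def by (simp add: not_integrable_integral_eq)
    qed
    then show "ennreal (\<bar>H t\<bar> * indicator {e<..} t) \<le> (\<integral>\<^sup>+x. ennreal (\<bar>u x * heat_dt t (x - a)\<bar>) \<partial>lborel) * indicator {e<..} t"
      by (auto simp: indicator_def)
  qed
  fix r T :: real assume r: "e \<le> r" "r < T"
  have r0: "r > 0" using r e by simp
  have int: "integrable (lborel \<Otimes>\<^sub>M lborel) (case_prod (\<lambda>x t. u x * heat_dt t (x - a) * indicator {r<..<T} t))"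
  proof (rule integrableI_bounded)
    show "case_prod (\<lambda>x t. u x * heat_dt t (x - a) * indicator {r<..<T} t) \<in> borel_measurable (lborel \<Otimes>\<^sub>M lborel)"
      unfolding case_prod_beta by measurable
    have m: "(\<lambda>p. ennreal \<bar>u (fst p) * heat_dt (snd p) (fst p - a)\<bar> * indicator {r<..<T} (snd p)) \<in> borel_measurable (lborel \<Otimes>\<^sub>M lborel)"
      by measurable
    have "(\<integral>\<^sup>+p. ennreal (norm (case p of (x, t) \<Rightarrow> u x * heat_dt t (x - a) * indicator {r<..<T} t)) \<partial>(lborel \<Otimes>\<^sub>M lborel))
      = (\<integral>\<^sup>+p. ennreal \<bar>u (fst p) * heat_dt (snd p) (fst p - a)\<bar> * indicator {r<..<T} (snd p) \<partial>(lborel \<Otimes>\<^sub>M lborel))"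
      by (intro nn_integral_cong) (auto simp: indicator_def split: prod.split)
    also have "\<dots> = (\<integral>\<^sup>+t. (\<integral>\<^sup>+x. ennreal \<bar>u x * heat_dt t (x - a)\<bar> * indicator {r<..<T} t \<partial>lborel) \<partial>lborel)"
      using lborel_pair.nn_integral_snd[OF m] by simp
    also have "\<dots> \<le> (\<integral>\<^sup>+t. (\<integral>\<^sup>+x. ennreal (\<bar>u x * heat_dt t (x - a)\<bar>) \<partial>lborel) * indicator {r<..} t \<partial>lborel)"
      by (intro nn_integral_mono) (auto simp: indicator_def)
    also have "\<dots> < \<infinity>" by (rule fin[OF r0])
    finally show "(\<integral>\<^sup>+p. ennreal (norm (case p of (x, t) \<Rightarrow> u x * heat_dt t (x - a) * indicator {r<..<T} t)) \<partial>(lborel \<Otimes>\<^sub>M lborel)) < \<infinity>" .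
  qed
  have ftc: "(\<integral>t. heat_dt t z * indicator {r<..<T} t \<partial>lborel) = heat T z - heat r z" for z :: 'a
  proof -
    have "(\<integral>t. indicator {r..T} t *\<^sub>R heat_dt t z \<partial>lborel) = heat T z - heat r z"
    proof (rule integral_FTC_atLeastAtMost)
      show "r \<le> T" using r by simp
      show "((\<lambda>t. heat t z) has_vector_derivative heat_dt t z) (at t within {r..T})" if "r \<le> t" "t \<le> T" for t
        using heat_has_derivative[of t z] that r0
        by (auto simp: has_real_derivative_iff_has_vector_derivative intro: has_vector_derivative_at_within)
      show "continuous_on {r..T} (\<lambda>t. heat_dt t z)"
        unfolding heat_dt_def heat_def using r0 gauss_mass_pos[where 'a='a] by (auto intro!: continuous_intros)
    qed
    moreover have "(\<integral>t. heat_dt t z * indicator {r<..<T} t \<partial>lborel) = (\<integral>t. indicator {r..T} t *\<^sub>R heat_dt t z \<partial>lborel)"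
    proof (rule integral_cong_AE)
      have "AE t in lborel. t \<noteq> r" "AE t in lborel. t \<noteq> T" by (rule AE_lborel_singleton)+
      then show "AE t in lborel. heat_dt t z * indicator {r<..<T} t = indicator {r..T} t *\<^sub>R heat_dt t z"
        by eventually_elim (auto simp: indicator_def)
    qed measurable
    ultimately show ?thesis by simp
  qed
  have "(\<integral>t. H t * indicator {r<..<T} t \<partial>lborel) = (\<integral>t. (\<integral>x. u x * heat_dt t (x - a) * indicator {r<..<T} t \<partial>lborel) \<partial>lborel)"
    unfolding H_def by simp
  also have "\<dots> = (\<integral>x. (\<integral>t. u x * heat_dt t (x - a) * indicator {r<..<T} t \<partial>lborel) \<partial>lborel)"
    by (rule lborel_pair.Fubini_integral[OF int])
  also have "\<dots> = (\<integral>x. u x * heat T (x - a) - u x * heat r (x - a) \<partial>lborel)"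
    by (simp add: mult.assoc ftc right_diff_distrib)
  also have "\<dots> = U T - U r" unfolding U_def using ui r r0 by simp
  finally show "U r - U T = - (\<integral>x. H x * indicator {r<..<T} x \<partial>lborel)" by simp
qed

section \<open>The weak form tested with heat kernels\<close>

text \<open>The energy inside \<open>Hs_seminorm\<close>, taken over \<open>lborel\<close> and
  without constant and root; kept in \<open>ennreal\<close> so that finiteness is a statement of its
  own.\<close>

definition gagliardo :: "real \<Rightarrow> ('a::euclidean_space \<Rightarrow> real) \<Rightarrow> ennreal" where
  "gagliardo s w = (\<integral>\<^sup>+x. (\<integral>\<^sup>+y. ennreal (\<bar>w x - w y\<bar>\<^sup>2 / norm (x - y) powr (real DIM('a) + 2 * s)) \<partial>lborel) \<partial>lborel)"

lemma nonneg_product_integral: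
  fixes g :: "'a::euclidean_space \<Rightarrow> 'b::euclidean_space \<Rightarrow> real"
  assumes [measurable]: "case_prod g \<in> borel_measurable (lborel \<Otimes>\<^sub>M lborel)" and g: "\<And>x y. g x y \<ge> 0" and c: "c \<ge> 0"
    and i: "(\<integral>\<^sup>+x. (\<integral>\<^sup>+y. ennreal (g x y) \<partial>lborel) \<partial>lborel) = ennreal c"
  shows "integrable (lborel \<Otimes>\<^sub>M lborel) (case_prod g)" "integral\<^sup>L (lborel \<Otimes>\<^sub>M lborel) (case_prod g) = c"
proof -
  have m: "(\<lambda>p. ennreal (case_prod g p)) \<in> borel_measurable (lborel \<Otimes>\<^sub>M lborel)" by measurable
  have e: "(\<integral>\<^sup>+p. ennreal (case_prod g p) \<partial>(lborel \<Otimes>\<^sub>M lborel)) = ennreal c"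
    using lborel.nn_integral_fst[OF m] i by simp
  have g': "norm (case_prod g p) = case_prod g p" for p using g by (cases p) simp
  show int: "integrable (lborel \<Otimes>\<^sub>M lborel) (case_prod g)"
  proof (rule integrableI_bounded)
    show "(\<integral>\<^sup>+p. ennreal (norm (case_prod g p)) \<partial>(lborel \<Otimes>\<^sub>M lborel)) < \<infinity>"
      by (simp only: g' e) simp
  qed measurable
  have "ennreal (integral\<^sup>L (lborel \<Otimes>\<^sub>M lborel) (case_prod g)) = ennreal c"
    using nn_integral_eq_integral[OF int] e g by (auto split: prod.split)
  moreover have "integral\<^sup>L (lborel \<Otimes>\<^sub>M lborel) (case_prod g) \<ge> 0" using g by (intro integral_nonneg_AE) auto
  ultimately show "integral\<^sup>L (lborel \<Otimes>\<^sub>M lborel) (case_prod g) = c" using c by simp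
qed

text \<open>After expansion the four products are nonnegative and, unlike for the singular kernel,
  separately integrable. The two diagonal products integrate to the pairing at time \<open>r\<close>
  by unit mass, the two mixed ones to the pairing at time \<open>r + t\<close> by the semigroup
  law.\<close>

lemma heat_quadratic_form:
  fixes u :: "'a::euclidean_space \<Rightarrow> real"
  assumes [measurable]: "u \<in> borel_measurable borel" and u: "\<And>x. u x \<ge> 0"
    and fin: "\<And>t. t > 0 \<Longrightarrow> (\<integral>\<^sup>+x. ennreal (u x * heat t (x - a)) \<partial>lborel) < \<infinity>"
    and t: "t > 0" "r > 0"
  shows "(\<integral>z. heat t (fst z - snd z) * ((u (fst z) - u (snd z)) * (heat r (fst z - a) - heat r (snd z - a))) \<partial>(lborel \<Otimes>\<^sub>M lborel))
    = 2 * ((\<integral>x. u x * heat r (x - a) \<partial>lborel) - (\<integral>x. u x * heat (r + t) (x - a) \<partial>lborel))"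
proof -
  define U where "U t = (\<integral>x. u x * heat t (x - a) \<partial>lborel)" for t
  have U0: "U t \<ge> 0" for t unfolding U_def using u by (intro integral_nonneg_AE) auto
  have Unn: "(\<integral>\<^sup>+x. ennreal (u x * heat t (x - a)) \<partial>lborel) = ennreal (U t)" if "t > 0" for t
  proof -
    have "integrable lborel (\<lambda>x. u x * heat t (x - a))"
      by (rule integrableI_bounded) (use fin[OF that] u in \<open>auto simp: abs_mult\<close>)
    then show ?thesis unfolding U_def using u by (intro nn_integral_eq_integral) auto
  qed
  define g1 where "g1 x y = heat t (x - y) * (u x * heat r (x - a))" for x y
  define g2 where "g2 x y = heat t (x - y) * (u x * heat r (y - a))" for x y
  define g3 where "g3 x y = heat t (x - y) * (u y * heat r (x - a))" for x y
  define g4 where "g4 x y = heat t (x - y) * (u y * heat r (y - a))" for x y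
  have m: "case_prod g1 \<in> borel_measurable (lborel \<Otimes>\<^sub>M lborel)" "case_prod g2 \<in> borel_measurable (lborel \<Otimes>\<^sub>M lborel)"
    "case_prod g3 \<in> borel_measurable (lborel \<Otimes>\<^sub>M lborel)" "case_prod g4 \<in> borel_measurable (lborel \<Otimes>\<^sub>M lborel)"
    unfolding g1_def g2_def g3_def g4_def case_prod_beta by measurable
  have pos: "g1 x y \<ge> 0" "g2 x y \<ge> 0" "g3 x y \<ge> 0" "g4 x y \<ge> 0" for x y
    unfolding g1_def g2_def g3_def g4_def using u by auto
  have mass: "(\<integral>\<^sup>+y. ennreal (heat t (x - y) * c) \<partial>lborel) = ennreal c" if "c \<ge> 0" for x :: 'a and c
    using that heat_mass[OF t(1), of x] by (simp add: ennreal_mult nn_integral_multc)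
  have semi: "(\<integral>\<^sup>+y. ennreal (heat t (x - y) * (c * heat r (y - a))) \<partial>lborel) = ennreal (c * heat (r + t) (x - a))" if "c \<ge> 0" for x and c
  proof -
    have "(\<integral>\<^sup>+y. ennreal (heat t (x - y) * (c * heat r (y - a))) \<partial>lborel) = (\<integral>\<^sup>+y. ennreal c * ennreal (heat t (x - y) * heat r (y - a)) \<partial>lborel)"
      using that by (intro nn_integral_cong) (simp add: ennreal_mult[symmetric] mult_ac)
    also have "\<dots> = ennreal c * ennreal (heat (t + r) (x - a))"
      by (subst nn_integral_cmult) (auto simp: heat_semigroup[OF t])
    finally show ?thesis using that by (simp add: ennreal_mult add.commute)
  qed
  have swap: "(\<integral>\<^sup>+x. (\<integral>\<^sup>+y. ennreal (g x y) \<partial>lborel) \<partial>lborel) = (\<integral>\<^sup>+y. (\<integral>\<^sup>+x. ennreal (g x y) \<partial>lborel) \<partial>lborel)"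
    if m: "case_prod g \<in> borel_measurable (lborel \<Otimes>\<^sub>M lborel)" for g :: "'a \<Rightarrow> 'a \<Rightarrow> real"
    using lborel_pair.Fubini'[of "\<lambda>x y. ennreal (g x y)"] m by simp
  have i1: "(\<integral>\<^sup>+x. (\<integral>\<^sup>+y. ennreal (g1 x y) \<partial>lborel) \<partial>lborel) = ennreal (U r)"
    unfolding g1_def using u t by (simp add: mass Unn)
  have i2: "(\<integral>\<^sup>+x. (\<integral>\<^sup>+y. ennreal (g2 x y) \<partial>lborel) \<partial>lborel) = ennreal (U (r + t))"
    unfolding g2_def using u t by (simp add: semi Unn)
  have i3: "(\<integral>\<^sup>+x. (\<integral>\<^sup>+y. ennreal (g3 x y) \<partial>lborel) \<partial>lborel) = ennreal (U (r + t))"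
    unfolding swap[OF m(3)] unfolding g3_def using u t by (simp add: heat_commute[of t] semi Unn)
  have i4: "(\<integral>\<^sup>+x. (\<integral>\<^sup>+y. ennreal (g4 x y) \<partial>lborel) \<partial>lborel) = ennreal (U r)"
    unfolding swap[OF m(4)] unfolding g4_def using u t by (simp add: heat_commute[of t] mass Unn)
  note I1 = nonneg_product_integral[OF m(1) pos(1) U0 i1]
  note I2 = nonneg_product_integral[OF m(2) pos(2) U0 i2]
  note I3 = nonneg_product_integral[OF m(3) pos(3) U0 i3]
  note I4 = nonneg_product_integral[OF m(4) pos(4) U0 i4]
  have "(\<integral>z. heat t (fst z - snd z) * ((u (fst z) - u (snd z)) * (heat r (fst z - a) - heat r (snd z - a))) \<partial>(lborel \<Otimes>\<^sub>M lborel))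
    = (\<integral>z. (case_prod g1 z - case_prod g2 z) - (case_prod g3 z - case_prod g4 z) \<partial>(lborel \<Otimes>\<^sub>M lborel))"
    unfolding g1_def g2_def g3_def g4_def by (intro Bochner_Integration.integral_cong) (auto simp: algebra_simps)
  also have "\<dots> = (U r - U (r + t)) - (U (r + t) - U r)"
    by (simp only: Bochner_Integration.integral_diff Bochner_Integration.integrable_diff I1 I2 I3 I4)
  finally show ?thesis unfolding U_def by simp
qed

text \<open>The singular kernel is replaced by its superposition of heat kernels, the time integral
  is moved outside, and \<open>heat_quadratic_form\<close> evaluates the rest at each time. The
  exchange is legitimate because the product of increments is bounded by the sum of the two squared
  increments, whose energies are finite.\<close>

lemma heat_weak_form:
  fixes u :: "'a::euclidean_space \<Rightarrow> real"
  assumes [measurable]: "u \<in> borel_measurable borel" and u: "\<And>x. u x \<ge> 0"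
    and fin: "\<And>t. t > 0 \<Longrightarrow> (\<integral>\<^sup>+x. ennreal (u x * heat t (x - a)) \<partial>lborel) < \<infinity>"
    and s: "0 < s" and r: "r > 0" and k: "k > 0"
    and sub: "\<And>z::'a. z \<noteq> 0 \<Longrightarrow>
     (\<integral>\<^sup>+t. ennreal (t powr (- s - 1) * heat t z) * indicator {0<..} t \<partial>lborel) = ennreal (k * norm z powr (2 * (- s) - real DIM('a)))"
    and Eu: "gagliardo s u < \<infinity>" and Eh: "gagliardo s (\<lambda>x. heat r (x - a)) < \<infinity>"
  shows "k * (\<integral>x. (\<integral>y. (u x - u y) * (heat r (x - a) - heat r (y - a)) / norm (x - y) powr (real DIM('a) + 2 * s) \<partial>lborel) \<partial>lborel)
    = (\<integral>t. indicator {0<..} t * t powr (- 1 - s) * (2 * ((\<integral>x. u x * heat r (x - a) \<partial>lborel) - (\<integral>x. u x * heat (r + t) (x - a) \<partial>lborel))) \<partial>lborel)"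
proof -
  let ?M = "lborel \<Otimes>\<^sub>M lborel :: ('a \<times> 'a) measure"
  have "sigma_finite_measure ?M"
    by (simp add: lborel_prod lborel.sigma_finite_measure_axioms)
  then interpret P3: pair_sigma_finite ?M "lborel :: real measure"
    by (intro pair_sigma_finite.intro lborel.sigma_finite_measure_axioms)
  define h where "h x = heat r (x - a)" for x
  have [measurable]: "h \<in> borel_measurable borel" unfolding h_def[abs_def] by measurable
  define D where "D z = (u (fst z) - u (snd z)) * (h (fst z) - h (snd z))" for z
  have [measurable]: "D \<in> borel_measurable ?M" unfolding D_def[abs_def] by measurable
  define W where "W z t = indicator {0<..} t * t powr (- 1 - s) * heat t (fst z - snd z)" for z :: "'a \<times> 'a" and t :: real
  have W0: "W z t \<ge> 0" for z t unfolding W_def by simp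
  have Wmt: "W z \<in> borel_measurable lborel" for z unfolding W_def[abs_def] by measurable
  define P where "P z = k * norm (fst z - snd z) powr (-(real DIM('a) + 2 * s))" for z :: "'a \<times> 'a"
  have Pm[measurable]: "P \<in> borel_measurable ?M" unfolding P_def[abs_def] by measurable
  have P0: "P z \<ge> 0" for z unfolding P_def using k by simp
  have Wt: "(\<integral>\<^sup>+t. ennreal (W z t) \<partial>lborel) = ennreal (P z)" if "fst z \<noteq> snd z" for z
  proof -
    have "(\<integral>\<^sup>+t. ennreal (W z t) \<partial>lborel) = (\<integral>\<^sup>+t. ennreal (t powr (- s - 1) * heat t (fst z - snd z)) * indicator {0<..} t \<partial>lborel)"
    proof -
      have c: "- 1 - s = - s - 1" by simp
      show ?thesis unfolding W_def c by (intro nn_integral_cong) (auto simp: indicator_def)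
    qed
    also have "\<dots> = ennreal (k * norm (fst z - snd z) powr (2 * (- s) - real DIM('a)))" using that by (intro sub) auto
    also have "2 * (- s) - real DIM('a) = -(real DIM('a) + 2 * s)" by simp
    finally show ?thesis unfolding P_def .
  qed
  \<comment> \<open>Subordination fails on the diagonal, but there the product of increments
    \<open>D\<close> vanishes.\<close>
  have WD: "(\<integral>\<^sup>+t. ennreal \<bar>W z t * D z\<bar> \<partial>lborel) = ennreal (P z * \<bar>D z\<bar>)" for z
  proof (cases "fst z = snd z")
    case True then show ?thesis by (simp add: D_def)
  next
    case False
    have "(\<integral>\<^sup>+t. ennreal \<bar>W z t * D z\<bar> \<partial>lborel) = (\<integral>\<^sup>+t. ennreal (W z t) * ennreal \<bar>D z\<bar> \<partial>lborel)"
      using W0 by (intro nn_integral_cong) (simp add: abs_mult ennreal_mult)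
    also have "\<dots> = ennreal (P z) * ennreal \<bar>D z\<bar>" using Wmt[of z] by (subst nn_integral_multc) (auto simp: Wt[OF False])
    finally show ?thesis using P0 by (simp add: ennreal_mult)
  qed
  have WDi: "(\<integral>t. W z t * D z \<partial>lborel) = P z * D z" for z
  proof (cases "fst z = snd z")
    case True then show ?thesis by (simp add: D_def)
  next
    case False
    have "(\<integral>t. W z t \<partial>lborel) = enn2real (\<integral>\<^sup>+t. ennreal (W z t) \<partial>lborel)"
      by (rule integral_eq_nn_integral) (use Wmt W0 in auto)
    then have "(\<integral>t. W z t \<partial>lborel) = P z" using Wt[OF False] P0 by simp
    then show ?thesis by simp
  qed
  have m: "(\<lambda>(z, t). W z t * D z) \<in> borel_measurable (?M \<Otimes>\<^sub>M lborel)"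
    unfolding W_def D_def case_prod_beta by measurable
  have PD: "(\<integral>\<^sup>+z. ennreal (P z * \<bar>D z\<bar>) \<partial>?M) < \<infinity>"
  proof -
    define e where "e w x y = ennreal (\<bar>w x - w y\<bar>\<^sup>2 / norm (x - y) powr (real DIM('a) + 2 * s))" for w :: "'a \<Rightarrow> real" and x y
    have em: "(\<lambda>z. e w (fst z) (snd z)) \<in> borel_measurable ?M" if [measurable]: "w \<in> borel_measurable borel" for w
      unfolding e_def by measurable
    have ge: "(\<integral>\<^sup>+z. e w (fst z) (snd z) \<partial>?M) = gagliardo s w" if w: "w \<in> borel_measurable borel" for w
      using lborel.nn_integral_fst[OF em[OF w]] by (simp add: gagliardo_def e_def)
    have "(\<integral>\<^sup>+z. ennreal (P z * \<bar>D z\<bar>) \<partial>?M) \<le> (\<integral>\<^sup>+z. ennreal k * (e u (fst z) (snd z) + e h (fst z) (snd z)) \<partial>?M)"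
    proof (rule nn_integral_mono)
      fix z :: "'a \<times> 'a"
      define n where "n = norm (fst z - snd z) powr (-(real DIM('a) + 2 * s))"
      have n: "n \<ge> 0" "x / norm (fst z - snd z) powr (real DIM('a) + 2 * s) = n * x" for x
        unfolding n_def powr_minus by (simp_all add: divide_inverse)
      have "\<bar>D z\<bar> \<le> \<bar>u (fst z) - u (snd z)\<bar>\<^sup>2 + \<bar>h (fst z) - h (snd z)\<bar>\<^sup>2"
      proof -
        have pq: "p * q \<le> p\<^sup>2 + q\<^sup>2" if "p \<ge> 0" "q \<ge> 0" for p q :: real
        proof -
          have "0 \<le> p * q" using that by simp
          moreover have "2 * (p * q) \<le> p\<^sup>2 + q\<^sup>2" using sum_squares_bound[of p q] by (simp add: mult.assoc)
          ultimately show ?thesis by linarith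
        qed
        show ?thesis unfolding D_def abs_mult by (rule pq) auto
      qed
      then have "P z * \<bar>D z\<bar> \<le> k * n * (\<bar>u (fst z) - u (snd z)\<bar>\<^sup>2 + \<bar>h (fst z) - h (snd z)\<bar>\<^sup>2)"
        unfolding P_def n_def using k by (intro mult_left_mono) auto
      then have "ennreal (P z * \<bar>D z\<bar>) \<le> ennreal (k * (n * \<bar>u (fst z) - u (snd z)\<bar>\<^sup>2 + n * \<bar>h (fst z) - h (snd z)\<bar>\<^sup>2))"
        by (intro ennreal_leI) (simp add: algebra_simps)
      also have "\<dots> = ennreal k * (e u (fst z) (snd z) + e h (fst z) (snd z))"
        unfolding e_def n(2) using k n(1) by (simp add: ennreal_mult)
      finally show "ennreal (P z * \<bar>D z\<bar>) \<le> ennreal k * (e u (fst z) (snd z) + e h (fst z) (snd z))" .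
    qed
    also have "\<dots> = ennreal k * (gagliardo s u + gagliardo s h)"
      using em[of u] em[of h] by (simp add: nn_integral_cmult nn_integral_add ge)
    also have "\<dots> < \<infinity>" using Eu Eh unfolding h_def[abs_def] by (simp add: ennreal_mult_less_top)
    finally show ?thesis .
  qed
  have int: "integrable (?M \<Otimes>\<^sub>M lborel) (\<lambda>(z, t). W z t * D z)"
  proof (rule integrableI_bounded[OF m])
    have m2: "(\<lambda>p. ennreal (norm (case p of (z, t) \<Rightarrow> W z t * D z))) \<in> borel_measurable (?M \<Otimes>\<^sub>M lborel)"
      using m by measurable
    show "(\<integral>\<^sup>+p. ennreal (norm (case p of (z, t) \<Rightarrow> W z t * D z)) \<partial>(?M \<Otimes>\<^sub>M lborel)) < \<infinity>"
      using lborel.nn_integral_fst[OF m2] PD by (simp add: WD)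
  qed
  have intPD: "integrable ?M (\<lambda>z. P z * D z)"
    using P3.integrable_fst[OF int] unfolding WDi .
  have "k * (\<integral>x. (\<integral>y. (u x - u y) * (h x - h y) / norm (x - y) powr (real DIM('a) + 2 * s) \<partial>lborel) \<partial>lborel)
     = (\<integral>x. (\<integral>y. P (x, y) * D (x, y) \<partial>lborel) \<partial>lborel)"
    unfolding P_def D_def powr_minus by (simp add: divide_inverse mult_ac)
  also have "\<dots> = (\<integral>z. P z * D z \<partial>?M)"
    using lborel_pair.integral_fst'[OF intPD] by simp
  also have "\<dots> = (\<integral>z. (\<integral>t. W z t * D z \<partial>lborel) \<partial>?M)" by (simp only: WDi)
  also have "\<dots> = (\<integral>t. (\<integral>z. W z t * D z \<partial>?M) \<partial>lborel)" by (rule P3.Fubini_integral[OF int, symmetric])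
  also have "\<dots> = (\<integral>t. indicator {0<..} t * t powr (- 1 - s) * (2 * ((\<integral>x. u x * heat r (x - a) \<partial>lborel) - (\<integral>x. u x * heat (r + t) (x - a) \<partial>lborel))) \<partial>lborel)"
  proof (rule Bochner_Integration.integral_cong[OF refl])
    fix t :: real
    show "(\<integral>z. W z t * D z \<partial>?M) = indicator {0<..} t * t powr (- 1 - s) * (2 * ((\<integral>x. u x * heat r (x - a) \<partial>lborel) - (\<integral>x. u x * heat (r + t) (x - a) \<partial>lborel)))"
    proof (cases "t > 0")
      case True
      have "(\<integral>z. W z t * D z \<partial>?M) = (\<integral>z. t powr (- 1 - s) * (heat t (fst z - snd z) * D z) \<partial>?M)"
        unfolding W_def using True by (intro Bochner_Integration.integral_cong) auto
      then show ?thesis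
        using heat_quadratic_form[OF assms(1) u fin True r] True unfolding D_def h_def by simp
    qed (simp add: W_def)
  qed
  finally show ?thesis unfolding h_def .
qed

section \<open>Riesz potentials and uniqueness for the heat transform\<close>

text \<open>The values lie in \<open>ennreal\<close> since the potentials of the powers of
  \<open>u\<close> may be infinite until boundedness is known. The kernel carries no normalising
  constant; \<open>heat_subordination\<close> provides one.\<close>

definition riesz :: "real \<Rightarrow> ('a::euclidean_space \<Rightarrow> real) \<Rightarrow> 'a \<Rightarrow> ennreal" where
  "riesz A g y = (\<integral>\<^sup>+x. ennreal (norm (y - x) powr (-A) * g x) \<partial>lborel)"

lemma measurable_riesz[measurable (raw)]:
  assumes [measurable]: "g \<in> borel_measurable borel"
  shows "riesz A g \<in> borel_measurable borel"
  unfolding riesz_def[abs_def] by measurable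

text \<open>For \<open>t = r - e\<close> the semigroup law factors \<open>heat r\<close> into
  \<open>heat t\<close> and \<open>heat e\<close>. By Tonelli's theorem the time integral can be
  done first, and there subordination turns it into the Riesz kernel.\<close>

lemma heat_potential:
  fixes g :: "'a::euclidean_space \<Rightarrow> real"
  assumes [measurable]: "g \<in> borel_measurable borel" and g: "\<And>x. g x \<ge> 0" and e: "e > 0" and k: "k > 0"
    and sub: "\<And>z::'a. z \<noteq> 0 \<Longrightarrow>
     (\<integral>\<^sup>+t. ennreal (t powr (s - 1) * heat t z) * indicator {0<..} t \<partial>lborel) = ennreal (k * norm z powr (-A))"
  shows "(\<integral>\<^sup>+r. ennreal ((r - e) powr (s - 1)) * indicator {e<..} r * (\<integral>\<^sup>+x. ennreal (g x * heat r (x - a)) \<partial>lborel) \<partial>lborel)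
    = ennreal k * (\<integral>\<^sup>+y. ennreal (heat e (y - a)) * riesz A g y \<partial>lborel)"
proof -
  define w where "w t = ennreal (t powr (s - 1)) * indicator {0<..} t" for t :: real
  have [measurable]: "w \<in> borel_measurable borel" unfolding w_def[abs_def] by measurable
  have "(\<integral>\<^sup>+r. ennreal ((r - e) powr (s - 1)) * indicator {e<..} r * (\<integral>\<^sup>+x. ennreal (g x * heat r (x - a)) \<partial>lborel) \<partial>lborel)
    = (\<integral>\<^sup>+r. (\<lambda>t. w t * (\<integral>\<^sup>+x. ennreal (g x * heat (t + e) (x - a)) \<partial>lborel)) (r + (-e)) \<partial>lborel)"
    by (intro nn_integral_cong) (auto simp: w_def indicator_def)
  also have "\<dots> = (\<integral>\<^sup>+t. w t * (\<integral>\<^sup>+x. ennreal (g x * heat (t + e) (x - a)) \<partial>lborel) \<partial>lborel)"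
    by (rule nn_integral_lborel_translate) measurable
  also have "\<dots> = (\<integral>\<^sup>+t. (\<integral>\<^sup>+x. (\<integral>\<^sup>+y. w t * ennreal (g x) * ennreal (heat t (x - y)) * ennreal (heat e (y - a)) \<partial>lborel) \<partial>lborel) \<partial>lborel)"
  proof (rule nn_integral_cong)
    fix t :: real
    show "w t * (\<integral>\<^sup>+x. ennreal (g x * heat (t + e) (x - a)) \<partial>lborel) =
       (\<integral>\<^sup>+x. (\<integral>\<^sup>+y. w t * ennreal (g x) * ennreal (heat t (x - y)) * ennreal (heat e (y - a)) \<partial>lborel) \<partial>lborel)"
    proof (cases "t > 0")
      case True
      have "(\<integral>\<^sup>+y. w t * ennreal (g x) * ennreal (heat t (x - y)) * ennreal (heat e (y - a)) \<partial>lborel)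
         = w t * ennreal (g x * heat (t + e) (x - a))" for x
      proof -
        have "(\<integral>\<^sup>+y. w t * ennreal (g x) * ennreal (heat t (x - y)) * ennreal (heat e (y - a)) \<partial>lborel)
          = (\<integral>\<^sup>+y. w t * ennreal (g x) * ennreal (heat t (x - y) * heat e (y - a)) \<partial>lborel)"
          by (simp add: ennreal_mult mult.assoc)
        also have "\<dots> = w t * ennreal (g x) * ennreal (heat (t + e) (x - a))"
          by (subst nn_integral_cmult) (auto simp: heat_semigroup[OF True e])
        finally show ?thesis using g by (simp add: ennreal_mult mult.assoc)
      qed
      then show ?thesis by (subst nn_integral_cmult[symmetric]) auto
    qed (simp add: w_def)
  qed
  also have "\<dots> = (\<integral>\<^sup>+t. (\<integral>\<^sup>+y. (\<integral>\<^sup>+x. w t * ennreal (g x) * ennreal (heat t (x - y)) * ennreal (heat e (y - a)) \<partial>lborel) \<partial>lborel) \<partial>lborel)"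
  proof (rule nn_integral_cong)
    fix t :: real
    show "(\<integral>\<^sup>+x. (\<integral>\<^sup>+y. w t * ennreal (g x) * ennreal (heat t (x - y)) * ennreal (heat e (y - a)) \<partial>lborel) \<partial>lborel) =
      (\<integral>\<^sup>+y. (\<integral>\<^sup>+x. w t * ennreal (g x) * ennreal (heat t (x - y)) * ennreal (heat e (y - a)) \<partial>lborel) \<partial>lborel)"
      by (rule lborel_pair.Fubini'[symmetric]) measurable
  qed
  also have "\<dots> = (\<integral>\<^sup>+y. (\<integral>\<^sup>+t. (\<integral>\<^sup>+x. w t * ennreal (g x) * ennreal (heat t (x - y)) * ennreal (heat e (y - a)) \<partial>lborel) \<partial>lborel) \<partial>lborel)"
    by (rule lborel_pair.Fubini'[symmetric]) measurable
  also have "\<dots> = (\<integral>\<^sup>+y. ennreal k * (ennreal (heat e (y - a)) * riesz A g y) \<partial>lborel)"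
  proof (rule nn_integral_cong)
    fix y :: 'a
    have "(\<integral>\<^sup>+t. (\<integral>\<^sup>+x. w t * ennreal (g x) * ennreal (heat t (x - y)) * ennreal (heat e (y - a)) \<partial>lborel) \<partial>lborel)
      = (\<integral>\<^sup>+x. (\<integral>\<^sup>+t. w t * ennreal (g x) * ennreal (heat t (x - y)) * ennreal (heat e (y - a)) \<partial>lborel) \<partial>lborel)"
      by (rule lborel_pair.Fubini'[symmetric]) measurable
    also have "\<dots> = (\<integral>\<^sup>+x. ennreal (k * heat e (y - a)) * ennreal (norm (y - x) powr (-A) * g x) \<partial>lborel)"
    proof (rule nn_integral_cong_AE)
      have "AE x in lborel. x \<noteq> y" by (rule AE_lborel_singleton)
      then show "AE x in lborel. (\<integral>\<^sup>+t. w t * ennreal (g x) * ennreal (heat t (x - y)) * ennreal (heat e (y - a)) \<partial>lborel)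
         = ennreal (k * heat e (y - a)) * ennreal (norm (y - x) powr (-A) * g x)"
      proof eventually_elim
        case (elim x)
        have "(\<integral>\<^sup>+t. w t * ennreal (g x) * ennreal (heat t (x - y)) * ennreal (heat e (y - a)) \<partial>lborel)
          = (\<integral>\<^sup>+t. ennreal (t powr (s - 1) * heat t (x - y)) * indicator {0<..} t * ennreal (g x * heat e (y - a)) \<partial>lborel)"
          using g by (intro nn_integral_cong) (simp add: w_def ennreal_mult mult_ac)
        also have "\<dots> = ennreal (k * norm (x - y) powr (-A)) * ennreal (g x * heat e (y - a))"
          using elim sub[of "x - y"] by (subst nn_integral_multc) auto
        also have "\<dots> = ennreal (k * heat e (y - a)) * ennreal (norm (y - x) powr (-A) * g x)"
          using k g by (simp add: ennreal_mult[symmetric] norm_minus_commute mult_ac)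
        finally show ?case .
      qed
    qed
    also have "\<dots> = ennreal (k * heat e (y - a)) * riesz A g y"
      unfolding riesz_def by (rule nn_integral_cmult) measurable
    finally show "(\<integral>\<^sup>+t. (\<integral>\<^sup>+x. w t * ennreal (g x) * ennreal (heat t (x - y)) * ennreal (heat e (y - a)) \<partial>lborel) \<partial>lborel)
       = ennreal k * (ennreal (heat e (y - a)) * riesz A g y)"
      using k by (simp add: ennreal_mult mult.assoc)
  qed
  also have "\<dots> = ennreal k * (\<integral>\<^sup>+y. ennreal (heat e (y - a)) * riesz A g y \<partial>lborel)"
    by (rule nn_integral_cmult) measurable
  finally show ?thesis .
qed

section \<open>Small times and uniqueness\<close>

lemma heat_outside_small:
  fixes y :: "'a::euclidean_space"
  assumes t: "t > 0" and d: "d > 0" and Q[measurable]: "Q \<in> sets borel" and far: "\<And>a. a \<in> Q \<Longrightarrow> norm (y - a) \<ge> d"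
  shows "(\<integral>\<^sup>+a. ennreal (heat t (y - a)) * indicator Q a \<partial>lborel) \<le> ennreal (2 powr (real DIM('a) / 2) * exp (- (d\<^sup>2 / (8 * t))))"
proof -
  have "(\<integral>\<^sup>+a. ennreal (heat t (y - a)) * indicator Q a \<partial>lborel) \<le>
    (\<integral>\<^sup>+a. ennreal (2 powr (real DIM('a) / 2) * exp (- (d\<^sup>2 / (8 * t)))) * ennreal (heat (2 * t) (y - a)) \<partial>lborel)"
  proof (rule nn_integral_mono)
    fix a
    show "ennreal (heat t (y - a)) * indicator Q a \<le> ennreal (2 powr (real DIM('a) / 2) * exp (- (d\<^sup>2 / (8 * t)))) * ennreal (heat (2 * t) (y - a))"
    proof (cases "a \<in> Q")
      case True
      have "d\<^sup>2 \<le> (norm (y - a))\<^sup>2" using far[OF True] d by (intro power_mono) auto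
      then have "exp (- ((norm (y - a))\<^sup>2 / (8 * t))) \<le> exp (- (d\<^sup>2 / (8 * t)))" using t by (simp add: divide_right_mono)
      then have "heat t (y - a) \<le> 2 powr (real DIM('a) / 2) * heat (2 * t) (y - a) * exp (- (d\<^sup>2 / (8 * t)))"
        unfolding heat_eq_double[OF t, of "y - a"] by (intro mult_left_mono) auto
      then show ?thesis using True by (simp add: ennreal_mult[symmetric] mult_ac ennreal_leI)
    qed simp
  qed
  also have "\<dots> = ennreal (2 powr (real DIM('a) / 2) * exp (- (d\<^sup>2 / (8 * t))))"
    using t by (subst nn_integral_cmult) (auto simp: heat_mass)
  finally show ?thesis .
qed

text \<open>The dominating function for the limit of small times. For \<open>norm a \<le> R\<close>
  one has \<open>(norm y)\<^sup>2 \<le> 2 * (norm (y - a))\<^sup>2 + 2 * R\<^sup>2\<close>, so the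
  Gaussian factor left over from doubling a time \<open>t \<le> 1\<close> is at most
  \<open>exp (R\<^sup>2 / 8)\<close> times \<open>exp (- (norm y)\<^sup>2 / 16)\<close>, a multiple
  of \<open>heat 4 y\<close>.\<close>

lemma heat_box_bound:
  fixes y :: "'a::euclidean_space"
  assumes t: "0 < t" "t \<le> 1" and Q[measurable]: "Q \<in> sets borel" and bd: "\<And>a. a \<in> Q \<Longrightarrow> norm a \<le> R"
  shows "(\<integral>\<^sup>+a. ennreal (heat t (y - a)) * indicator Q a \<partial>lborel)
    \<le> ennreal (2 powr (real DIM('a) / 2) * exp (R\<^sup>2 / 8) * 16 powr (real DIM('a) / 2) * gauss_mass TYPE('a)) * ennreal (heat 4 y)"
proof -
  let ?g = "gauss_mass TYPE('a)"
  have g: "?g > 0" by (rule gauss_mass_pos)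
  define c where "c = 2 powr (real DIM('a) / 2) * exp (R\<^sup>2 / 8) * 16 powr (real DIM('a) / 2) * ?g"
  have c: "c \<ge> 0" unfolding c_def using g by simp
  have h4: "exp (- (norm y)\<^sup>2 / 16) = 16 powr (real DIM('a) / 2) * ?g * heat 4 y"
    unfolding heat_def using g by (simp add: powr_minus)
  have "(\<integral>\<^sup>+a. ennreal (heat t (y - a)) * indicator Q a \<partial>lborel) \<le>
    (\<integral>\<^sup>+a. ennreal (c * heat 4 y) * ennreal (heat (2 * t) (y - a)) \<partial>lborel)"
  proof (rule nn_integral_mono)
    fix a
    show "ennreal (heat t (y - a)) * indicator Q a \<le> ennreal (c * heat 4 y) * ennreal (heat (2 * t) (y - a))"
    proof (cases "a \<in> Q")
      case True
      have "norm y \<le> norm (y - a) + norm a" using norm_triangle_ineq[of "y - a" a] by simp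
      then have "norm y \<le> norm (y - a) + R" using bd[OF True] by simp
      then have "(norm y)\<^sup>2 \<le> (norm (y - a) + R)\<^sup>2" by (intro power_mono) auto
      also have "\<dots> \<le> 2 * (norm (y - a))\<^sup>2 + 2 * R\<^sup>2"
        using sum_squares_bound[of "norm (y - a)" R] by (simp add: power2_sum)
      finally have n: "- ((norm (y - a))\<^sup>2 / 8) \<le> - (norm y)\<^sup>2 / 16 + R\<^sup>2 / 8" by simp
      have "(norm (y - a))\<^sup>2 / 8 \<le> (norm (y - a))\<^sup>2 / (8 * t)" using t by (intro divide_left_mono) auto
      then have "- ((norm (y - a))\<^sup>2 / (8 * t)) \<le> - (norm y)\<^sup>2 / 16 + R\<^sup>2 / 8" using n by linarith
      then have "exp (- ((norm (y - a))\<^sup>2 / (8 * t))) \<le> exp (- (norm y)\<^sup>2 / 16 + R\<^sup>2 / 8)" by (simp only: exp_le_cancel_iff)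
      also have "\<dots> = exp (R\<^sup>2 / 8) * (16 powr (real DIM('a) / 2) * ?g * heat 4 y)" by (simp only: exp_add h4 mult.commute)
      finally have "heat t (y - a) \<le> 2 powr (real DIM('a) / 2) * heat (2 * t) (y - a) * (exp (R\<^sup>2 / 8) * (16 powr (real DIM('a) / 2) * ?g * heat 4 y))"
        unfolding heat_eq_double[OF t(1), of "y - a"] by (intro mult_left_mono) auto
      also have "\<dots> = c * heat 4 y * heat (2 * t) (y - a)" unfolding c_def by (simp only: mult_ac)
      finally show ?thesis using True c by (simp add: ennreal_mult[symmetric] ennreal_leI)
    qed simp
  qed
  also have "\<dots> = ennreal (c * heat 4 y)"
    using t by (subst nn_integral_cmult) (auto simp: heat_mass)
  finally show ?thesis unfolding c_def[symmetric] using c by (simp add: ennreal_mult)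
qed

text \<open>Off the closure of a set the heat mass it receives vanishes exponentially. For an
  interior point the same is applied to the complement, and unit total mass gives the limit
  one.\<close>

lemma heat_box_tendsto:
  fixes y :: "'a::euclidean_space"
  assumes Q[measurable]: "Q \<in> sets borel" and y: "y \<notin> frontier Q"
  shows "(\<lambda>n. \<integral>\<^sup>+a. ennreal (heat (1 / real (Suc n)) (y - a)) * indicator Q a \<partial>lborel) \<longlonglongrightarrow> indicator Q y"
proof -
  define F where "F Q n = (\<integral>\<^sup>+a. ennreal (heat (1 / real (Suc n)) (y - a)) * indicator Q a \<partial>lborel)" for Q n
  have out: "F S \<longlonglongrightarrow> 0" if S[measurable]: "S \<in> sets borel" and yS: "y \<notin> closure S" for S
  proof -
    have "open (- closure S)" "y \<in> - closure S" using yS by auto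
    then obtain d where d: "d > 0" "ball y d \<subseteq> - closure S" by (meson open_contains_ball)
    have far: "norm (y - a) \<ge> d" if "a \<in> S" for a
      using d(2) that closure_subset[of S] by (force simp: subset_eq dist_norm not_le)
    define B where "B n = 2 powr (real DIM('a) / 2) * exp (- (d\<^sup>2 / 8) * real (Suc n))" for n
    have FB: "F S n \<le> ennreal (B n)" for n
      using heat_outside_small[of "1 / real (Suc n)" d S y] d(1) far S unfolding F_def B_def by simp
    have "B \<longlonglongrightarrow> 0"
    proof -
      have "(\<lambda>n. exp (- (d\<^sup>2 / 8)) ^ Suc n) \<longlonglongrightarrow> 0"
        using d(1) by (intro LIMSEQ_Suc LIMSEQ_realpow_zero) auto
      then have "(\<lambda>n. exp (- (d\<^sup>2 / 8) * real (Suc n))) \<longlonglongrightarrow> 0"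
        by (simp only: exp_of_nat2_mult)
      then show ?thesis unfolding B_def[abs_def] by (rule tendsto_mult_right_zero)
    qed
    then have "(\<lambda>n. ennreal (B n)) \<longlonglongrightarrow> ennreal 0" by (rule tendsto_ennrealI)
    then show ?thesis
      by (intro tendsto_sandwich[of "\<lambda>_. 0" "F S" sequentially "\<lambda>n. ennreal (B n)"]) (auto simp: FB)
  qed
  have sum1: "F Q n + F (- Q) n = 1" for n
  proof -
    have "F Q n + F (- Q) n = (\<integral>\<^sup>+a. ennreal (heat (1 / real (Suc n)) (y - a)) * indicator Q a + ennreal (heat (1 / real (Suc n)) (y - a)) * indicator (- Q) a \<partial>lborel)"
      unfolding F_def by (rule nn_integral_add[symmetric]) measurable
    also have "\<dots> = (\<integral>\<^sup>+a. ennreal (heat (1 / real (Suc n)) (y - a)) \<partial>lborel)"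
      by (intro nn_integral_cong) (auto simp: indicator_def)
    finally show ?thesis by (simp add: heat_mass)
  qed
  show ?thesis
  proof (cases "y \<in> Q")
    case False
    then have "y \<notin> closure Q" using y interior_subset by (auto simp: frontier_def)
    then show ?thesis using out[OF Q] False unfolding F_def[abs_def] by simp
  next
    case True
    then have "y \<notin> closure (- Q)" using y closure_subset[of Q] by (auto simp: frontier_def closure_complement)
    then have "F (- Q) \<longlonglongrightarrow> 0" using Q by (intro out) auto
    then have "(\<lambda>n. 1 - F (- Q) n) \<longlonglongrightarrow> 1 - 0" by (intro tendsto_diff_ennreal tendsto_const) auto
    moreover have "1 - F (- Q) n = F Q n" for n
    proof -
      have "F (- Q) n \<noteq> \<infinity>" using sum1[of n] by auto
      then show ?thesis using sum1[of n] by (metis ennreal_add_diff_cancel_right infinity_ennreal_def)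
    qed
    ultimately show ?thesis using True unfolding F_def[abs_def] by simp
  qed
qed

text \<open>Integrating the transforms over a box and letting the time tend to zero identifies the
  integrals of \<open>g1\<close> and \<open>g2\<close> over the box, whose frontier is a null set.
  Boxes are stable under intersection and generate the Borel sets, so the two densities define the
  same measure. Finiteness at time 4 provides the domination and the finiteness on boxes.\<close>

lemma heat_transform_unique:
  fixes g1 g2 :: "'a::euclidean_space \<Rightarrow> ennreal"
  assumes g1[measurable]: "g1 \<in> borel_measurable borel" and g2[measurable]: "g2 \<in> borel_measurable borel"
    and eq: "\<And>e a. e > 0 \<Longrightarrow> (\<integral>\<^sup>+y. ennreal (heat e (y - a)) * g1 y \<partial>lborel) = (\<integral>\<^sup>+y. ennreal (heat e (y - a)) * g2 y \<partial>lborel)"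
    and fin: "\<And>e a. e > 0 \<Longrightarrow> (\<integral>\<^sup>+y. ennreal (heat e (y - a)) * g2 y \<partial>lborel) < \<infinity>"
  shows "AE y in lborel. g1 y = g2 y"
proof -
  have box: "(\<integral>\<^sup>+y. indicator (box l r) y * g y \<partial>lborel) < \<infinity> \<and>
      (\<lambda>n. \<integral>\<^sup>+a. indicator (box l r) a * (\<integral>\<^sup>+y. ennreal (heat (1 / real (Suc n)) (y - a)) * g y \<partial>lborel) \<partial>lborel) \<longlonglongrightarrow>
       (\<integral>\<^sup>+y. indicator (box l r) y * g y \<partial>lborel)"
    if [measurable]: "g \<in> borel_measurable borel" and f: "\<And>e a. e > 0 \<Longrightarrow> (\<integral>\<^sup>+y. ennreal (heat e (y - a)) * g y \<partial>lborel) < \<infinity>"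
    for g and l r :: 'a
  proof -
    define Q where "Q = box l r"
    have [measurable]: "Q \<in> sets borel" unfolding Q_def by simp
    obtain R where R: "\<And>a. a \<in> Q \<Longrightarrow> norm a \<le> R" using bounded_box[of l r] unfolding Q_def bounded_iff by blast
    define c where "c = 2 powr (real DIM('a) / 2) * exp (R\<^sup>2 / 8) * 16 powr (real DIM('a) / 2) * gauss_mass TYPE('a)"
    define F where "F n y = (\<integral>\<^sup>+a. ennreal (heat (1 / real (Suc n)) (y - a)) * indicator Q a \<partial>lborel)" for n and y :: 'a
    have Fm[measurable]: "F n \<in> borel_measurable borel" for n unfolding F_def[abs_def] by measurable
    have Fb: "F n y \<le> ennreal c * ennreal (heat 4 y)" for n y
      unfolding F_def c_def by (rule heat_box_bound) (use R in auto)
    have AEQ: "AE y in lborel. y \<notin> frontier Q"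
    proof -
      have "negligible (frontier Q)" unfolding Q_def by (intro negligible_convex_frontier convex_box)
      then have "frontier Q \<in> null_sets lborel"
        by (simp add: negligible_iff_null_sets null_sets_completion_iff)
      then show ?thesis by (rule AE_not_in)
    qed
    have "(\<integral>\<^sup>+y. ennreal (heat 4 (y - 0)) * g y \<partial>lborel) < \<infinity>" by (rule f) simp
    then have fin4: "(\<integral>\<^sup>+y. ennreal (heat 4 y) * g y \<partial>lborel) < \<infinity>" by simp
    then have "AE y in lborel. ennreal (heat 4 y) * g y \<noteq> \<infinity>" by (intro nn_integral_PInf_AE) auto
    then have gfin: "AE y in lborel. g y < top"
    proof eventually_elim
      case (elim y)
      have "ennreal (heat 4 y) \<noteq> 0" using heat_pos[of 4 y] by simp
      then show ?case using elim by (auto simp: ennreal_mult_eq_top_iff less_top)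
    qed
    have W: "(\<integral>\<^sup>+y. ennreal c * (ennreal (heat 4 y) * g y) \<partial>lborel) < \<infinity>"
      using fin4 by (subst nn_integral_cmult) (auto simp: ennreal_mult_less_top)
    have lim: "(\<lambda>n. \<integral>\<^sup>+y. F n y * g y \<partial>lborel) \<longlonglongrightarrow> (\<integral>\<^sup>+y. indicator Q y * g y \<partial>lborel)"
    proof (rule nn_integral_dominated_convergence[where w = "\<lambda>y. ennreal c * (ennreal (heat 4 y) * g y)"])
      show "AE y in lborel. F n y * g y \<le> ennreal c * (ennreal (heat 4 y) * g y)" for n
        using Fb[of n] by (intro AE_I2) (metis mult.assoc mult_right_mono zero_le)
      show "AE y in lborel. (\<lambda>n. F n y * g y) \<longlonglongrightarrow> indicator Q y * g y"
        using AEQ gfin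
      proof eventually_elim
        case (elim y)
        have "(\<lambda>n. g y * F n y) \<longlonglongrightarrow> g y * indicator Q y"
          unfolding F_def using elim by (intro ennreal_tendsto_cmult heat_box_tendsto) auto
        then show ?case by (simp only: mult.commute)
      qed
    qed (use W in auto)
    have Fsw: "(\<integral>\<^sup>+a. indicator Q a * (\<integral>\<^sup>+y. ennreal (heat (1 / real (Suc n)) (y - a)) * g y \<partial>lborel) \<partial>lborel) = (\<integral>\<^sup>+y. F n y * g y \<partial>lborel)" for n
    proof -
      have "(\<integral>\<^sup>+a. indicator Q a * (\<integral>\<^sup>+y. ennreal (heat (1 / real (Suc n)) (y - a)) * g y \<partial>lborel) \<partial>lborel)
         = (\<integral>\<^sup>+a. (\<integral>\<^sup>+y. indicator Q a * (ennreal (heat (1 / real (Suc n)) (y - a)) * g y) \<partial>lborel) \<partial>lborel)"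
        by (intro nn_integral_cong nn_integral_cmult[symmetric]) measurable
      also have "\<dots> = (\<integral>\<^sup>+y. (\<integral>\<^sup>+a. indicator Q a * (ennreal (heat (1 / real (Suc n)) (y - a)) * g y) \<partial>lborel) \<partial>lborel)"
        by (rule lborel_pair.Fubini'[symmetric]) measurable
      also have "\<dots> = (\<integral>\<^sup>+y. F n y * g y \<partial>lborel)"
        unfolding F_def by (intro nn_integral_cong, subst nn_integral_multc[symmetric]) (measurable, simp only: mult_ac)
      finally show ?thesis .
    qed
    have "(\<integral>\<^sup>+y. indicator Q y * g y \<partial>lborel) \<le> (\<integral>\<^sup>+y. ennreal c * (ennreal (heat 4 y) * g y) \<partial>lborel)"
    proof (rule LIMSEQ_le_const2[OF lim], intro exI allI impI)
      fix n
      show "(\<integral>\<^sup>+y. F n y * g y \<partial>lborel) \<le> (\<integral>\<^sup>+y. ennreal c * (ennreal (heat 4 y) * g y) \<partial>lborel)"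
        using Fb[of n] by (intro nn_integral_mono) (metis mult.assoc mult_right_mono zero_le)
    qed
    then have "(\<integral>\<^sup>+y. indicator Q y * g y \<partial>lborel) < \<infinity>" using W by (rule le_less_trans)
    then show ?thesis using lim unfolding Fsw[symmetric] Q_def by simp
  qed
  have fin1: "\<And>e a. e > 0 \<Longrightarrow> (\<integral>\<^sup>+y. ennreal (heat e (y - a)) * g1 y \<partial>lborel) < \<infinity>" using eq fin by simp
  have boxeq: "(\<integral>\<^sup>+y. indicator (box l r) y * g1 y \<partial>lborel) = (\<integral>\<^sup>+y. indicator (box l r) y * g2 y \<partial>lborel)" for l r
  proof -
    have e: "(\<integral>\<^sup>+y. ennreal (heat (1 / real (Suc n)) (y - a)) * g1 y \<partial>lborel) = (\<integral>\<^sup>+y. ennreal (heat (1 / real (Suc n)) (y - a)) * g2 y \<partial>lborel)" for n a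
      by (rule eq) simp
    show ?thesis
      by (rule LIMSEQ_unique[OF conjunct2[OF box[OF g1 fin1, of l r, unfolded e]] conjunct2[OF box[OF g2 fin, of l r]]])
  qed
  have em: "emeasure (density lborel g) (box l r) = (\<integral>\<^sup>+y. indicator (box l r) y * g y \<partial>lborel)"
    if [measurable]: "g \<in> borel_measurable borel" for g and l r :: 'a
    by (subst emeasure_density) (auto simp: mult.commute)
  have "density lborel g1 = density lborel g2"
  proof (rule measure_eqI_generator_eq)
    let ?E = "range (\<lambda>(a, b). box a b::'a set)"
    show "Int_stable ?E" by (auto simp: Int_stable_def box_Int_box)
    show "?E \<subseteq> Pow UNIV" "sets (density lborel g1) = sigma_sets UNIV ?E" "sets (density lborel g2) = sigma_sets UNIV ?E"
      by (simp_all add: borel_eq_box)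
    let ?A = "\<lambda>n::nat. box (- (real n *\<^sub>R One)) (real n *\<^sub>R One) :: 'a set"
    show "range ?A \<subseteq> ?E" "(\<Union>i. ?A i) = UNIV" unfolding UN_box_eq_UNIV by auto
    show "emeasure (density lborel g1) (?A i) \<noteq> \<infinity>" for i
      using conjunct1[OF box[OF g1 fin1, of "- (real i *\<^sub>R One)" "real i *\<^sub>R One"]] by (simp add: em less_top[symmetric])
    show "emeasure (density lborel g1) X = emeasure (density lborel g2) X" if "X \<in> ?E" for X
      using that by (auto simp: em boxeq)
  qed
  then show ?thesis by (intro sigma_finite_measure.density_unique[OF lborel.sigma_finite_measure_axioms]) auto
qed

section \<open>Energy and Lebesgue norms of functions dominated by a Gaussian\<close>

text \<open>Pairs at distance below one use the bound on increments, which lowers the kernel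
  exponent to \<open>N + 2 * s - 2 < N\<close>; the other pairs use the bound on values, with the
  exponent \<open>N + 2 * s > N\<close>. As the heat kernel has unit mass, the result is linear in
  \<open>e\<close> and independent of \<open>t\<close> and \<open>a\<close>: convergence in energy
  reduces to \<open>e\<close> tending to zero.\<close>

lemma gagliardo_heat_bound:
  assumes s: "0 < s" "s < 1"
  shows "\<exists>C>0. \<forall>(w :: 'a::euclidean_space \<Rightarrow> real) e t a. w \<in> borel_measurable borel \<and> e \<ge> 0 \<and> t > 0 \<and>
     (\<forall>x. (w x)\<^sup>2 \<le> e * heat t (x - a)) \<and>
     (\<forall>x y. norm (x - y) < 1 \<longrightarrow> (w x - w y)\<^sup>2 \<le> e * (norm (x - y))\<^sup>2 * heat t (x - a)) \<longrightarrow>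
     gagliardo s w \<le> ennreal (C * e)"
proof -
  let ?N = "real DIM('a)"
  have n1: "?N + 2 * s - 2 < ?N" using s by simp
  obtain C1 where C1: "C1 > 0"
    "\<And>r (x::'a). r > 0 \<Longrightarrow> (\<integral>\<^sup>+y. ennreal (norm (x - y) powr (-(?N + 2 * s - 2))) * indicator {y. norm (x - y) < r} y \<partial>lborel)
      \<le> ennreal (C1 * r powr (?N - (?N + 2 * s - 2)))"
    using nn_integral_near_powr[OF n1] by blast
  have n2: "?N < ?N + 2 * s" using s by simp
  obtain C2 where C2: "C2 > 0"
    "\<And>r (x::'a). r > 0 \<Longrightarrow> (\<integral>\<^sup>+y. ennreal (norm (x - y) powr (-(?N + 2 * s))) * indicator {y. norm (x - y) \<ge> r} y \<partial>lborel)
      \<le> ennreal (C2 * r powr (?N - (?N + 2 * s)))"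
    using nn_integral_far_powr[OF n2] by blast
  have main: "gagliardo s w \<le> ennreal ((C1 + 4 * C2) * e)"
    if [measurable]: "w \<in> borel_measurable borel" and e: "e \<ge> 0" and t: "t > 0" and w: "\<And>x. (w x)\<^sup>2 \<le> e * heat t (x - a)"
      and wl: "\<And>x y. norm (x - y) < 1 \<Longrightarrow> (w x - w y)\<^sup>2 \<le> e * (norm (x - y))\<^sup>2 * heat t (x - a)"
    for w :: "'a \<Rightarrow> real" and e t a
  proof -
    define near where "near x y = ennreal (norm (x - y) powr (-(?N + 2 * s - 2))) * indicator {y. norm (x - y) < 1} y" for x y :: 'a
    define far where "far x y = ennreal (norm (x - y) powr (-(?N + 2 * s))) * indicator {y. norm (x - y) \<ge> 1} y" for x y :: 'a
    have [measurable]: "(\<lambda>x. near (f x) (g x)) \<in> borel_measurable M" "(\<lambda>x. far (f x) (g x)) \<in> borel_measurable M"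
      if [measurable]: "f \<in> borel_measurable M" "g \<in> borel_measurable M" for f g M
      unfolding near_def far_def indicator_def mem_Collect_eq by measurable
    have farsym: "far x y = far y x" for x y unfolding far_def by (simp add: norm_minus_commute indicator_def)
    define h where "h x = ennreal (e * heat t (x - a))" for x
    have [measurable]: "h \<in> borel_measurable borel" unfolding h_def[abs_def] by measurable
    have hi: "(\<integral>\<^sup>+x. h x \<partial>lborel) = ennreal e"
      unfolding h_def using e heat_mass[OF t, of a] by (simp add: ennreal_mult nn_integral_cmult heat_commute[of t _ a])
    have ptw: "ennreal (\<bar>w x - w y\<bar>\<^sup>2 / norm (x - y) powr (?N + 2 * s)) \<le> h x * near x y + (2 * (h x * far x y) + 2 * (h y * far x y))" for x y
    proof (cases "norm (x - y) < 1")
      case True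
      show ?thesis
      proof (cases "x = y")
        case False
        have "\<bar>w x - w y\<bar>\<^sup>2 / norm (x - y) powr (?N + 2 * s) \<le> (e * (norm (x - y))\<^sup>2 * heat t (x - a)) / norm (x - y) powr (?N + 2 * s)"
          using wl[OF True] by (intro divide_right_mono) auto
        also have "\<dots> = e * heat t (x - a) * norm (x - y) powr (-(?N + 2 * s - 2))"
        proof -
          have "(norm (x - y))\<^sup>2 = norm (x - y) powr 2" using False by simp
          then have "(norm (x - y))\<^sup>2 / norm (x - y) powr (?N + 2 * s) = norm (x - y) powr (2 - (?N + 2 * s))" by (simp only: powr_diff)
          also have "2 - (?N + 2 * s) = -(?N + 2 * s - 2)" by simp
          finally have n: "(norm (x - y))\<^sup>2 / norm (x - y) powr (?N + 2 * s) = norm (x - y) powr (-(?N + 2 * s - 2))" .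
          have "(e * (norm (x - y))\<^sup>2 * heat t (x - a)) / norm (x - y) powr (?N + 2 * s) =
            e * heat t (x - a) * ((norm (x - y))\<^sup>2 / norm (x - y) powr (?N + 2 * s))" by simp
          then show ?thesis unfolding n .
        qed
        finally have "ennreal (\<bar>w x - w y\<bar>\<^sup>2 / norm (x - y) powr (?N + 2 * s)) \<le> h x * near x y"
          unfolding h_def near_def using True e by (simp add: ennreal_mult[symmetric] ennreal_leI)
        then show ?thesis by (rule order_trans) simp
      qed simp
    next
      case False
      have "\<bar>w x - w y\<bar>\<^sup>2 \<le> 2 * (w x)\<^sup>2 + 2 * (w y)\<^sup>2"
        using sum_squares_bound[of "w x" "- w y"] by (simp add: power2_diff)
      also have "\<dots> \<le> 2 * (e * heat t (x - a)) + 2 * (e * heat t (y - a))" using w[of x] w[of y] by linarith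
      finally have "\<bar>w x - w y\<bar>\<^sup>2 * norm (x - y) powr (-(?N + 2 * s)) \<le> (2 * (e * heat t (x - a)) + 2 * (e * heat t (y - a))) * norm (x - y) powr (-(?N + 2 * s))"
        by (intro mult_right_mono) auto
      then have "ennreal (\<bar>w x - w y\<bar>\<^sup>2 / norm (x - y) powr (?N + 2 * s)) \<le>
         ennreal (2 * (e * heat t (x - a) * norm (x - y) powr (-(?N + 2 * s))) + 2 * (e * heat t (y - a) * norm (x - y) powr (-(?N + 2 * s))))"
        unfolding powr_minus by (intro ennreal_leI) (simp add: divide_inverse algebra_simps)
      also have "\<dots> = 2 * (h x * far x y) + 2 * (h y * far x y)"
        unfolding h_def far_def using False e by (simp add: ennreal_mult)
      finally show ?thesis by (simp add: add_increasing)
    qed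
    have nr: "(\<integral>\<^sup>+y. near x y \<partial>lborel) \<le> ennreal C1" for x unfolding near_def using C1(2)[of 1 x] by simp
    have fr: "(\<integral>\<^sup>+y. far x y \<partial>lborel) \<le> ennreal C2" for x unfolding far_def using C2(2)[of 1 x] by simp
    have A1: "(\<integral>\<^sup>+x. (\<integral>\<^sup>+y. h x * near x y \<partial>lborel) \<partial>lborel) \<le> ennreal e * ennreal C1"
    proof -
      have "(\<integral>\<^sup>+x. (\<integral>\<^sup>+y. h x * near x y \<partial>lborel) \<partial>lborel) \<le> (\<integral>\<^sup>+x. h x * ennreal C1 \<partial>lborel)"
        using nr by (intro nn_integral_mono) (simp add: nn_integral_cmult mult_left_mono)
      then show ?thesis by (simp add: nn_integral_multc hi)
    qed
    have A2: "(\<integral>\<^sup>+x. (\<integral>\<^sup>+y. h x * far x y \<partial>lborel) \<partial>lborel) \<le> ennreal e * ennreal C2"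
    proof -
      have "(\<integral>\<^sup>+x. (\<integral>\<^sup>+y. h x * far x y \<partial>lborel) \<partial>lborel) \<le> (\<integral>\<^sup>+x. h x * ennreal C2 \<partial>lborel)"
        using fr by (intro nn_integral_mono) (simp add: nn_integral_cmult mult_left_mono)
      then show ?thesis by (simp add: nn_integral_multc hi)
    qed
    have A3: "(\<integral>\<^sup>+x. (\<integral>\<^sup>+y. h y * far x y \<partial>lborel) \<partial>lborel) \<le> ennreal e * ennreal C2"
    proof -
      have "(\<integral>\<^sup>+x. (\<integral>\<^sup>+y. h y * far x y \<partial>lborel) \<partial>lborel) = (\<integral>\<^sup>+y. (\<integral>\<^sup>+x. h y * far x y \<partial>lborel) \<partial>lborel)"
        by (rule lborel_pair.Fubini'[symmetric]) measurable
      then show ?thesis using A2 by (simp add: farsym)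
    qed
    have "gagliardo s w \<le> (\<integral>\<^sup>+x. (\<integral>\<^sup>+y. h x * near x y + (2 * (h x * far x y) + 2 * (h y * far x y)) \<partial>lborel) \<partial>lborel)"
      unfolding gagliardo_def by (intro nn_integral_mono ptw)
    also have "\<dots> = (\<integral>\<^sup>+x. (\<integral>\<^sup>+y. h x * near x y \<partial>lborel) \<partial>lborel) +
      (2 * (\<integral>\<^sup>+x. (\<integral>\<^sup>+y. h x * far x y \<partial>lborel) \<partial>lborel) + 2 * (\<integral>\<^sup>+x. (\<integral>\<^sup>+y. h y * far x y \<partial>lborel) \<partial>lborel))"
      by (simp add: nn_integral_add nn_integral_cmult[of _ lborel 2])
    also have "\<dots> \<le> ennreal e * ennreal C1 + (2 * (ennreal e * ennreal C2) + 2 * (ennreal e * ennreal C2))"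
      by (intro add_mono mult_left_mono A1 A2 A3) auto
    also have "\<dots> = ennreal ((C1 + 4 * C2) * e)"
    proof -
      show ?thesis unfolding mult_2 using e C1 C2
        by (simp add: ennreal_mult[symmetric] ennreal_plus[symmetric] del: ennreal_plus) (simp add: algebra_simps)
    qed
    finally show ?thesis .
  qed
  show ?thesis
  proof (intro exI[of _ "C1 + 4 * C2"] conjI allI impI)
    show "C1 + 4 * C2 > 0" using C1 C2 by simp
  qed (elim conjE, rule main, auto)
qed

lemma heat_le_max: "t > 0 \<Longrightarrow> heat t (z::'a::euclidean_space) \<le> (4 * t) powr (- real DIM('a) / 2) / gauss_mass TYPE('a)"
  unfolding heat_def using gauss_mass_pos[where 'a='a]
  by (intro divide_right_mono mult_left_le) auto

text \<open>The power \<open>al\<close> of \<open>w\<close> is the power \<open>al / 2\<close> of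
  its square. One factor of the heat kernel is kept for its unit mass, and the remaining power,
  positive because \<open>al > 2\<close>, is bounded by the maximum of the kernel.\<close>

lemma Lp_heat_bound:
  fixes w :: "'a::euclidean_space \<Rightarrow> real"
  assumes al: "al > 2" and e: "e \<ge> 0" and t: "t > 0" and w: "\<And>x. (w x)\<^sup>2 \<le> e * heat t (x - a)"
  shows "(\<integral>\<^sup>+x. ennreal (\<bar>w x\<bar> powr al) \<partial>lborel) \<le> ennreal (e powr (al / 2) * ((4 * t) powr (- real DIM('a) / 2) / gauss_mass TYPE('a)) powr (al / 2 - 1))"
proof -
  define H where "H = (4 * t) powr (- real DIM('a) / 2) / gauss_mass TYPE('a)"
  have "(\<integral>\<^sup>+x. ennreal (\<bar>w x\<bar> powr al) \<partial>lborel) \<le> (\<integral>\<^sup>+x. ennreal (e powr (al / 2) * H powr (al / 2 - 1)) * ennreal (heat t (x - a)) \<partial>lborel)"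
  proof (rule nn_integral_mono)
    fix x
    have "\<bar>w x\<bar> powr al = ((w x)\<^sup>2) powr (al / 2)"
    proof (cases "w x = 0")
      case False
      then have "(w x)\<^sup>2 = \<bar>w x\<bar> powr 2" by simp
      then show ?thesis by (simp only: powr_powr) simp
    qed (use al in simp)
    also have "\<dots> \<le> (e * heat t (x - a)) powr (al / 2)" using w al by (intro powr_mono2) auto
    also have "\<dots> = e powr (al / 2) * (heat t (x - a) powr (al / 2 - 1) * heat t (x - a))"
      using powr_add[of "heat t (x - a)" "al / 2 - 1" 1] heat_pos[OF t, of "x - a"] by (simp add: powr_mult)
    also have "\<dots> \<le> e powr (al / 2) * (H powr (al / 2 - 1) * heat t (x - a))"
      unfolding H_def using al heat_le_max[OF t, of "x - a"] by (intro mult_left_mono mult_right_mono powr_mono2) auto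
    finally show "ennreal (\<bar>w x\<bar> powr al) \<le> ennreal (e powr (al / 2) * H powr (al / 2 - 1)) * ennreal (heat t (x - a))"
      by (simp add: ennreal_mult[symmetric] mult_ac ennreal_leI)
  qed
  also have "\<dots> = ennreal (e powr (al / 2) * H powr (al / 2 - 1))"
    using heat_mass[OF t, of a] by (simp add: nn_integral_cmult heat_commute[of t _ a])
  finally show ?thesis unfolding H_def .
qed

section \<open>Gaussians as admissible test functions\<close>

text \<open>The classical flat function \<open>exp (- (1 / y))\<close> together with all its
  derivatives: the family is closed under differentiation, \<open>P\<close> being replaced by
  \<open>flat_exp_deriv P\<close>, where the polynomial \<open>[:0, 0, 1:]\<close> is the factor
  \<open>1 / y\<^sup>2\<close> from the chain rule.\<close>

definition flat_exp :: "real poly \<Rightarrow> real \<Rightarrow> real" where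
  "flat_exp P y = (if y > 0 then poly P (1 / y) * exp (- (1 / y)) else 0)"

definition flat_exp_deriv :: "real poly \<Rightarrow> real poly" where
  "flat_exp_deriv P = [:0, 0, 1:] * (P - pderiv P)"

lemma flat_exp_tendsto:
  fixes P :: "real poly"
  shows "((\<lambda>y. poly P (1 / y) * exp (- (1 / y))) \<longlongrightarrow> 0) (at_right 0)"
proof -
  have "((\<lambda>x. poly P x * exp (- x)) \<longlongrightarrow> 0) at_top"
  proof -
    have "((\<lambda>x. \<Sum>i\<le>degree P. coeff P i * (x ^ i * exp (- x))) \<longlongrightarrow> (\<Sum>i\<le>degree P. coeff P i * 0)) at_top"
    proof (intro tendsto_sum tendsto_mult tendsto_const)
      fix i
      have "((\<lambda>x::real. x ^ i / exp x) \<longlongrightarrow> 0) at_top" by (rule tendsto_power_div_exp_0)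
      then show "((\<lambda>x::real. x ^ i * exp (- x)) \<longlongrightarrow> 0) at_top" by (simp add: exp_minus divide_inverse)
    qed
    then show ?thesis by (simp add: poly_altdef sum_distrib_right mult.assoc)
  qed
  then have "((\<lambda>y. poly P (inverse y) * exp (- inverse y)) \<longlongrightarrow> 0) (at_right 0)"
    using filterlim_compose[OF _ filterlim_inverse_at_top_right] by blast
  then show ?thesis by (simp add: divide_inverse)
qed

lemma flat_exp_has_derivative: "(flat_exp P has_field_derivative flat_exp (flat_exp_deriv P) y) (at y)"
proof -
  consider "y > 0" | "y < 0" | "y = 0" by linarith
  then show ?thesis
  proof cases
    case 1
    have "((\<lambda>y. poly P (1 / y) * exp (- (1 / y))) has_field_derivative flat_exp (flat_exp_deriv P) y) (at y)"
    proof -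
      have "((\<lambda>y. poly P (1 / y)) has_field_derivative poly (pderiv P) (1 / y) * (- (1 / y\<^sup>2))) (at y)"
        by (rule DERIV_chain2[OF poly_DERIV]) (use 1 in \<open>auto intro!: derivative_eq_intros simp: power2_eq_square\<close>)
      moreover have "((\<lambda>y. exp (- (1 / y))) has_field_derivative exp (- (1 / y)) * (1 / y\<^sup>2)) (at y)"
        using 1 by (auto intro!: derivative_eq_intros simp: power2_eq_square)
      ultimately have "((\<lambda>y. poly P (1 / y) * exp (- (1 / y))) has_field_derivative
        poly (pderiv P) (1 / y) * (- (1 / y\<^sup>2)) * exp (- (1 / y)) + exp (- (1 / y)) * (1 / y\<^sup>2) * poly P (1 / y)) (at y)"
        by (rule DERIV_mult)
      then show ?thesis
        by (rule DERIV_cong) (use 1 in \<open>simp add: flat_exp_def flat_exp_deriv_def power2_eq_square field_simps\<close>)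
    qed
    then show ?thesis
      by (rule DERIV_cong_ev[THEN iffD1, rotated -1])
         (use 1 eventually_gt_at_top in \<open>auto simp: flat_exp_def intro!: eventually_mono[OF eventually_nhds_in_open[of "{0<..}" y]]\<close>)
  next
    case 2
    have "((\<lambda>y. 0::real) has_field_derivative 0) (at y)" by simp
    then have "(flat_exp P has_field_derivative 0) (at y)"
      by (rule DERIV_cong_ev[THEN iffD1, rotated -1])
         (use 2 in \<open>auto simp: flat_exp_def intro!: eventually_mono[OF eventually_nhds_in_open[of "{..<0}" y]]\<close>)
    then show ?thesis using 2 by (simp add: flat_exp_def)
  next
    case 3
    have "((\<lambda>h. flat_exp P h / h) \<longlongrightarrow> 0) (at_right 0)"
    \<comment> \<open>Dividing by \<open>y\<close> multiplies the polynomial in \<open>1 / y\<close>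
      by its variable, so the difference quotient is again of the form covered by
      \<open>flat_exp_tendsto\<close>.\<close>
    proof (rule Lim_transform_eventually[OF flat_exp_tendsto[of "pCons 0 P"]])
      show "eventually (\<lambda>y. poly (pCons 0 P) (1 / y) * exp (- (1 / y)) = flat_exp P y / y) (at_right 0)"
        using eventually_at_right_less[of "0::real"] by eventually_elim (simp add: flat_exp_def)
    qed
    moreover have "((\<lambda>h. flat_exp P h / h) \<longlongrightarrow> 0) (at_left 0)"
    proof (rule Lim_transform_eventually[OF tendsto_const])
      show "eventually (\<lambda>y. 0 = flat_exp P y / y) (at_left 0)"
        unfolding eventually_at_filter by (rule always_eventually) (simp add: flat_exp_def)
    qed
    ultimately have "((\<lambda>h. flat_exp P h / h) \<longlongrightarrow> 0) (at 0)" by (simp add: filterlim_split_at)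
    then show ?thesis using 3 by (simp add: has_field_derivative_iff flat_exp_def)
  qed
qed

text \<open>A profile in the squared distance, which keeps the radial function smooth at its centre
  as well. For \<open>k > 0\<close> it vanishes for \<open>r \<ge> k\<close>, so its composition
  with the squared distance has bounded support.\<close>

definition cut_gauss :: "real \<Rightarrow> real \<Rightarrow> real poly \<Rightarrow> real \<Rightarrow> real" where
  "cut_gauss l k P r = exp (- l * r) * flat_exp P (1 - r / k)"

lemma cut_gauss_has_derivative:
  "(cut_gauss l k P has_field_derivative cut_gauss l k (smult (- l) P + smult (- (1 / k)) (flat_exp_deriv P)) r) (at r)"
proof -
  have d1: "((\<lambda>r. flat_exp P (1 - r / k)) has_field_derivative flat_exp (flat_exp_deriv P) (1 - r / k) * (- (1 / k))) (at r)"
  proof (rule DERIV_chain2[OF flat_exp_has_derivative])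
    have "((\<lambda>r. 1 - r * c) has_field_derivative - c) (at r)" for c by (auto intro!: derivative_eq_intros)
    from this[of "1 / k"] show "((\<lambda>r. 1 - r / k) has_field_derivative - (1 / k)) (at r)" by simp
  qed
  have d2: "((\<lambda>r. exp (- l * r)) has_field_derivative exp (- l * r) * (- l)) (at r)"
    by (auto intro!: derivative_eq_intros)
  have "(cut_gauss l k P has_field_derivative exp (- l * r) * (- l) * flat_exp P (1 - r / k) +
     flat_exp (flat_exp_deriv P) (1 - r / k) * (- (1 / k)) * exp (- l * r)) (at r)"
    unfolding cut_gauss_def[abs_def] by (rule DERIV_mult[OF d2 d1])
  then show ?thesis by (rule DERIV_cong) (simp add: cut_gauss_def flat_exp_def algebra_simps)
qed

text \<open>A class of smooth functions that contains the cut-off Gaussians and is closed under partial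
  derivatives, which makes \<open>Ck\<close> accessible to induction.\<close>

inductive_set radial_class :: "real \<Rightarrow> real \<Rightarrow> real^'n \<Rightarrow> (real^'n \<Rightarrow> real) set" for l k a where
  base: "(\<lambda>x. cut_gauss l k P ((norm (x - a))\<^sup>2)) \<in> radial_class l k a"
| coord: "f \<in> radial_class l k a \<Longrightarrow> (\<lambda>x. (x - a) $ i * f x) \<in> radial_class l k a"
| add: "f \<in> radial_class l k a \<Longrightarrow> g \<in> radial_class l k a \<Longrightarrow> (\<lambda>x. f x + g x) \<in> radial_class l k a"
| scale: "f \<in> radial_class l k a \<Longrightarrow> (\<lambda>x. c * f x) \<in> radial_class l k a"

lemma radial_class_derivative:
  assumes "f \<in> radial_class l k (a :: real^'n)"
  shows "\<exists>f'. (\<forall>x. (f has_derivative f' x) (at x)) \<and> (\<forall>i. (\<lambda>x. f' x (axis i 1)) \<in> radial_class l k a)"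
  using assms
proof induction
  case (base P)
  define P' where "P' = smult (- l) P + smult (- (1 / k)) (flat_exp_deriv P)"
  have d: "((\<lambda>x. cut_gauss l k P ((norm (x - a))\<^sup>2)) has_derivative (\<lambda>h. 2 * inner (x - a) h * cut_gauss l k P' ((norm (x - a))\<^sup>2))) (at x)" for x
  proof -
    have "((\<lambda>x. inner (x - a) (x - a)) has_derivative (\<lambda>h. 2 * inner (x - a) h)) (at x)"
      by (auto intro!: derivative_eq_intros simp: inner_commute)
    then have "((\<lambda>x. (norm (x - a))\<^sup>2) has_derivative (\<lambda>h. 2 * inner (x - a) h)) (at x)"
      by (simp add: power2_norm_eq_inner)
    from DERIV_compose_FDERIV[OF cut_gauss_has_derivative this]
    show ?thesis unfolding P'_def .
  qed
  have "(\<lambda>x. 2 * inner (x - a) (axis i 1) * cut_gauss l k P' ((norm (x - a))\<^sup>2)) \<in> radial_class l k a" for i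
  proof -
    have "2 * inner (x - a) (axis i 1) * c = 2 * ((x - a) $ i * c)" for x c by (simp add: inner_axis)
    then show ?thesis
      using radial_class.scale[OF radial_class.coord[OF radial_class.base[of l k P' a], of i], of 2] by (simp only:)
  qed
  then show ?case using d by (intro exI[of _ "\<lambda>x h. 2 * inner (x - a) h * cut_gauss l k P' ((norm (x - a))\<^sup>2)"]) blast
next
  case (coord f i)
  then obtain f' where f': "\<And>x. (f has_derivative f' x) (at x)" "\<And>i. (\<lambda>x. f' x (axis i 1)) \<in> radial_class l k a" by blast
  have d: "((\<lambda>x. (x - a) $ i * f x) has_derivative (\<lambda>h. (x - a) $ i * f' x h + h $ i * f x)) (at x)" for x
  proof -
    have "((\<lambda>x. x $ i - a $ i) has_derivative (\<lambda>h. h $ i - 0)) (at x)"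
      by (intro has_derivative_diff has_derivative_const bounded_linear_imp_has_derivative bounded_linear_vec_nth)
    then have "((\<lambda>x. (x - a) $ i) has_derivative (\<lambda>h. h $ i)) (at x)" by simp
    from has_derivative_mult[OF this f'(1)] show ?thesis .
  qed
  have "(\<lambda>x. (x - a) $ i * f' x (axis j 1) + axis j 1 $ i * f x) \<in> radial_class l k a" for j
    by (intro radial_class.add radial_class.scale coord radial_class.coord f')
  then show ?case using d by (intro exI[of _ "\<lambda>x h. (x - a) $ i * f' x h + h $ i * f x"]) blast
next
  case (add f g)
  then obtain f' g' where f': "\<And>x. (f has_derivative f' x) (at x)" "\<And>i. (\<lambda>x. f' x (axis i 1)) \<in> radial_class l k a"
    and g': "\<And>x. (g has_derivative g' x) (at x)" "\<And>i. (\<lambda>x. g' x (axis i 1)) \<in> radial_class l k a" by blast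
  then show ?case
    by (intro exI[of _ "\<lambda>x h. f' x h + g' x h"]) (auto intro!: has_derivative_add radial_class.add)
next
  case (scale f c)
  then obtain f' where f': "\<And>x. (f has_derivative f' x) (at x)" "\<And>i. (\<lambda>x. f' x (axis i 1)) \<in> radial_class l k a" by blast
  then show ?case
    by (intro exI[of _ "\<lambda>x h. c * f' x h"]) (auto intro!: has_derivative_mult_right radial_class.scale)
qed

lemma radial_class_Ck: "f \<in> radial_class l k a \<Longrightarrow> Ck m f"
proof (induction m arbitrary: f)
  case 0
  then obtain f' where f': "\<And>x. (f has_derivative f' x) (at x)" using radial_class_derivative by blast
  have "continuous (at x) f" for x by (rule has_derivative_continuous[OF f'])
  then show ?case by (simp add: continuous_at_imp_continuous_on)
next
  case (Suc m)
  then obtain f' where f': "\<And>x. (f has_derivative f' x) (at x)" "\<And>i. (\<lambda>x. f' x (axis i 1)) \<in> radial_class l k a"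
    using radial_class_derivative by blast
  have "frechet_derivative f (at x) = f' x" for x by (rule frechet_derivative_at[OF f'(1), symmetric])
  then have "Ck m (\<lambda>x. frechet_derivative f (at x) (axis i 1))" for i
    using Suc.IH[OF f'(2)[of i]] by simp
  moreover have "f differentiable (at x)" for x using f'(1)[of x] by (rule differentiableI)
  ultimately show ?case by simp
qed

text \<open>A test function is bounded, Lipschitz and of bounded support, while the Gaussian is
  bounded below on every ball; a large \<open>e\<close> therefore gives the hypotheses of
  \<open>gagliardo_heat_bound\<close> and \<open>Lp_heat_bound\<close>.\<close>

lemma test_function_heat_bound:
  fixes f :: "real^'n \<Rightarrow> real"
  assumes f: "f \<in> test_functions"
  obtains e where "e \<ge> 0" "\<And>x. (f x)\<^sup>2 \<le> e * heat 1 x"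
    "\<And>x y. norm (x - y) < 1 \<Longrightarrow> (f x - f y)\<^sup>2 \<le> e * (norm (x - y))\<^sup>2 * heat 1 x"
proof -
  have Ck: "Ck k f" for k using f by (simp add: test_functions_def)
  have df: "(f has_derivative frechet_derivative f (at x)) (at x)" for x
    using Ck[of "Suc 0"] by (simp add: frechet_derivative_works)
  have cp: "continuous_on UNIV (\<lambda>x. frechet_derivative f (at x) (axis i 1))" for i
    using Ck[of "Suc 0"] by simp
  have cf: "continuous_on UNIV f" using Ck[of 0] by simp
  have "bounded (closure {x. f x \<noteq> 0})" using f by (simp add: test_functions_def compact_imp_bounded)
  then obtain R where "R > 0" "\<And>x. x \<in> closure {x. f x \<noteq> 0} \<Longrightarrow> norm x \<le> R" by (auto simp: bounded_pos)
  then have R: "R > 0" "\<And>x. norm x > R \<Longrightarrow> f x = 0"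
    using closure_subset[of "{x. f x \<noteq> 0}"] by (auto simp: not_le[symmetric])
  \<comment> \<open>The margins cover a pair of points at distance below one: if
    \<open>norm x \<le> R + 1\<close>, both points lie in \<open>B\<close>, and otherwise both have
    norm above \<open>R\<close>, where \<open>f\<close> vanishes.\<close>
  define B where "B = cball (0::real^'n) (R + 2)"
  have "compact (f ` B)" unfolding B_def by (intro compact_continuous_image continuous_on_subset[OF cf]) auto
  then obtain M where M: "M > 0" "\<And>x. x \<in> B \<Longrightarrow> \<bar>f x\<bar> \<le> M"
    using compact_imp_bounded[of "f ` B"] by (auto simp: bounded_pos)
  have "\<exists>L>0. \<forall>x\<in>B. \<bar>frechet_derivative f (at x) (axis i 1)\<bar> \<le> L" for i
  proof -
    have "compact ((\<lambda>x. frechet_derivative f (at x) (axis i 1)) ` B)"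
      unfolding B_def by (intro compact_continuous_image continuous_on_subset[OF cp]) auto
    from compact_imp_bounded[OF this] show ?thesis by (auto simp: bounded_pos)
  qed
  then obtain L where L: "\<And>i. L i > 0" "\<And>i x. x \<in> B \<Longrightarrow> \<bar>frechet_derivative f (at x) (axis i 1)\<bar> \<le> L i" by metis
  define L0 where "L0 = (\<Sum>i\<in>UNIV. L i)"
  have L0: "L0 \<ge> 0" unfolding L0_def using L(1) by (intro sum_nonneg) (simp add: less_imp_le)
  have on: "onorm (frechet_derivative f (at x)) \<le> L0" if x: "x \<in> B" for x
  proof (rule onorm_le)
    fix h :: "real^'n"
    have lin: "linear (frechet_derivative f (at x))" by (rule has_derivative_linear[OF df])
    have "h = (\<Sum>i\<in>UNIV. h $ i *\<^sub>R axis i 1)"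
      using basis_expansion[of h] by (simp add: scalar_mult_eq_scaleR)
    then have "frechet_derivative f (at x) h = frechet_derivative f (at x) (\<Sum>i\<in>UNIV. h $ i *\<^sub>R axis i 1)" by simp
    also have "\<dots> = (\<Sum>i\<in>UNIV. h $ i * frechet_derivative f (at x) (axis i 1))"
      by (simp add: linear_sum[OF lin] linear_scale[OF lin])
    also have "\<bar>\<dots>\<bar> \<le> (\<Sum>i\<in>UNIV. \<bar>h $ i * frechet_derivative f (at x) (axis i 1)\<bar>)" by (rule sum_abs)
    also have "\<dots> \<le> (\<Sum>i\<in>UNIV. L i * norm h)"
      unfolding abs_mult by (intro sum_mono, subst mult.commute, intro mult_mono L x component_le_norm_cart) auto
    finally show "norm (frechet_derivative f (at x) h) \<le> L0 * norm h" unfolding L0_def by (simp add: sum_distrib_right)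
  qed
  have lip: "\<bar>f x - f y\<bar> \<le> L0 * norm (x - y)" if "x \<in> B" "y \<in> B" for x y
    using differentiable_bound[of B f "\<lambda>x. frechet_derivative f (at x)" L0 x y] on that
    by (simp add: B_def has_derivative_at_withinI[OF df])
  define h0 where "h0 = (4 * 1) powr (- real CARD('n) / 2) * exp (- (R + 1)\<^sup>2 / (4 * 1)) / gauss_mass TYPE(real^'n)"
  have h0: "h0 > 0" unfolding h0_def using gauss_mass_pos[where 'a="real^'n"] by simp
  have hh: "h0 \<le> heat 1 x" if "norm x \<le> R + 1" for x :: "real^'n"
  proof -
    have "(norm x)\<^sup>2 \<le> (R + 1)\<^sup>2" using that by (intro power_mono) auto
    then show ?thesis unfolding h0_def heat_def using gauss_mass_pos[where 'a="real^'n"]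
      by (intro divide_right_mono mult_mono) auto
  qed
  define e where "e = max (M\<^sup>2) (L0\<^sup>2) / h0"
  have e: "e \<ge> 0" "M\<^sup>2 \<le> e * h0" "L0\<^sup>2 \<le> e * h0" unfolding e_def using h0 by (auto simp: le_max_iff_disj)
  show ?thesis
  proof (rule that[OF e(1)])
    fix x
    show "(f x)\<^sup>2 \<le> e * heat 1 x"
    proof (cases "norm x \<le> R + 1")
      case True
      have "\<bar>f x\<bar>\<^sup>2 \<le> M\<^sup>2" using M True by (intro power_mono) (auto simp: B_def)
      then have "(f x)\<^sup>2 \<le> M\<^sup>2" by simp
      also note e(2)
      also have "e * h0 \<le> e * heat 1 x" using hh[OF True] e by (intro mult_left_mono) auto
      finally show ?thesis .
    qed (use R e in simp)
    fix y assume xy: "norm (x - y) < 1"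
    show "(f x - f y)\<^sup>2 \<le> e * (norm (x - y))\<^sup>2 * heat 1 x"
    proof (cases "norm x \<le> R + 1")
      case True
      have "norm y \<le> norm x + norm (x - y)" using norm_triangle_ineq4[of x "x - y"] by simp
      then have "y \<in> B" "x \<in> B" using True xy by (auto simp: B_def)
      then have "\<bar>f x - f y\<bar>\<^sup>2 \<le> (L0 * norm (x - y))\<^sup>2" using lip by (intro power_mono) auto
      then have "(f x - f y)\<^sup>2 \<le> L0\<^sup>2 * (norm (x - y))\<^sup>2" by (simp add: power_mult_distrib)
      also have "\<dots> \<le> (e * heat 1 x) * (norm (x - y))\<^sup>2"
        using e(3) mult_left_mono[OF hh[OF True] e(1)] by (intro mult_right_mono) auto
      finally show ?thesis by (simp add: mult_ac)
    next
      case False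
      have "norm x \<le> norm y + norm (x - y)" using norm_triangle_ineq[of y "x - y"] by simp
      then have "norm y > R" using False xy by simp
      then show ?thesis using R False e by simp
    qed
  qed
qed

lemma flat_exp_one_deriv_bound:
  "\<bar>flat_exp (flat_exp_deriv [:1:]) y\<bar> \<le> 2"
proof (cases "y > 0")
  case True
  define x where "x = 1 / y"
  have x: "x > 0" using True by (simp add: x_def)
  have "x\<^sup>2 / 2 \<le> exp x" using exp_lower_Taylor_quadratic[of x] x by (smt (verit) less_imp_le)
  then have "x\<^sup>2 * exp (- x) \<le> 2" by (simp add: exp_minus field_simps)
  moreover have "flat_exp (flat_exp_deriv [:1:]) y = x\<^sup>2 * exp (- x)"
    using True by (simp add: flat_exp_def flat_exp_deriv_def x_def power2_eq_square)
  ultimately show ?thesis using x by simp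
qed (simp add: flat_exp_def)

lemma cut_off_bound:
  assumes k: "k > 0" and r: "r \<ge> 0"
  shows "\<bar>1 - exp 1 * flat_exp [:1:] (1 - r / k)\<bar> \<le> 2 * exp 1 * r / k"
proof -
  have "\<bar>flat_exp [:1:] (1 - r / k) - flat_exp [:1:] 1\<bar> \<le> 2 * \<bar>(1 - r / k) - 1\<bar>"
  proof -
    have "norm (flat_exp [:1:] (1 - r / k) - flat_exp [:1:] 1) \<le> 2 * norm ((1 - r / k) - 1)"
      by (rule field_differentiable_bound[of UNIV "flat_exp [:1:]" "flat_exp (flat_exp_deriv [:1:])"])
         (use flat_exp_has_derivative flat_exp_one_deriv_bound in auto)
    then show ?thesis by simp
  qed
  then have "exp 1 * \<bar>flat_exp [:1:] (1 - r / k) - flat_exp [:1:] 1\<bar> \<le> exp 1 * (2 * \<bar>(1 - r / k) - 1\<bar>)"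
    by (intro mult_left_mono) auto
  moreover have "exp 1 * flat_exp [:1:] 1 = (1::real)" by (simp add: flat_exp_def exp_minus)
  moreover have "\<bar>exp 1 * (flat_exp [:1:] (1 - r / k) - flat_exp [:1:] 1)\<bar> = exp 1 * \<bar>flat_exp [:1:] (1 - r / k) - flat_exp [:1:] 1\<bar>"
    by (simp add: abs_mult)
  ultimately show ?thesis using k r by (simp add: right_diff_distrib abs_minus_commute mult_ac)
qed

text \<open>\<open>W\<close> is, up to a factor, the profile of the error made by cutting a Gaussian
  off. The relative error grows at most linearly in \<open>r / k\<close>, which a part of the
  exponential absorbs. The remaining decay is what a Gaussian at four times the original time
  requires.\<close>

lemma cut_gauss_error:
  fixes t k r :: real
  assumes l: "l > 0" and k: "k > 0"
  defines "W \<equiv> \<lambda>r. exp (- l * r) * (1 - exp 1 * flat_exp [:1:] (1 - r / k))"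
  shows "r \<ge> 0 \<Longrightarrow> (W r)\<^sup>2 \<le> (4 * exp 1 / l)\<^sup>2 / k\<^sup>2 * exp (- l * r / 4)"
    and "0 \<le> m \<Longrightarrow> m \<le> r1 \<Longrightarrow> m \<le> r2 \<Longrightarrow> \<bar>W r1 - W r2\<bar> \<le> 4 * exp 1 / k * exp (- l * m / 2) * \<bar>r1 - r2\<bar>"
proof -
  have xe: "x * exp (- x) \<le> 1" for x :: real
  proof -
    have "x \<le> exp x" using exp_ge_add_one_self[of x] by linarith
    then show ?thesis by (simp add: exp_minus field_simps)
  qed
  {
    assume r: "r \<ge> 0"
    have "\<bar>W r\<bar> = exp (- l * r) * \<bar>1 - exp 1 * flat_exp [:1:] (1 - r / k)\<bar>" unfolding W_def by (simp add: abs_mult)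
    also have "\<dots> \<le> exp (- l * r) * (2 * exp 1 * r / k)" by (intro mult_left_mono cut_off_bound k r) auto
    also have "\<dots> = (4 * exp 1 / l) / k * ((l * r / 2) * exp (- (l * r / 2))) * exp (- (l * r / 2))"
    proof -
      have "exp (- l * r) = exp (- (l * r / 2)) * exp (- (l * r / 2))" by (simp add: exp_add[symmetric])
      then show ?thesis using l k by (simp add: field_simps)
    qed
    also have "\<dots> \<le> (4 * exp 1 / l) / k * 1 * exp (- (l * r / 2))"
      using l k by (intro mult_right_mono mult_left_mono xe) auto
    finally have "\<bar>W r\<bar>\<^sup>2 \<le> ((4 * exp 1 / l) / k * 1 * exp (- (l * r / 2)))\<^sup>2" by (intro power_mono) auto
    then have "(W r)\<^sup>2 \<le> (4 * exp 1 / l)\<^sup>2 / k\<^sup>2 * (exp (- (l * r / 2)))\<^sup>2" by (simp add: power_mult_distrib power_divide)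
    also have "(exp (- (l * r / 2)))\<^sup>2 = exp (- l * r)" by (simp add: power2_eq_square exp_add[symmetric])
    also have "(4 * exp 1 / l)\<^sup>2 / k\<^sup>2 * exp (- l * r) \<le> (4 * exp 1 / l)\<^sup>2 / k\<^sup>2 * exp (- l * r / 4)"
      using l r by (intro mult_left_mono) auto
    finally show "(W r)\<^sup>2 \<le> (4 * exp 1 / l)\<^sup>2 / k\<^sup>2 * exp (- l * r / 4)" .
  }
  assume m: "0 \<le> m" "m \<le> r1" "m \<le> r2"
  define W' where "W' r = - l * exp (- l * r) * (1 - exp 1 * flat_exp [:1:] (1 - r / k))
     + exp (- l * r) * (exp 1 * (flat_exp (flat_exp_deriv [:1:]) (1 - r / k) / k))" for r
  have dW: "(W has_field_derivative W' r) (at r)" for r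
  proof -
    have "((\<lambda>r. 1 - r * c) has_field_derivative - c) (at r)" for c by (auto intro!: derivative_eq_intros)
    from this[of "1 / k"] have "((\<lambda>r. 1 - r / k) has_field_derivative - (1 / k)) (at r)" by simp
    from DERIV_chain2[OF flat_exp_has_derivative this]
    have "((\<lambda>r. flat_exp [:1:] (1 - r / k)) has_field_derivative flat_exp (flat_exp_deriv [:1:]) (1 - r / k) * - (1 / k)) (at r)" .
    then show ?thesis unfolding W_def W'_def
      by (auto intro!: derivative_eq_intros)
  qed
  have W'b: "\<bar>W' r\<bar> \<le> 4 * exp 1 / k * exp (- l * m / 2)" if r: "r \<ge> m" for r
  proof -
    have r0: "r \<ge> 0" using r m by simp
    have "\<bar>W' r\<bar> \<le> l * exp (- l * r) * \<bar>1 - exp 1 * flat_exp [:1:] (1 - r / k)\<bar>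
       + exp (- l * r) * (exp 1 * (\<bar>flat_exp (flat_exp_deriv [:1:]) (1 - r / k)\<bar> / k))"
      unfolding W'_def using l k by (intro order_trans[OF abs_triangle_ineq]) (simp add: abs_mult)
    also have "\<dots> \<le> l * exp (- l * r) * (2 * exp 1 * r / k) + exp (- l * r) * (exp 1 * (2 / k))"
      using l k by (intro add_mono mult_left_mono divide_right_mono cut_off_bound flat_exp_one_deriv_bound r0) auto
    also have "\<dots> = 4 * exp 1 / k * (((1 + l * r) / 2) * exp (- l * r))" using k by (simp add: field_simps)
    also have "\<dots> \<le> 4 * exp 1 / k * exp (- l * m / 2)"
    proof (rule mult_left_mono)
      have "(1 + l * r) / 2 \<le> exp (l * r / 2)" using exp_ge_add_one_self[of "l * r / 2"] by (simp only: add_divide_distrib)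
      then have "((1 + l * r) / 2) * exp (- l * r) \<le> exp (l * r / 2) * exp (- l * r)" by (intro mult_right_mono) auto
      also have "\<dots> = exp (- l * r / 2)" by (simp add: exp_add[symmetric])
      also have "\<dots> \<le> exp (- l * m / 2)" using l r by simp
      finally show "((1 + l * r) / 2) * exp (- l * r) \<le> exp (- l * m / 2)" .
    qed (use k in auto)
    finally show ?thesis .
  qed
  have "norm (W r1 - W r2) \<le> 4 * exp 1 / k * exp (- l * m / 2) * norm (r1 - r2)"
    by (rule field_differentiable_bound[of "{m..}" W W'])
       (use dW W'b m in \<open>auto intro: has_field_derivative_at_within\<close>)
  then show "\<bar>W r1 - W r2\<bar> \<le> 4 * exp 1 / k * exp (- l * m / 2) * \<bar>r1 - r2\<bar>" by simp
qed

text \<open>The factor \<open>exp 1\<close> normalises the cut-off to be \<open>1\<close> at the centre.\<close>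

definition heat_cut :: "real \<Rightarrow> real^'n \<Rightarrow> nat \<Rightarrow> real^'n \<Rightarrow> real" where
  "heat_cut t a j x = cut_gauss (1 / (4 * t)) (real (Suc j))
     [:(4 * t) powr (- real CARD('n) / 2) / gauss_mass TYPE(real^'n) * exp 1:] ((norm (x - a))\<^sup>2)"

lemma heat_cut_test_function: "heat_cut t a j \<in> test_functions"
proof -
  have "heat_cut t a j \<in> radial_class (1 / (4 * t)) (real (Suc j)) a"
    unfolding heat_cut_def[abs_def] by (rule radial_class.base)
  then have "Ck m (heat_cut t a j)" for m by (rule radial_class_Ck)
  moreover have "{x. heat_cut t a j x \<noteq> 0} \<subseteq> cball a (real (Suc j))"
  proof
    fix x assume "x \<in> {x. heat_cut t a j x \<noteq> 0}"
    then have "1 - (norm (x - a))\<^sup>2 / real (Suc j) > 0"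
      unfolding heat_cut_def cut_gauss_def flat_exp_def by (auto split: if_splits)
    then have "(norm (x - a))\<^sup>2 < real (Suc j)" by (simp add: field_simps)
    also have "\<dots> \<le> (real (Suc j))\<^sup>2" by (simp add: power2_eq_square)
    finally have "norm (x - a) \<le> real (Suc j)" using power2_less_imp_less[of "norm (x - a)" "real (Suc j)"] by simp
    then show "x \<in> cball a (real (Suc j))" by (simp add: dist_norm norm_minus_commute)
  qed
  then have "bounded {x. heat_cut t a j x \<noteq> 0}" by (rule bounded_subset[OF bounded_cball])
  then have "compact (closure {x. heat_cut t a j x \<noteq> 0})" by (simp add: compact_closure)
  ultimately show ?thesis by (simp add: test_functions_def)
qed

text \<open>Brings the error of the cut-off into the form required by
  \<open>gagliardo_heat_bound\<close> and \<open>Lp_heat_bound\<close>, with the Gaussian at time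
  \<open>4 * t\<close> and a factor of order \<open>1 / (j + 1)\<^sup>2\<close>. The increment of
  the squared distance costs a factor linear in the distance, absorbed by the exponential once
  more.\<close>

lemma heat_cut_error:
  fixes a :: "real^'n"
  assumes t: "t > 0"
  obtains C where "C > 0" "\<And>j x. (heat t (x - a) - heat_cut t a j x)\<^sup>2 \<le> C / (real (Suc j))\<^sup>2 * heat (4 * t) (x - a)"
    "\<And>j x y. norm (x - y) < 1 \<Longrightarrow> ((heat t (x - a) - heat_cut t a j x) - (heat t (y - a) - heat_cut t a j y))\<^sup>2
       \<le> C / (real (Suc j))\<^sup>2 * (norm (x - y))\<^sup>2 * heat (4 * t) (x - a)"
proof -
  let ?N = "real CARD('n)" let ?g = "gauss_mass TYPE(real^'n)"
  have g: "?g > 0" by (rule gauss_mass_pos)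
  define l where "l = 1 / (4 * t)"
  have l: "l > 0" unfolding l_def using t by simp
  define c where "c = (4 * t) powr (- ?N / 2) / ?g"
  have c: "c > 0" unfolding c_def using t g by simp
  define c4 where "c4 = (4 * (4 * t)) powr (- ?N / 2) / ?g"
  have c4: "c4 > 0" unfolding c4_def using t g by simp
  have h4: "heat (4 * t) z = c4 * exp (- l * (norm z)\<^sup>2 / 4)" for z :: "real^'n"
    unfolding heat_def c4_def l_def by (simp add: field_simps)
  define W where "W k r = exp (- l * r) * (1 - exp 1 * flat_exp [:1:] (1 - r / k))" for k r
  have err: "heat t (x - a) - heat_cut t a j x = c * W (real (Suc j)) ((norm (x - a))\<^sup>2)" for x j
  proof -
    have "heat t (x - a) = c * exp (- l * (norm (x - a))\<^sup>2)" unfolding heat_def c_def l_def by simp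
    moreover have "heat_cut t a j x = c * (exp (- l * (norm (x - a))\<^sup>2) * (exp 1 * flat_exp [:1:] (1 - (norm (x - a))\<^sup>2 / real (Suc j))))"
      unfolding heat_cut_def cut_gauss_def c_def[symmetric] l_def[symmetric] by (simp add: flat_exp_def)
    ultimately show ?thesis unfolding W_def by (simp add: algebra_simps)
  qed
  define C1 where "C1 = c\<^sup>2 * (4 * exp 1 / l)\<^sup>2 / c4"
  define C2 where "C2 = c\<^sup>2 * (4 * exp 1)\<^sup>2 * exp l * (32 / l + 2) / c4"
  have C1: "C1 > 0" unfolding C1_def using c c4 l by simp
  have C2: "C2 > 0" unfolding C2_def using c c4 l by (simp add: add_pos_pos)
  have b1: "(heat t (x - a) - heat_cut t a j x)\<^sup>2 \<le> C1 / (real (Suc j))\<^sup>2 * heat (4 * t) (x - a)" for j x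
  proof -
    have "(heat t (x - a) - heat_cut t a j x)\<^sup>2 = c\<^sup>2 * (W (real (Suc j)) ((norm (x - a))\<^sup>2))\<^sup>2" unfolding err by (simp add: power_mult_distrib)
    also have "\<dots> \<le> c\<^sup>2 * ((4 * exp 1 / l)\<^sup>2 / (real (Suc j))\<^sup>2 * exp (- l * (norm (x - a))\<^sup>2 / 4))"
      unfolding W_def by (intro mult_left_mono cut_gauss_error(1) l) auto
    also have "\<dots> = C1 / (real (Suc j))\<^sup>2 * heat (4 * t) (x - a)" unfolding h4 C1_def using c4 by simp
    finally show ?thesis .
  qed
  have b2: "((heat t (x - a) - heat_cut t a j x) - (heat t (y - a) - heat_cut t a j y))\<^sup>2
       \<le> C2 / (real (Suc j))\<^sup>2 * (norm (x - y))\<^sup>2 * heat (4 * t) (x - a)" if xy: "norm (x - y) < 1" for j x y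
  proof -
    define k where "k = real (Suc j)"
    have k: "k > 0" by (simp add: k_def)
    define p where "p = norm (x - a)" define q where "q = norm (y - a)" define d where "d = norm (x - y)"
    have d: "0 \<le> d" "d < 1" unfolding d_def using xy by auto
    have pq: "\<bar>p - q\<bar> \<le> d" unfolding p_def q_def d_def using norm_triangle_ineq3[of "x - a" "y - a"] by simp
    have p0: "p \<ge> 0" "q \<ge> 0" unfolding p_def q_def by auto
    \<comment> \<open>A common lower bound of \<open>p\<^sup>2\<close> and \<open>q\<^sup>2\<close>:
      from \<open>p \<le> q + 1\<close> follows \<open>p\<^sup>2 \<le> 2 * q\<^sup>2 + 2\<close>. It
      allows the error bound to be expressed by \<open>p\<close> alone.\<close>
    define m where "m = max 0 (p\<^sup>2 / 2 - 1)"
    have "p\<^sup>2 \<ge> 0" by simp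
    then have mp: "m \<le> p\<^sup>2" unfolding m_def by (intro max.boundedI) linarith+
    have mq: "m \<le> q\<^sup>2"
    proof -
      have "p \<le> q + 1" using pq d by linarith
      then have "p\<^sup>2 \<le> (q + 1)\<^sup>2" using p0 by (intro power_mono) auto
      also have "\<dots> \<le> 2 * q\<^sup>2 + 2" using sum_squares_bound[of q 1] by (simp add: power2_sum)
      finally show ?thesis unfolding m_def by simp
    qed
    have "\<bar>W k (p\<^sup>2) - W k (q\<^sup>2)\<bar> \<le> 4 * exp 1 / k * exp (- l * m / 2) * \<bar>p\<^sup>2 - q\<^sup>2\<bar>"
      unfolding W_def by (rule cut_gauss_error(2)[OF l k]) (use mp mq in \<open>auto simp: m_def\<close>)
    also have "\<dots> \<le> 4 * exp 1 / k * exp (- l * m / 2) * (d * (2 * p + 1))"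
    proof (rule mult_left_mono)
      have "p\<^sup>2 - q\<^sup>2 = (p - q) * (p + q)" by (simp add: power2_eq_square algebra_simps)
      then have "\<bar>p\<^sup>2 - q\<^sup>2\<bar> = \<bar>p - q\<bar> * (p + q)" using p0 by (simp add: abs_mult)
      also have "\<dots> \<le> d * (2 * p + 1)" using pq d p0 by (intro mult_mono) auto
      finally show "\<bar>p\<^sup>2 - q\<^sup>2\<bar> \<le> d * (2 * p + 1)" .
    qed (use k in auto)
    finally have "\<bar>W k (p\<^sup>2) - W k (q\<^sup>2)\<bar> \<le> 4 * exp 1 / k * exp (- l * m / 2) * (d * (2 * p + 1))" .
    then have "\<bar>W k (p\<^sup>2) - W k (q\<^sup>2)\<bar>\<^sup>2 \<le> (4 * exp 1 / k * exp (- l * m / 2) * (d * (2 * p + 1)))\<^sup>2" by (intro power_mono) auto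
    also have "\<dots> = (4 * exp 1)\<^sup>2 / k\<^sup>2 * d\<^sup>2 * ((2 * p + 1)\<^sup>2 * exp (- l * m))"
    proof -
      have "(exp (- l * m / 2))\<^sup>2 = exp (- l * m)" by (simp add: power2_eq_square exp_add[symmetric])
      then show ?thesis by (simp only: power_mult_distrib power_divide) simp
    qed
    also have "\<dots> \<le> (4 * exp 1)\<^sup>2 / k\<^sup>2 * d\<^sup>2 * (exp l * (32 / l + 2) * exp (- l * p\<^sup>2 / 4))"
    proof (rule mult_left_mono)
      have "- l * m \<le> l - l * p\<^sup>2 / 2" using l mult_left_mono[of "p\<^sup>2 / 2 - 1" m l] by (simp add: m_def algebra_simps)
      then have "exp (- l * m) \<le> exp (l - l * p\<^sup>2 / 2)" by simp
      also have "l - l * p\<^sup>2 / 2 = l + (- (l * p\<^sup>2 / 4) + - l * p\<^sup>2 / 4)" by simp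
      also have "exp \<dots> = exp l * (exp (- (l * p\<^sup>2 / 4)) * exp (- l * p\<^sup>2 / 4))" by (simp only: exp_add)
      finally have e1: "exp (- l * m) \<le> exp l * (exp (- (l * p\<^sup>2 / 4)) * exp (- l * p\<^sup>2 / 4))" .
      have e2: "(2 * p + 1)\<^sup>2 \<le> 8 * p\<^sup>2 + 2" using sum_squares_bound[of "2 * p" 1] by (simp add: power2_sum power_mult_distrib)
      have "(2 * p + 1)\<^sup>2 * exp (- l * m) \<le> (8 * p\<^sup>2 + 2) * (exp l * (exp (- (l * p\<^sup>2 / 4)) * exp (- l * p\<^sup>2 / 4)))"
        using e1 e2 by (intro mult_mono) auto
      also have "\<dots> = exp l * ((8 * p\<^sup>2 + 2) * exp (- (l * p\<^sup>2 / 4))) * exp (- l * p\<^sup>2 / 4)" by simp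
      also have "\<dots> \<le> exp l * (32 / l + 2) * exp (- l * p\<^sup>2 / 4)"
      proof (intro mult_right_mono mult_left_mono)
        have "(l * p\<^sup>2 / 4) * exp (- (l * p\<^sup>2 / 4)) \<le> 1"
          using exp_ge_add_one_self[of "l * p\<^sup>2 / 4"] by (simp add: exp_minus field_simps)
        then have "32 / l * ((l * p\<^sup>2 / 4) * exp (- (l * p\<^sup>2 / 4))) \<le> 32 / l * 1" using l by (intro mult_left_mono) auto
        moreover have "32 / l * ((l * p\<^sup>2 / 4) * exp (- (l * p\<^sup>2 / 4))) = 8 * p\<^sup>2 * exp (- (l * p\<^sup>2 / 4))" using l by simp
        moreover have "exp (- (l * p\<^sup>2 / 4)) \<le> 1" using l by simp
        moreover have "(8 * p\<^sup>2 + 2) * exp (- (l * p\<^sup>2 / 4)) = 8 * p\<^sup>2 * exp (- (l * p\<^sup>2 / 4)) + 2 * exp (- (l * p\<^sup>2 / 4))"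
          by (rule distrib_right)
        ultimately show "(8 * p\<^sup>2 + 2) * exp (- (l * p\<^sup>2 / 4)) \<le> 32 / l + 2" by linarith
      qed auto
      finally show "(2 * p + 1)\<^sup>2 * exp (- l * m) \<le> exp l * (32 / l + 2) * exp (- l * p\<^sup>2 / 4)" .
    qed (use k in auto)
    finally have "(W k (p\<^sup>2) - W k (q\<^sup>2))\<^sup>2 \<le> (4 * exp 1)\<^sup>2 / k\<^sup>2 * d\<^sup>2 * (exp l * (32 / l + 2) * exp (- l * p\<^sup>2 / 4))"
      by simp
    then have "c\<^sup>2 * (W k (p\<^sup>2) - W k (q\<^sup>2))\<^sup>2 \<le> c\<^sup>2 * ((4 * exp 1)\<^sup>2 / k\<^sup>2 * d\<^sup>2 * (exp l * (32 / l + 2) * exp (- l * p\<^sup>2 / 4)))"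
      by (intro mult_left_mono) auto
    also have "\<dots> = C2 / k\<^sup>2 * d\<^sup>2 * heat (4 * t) (x - a)" unfolding h4 C2_def p_def using c4 by simp
    finally show ?thesis unfolding err k_def[symmetric] p_def[symmetric] q_def[symmetric] d_def[symmetric]
      by (simp add: right_diff_distrib[symmetric] power_mult_distrib)
  qed
  define C where "C = max C1 C2"
  have C: "C > 0" "C1 \<le> C" "C2 \<le> C" unfolding C_def using C1 by auto
  show ?thesis
  proof (rule that[OF C(1)])
    fix j x
    show "(heat t (x - a) - heat_cut t a j x)\<^sup>2 \<le> C / (real (Suc j))\<^sup>2 * heat (4 * t) (x - a)"
      using C by (intro order_trans[OF b1] mult_right_mono divide_right_mono) auto
    fix y assume xy: "norm (x - y) < 1"
    show "((heat t (x - a) - heat_cut t a j x) - (heat t (y - a) - heat_cut t a j y))\<^sup>2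
       \<le> C / (real (Suc j))\<^sup>2 * (norm (x - y))\<^sup>2 * heat (4 * t) (x - a)"
      using C by (intro order_trans[OF b2[OF xy]] mult_right_mono divide_right_mono) auto
  qed
qed

section \<open>Finite energy, and passage from Lebesgue to Borel functions\<close>

lemma ennpowr_le:
  assumes "a \<le> ennreal b" "b \<ge> 0" "r > 0"
  shows "ennpowr a r \<le> ennreal (b powr r)"
proof -
  have "a \<noteq> \<infinity>" using assms(1) by (auto simp: top_unique)
  moreover have "enn2real a \<le> b" using assms(1,2) by (rule enn2real_leI[rotated])
  ultimately show ?thesis using assms unfolding ennpowr_def by (auto intro!: ennreal_leI powr_mono2)
qed

lemma ennpowr_finiteD: "ennpowr a r < \<infinity> \<Longrightarrow> a < \<infinity>"
  unfolding ennpowr_def by (auto simp: less_top split: if_splits)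

lemma frac_const_pos:
  assumes "0 < s" "s < 1" "N > 0"
  shows "frac_const N s > 0"
  unfolding frac_const_def using assms by simp

lemma Hs_seminorm_eq:
  "Hs_seminorm s (w :: real^'n \<Rightarrow> real) = ennpowr (ennreal (frac_const (real CARD('n)) s / 2) * gagliardo s w) (1/2)"
  unfolding Hs_seminorm_def gagliardo_def by (simp add: nn_integral_completion)

lemma Lp_norm_eq: "Lp_norm r (w :: real^'n \<Rightarrow> real) = ennpowr (\<integral>\<^sup>+x. ennreal (\<bar>w x\<bar> powr r) \<partial>lborel) (1 / r)"
  unfolding Lp_norm_def by (simp add: nn_integral_completion)

lemma gagliardo_cong_AE:
  assumes "AE x in lborel. u x = v x"
  shows "gagliardo s u = gagliardo s v"
  unfolding gagliardo_def
proof (rule nn_integral_cong_AE)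
  show "AE x in lborel. (\<integral>\<^sup>+y. ennreal (\<bar>u x - u y\<bar>\<^sup>2 / norm (x - y) powr (real DIM('a) + 2 * s)) \<partial>lborel) =
      (\<integral>\<^sup>+y. ennreal (\<bar>v x - v y\<bar>\<^sup>2 / norm (x - y) powr (real DIM('a) + 2 * s)) \<partial>lborel)"
    using assms
  proof eventually_elim
    case (elim x)
    show ?case
    proof (rule nn_integral_cong_AE)
      show "AE y in lborel. ennreal (\<bar>u x - u y\<bar>\<^sup>2 / norm (x - y) powr (real DIM('a) + 2 * s)) = ennreal (\<bar>v x - v y\<bar>\<^sup>2 / norm (x - y) powr (real DIM('a) + 2 * s))"
        using assms by eventually_elim (simp add: elim)
    qed
  qed
qed

lemma crit_exp_gt_2:
  assumes "0 < s" "2 * s < N"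
  shows "crit_exp N s > 2"
  unfolding crit_exp_def using assms by (simp add: field_simps)

lemma gagliardo_add_le:
  fixes u v :: "'a::euclidean_space \<Rightarrow> real"
  assumes [measurable]: "u \<in> borel_measurable borel" "v \<in> borel_measurable borel"
  shows "gagliardo s (\<lambda>x. u x + v x) \<le> 2 * gagliardo s u + 2 * gagliardo s v"
proof -
  define e where "e w x y = ennreal (\<bar>w x - w y\<bar>\<^sup>2 / norm (x - y) powr (real DIM('a) + 2 * s))" for w :: "'a \<Rightarrow> real" and x y
  have [measurable]: "(\<lambda>z. e w (f z) (g z)) \<in> borel_measurable M"
    if [measurable]: "w \<in> borel_measurable borel" "f \<in> borel_measurable M" "g \<in> borel_measurable M" for w f g M
    unfolding e_def by measurable
  have "e (\<lambda>x. u x + v x) x y \<le> 2 * e u x y + 2 * e v x y" for x y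
  proof -
    define n where "n = norm (x - y) powr (real DIM('a) + 2 * s)"
    have n: "n \<ge> 0" by (simp add: n_def)
    have "\<bar>(u x + v x) - (u y + v y)\<bar>\<^sup>2 = ((u x - u y) + (v x - v y))\<^sup>2" by (simp add: algebra_simps)
    also have "\<dots> \<le> 2 * (u x - u y)\<^sup>2 + 2 * (v x - v y)\<^sup>2"
      using sum_squares_bound[of "u x - u y" "v x - v y"] by (simp add: power2_sum)
    finally have "\<bar>(u x + v x) - (u y + v y)\<bar>\<^sup>2 / n \<le> (2 * (u x - u y)\<^sup>2 + 2 * (v x - v y)\<^sup>2) / n"
      using n by (intro divide_right_mono)
    then have "ennreal (\<bar>(u x + v x) - (u y + v y)\<bar>\<^sup>2 / n) \<le> ennreal (2 * (\<bar>u x - u y\<bar>\<^sup>2 / n) + 2 * (\<bar>v x - v y\<bar>\<^sup>2 / n))"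
      by (intro ennreal_leI) (simp add: add_divide_distrib)
    also have "\<dots> = 2 * ennreal (\<bar>u x - u y\<bar>\<^sup>2 / n) + 2 * ennreal (\<bar>v x - v y\<bar>\<^sup>2 / n)"
    proof -
      have pq: "ennreal (2 * p + 2 * q) = 2 * ennreal p + 2 * ennreal q" if "p \<ge> 0" "q \<ge> 0" for p q
        using that by (simp add: ennreal_mult)
      show ?thesis by (rule pq) (use n in auto)
    qed
    finally show ?thesis unfolding e_def n_def .
  qed
  then have "gagliardo s (\<lambda>x. u x + v x) \<le> (\<integral>\<^sup>+x. (\<integral>\<^sup>+y. 2 * e u x y + 2 * e v x y \<partial>lborel) \<partial>lborel)"
    unfolding gagliardo_def e_def by (intro nn_integral_mono)
  also have "\<dots> = 2 * (\<integral>\<^sup>+x. (\<integral>\<^sup>+y. e u x y \<partial>lborel) \<partial>lborel) + 2 * (\<integral>\<^sup>+x. (\<integral>\<^sup>+y. e v x y \<partial>lborel) \<partial>lborel)"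
    by (simp add: nn_integral_add nn_integral_cmult)
  finally show ?thesis unfolding gagliardo_def e_def .
qed

lemma test_function_borel: "f \<in> test_functions \<Longrightarrow> f \<in> borel_measurable borel"
proof -
  assume "f \<in> test_functions"
  then have "Ck 0 f" unfolding test_functions_def by blast
  then show ?thesis by (simp add: borel_measurable_continuous_onI)
qed

lemma test_function_gagliardo:
  fixes f :: "real^'n \<Rightarrow> real"
  assumes s: "0 < s" "s < 1" and f: "f \<in> test_functions"
  shows "gagliardo s f < \<infinity>"
proof -
  obtain e where e: "e \<ge> 0" "\<And>x. (f x)\<^sup>2 \<le> e * heat 1 x"
    "\<And>x y. norm (x - y) < 1 \<Longrightarrow> (f x - f y)\<^sup>2 \<le> e * (norm (x - y))\<^sup>2 * heat 1 x"
    using test_function_heat_bound[OF f] by blast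
  obtain G where G: "G > 0" "\<forall>(w :: real^'n \<Rightarrow> real) e t a. w \<in> borel_measurable borel \<and> e \<ge> 0 \<and> t > 0 \<and>
     (\<forall>x. (w x)\<^sup>2 \<le> e * heat t (x - a)) \<and>
     (\<forall>x y. norm (x - y) < 1 \<longrightarrow> (w x - w y)\<^sup>2 \<le> e * (norm (x - y))\<^sup>2 * heat t (x - a)) \<longrightarrow>
     gagliardo s w \<le> ennreal (G * e)"
    using gagliardo_heat_bound[OF s, where 'a="real^'n"] by (elim exE conjE) (rule that)
  have "gagliardo s f \<le> ennreal (G * e)"
    using e test_function_borel[OF f] by (intro G(2)[rule_format, of _ _ 1 0]) auto
  then show ?thesis by (rule le_less_trans) simp
qed

text \<open>The cut-off Gaussians are test functions, and by \<open>heat_cut_error\<close> both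
  norms of the errors tend to zero. Finiteness of the energy follows by writing the Gaussian as the
  first error plus the first cut-off.\<close>

lemma heat_mem_Hs_dot:
  fixes a :: "real^'n"
  assumes s: "0 < s" "s < 1" "2 * s < real CARD('n)" and t: "t > 0"
  shows "(\<lambda>x. heat t (x - a)) \<in> Hs_dot s" and "gagliardo s (\<lambda>x. heat t (x - a)) < \<infinity>"
proof -
  let ?N = "real CARD('n)" let ?al = "crit_exp (real CARD('n)) s"
  have al: "?al > 2" using s by (intro crit_exp_gt_2) auto
  define fc where "fc = frac_const ?N s / 2"
  have fc: "fc > 0" unfolding fc_def using s frac_const_pos[of s ?N] by simp
  obtain C where C: "C > 0" "\<And>j x. (heat t (x - a) - heat_cut t a j x)\<^sup>2 \<le> C / (real (Suc j))\<^sup>2 * heat (4 * t) (x - a)"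
    "\<And>j x y. norm (x - y) < 1 \<Longrightarrow> ((heat t (x - a) - heat_cut t a j x) - (heat t (y - a) - heat_cut t a j y))\<^sup>2
       \<le> C / (real (Suc j))\<^sup>2 * (norm (x - y))\<^sup>2 * heat (4 * t) (x - a)"
    using heat_cut_error[OF t, of a] by blast
  obtain G where G: "G > 0" "\<forall>(w :: real^'n \<Rightarrow> real) e t a. w \<in> borel_measurable borel \<and> e \<ge> 0 \<and> t > 0 \<and>
     (\<forall>x. (w x)\<^sup>2 \<le> e * heat t (x - a)) \<and>
     (\<forall>x y. norm (x - y) < 1 \<longrightarrow> (w x - w y)\<^sup>2 \<le> e * (norm (x - y))\<^sup>2 * heat t (x - a)) \<longrightarrow>
     gagliardo s w \<le> ennreal (G * e)"
    using gagliardo_heat_bound[OF s(1,2), where 'a="real^'n"] by (elim exE conjE) (rule that)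
  define w where "w j x = heat t (x - a) - heat_cut t a j x" for j x
  define e where "e j = C / (real (Suc j))\<^sup>2" for j
  have e0: "e j > 0" for j unfolding e_def using C by simp
  have [measurable]: "heat_cut t a j \<in> borel_measurable borel" for j
    by (rule test_function_borel[OF heat_cut_test_function])
  have [measurable]: "w j \<in> borel_measurable borel" for j unfolding w_def[abs_def] by measurable
  have t4: "4 * t > 0" using t by simp
  have gw: "gagliardo s (w j) \<le> ennreal (G * e j)" for j
    using C e0[of j] t4 by (intro G(2)[rule_format, of _ _ "4 * t" a]) (auto simp: w_def e_def)
  have Sw: "Hs_seminorm s (w j) \<le> ennreal ((fc * (G * e j)) powr (1/2))" for j
  proof -
    have "ennreal fc * gagliardo s (w j) \<le> ennreal fc * ennreal (G * e j)" by (intro mult_left_mono gw) auto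
    also have "\<dots> = ennreal (fc * (G * e j))" using fc G e0[of j] by (simp add: ennreal_mult)
    finally show ?thesis unfolding Hs_seminorm_eq fc_def[symmetric] using fc G e0[of j] by (intro ennpowr_le) auto
  qed
  define H where "H = ((4 * (4 * t)) powr (- real DIM(real^'n) / 2) / gauss_mass TYPE(real^'n)) powr (?al / 2 - 1)"
  have Lw: "Lp_norm ?al (w j) \<le> ennreal ((e j powr (?al / 2) * H) powr (1 / ?al))" for j
    unfolding Lp_norm_eq H_def
    by (intro ennpowr_le Lp_heat_bound[where a = a and w = "w j"]) (use al e0[of j] t C in \<open>auto simp: w_def e_def\<close>)
  have elim: "e \<longlonglongrightarrow> 0"
  proof -
    have "(\<lambda>j. C * (inverse (real (Suc j)))\<^sup>2) \<longlonglongrightarrow> C * 0\<^sup>2"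
      by (intro tendsto_mult tendsto_const tendsto_power LIMSEQ_inverse_real_of_nat)
    then show ?thesis unfolding e_def[abs_def] by (simp add: power_inverse divide_inverse)
  qed
  have "(\<lambda>j. (fc * (G * e j)) powr (1/2)) \<longlonglongrightarrow> 0 powr (1/2)"
    by (intro tendsto_powr' tendsto_const tendsto_mult_right_zero elim) (use fc G e0 in \<open>auto simp: less_imp_le\<close>)
  moreover have "(\<lambda>j. (e j powr (?al / 2) * H) powr (1 / ?al)) \<longlonglongrightarrow> 0 powr (1 / ?al)"
  proof (intro tendsto_powr' tendsto_const tendsto_mult_left_zero)
    have "(\<lambda>j. e j powr (?al / 2)) \<longlonglongrightarrow> 0 powr (?al / 2)"
      by (intro tendsto_powr' tendsto_const elim) (use al e0 in \<open>auto simp: less_imp_le\<close>)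
    then show "(\<lambda>j. e j powr (?al / 2)) \<longlonglongrightarrow> 0" using al by simp
  qed (use al in \<open>auto simp: H_def\<close>)
  ultimately have lim: "(\<lambda>j. ennreal ((fc * (G * e j)) powr (1/2)) + ennreal ((e j powr (?al / 2) * H) powr (1 / ?al))) \<longlonglongrightarrow> ennreal 0 + ennreal 0"
    by (intro tendsto_add tendsto_ennrealI) auto
  have "(\<lambda>j. Hs_seminorm s (w j) + Lp_norm ?al (w j)) \<longlonglongrightarrow> 0"
  proof (rule tendsto_sandwich[OF _ _ tendsto_const])
    show "eventually (\<lambda>j. Hs_seminorm s (w j) + Lp_norm ?al (w j) \<le> ennreal ((fc * (G * e j)) powr (1/2)) + ennreal ((e j powr (?al / 2) * H) powr (1 / ?al))) sequentially"
      by (intro always_eventually allI add_mono Sw Lw)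
    show "(\<lambda>j. ennreal ((fc * (G * e j)) powr (1/2)) + ennreal ((e j powr (?al / 2) * H) powr (1 / ?al))) \<longlonglongrightarrow> 0"
      using lim by simp
  qed auto
  moreover have "(\<lambda>x. heat t (x - a)) \<in> borel_measurable lebesgue"
    by (rule measurable_completion) measurable
  ultimately show "(\<lambda>x. heat t (x - a)) \<in> Hs_dot s"
    unfolding Hs_dot_def w_def[abs_def] using heat_cut_test_function by (auto intro!: exI[of _ "heat_cut t a"])
  have "gagliardo s (heat_cut t a 0) < \<infinity>" by (rule test_function_gagliardo[OF s(1,2) heat_cut_test_function])
  moreover have "gagliardo s (w 0) < \<infinity>" using gw[of 0] by (rule le_less_trans) simp
  ultimately have fin: "2 * gagliardo s (w 0) + 2 * gagliardo s (heat_cut t a 0) < \<infinity>"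
    by (simp add: ennreal_mult_less_top)
  have "gagliardo s (\<lambda>x. w 0 x + heat_cut t a 0 x) \<le> 2 * gagliardo s (w 0) + 2 * gagliardo s (heat_cut t a 0)"
    by (rule gagliardo_add_le) measurable
  from le_less_trans[OF this fin] show "gagliardo s (\<lambda>x. heat t (x - a)) < \<infinity>" by (simp add: w_def)
qed

text \<open>A single test function at distance less than one is enough, because test functions have
  finite energy and finite critical norm. The conclusion concerns a Borel representative
  \<open>v\<close>, as Fubini's theorem on the Borel product is applied to it later.\<close>

lemma Hs_dot_finite:
  fixes u v :: "real^'n \<Rightarrow> real"
  assumes s: "0 < s" "s < 1" "2 * s < real CARD('n)" and u: "u \<in> Hs_dot s"
    and v[measurable]: "v \<in> borel_measurable borel" and uv: "AE x in lborel. v x = u x"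
  shows "gagliardo s v < \<infinity>" and "(\<integral>\<^sup>+x. ennreal (\<bar>v x\<bar> powr crit_exp (real CARD('n)) s) \<partial>lborel) < \<infinity>"
proof -
  let ?al = "crit_exp (real CARD('n)) s"
  have al: "?al > 2" using s by (intro crit_exp_gt_2) auto
  obtain ph where ph: "\<And>k::nat. ph k \<in> test_functions"
    "(\<lambda>k. Hs_seminorm s (\<lambda>x. u x - ph k x) + Lp_norm ?al (\<lambda>x. u x - ph k x)) \<longlonglongrightarrow> 0"
    using u unfolding Hs_dot_def by blast
  have "eventually (\<lambda>k. Hs_seminorm s (\<lambda>x. u x - ph k x) + Lp_norm ?al (\<lambda>x. u x - ph k x) < 1) sequentially"
    by (rule order_tendstoD(2)[OF ph(2)]) simp
  then obtain k where k: "Hs_seminorm s (\<lambda>x. u x - ph k x) + Lp_norm ?al (\<lambda>x. u x - ph k x) < 1"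
    by (auto simp: eventually_sequentially)
  define f where "f = ph k"
  have f: "f \<in> test_functions" unfolding f_def by (rule ph)
  have [measurable]: "f \<in> borel_measurable borel" by (rule test_function_borel[OF f])
  have "Hs_seminorm s (\<lambda>x. u x - f x) < \<infinity>" "Lp_norm ?al (\<lambda>x. u x - f x) < \<infinity>"
    using k unfolding f_def by (auto intro: le_less_trans[of _ _ \<infinity>] simp: less_top[symmetric] top_add add_top top_unique)
  from this[unfolded Hs_seminorm_eq Lp_norm_eq, THEN ennpowr_finiteD]
  have fin: "ennreal (frac_const (real CARD('n)) s / 2) * gagliardo s (\<lambda>x. u x - f x) < \<infinity>"
    "(\<integral>\<^sup>+x. ennreal (\<bar>u x - f x\<bar> powr ?al) \<partial>lborel) < \<infinity>"
    by this
  have "frac_const (real CARD('n)) s > 0" using s by (intro frac_const_pos) auto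
  then have "gagliardo s (\<lambda>x. u x - f x) < \<infinity>" using fin(1) by (auto simp: ennreal_mult_less_top)
  moreover have "gagliardo s (\<lambda>x. u x - f x) = gagliardo s (\<lambda>x. v x - f x)"
    by (rule gagliardo_cong_AE) (use uv in \<open>eventually_elim, simp\<close>)
  ultimately have fin': "2 * gagliardo s (\<lambda>x. v x - f x) + 2 * gagliardo s f < \<infinity>"
    using test_function_gagliardo[OF s(1,2) f] by (simp add: ennreal_mult_less_top)
  have "gagliardo s (\<lambda>x. (v x - f x) + f x) \<le> 2 * gagliardo s (\<lambda>x. v x - f x) + 2 * gagliardo s f"
    by (rule gagliardo_add_le) measurable
  from le_less_trans[OF this fin'] show "gagliardo s v < \<infinity>" by simp
  obtain e where e: "e \<ge> 0" "\<And>x. (f x)\<^sup>2 \<le> e * heat 1 x"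
    "\<And>x y. norm (x - y) < 1 \<Longrightarrow> (f x - f y)\<^sup>2 \<le> e * (norm (x - y))\<^sup>2 * heat 1 x"
    using test_function_heat_bound[OF f] by blast
  have "(\<integral>\<^sup>+x. ennreal (\<bar>f x\<bar> powr ?al) \<partial>lborel) \<le> ennreal (e powr (?al / 2) * ((4 * 1) powr (- real DIM(real^'n) / 2) / gauss_mass TYPE(real^'n)) powr (?al / 2 - 1))"
    by (rule Lp_heat_bound[where a = 0]) (use e al in auto)
  then have ff: "(\<integral>\<^sup>+x. ennreal (\<bar>f x\<bar> powr ?al) \<partial>lborel) < \<infinity>" by (rule le_less_trans) simp
  have "(\<integral>\<^sup>+x. ennreal (\<bar>v x\<bar> powr ?al) \<partial>lborel) \<le>
    (\<integral>\<^sup>+x. ennreal (2 powr ?al) * ennreal (\<bar>v x - f x\<bar> powr ?al) + ennreal (2 powr ?al) * ennreal (\<bar>f x\<bar> powr ?al) \<partial>lborel)"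
  proof (rule nn_integral_mono)
    fix x
    have "\<bar>v x\<bar> \<le> \<bar>v x - f x\<bar> + \<bar>f x\<bar>" using abs_triangle_ineq[of "v x - f x" "f x"] by simp
    also have "\<dots> \<le> max \<bar>v x - f x\<bar> \<bar>f x\<bar> + max \<bar>v x - f x\<bar> \<bar>f x\<bar>" by (intro add_mono) auto
    finally have "\<bar>v x\<bar> \<le> 2 * max \<bar>v x - f x\<bar> \<bar>f x\<bar>" by simp
    then have "\<bar>v x\<bar> powr ?al \<le> (2 * max \<bar>v x - f x\<bar> \<bar>f x\<bar>) powr ?al" using al by (intro powr_mono2) auto
    also have "\<dots> = 2 powr ?al * max \<bar>v x - f x\<bar> \<bar>f x\<bar> powr ?al" by (simp add: powr_mult)
    also have "\<dots> \<le> 2 powr ?al * (\<bar>v x - f x\<bar> powr ?al + \<bar>f x\<bar> powr ?al)" by (intro mult_left_mono) (auto simp: max_def)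
    finally have "ennreal (\<bar>v x\<bar> powr ?al) \<le> ennreal (2 powr ?al * (\<bar>v x - f x\<bar> powr ?al + \<bar>f x\<bar> powr ?al))" by (rule ennreal_leI)
    then show "ennreal (\<bar>v x\<bar> powr ?al) \<le> ennreal (2 powr ?al) * ennreal (\<bar>v x - f x\<bar> powr ?al) + ennreal (2 powr ?al) * ennreal (\<bar>f x\<bar> powr ?al)"
      by (simp add: distrib_left ennreal_mult)
  qed
  also have "\<dots> = ennreal (2 powr ?al) * (\<integral>\<^sup>+x. ennreal (\<bar>v x - f x\<bar> powr ?al) \<partial>lborel) + ennreal (2 powr ?al) * (\<integral>\<^sup>+x. ennreal (\<bar>f x\<bar> powr ?al) \<partial>lborel)"
    by (simp add: nn_integral_add nn_integral_cmult)
  also have "(\<integral>\<^sup>+x. ennreal (\<bar>v x - f x\<bar> powr ?al) \<partial>lborel) = (\<integral>\<^sup>+x. ennreal (\<bar>u x - f x\<bar> powr ?al) \<partial>lborel)"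
    by (rule nn_integral_cong_AE) (use uv in \<open>eventually_elim, simp\<close>)
  also have "ennreal (2 powr ?al) * (\<integral>\<^sup>+x. ennreal (\<bar>u x - f x\<bar> powr ?al) \<partial>lborel) + ennreal (2 powr ?al) * (\<integral>\<^sup>+x. ennreal (\<bar>f x\<bar> powr ?al) \<partial>lborel) < \<infinity>"
    using fin(2) ff by (simp add: ennreal_mult_less_top)
  finally show "(\<integral>\<^sup>+x. ennreal (\<bar>v x\<bar> powr ?al) \<partial>lborel) < \<infinity>" .
qed

lemma lebesgue_measurable_AE_cong:
  fixes f g :: "'a::euclidean_space \<Rightarrow> real"
  assumes g: "g \<in> borel_measurable borel" and fg: "AE x in lborel. f x = g x"
  shows "f \<in> borel_measurable lebesgue"
proof (rule measurableI)
  fix S :: "real set" assume S: "S \<in> sets borel"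
  have "g \<in> borel_measurable lebesgue" using g by (intro measurable_completion) simp
  then have gS: "g -` S \<inter> space lebesgue \<in> sets lebesgue" using S by (rule measurable_sets)
  have "AE x in lebesgue. f x = g x" using fg by (rule AE_completion)
  then have "AE x in lebesgue. x \<in> g -` S \<inter> space lebesgue \<longleftrightarrow> x \<in> f -` S \<inter> space lebesgue"
    by eventually_elim simp
  then show "f -` S \<inter> space lebesgue \<in> sets lebesgue" by (rule completion.in_sets_AE[OF _ gS]) simp
qed simp

text \<open>The function \<open>u\<close> is replaced one slice at a time: for almost every
  \<open>x\<close> the inner integrands agree almost everywhere in \<open>y\<close>. Joint
  measurability is then needed for the Borel function \<open>v\<close> alone.\<close>

lemma Hs_form_eq:
  fixes u v h :: "real^'n \<Rightarrow> real"
  assumes [measurable]: "v \<in> borel_measurable borel" "h \<in> borel_measurable borel" and uv: "AE x in lborel. v x = u x"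
  shows "Hs_form s u h = frac_const (real CARD('n)) s / 2 *
    (\<integral>x. (\<integral>y. (v x - v y) * (h x - h y) / norm (x - y) powr (real DIM(real^'n) + 2 * s) \<partial>lborel) \<partial>lborel)"
proof -
  define g where "g w x y = (w x - w y) * (h x - h y) / norm (x - y) powr (real CARD('n) + 2 * s)" for w :: "real^'n \<Rightarrow> real" and x y
  have gm[measurable]: "(\<lambda>z. g v (a z) (b z)) \<in> borel_measurable M" if [measurable]: "a \<in> borel_measurable M" "b \<in> borel_measurable M" for a b M
    unfolding g_def by measurable
  have inner: "AE x in lborel. (\<integral>y. g u x y \<partial>lebesgue) = (\<integral>y. g v x y \<partial>lborel)"
    using uv
  proof eventually_elim
    case (elim x)
    have gv: "(\<lambda>y. g v x y) \<in> borel_measurable lborel" by measurable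
    have ae: "AE y in lborel. g u x y = g v x y" using uv by eventually_elim (simp add: g_def elim)
    have "(\<integral>y. g u x y \<partial>lebesgue) = (\<integral>y. g v x y \<partial>lebesgue)"
      by (rule integral_cong_AE) (use gv ae in \<open>auto intro: lebesgue_measurable_AE_cong[OF _ ae] measurable_completion AE_completion\<close>)
    also have "\<dots> = (\<integral>y. g v x y \<partial>lborel)" by (rule integral_completion[OF gv])
    finally show ?case .
  qed
  have gv2: "(\<lambda>x. \<integral>y. g v x y \<partial>lborel) \<in> borel_measurable borel" by measurable
  have "(\<integral>x. (\<integral>y. g u x y \<partial>lebesgue) \<partial>lebesgue) = (\<integral>x. (\<integral>y. g v x y \<partial>lborel) \<partial>lebesgue)"
    by (rule integral_cong_AE) (use gv2 inner in \<open>auto intro: lebesgue_measurable_AE_cong[OF gv2 inner] measurable_completion AE_completion\<close>)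
  also have "\<dots> = (\<integral>x. (\<integral>y. g v x y \<partial>lborel) \<partial>lborel)" using gv2 by (intro integral_completion) simp
  finally show ?thesis unfolding Hs_form_def g_def by simp
qed

section \<open>From the weak formulation to an integral equation\<close>

text \<open>Near \<open>e\<close> the singularity \<open>(r - e) powr (s - 1)\<close> is integrable
  because \<open>s > 0\<close>; at infinity the total exponent \<open>s - 1 - d\<close> is below
  \<open>-1\<close> because \<open>s < d\<close>.\<close>

lemma abel_tail_finite:
  assumes s: "0 < s" "s < d" and e: "e > 0"
  shows "(\<integral>\<^sup>+r. ennreal ((r - e) powr (s - 1)) * indicator {e<..} r * ennreal (r powr (-d)) \<partial>lborel) < \<infinity>"
proof -
  define f where "f t = ennreal (e powr (-d)) * (ennreal (t powr (-(1-s))) * indicator {0<..<2} t)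
     + ennreal (t powr (-(1 + d - s))) * indicator {1<..} t" for t :: real
  have [measurable]: "f \<in> borel_measurable borel" unfolding f_def[abs_def] by measurable
  have "ennreal ((r - e) powr (s - 1)) * indicator {e<..} r * ennreal (r powr (-d)) \<le> f (r + (-e))" for r
  proof (cases "r > e")
    case True
    define t where "t = r - e"
    have t: "t > 0" "r > t" "r > e" using True e by (auto simp: t_def)
    show ?thesis
    proof (cases "t \<le> 1")
      case h: True
      have "r powr (-d) \<le> e powr (-d)" using t e s by (intro powr_mono2') auto
      then have "t powr (s - 1) * r powr (-d) \<le> t powr (s - 1) * e powr (-d)" by (intro mult_left_mono) auto
      then have "ennreal (t powr (s - 1)) * ennreal (r powr (-d)) \<le> ennreal (e powr (-d)) * (ennreal (t powr (-(1-s))) * indicator {0<..<2} t)"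
        using t h by (simp add: ennreal_mult[symmetric] mult.commute ennreal_leI)
      then show ?thesis using True unfolding f_def by (simp add: t_def add_increasing2)
    next
      case h: False
      have "r powr (-d) \<le> t powr (-d)" using t e s by (intro powr_mono2') auto
      then have "t powr (s - 1) * r powr (-d) \<le> t powr (s - 1) * t powr (-d)" by (intro mult_left_mono) auto
      also have "\<dots> = t powr (s - 1 + - d)" by (simp only: powr_add)
      also have "s - 1 + - d = -(1 + d - s)" by simp
      finally have "ennreal (t powr (s - 1)) * ennreal (r powr (-d)) \<le> ennreal (t powr (-(1 + d - s))) * indicator {1<..} t"
        using t h by (simp add: ennreal_mult[symmetric] ennreal_leI)
      then show ?thesis using True unfolding f_def by (simp add: t_def add_increasing)
    qed
  qed simp
  then have "(\<integral>\<^sup>+r. ennreal ((r - e) powr (s - 1)) * indicator {e<..} r * ennreal (r powr (-d)) \<partial>lborel) \<le> (\<integral>\<^sup>+r. f (r + (-e)) \<partial>lborel)"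
    by (intro nn_integral_mono)
  also have "\<dots> = (\<integral>\<^sup>+r. f r \<partial>lborel)" by (rule nn_integral_lborel_translate) measurable
  also have "\<dots> = ennreal (e powr (-d)) * (\<integral>\<^sup>+t. ennreal (t powr (-(1-s))) * indicator {0<..<2} t \<partial>lborel)
    + (\<integral>\<^sup>+t. ennreal (t powr (-(1 + d - s))) * indicator {1<..} t \<partial>lborel)"
    unfolding f_def by (simp add: nn_integral_add nn_integral_cmult)
  also have "\<dots> < \<infinity>"
    using nn_integral_real_near_powr[of "1 - s" 2] nn_integral_real_far_powr[of "1 + d - s" 1] s by (simp add: ennreal_mult_less_top)
  finally show ?thesis .
qed

text \<open>The heat pairing of a source with finite integral of \<open>g powr r\<close> decays like
  \<open>t powr (- (N / (2 * r)))\<close>, and \<open>s < N / (2 * r)\<close> is precisely what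
  makes its Abel integral converge at infinity. The two source terms can therefore be integrated,
  and subtracted, separately.\<close>

lemma heat_source_integrable:
  fixes g :: "'a::euclidean_space \<Rightarrow> real" and a :: 'a
  assumes [measurable]: "g \<in> borel_measurable borel" and g: "\<And>x. g x \<ge> 0"
    and r: "r > 1" and I: "(\<integral>\<^sup>+x. ennreal (g x powr r) \<partial>lborel) < \<infinity>"
    and s: "0 < s" "s < real DIM('a) / (2 * r)" and e: "e > 0"
  defines "P \<equiv> \<lambda>t. \<integral>x. g x * heat t (x - a) \<partial>lborel"
  shows "\<And>t. t > 0 \<Longrightarrow> (\<integral>\<^sup>+x. ennreal (g x * heat t (x - a)) \<partial>lborel) = ennreal (P t)"
    and "integrable lborel (\<lambda>t. (t - e) powr (s - 1) * indicator {e<..} t * P t)"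
    and "ennreal (\<integral>t. (t - e) powr (s - 1) * indicator {e<..} t * P t \<partial>lborel) =
      (\<integral>\<^sup>+t. ennreal ((t - e) powr (s - 1)) * indicator {e<..} t * (\<integral>\<^sup>+x. ennreal (g x * heat t (x - a)) \<partial>lborel) \<partial>lborel)"
proof -
  obtain C where C: "C > 0" "\<And>t a. t > 0 \<Longrightarrow> (\<integral>\<^sup>+x. ennreal (g x * heat t (x - a)) \<partial>lborel) \<le> ennreal (C * t powr (- (real DIM('a) / (2 * r))))"
    using heat_pairing_decay[OF assms(1) g r I] by blast
  have P0: "P t \<ge> 0" for t unfolding P_def using g by (intro integral_nonneg_AE) auto
  show Pn: "(\<integral>\<^sup>+x. ennreal (g x * heat t (x - a)) \<partial>lborel) = ennreal (P t)" if "t > 0" for t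
  proof -
    have "integrable lborel (\<lambda>x. g x * heat t (x - a))"
      by (rule integrableI_bounded) (use le_less_trans[OF C(2)[OF that, of a]] g in \<open>auto simp: abs_mult\<close>)
    then show ?thesis unfolding P_def using g by (intro nn_integral_eq_integral) auto
  qed
  have Pm[measurable]: "P \<in> borel_measurable borel" unfolding P_def by measurable
  have eq: "ennreal ((t - e) powr (s - 1) * indicator {e<..} t * P t) =
     ennreal ((t - e) powr (s - 1)) * indicator {e<..} t * (\<integral>\<^sup>+x. ennreal (g x * heat t (x - a)) \<partial>lborel)" for t
    using Pn[of t] e P0 by (cases "e < t") (auto simp: ennreal_mult)
  have fin: "(\<integral>\<^sup>+t. ennreal ((t - e) powr (s - 1) * indicator {e<..} t * P t) \<partial>lborel) < \<infinity>"
  proof -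
    have "(\<integral>\<^sup>+t. ennreal ((t - e) powr (s - 1) * indicator {e<..} t * P t) \<partial>lborel) \<le>
      (\<integral>\<^sup>+t. ennreal C * (ennreal ((t - e) powr (s - 1)) * indicator {e<..} t * ennreal (t powr (- (real DIM('a) / (2 * r))))) \<partial>lborel)"
    proof (rule nn_integral_mono)
      fix t
      show "ennreal ((t - e) powr (s - 1) * indicator {e<..} t * P t) \<le>
        ennreal C * (ennreal ((t - e) powr (s - 1)) * indicator {e<..} t * ennreal (t powr (- (real DIM('a) / (2 * r)))))"
      proof (cases "t > e")
        case True
        have "ennreal ((t - e) powr (s - 1)) * (\<integral>\<^sup>+x. ennreal (g x * heat t (x - a)) \<partial>lborel) \<le>
          ennreal ((t - e) powr (s - 1)) * ennreal (C * t powr (- (real DIM('a) / (2 * r))))"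
          using True e by (intro mult_left_mono C(2)) auto
        then show ?thesis unfolding eq using True C(1) by (simp add: ennreal_mult mult_ac)
      qed simp
    qed
    also have "\<dots> = ennreal C * (\<integral>\<^sup>+t. ennreal ((t - e) powr (s - 1)) * indicator {e<..} t * ennreal (t powr (- (real DIM('a) / (2 * r)))) \<partial>lborel)"
      by (rule nn_integral_cmult) measurable
    also have "\<dots> < \<infinity>" using abel_tail_finite[OF s e] by (simp add: ennreal_mult_less_top)
    finally show ?thesis .
  qed
  have nn: "(t - e) powr (s - 1) * indicator {e<..} t * P t \<ge> 0" for t using P0 by simp
  show int: "integrable lborel (\<lambda>t. (t - e) powr (s - 1) * indicator {e<..} t * P t)"
    by (rule integrableI_bounded) (use fin nn in \<open>auto simp: abs_of_nonneg\<close>)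
  show "ennreal (\<integral>t. (t - e) powr (s - 1) * indicator {e<..} t * P t \<partial>lborel) =
      (\<integral>\<^sup>+t. ennreal ((t - e) powr (s - 1)) * indicator {e<..} t * (\<integral>\<^sup>+x. ennreal (g x * heat t (x - a)) \<partial>lborel) \<partial>lborel)"
    unfolding eq[symmetric] by (rule nn_integral_eq_integral[symmetric, OF int]) (use nn in auto)
qed

text \<open>For every time \<open>e\<close> and centre \<open>a\<close> the weak form, multiplied by
  Abel's kernel and integrated, becomes an equality of heat transforms, to which uniqueness applies.
  The potential of \<open>gq\<close> stands on the left since a difference of possibly infinite
  potentials would be meaningless. Finiteness of the potential of \<open>gp\<close> almost
  everywhere comes from finiteness of its transform at time one.\<close>

lemma riesz_representation:
  fixes u gp gq :: "'a::euclidean_space \<Rightarrow> real"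
  assumes u[measurable]: "u \<in> borel_measurable borel" and u0: "\<And>x. u x \<ge> 0"
    and s: "0 < s" "s < 1" "2 * s < real DIM('a)"
    and Eu: "gagliardo s u < \<infinity>" and Eh: "\<And>t (a::'a). t > 0 \<Longrightarrow> gagliardo s (\<lambda>x. heat t (x - a)) < \<infinity>"
    and al: "al > 1" "(\<integral>\<^sup>+x. ennreal (u x powr al) \<partial>lborel) < \<infinity>"
    and p[measurable]: "gp \<in> borel_measurable borel" and p0: "\<And>x. gp x \<ge> 0" and rp: "rp > 1" "s < real DIM('a) / (2 * rp)" "(\<integral>\<^sup>+x. ennreal (gp x powr rp) \<partial>lborel) < \<infinity>"
    and q[measurable]: "gq \<in> borel_measurable borel" and q0: "\<And>x. gq x \<ge> 0" and rq: "rq > 1" "s < real DIM('a) / (2 * rq)" "(\<integral>\<^sup>+x. ennreal (gq x powr rq) \<partial>lborel) < \<infinity>"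
    and f: "f > 0"
    and weak: "\<And>t a. t > 0 \<Longrightarrow> f * (\<integral>x. (\<integral>y. (u x - u y) * (heat t (x - a) - heat t (y - a)) / norm (x - y) powr (real DIM('a) + 2 * s) \<partial>lborel) \<partial>lborel)
      = (\<integral>x. gp x * heat t (x - a) \<partial>lborel) - (\<integral>x. gq x * heat t (x - a) \<partial>lborel)"
  obtains c k where "c > 0" "k > 0"
    "AE y in lborel. ennreal (c * u y) + ennreal k * riesz (real DIM('a) - 2 * s) gq y = ennreal k * riesz (real DIM('a) - 2 * s) gp y"
    "AE y in lborel. riesz (real DIM('a) - 2 * s) gp y < \<infinity>"
proof -
  let ?N = "real DIM('a)"
  define A where "A = ?N - 2 * s"
  have "s < ?N / 2" "- s < ?N / 2" using s by auto
  obtain k2 where k2: "k2 > 0" "\<And>z::'a. z \<noteq> 0 \<Longrightarrow>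
     (\<integral>\<^sup>+t. ennreal (t powr (s - 1) * heat t z) * indicator {0<..} t \<partial>lborel) = ennreal (k2 * norm z powr (2 * s - ?N))"
    using heat_subordination[OF \<open>s < ?N / 2\<close>] by blast
  then have k2': "\<And>z::'a. z \<noteq> 0 \<Longrightarrow>
     (\<integral>\<^sup>+t. ennreal (t powr (s - 1) * heat t z) * indicator {0<..} t \<partial>lborel) = ennreal (k2 * norm z powr (-A))"
    by (simp add: A_def)
  obtain k1 where k1: "k1 > 0" "\<And>z::'a. z \<noteq> 0 \<Longrightarrow>
     (\<integral>\<^sup>+t. ennreal (t powr (- s - 1) * heat t z) * indicator {0<..} t \<partial>lborel) = ennreal (k1 * norm z powr (2 * (- s) - ?N))"
    using heat_subordination[OF \<open>- s < ?N / 2\<close>] by blast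
  obtain k3 where k3: "k3 > 0" "\<And>e x. e < x \<Longrightarrow>
    (\<integral>\<^sup>+r. (\<integral>\<^sup>+t. ennreal (abel_weight s e r t * indicator {r<..<r + t} x) \<partial>lborel) \<partial>lborel) = ennreal k3"
    using abel_weight_integral[OF s(1,2)] by blast
  obtain Cu where Cu: "Cu > 0" "\<And>t a. t > 0 \<Longrightarrow> (\<integral>\<^sup>+x. ennreal (u x * heat t (x - a)) \<partial>lborel) \<le> ennreal (Cu * t powr (- (?N / (2 * al))))"
    using heat_pairing_decay[OF u u0 al] by blast
  have dl: "?N / (2 * al) > 0" using al by simp
  have ufin: "(\<integral>\<^sup>+x. ennreal (u x * heat t (x - a)) \<partial>lborel) < \<infinity>" if "t > 0" for t a
    using Cu(2)[OF that, of a] by (rule le_less_trans) simp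
  \<comment> \<open>Abel's constant \<open>k3\<close>, the factor \<open>2\<close> from
    \<open>heat_quadratic_form\<close>, the factor \<open>f\<close> of the weak form, and the
    subordination constant \<open>k1\<close> of the singular kernel. The constant \<open>k\<close>
    of the conclusion is \<open>k2\<close>, that of the Riesz kernel.\<close>
  define c where "c = 2 * f * k3 / k1"
  have c: "c > 0" unfolding c_def using f k3 k1 by simp
  have key: "(\<integral>\<^sup>+y. ennreal (heat e (y - a)) * (ennreal (c * u y) + ennreal k2 * riesz A gq y) \<partial>lborel) =
     (\<integral>\<^sup>+y. ennreal (heat e (y - a)) * (ennreal k2 * riesz A gp y) \<partial>lborel) \<and>
     (\<integral>\<^sup>+y. ennreal (heat e (y - a)) * (ennreal k2 * riesz A gp y) \<partial>lborel) < \<infinity>" if e: "e > 0" for e a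
  proof -
    define U where "U t = (\<integral>x. u x * heat t (x - a) \<partial>lborel)" for t
    define H where "H t = (\<integral>x. u x * heat_dt t (x - a) \<partial>lborel)" for t
    define P where "P t = (\<integral>x. gp x * heat t (x - a) \<partial>lborel)" for t
    define Q where "Q t = (\<integral>x. gq x * heat t (x - a) \<partial>lborel)" for t
    have Ca: "(\<integral>\<^sup>+x. ennreal (u x * heat t (x - a)) \<partial>lborel) \<le> ennreal (Cu * t powr (- (?N / (2 * al))))" if "t > 0" for t
      by (rule Cu(2)[OF that])
    note T = heat_pairing_time_derivative[OF u u0 Ca less_imp_le[OF Cu(1)] dl e]
    have T1: "H \<in> borel_measurable borel" unfolding H_def[abs_def] by (rule T(1))
    have T2: "(\<integral>\<^sup>+x. ennreal (\<bar>H x\<bar> * indicator {e<..} x) \<partial>lborel) < \<infinity>" unfolding H_def by (rule T(2))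
    have T3: "U r - U T = - (\<integral>x. H x * indicator {r<..<T} x \<partial>lborel)" if "e \<le> r" "r < T" for r T
      unfolding H_def U_def using that by (intro T(3))
    have T4: "(U \<longlongrightarrow> 0) at_top" unfolding U_def[abs_def] by (rule T(4))
    note Pf = heat_source_integrable[OF p p0 rp(1,3) s(1) rp(2) e, where a = a, folded P_def]
    note Qf = heat_source_integrable[OF q q0 rq(1,3) s(1) rq(2) e, where a = a, folded Q_def]
    have abel: "(\<integral>r. (\<integral>t. abel_weight s e r t * (U r - U (r + t)) \<partial>lborel) \<partial>lborel) = k3 * U e"
      by (rule abel_inversion[OF k3 T1 T2 T3 T4])
    \<comment> \<open>The inner integral is the fractional Laplacian paired with the heat kernel at
      time \<open>r\<close>; subordination relates it to the bilinear form, and the weak formulation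
      to the sources.\<close>
    have wk: "(\<integral>t. abel_weight s e r t * (U r - U (r + t)) \<partial>lborel) = k1 / (2 * f) * ((r - e) powr (s - 1) * indicator {e<..} r * (P r - Q r))" for r
    proof (cases "e < r")
      case True
      have r: "r > 0" using True e by simp
      have "k1 * (\<integral>x. (\<integral>y. (u x - u y) * (heat r (x - a) - heat r (y - a)) / norm (x - y) powr (?N + 2 * s) \<partial>lborel) \<partial>lborel)
        = (\<integral>t. indicator {0<..} t * t powr (- 1 - s) * (2 * (U r - U (r + t))) \<partial>lborel)"
        unfolding U_def by (rule heat_weak_form[OF u u0 ufin s(1) r k1 Eu Eh[OF r]])
      also have "\<dots> = (\<integral>t. 2 * (indicator {0<..} t * t powr (- 1 - s) * (U r - U (r + t))) \<partial>lborel)"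
        by (intro Bochner_Integration.integral_cong) auto
      also have "\<dots> = 2 * (\<integral>t. indicator {0<..} t * t powr (- 1 - s) * (U r - U (r + t)) \<partial>lborel)" by simp
      finally have 1: "k1 * (P r - Q r) = 2 * f * (\<integral>t. indicator {0<..} t * t powr (- 1 - s) * (U r - U (r + t)) \<partial>lborel)"
        unfolding P_def Q_def weak[OF r, symmetric] by simp
      have "(\<integral>t. abel_weight s e r t * (U r - U (r + t)) \<partial>lborel) = (\<integral>t. (r - e) powr (s - 1) * (indicator {0<..} t * t powr (- 1 - s) * (U r - U (r + t))) \<partial>lborel)"
        using True by (intro Bochner_Integration.integral_cong) (auto simp: abel_weight_def indicator_def)
      also have "\<dots> = (r - e) powr (s - 1) * (\<integral>t. indicator {0<..} t * t powr (- 1 - s) * (U r - U (r + t)) \<partial>lborel)" by simp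
      also have "(\<integral>t. indicator {0<..} t * t powr (- 1 - s) * (U r - U (r + t)) \<partial>lborel) = k1 / (2 * f) * (P r - Q r)"
        using 1 f by (simp add: field_simps)
      finally show ?thesis using True by simp
    qed (simp add: abel_weight_def)
    have "k3 * U e = (\<integral>r. k1 / (2 * f) * ((r - e) powr (s - 1) * indicator {e<..} r * P r - (r - e) powr (s - 1) * indicator {e<..} r * Q r) \<partial>lborel)"
      unfolding abel[symmetric] wk by (simp add: right_diff_distrib)
    also have "\<dots> = k1 / (2 * f) * ((\<integral>r. (r - e) powr (s - 1) * indicator {e<..} r * P r \<partial>lborel) - (\<integral>r. (r - e) powr (s - 1) * indicator {e<..} r * Q r \<partial>lborel))"
      using Pf(2) Qf(2) by simp
    finally have cU: "c * U e + (\<integral>r. (r - e) powr (s - 1) * indicator {e<..} r * Q r \<partial>lborel) = (\<integral>r. (r - e) powr (s - 1) * indicator {e<..} r * P r \<partial>lborel)"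
      unfolding c_def using k1 f by (simp add: field_simps)
    have U0: "U e \<ge> 0" unfolding U_def using u0 by (intro integral_nonneg_AE) auto
    have Q0: "(\<integral>r. (r - e) powr (s - 1) * indicator {e<..} r * Q r \<partial>lborel) \<ge> 0"
      unfolding Q_def using q0 by (intro integral_nonneg_AE AE_I2 mult_nonneg_nonneg) auto
    have Ue: "(\<integral>\<^sup>+x. ennreal (u x * heat e (x - a)) \<partial>lborel) = ennreal (U e)"
    proof -
      have "integrable lborel (\<lambda>x. u x * heat e (x - a))"
        by (rule integrableI_bounded) (use ufin[OF e] u0 in \<open>auto simp: abs_mult\<close>)
      then show ?thesis unfolding U_def using u0 by (intro nn_integral_eq_integral) auto
    qed
    have hp: "(\<integral>\<^sup>+y. ennreal (heat e (y - a)) * (ennreal k2 * riesz A g y) \<partial>lborel) =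
      (\<integral>\<^sup>+t. ennreal ((t - e) powr (s - 1)) * indicator {e<..} t * (\<integral>\<^sup>+x. ennreal (g x * heat t (x - a)) \<partial>lborel) \<partial>lborel)"
      if g[measurable]: "g \<in> borel_measurable borel" and g0: "\<And>x. g x \<ge> 0" for g
    proof -
      have "(\<integral>\<^sup>+y. ennreal (heat e (y - a)) * (ennreal k2 * riesz A g y) \<partial>lborel) = (\<integral>\<^sup>+y. ennreal k2 * (ennreal (heat e (y - a)) * riesz A g y) \<partial>lborel)"
        by (simp only: mult.left_commute)
      also have "\<dots> = ennreal k2 * (\<integral>\<^sup>+y. ennreal (heat e (y - a)) * riesz A g y \<partial>lborel)" by (rule nn_integral_cmult) measurable
      also have "\<dots> = (\<integral>\<^sup>+t. ennreal ((t - e) powr (s - 1)) * indicator {e<..} t * (\<integral>\<^sup>+x. ennreal (g x * heat t (x - a)) \<partial>lborel) \<partial>lborel)"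
        by (rule heat_potential[OF g g0 e k2(1) k2', symmetric])
      finally show ?thesis .
    qed
    have ch: "(\<integral>\<^sup>+y. ennreal (heat e (y - a)) * ennreal (c * u y) \<partial>lborel) = ennreal (c * U e)"
    proof -
      have "(\<integral>\<^sup>+y. ennreal (heat e (y - a)) * ennreal (c * u y) \<partial>lborel) = (\<integral>\<^sup>+y. ennreal c * ennreal (u y * heat e (y - a)) \<partial>lborel)"
        using c u0 by (intro nn_integral_cong) (simp add: ennreal_mult[symmetric] mult_ac)
      also have "\<dots> = ennreal c * ennreal (U e)" by (subst nn_integral_cmult) (auto simp: Ue)
      finally show ?thesis using c U0 by (simp add: ennreal_mult)
    qed
    have "(\<integral>\<^sup>+y. ennreal (heat e (y - a)) * (ennreal (c * u y) + ennreal k2 * riesz A gq y) \<partial>lborel) =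
      (\<integral>\<^sup>+y. ennreal (heat e (y - a)) * ennreal (c * u y) \<partial>lborel) + (\<integral>\<^sup>+y. ennreal (heat e (y - a)) * (ennreal k2 * riesz A gq y) \<partial>lborel)"
      unfolding distrib_left by (rule nn_integral_add) measurable
    also have "\<dots> = ennreal (c * U e) + ennreal (\<integral>r. (r - e) powr (s - 1) * indicator {e<..} r * Q r \<partial>lborel)"
      unfolding ch hp[OF q q0] Qf(3) ..
    also have "\<dots> = ennreal (\<integral>r. (r - e) powr (s - 1) * indicator {e<..} r * P r \<partial>lborel)"
      unfolding cU[symmetric] using c U0 Q0 by (simp add: ennreal_plus)
    finally show ?thesis unfolding hp[OF p p0] Pf(3)[symmetric] by simp
  qed
  have AE1: "AE y in lborel. ennreal (c * u y) + ennreal k2 * riesz A gq y = ennreal k2 * riesz A gp y"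
    by (rule heat_transform_unique) (use key in auto)
  have "(\<integral>\<^sup>+y. ennreal (heat 1 (y - 0)) * (ennreal k2 * riesz A gp y) \<partial>lborel) < \<infinity>" using key[of 1 0] by simp
  then have "AE y in lborel. ennreal (heat 1 (y - 0)) * (ennreal k2 * riesz A gp y) \<noteq> \<infinity>" by (intro nn_integral_PInf_AE) auto
  then have AE2: "AE y in lborel. riesz A gp y < \<infinity>"
  proof eventually_elim
    case (elim y)
    have "ennreal (heat 1 (y - 0)) \<noteq> 0" "ennreal k2 \<noteq> 0" using heat_pos[of 1 y] k2(1) by auto
    then show ?case using elim by (auto simp: ennreal_mult_eq_top_iff less_top[symmetric])
  qed
  show ?thesis by (rule that[OF c k2(1)]) (use AE1 AE2 in \<open>simp_all add: A_def\<close>)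
qed

section \<open>Boundedness and conclusion\<close>

lemma powr_diff_le:
  fixes p :: real
  assumes p: "p > 1" and xy: "0 \<le> x" "0 \<le> y" "x \<le> m" "y \<le> m"
  shows "\<bar>x powr p - y powr p\<bar> \<le> p * m powr (p - 1) * \<bar>x - y\<bar>"
proof -
  have *: "x powr p - y powr p \<le> p * m powr (p - 1) * (x - y)" if xy: "0 \<le> y" "y < x" "x \<le> m" for x y
  proof (cases "y = 0")
    case True
    have "x powr p = x powr (p - 1) * x" using xy powr_add[of x "p - 1" 1] by simp
    also have "\<dots> \<le> m powr (p - 1) * x" using xy p by (intro mult_right_mono powr_mono2) auto
    also have "\<dots> \<le> p * (m powr (p - 1) * x)" using xy p mult_right_mono[of 1 p "m powr (p - 1) * x"] by simp
    finally show ?thesis using True by (simp add: mult.assoc)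
  next
    case False
    have "\<exists>z. y < z \<and> z < x \<and> x powr p - y powr p = (x - y) * (p * z powr (p - 1))"
      using xy False by (intro MVT2) (auto intro!: derivative_eq_intros)
    then obtain z where z: "y < z" "z < x" "x powr p - y powr p = (x - y) * (p * z powr (p - 1))" by blast
    have "z powr (p - 1) \<le> m powr (p - 1)" using z xy p by (intro powr_mono2) auto
    then have "(x - y) * (p * z powr (p - 1)) \<le> (x - y) * (p * m powr (p - 1))" using xy p by (intro mult_left_mono) auto
    then show ?thesis unfolding z(3) by (simp add: mult_ac)
  qed
  consider "x = y" | "x < y" | "y < x" by linarith
  then show ?thesis
  proof cases
    case 2
    have "x powr p \<le> y powr p" using 2 xy p by (intro powr_mono2) auto
    then show ?thesis using *[of x y] 2 xy by simp
  next
    case 3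
    have "y powr p \<le> x powr p" using 3 xy p by (intro powr_mono2) auto
    then show ?thesis using *[of y x] 3 xy by simp
  qed simp
qed

text \<open>Near \<open>y\<close> the truncated source is at most one and the kernel is integrable.
  Away from \<open>y\<close>, Young's inequality separates the kernel, whose power \<open>al\<close>
  has the exponent \<open>2 N\<close> and is integrable there, from the critical integral of
  \<open>u\<close>. The bound is uniform in \<open>y\<close>.\<close>

lemma riesz_truncated_bound:
  assumes A: "0 < A" "A < real DIM('a::euclidean_space)" and al: "A * al = 2 * real DIM('a)" "al > 2"
  obtains C where "C > 0" "\<And>(u :: 'a \<Rightarrow> real) y. u \<in> borel_measurable borel \<Longrightarrow> (\<And>x. u x \<ge> 0) \<Longrightarrow>
    riesz A (\<lambda>x. min 1 (u x) powr (al - 1)) y \<le> ennreal C + (\<integral>\<^sup>+x. ennreal (u x powr al) \<partial>lborel)"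
proof -
  obtain C1 where C1: "C1 > 0"
    "\<And>r (x::'a). r > 0 \<Longrightarrow> (\<integral>\<^sup>+y. ennreal (norm (x - y) powr (-A)) * indicator {y. norm (x - y) < r} y \<partial>lborel)
      \<le> ennreal (C1 * r powr (real DIM('a) - A))"
    using nn_integral_near_powr[OF A(2)] by blast
  have "real DIM('a) < 2 * real DIM('a)" by simp
  then obtain C2 where C2: "C2 > 0"
    "\<And>r (x::'a). r > 0 \<Longrightarrow> (\<integral>\<^sup>+y. ennreal (norm (x - y) powr (-(2 * real DIM('a)))) * indicator {y. norm (x - y) \<ge> r} y \<partial>lborel)
      \<le> ennreal (C2 * r powr (real DIM('a) - 2 * real DIM('a)))"
    using nn_integral_far_powr[of "2 * real DIM('a)"] by blast
  have "riesz A (\<lambda>x. min 1 (u x) powr (al - 1)) y \<le> ennreal (C1 + C2) + (\<integral>\<^sup>+x. ennreal (u x powr al) \<partial>lborel)"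
    if [measurable]: "u \<in> borel_measurable borel" and u: "\<And>x. u x \<ge> 0" for u :: "'a \<Rightarrow> real" and y
  proof -
    define n where "n x = ennreal (norm (y - x) powr (-A)) * indicator {x. norm (y - x) < 1} x" for x
    define f where "f x = ennreal (norm (y - x) powr (-(2 * real DIM('a)))) * indicator {x. norm (y - x) \<ge> 1} x" for x
    have [measurable]: "n \<in> borel_measurable borel" "f \<in> borel_measurable borel" unfolding n_def[abs_def] f_def[abs_def] by measurable
    have "ennreal (norm (y - x) powr (-A) * min 1 (u x) powr (al - 1)) \<le> n x + (f x + ennreal (u x powr al))" for x
    proof (cases "norm (y - x) < 1")
      case True
      have "min 1 (u x) powr (al - 1) \<le> 1" using u[of x] al by (intro powr_le1) auto
      then have "norm (y - x) powr (-A) * min 1 (u x) powr (al - 1) \<le> norm (y - x) powr (-A) * 1" by (intro mult_left_mono) auto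
      then have "ennreal (norm (y - x) powr (-A) * min 1 (u x) powr (al - 1)) \<le> n x"
        unfolding n_def using True by (simp add: ennreal_leI)
      then show ?thesis by (simp add: add_increasing2)
    next
      case False
      have "norm (y - x) powr (-A) * min 1 (u x) powr (al - 1) \<le> 1 * (norm (y - x) powr (-A)) powr al + 1 powr (-(1/(al-1))) * (min 1 (u x) powr (al - 1)) powr (al/(al-1))"
        using u[of x] al by (intro weighted_young) auto
      also have "(norm (y - x) powr (-A)) powr al = norm (y - x) powr (-(2 * real DIM('a)))" using al by (simp add: powr_powr)
      also have "(min 1 (u x) powr (al - 1)) powr (al/(al-1)) = min 1 (u x) powr al" using al by (simp add: powr_powr)
      finally have "norm (y - x) powr (-A) * min 1 (u x) powr (al - 1) \<le> norm (y - x) powr (-(2 * real DIM('a))) + min 1 (u x) powr al" by simp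
      also have "min 1 (u x) powr al \<le> u x powr al" using u[of x] al by (intro powr_mono2) auto
      finally have "ennreal (norm (y - x) powr (-A) * min 1 (u x) powr (al - 1)) \<le> ennreal (norm (y - x) powr (-(2 * real DIM('a))) + u x powr al)"
        by (intro ennreal_leI) simp
      also have "\<dots> = f x + ennreal (u x powr al)" unfolding f_def using False by simp
      finally show ?thesis by (simp add: add_increasing)
    qed
    then have "riesz A (\<lambda>x. min 1 (u x) powr (al - 1)) y \<le> (\<integral>\<^sup>+x. n x + (f x + ennreal (u x powr al)) \<partial>lborel)"
      unfolding riesz_def by (intro nn_integral_mono)
    also have "\<dots> = (\<integral>\<^sup>+x. n x \<partial>lborel) + ((\<integral>\<^sup>+x. f x \<partial>lborel) + (\<integral>\<^sup>+x. ennreal (u x powr al) \<partial>lborel))"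
      by (simp add: nn_integral_add)
    also have "\<dots> \<le> ennreal C1 + (ennreal C2 + (\<integral>\<^sup>+x. ennreal (u x powr al) \<partial>lborel))"
      unfolding n_def f_def using C1(2)[of 1 y] C2(2)[of 1 y] by (intro add_mono) auto
    finally show ?thesis using C1 C2 by (simp add: ennreal_plus add.assoc)
  qed
  moreover have "C1 + C2 > 0" using C1 C2 by simp
  ultimately show ?thesis using that by blast
qed

lemma riesz_mono: "(\<And>x. g x \<le> h x) \<Longrightarrow> riesz A g y \<le> riesz A h y"
  unfolding riesz_def by (intro nn_integral_mono ennreal_leI mult_left_mono) auto

lemma riesz_cong_AE:
  assumes "AE x in lborel. g x = h x"
  shows "riesz A g y = riesz A h y"
  unfolding riesz_def by (rule nn_integral_cong_AE) (use assms in \<open>eventually_elim, simp\<close>)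

lemma riesz_cmult:
  fixes g :: "'a::euclidean_space \<Rightarrow> real"
  assumes [measurable]: "g \<in> borel_measurable borel" and "\<And>x. g x \<ge> 0" "c \<ge> 0"
  shows "riesz A (\<lambda>x. c * g x) y = ennreal c * riesz A g y"
proof -
  have "riesz A (\<lambda>x. c * g x) y = (\<integral>\<^sup>+x. ennreal c * ennreal (norm (y - x) powr (-A) * g x) \<partial>lborel)"
    unfolding riesz_def using assms by (intro nn_integral_cong) (simp add: ennreal_mult[symmetric] mult_ac)
  also have "\<dots> = ennreal c * riesz A g y" unfolding riesz_def by (rule nn_integral_cmult) measurable
  finally show ?thesis .
qed

lemma riesz_add:
  fixes g h :: "'a::euclidean_space \<Rightarrow> real"
  assumes [measurable]: "g \<in> borel_measurable borel" "h \<in> borel_measurable borel" and "\<And>x. g x \<ge> 0" "\<And>x. h x \<ge> 0"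
  shows "riesz A (\<lambda>x. g x + h x) y = riesz A g y + riesz A h y"
proof -
  have "riesz A (\<lambda>x. g x + h x) y = (\<integral>\<^sup>+x. ennreal (norm (y - x) powr (-A) * g x) + ennreal (norm (y - x) powr (-A) * h x) \<partial>lborel)"
    unfolding riesz_def using assms by (intro nn_integral_cong) (simp add: distrib_left)
  also have "\<dots> = riesz A g y + riesz A h y" unfolding riesz_def by (rule nn_integral_add) measurable
  finally show ?thesis .
qed

text \<open>Boundedness: \<open>u powr p \<le> u powr q + min 1 u powr (al - 1)\<close> pointwise, so the potential of
  \<open>u powr q\<close> cancels from the equation.\<close>

lemma gradient_decay_of_representation:
  fixes u :: "'a::euclidean_space \<Rightarrow> real"
  assumes s: "0 < s" "2 * s < real DIM('a)" and A: "A = real DIM('a) - 2 * s" and al: "al = 2 * real DIM('a) / A"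
    and pq: "al - 1 \<le> p" "p < q"
    and u[measurable]: "u \<in> borel_measurable borel" and u0: "\<And>x. u x \<ge> 0"
    and uL: "(\<integral>\<^sup>+x. ennreal (u x powr al) \<partial>lborel) < \<infinity>"
    and ck: "c > 0" "k > 0"
    and rep: "AE y in lborel. ennreal (c * u y) + ennreal k * riesz A (\<lambda>x. u x powr q) y = ennreal k * riesz A (\<lambda>x. u x powr p) y"
    and fin: "AE y in lborel. riesz A (\<lambda>x. u x powr p) y < \<infinity>"
  shows "\<exists>v. (AE x in lborel. v x = u x) \<and> (\<exists>C>0. \<exists>R>0. \<forall>x. norm x > R \<longrightarrow> (\<exists>D. GDERIV v x :> D \<and> norm D \<le> C * norm x powr (-(A + 1))))"
proof -
  define p0 where "p0 = al - 1"
  have A0: "A > 0" "A < real DIM('a)" using s A by auto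
  have Aal: "A * al = 2 * real DIM('a)" using A0 al by simp
  have "A * al > A * 2" unfolding Aal using A s by simp
  then have al2: "al > 2" using A0 by simp
  have p0: "p0 > 1" "p0 \<le> p" "p0 < q" "p > 1" "q > 1" using al2 pq unfolding p0_def by auto
  obtain C where C: "C > 0" "\<And>(u :: 'a \<Rightarrow> real) y. u \<in> borel_measurable borel \<Longrightarrow> (\<And>x. u x \<ge> 0) \<Longrightarrow>
    riesz A (\<lambda>x. min 1 (u x) powr (al - 1)) y \<le> ennreal C + (\<integral>\<^sup>+x. ennreal (u x powr al) \<partial>lborel)"
    using riesz_truncated_bound[OF A0 Aal al2] by blast
  define I where "I = enn2real (\<integral>\<^sup>+x. ennreal (u x powr al) \<partial>lborel)"
  have I: "(\<integral>\<^sup>+x. ennreal (u x powr al) \<partial>lborel) = ennreal I" "I \<ge> 0" using uL by (auto simp: I_def)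
  define g where "g x = min 1 (u x) powr p0" for x
  have [measurable]: "g \<in> borel_measurable borel" unfolding g_def[abs_def] by measurable
  have rg: "riesz A g y \<le> ennreal (C + I)" for y
    using C(2)[OF u u0, of y] C(1) I unfolding g_def[abs_def] p0_def by (simp add: ennreal_plus)
  define M where "M = max 1 (k * (C + I) / c)"
  have M: "M \<ge> 1" "k * (C + I) \<le> M * c" unfolding M_def using ck by (auto simp: field_simps max_def)
  have uM: "AE y in lborel. u y \<le> M"
    using rep fin
  proof eventually_elim
    case (elim y)
    have "u x powr p \<le> u x powr q + g x" for x
    proof (cases "u x \<le> 1")
      case True
      then have "u x powr p \<le> u x powr p0" using u0[of x] p0 by (cases "u x = 0") (auto intro!: powr_mono')
      then show ?thesis using True by (simp add: g_def min_def add_increasing)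
    next
      case False
      then have "u x powr p \<le> u x powr q" using p0 pq by (intro powr_mono) auto
      then show ?thesis by (simp add: g_def add_increasing2)
    qed
    then have "riesz A (\<lambda>x. u x powr p) y \<le> riesz A (\<lambda>x. u x powr q + g x) y" by (rule riesz_mono)
    also have "\<dots> = riesz A (\<lambda>x. u x powr q) y + riesz A g y" by (rule riesz_add) (auto simp: g_def)
    finally have le: "riesz A (\<lambda>x. u x powr p) y \<le> riesz A (\<lambda>x. u x powr q) y + riesz A g y" .
    \<comment> \<open>Cancellation in \<open>ennreal\<close> needs a finite term. The equation
      supplies it: the potential of \<open>u powr q\<close> is at most that of
      \<open>u powr p\<close>, which is finite at almost every point.\<close>
    have "ennreal k * riesz A (\<lambda>x. u x powr p) y < \<infinity>" using elim by (simp add: ennreal_mult_less_top)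
    then have Rq: "ennreal k * riesz A (\<lambda>x. u x powr q) y < \<infinity>"
      unfolding elim(1)[symmetric] by (simp add: less_top[symmetric] add_top)
    have "ennreal (c * u y) + ennreal k * riesz A (\<lambda>x. u x powr q) y \<le> ennreal k * (riesz A (\<lambda>x. u x powr q) y + riesz A g y)"
      unfolding elim(1) by (intro mult_left_mono le) simp
    also have "\<dots> = ennreal k * riesz A g y + ennreal k * riesz A (\<lambda>x. u x powr q) y" by (simp add: distrib_left add.commute)
    finally have "ennreal (c * u y) \<le> ennreal k * riesz A g y"
      using Rq by (simp add: ennreal_add_left_cancel_le add.commute[of _ "ennreal k * riesz A (\<lambda>x. u x powr q) y"] less_top[symmetric])
    also have "\<dots> \<le> ennreal k * ennreal (C + I)" by (intro mult_left_mono rg) simp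
    also have "\<dots> = ennreal (k * (C + I))" using ck C I by (simp add: ennreal_mult)
    finally have "c * u y \<le> k * (C + I)" using ck C I by (subst (asm) ennreal_le_iff) auto
    also have "\<dots> \<le> c * M" using M by (simp add: mult.commute)
    finally show ?case using ck by simp
  qed
  \<comment> \<open>A representative bounded at every point, so that its potentials are finite
    everywhere and not merely almost everywhere.\<close>
  define w where "w x = min M (u x)" for x
  have [measurable]: "w \<in> borel_measurable borel" unfolding w_def[abs_def] by measurable
  have wu: "AE x in lborel. w x = u x" using uM by eventually_elim (simp add: w_def)
  have w0: "0 \<le> w x" "w x \<le> M" for x using u0[of x] M unfolding w_def by auto
  have wg: "w x powr r \<le> M powr r * g x" if r: "r \<ge> p0" for x r
  proof (cases "u x \<le> 1")
    case True
    then have "w x = u x" using M by (simp add: w_def)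
    moreover have "u x powr r \<le> u x powr p0" using True u0[of x] p0 r by (cases "u x = 0") (auto intro!: powr_mono')
    moreover have "M powr r \<ge> 1" using M p0 r by (intro ge_one_powr_ge_zero) auto
    moreover have "1 * u x powr p0 \<le> M powr r * u x powr p0" using \<open>M powr r \<ge> 1\<close> by (intro mult_right_mono) auto
    ultimately show ?thesis using True by (simp add: g_def min_def)
  next
    case False
    then have "w x powr r \<le> M powr r" using w0 p0 r by (intro powr_mono2) auto
    then show ?thesis using False by (simp add: g_def)
  qed
  have rw: "riesz A (\<lambda>x. w x powr r) y \<le> ennreal (M powr r * (C + I))" if r: "r \<ge> p0" for r y
  proof -
    have "riesz A (\<lambda>x. w x powr r) y \<le> riesz A (\<lambda>x. M powr r * g x) y" by (intro riesz_mono wg r)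
    also have "\<dots> = ennreal (M powr r) * riesz A g y" by (rule riesz_cmult) (auto simp: g_def)
    also have "\<dots> \<le> ennreal (M powr r) * ennreal (C + I)" by (intro mult_left_mono rg) simp
    finally show ?thesis using C I by (simp add: ennreal_mult)
  qed
  have wi: "integrable lborel (\<lambda>x. norm (y - x) powr (-A) * w x powr r)" if r: "r \<ge> p0" for r y
    by (rule integrableI_bounded) (use le_less_trans[OF rw[OF r, of y]] in \<open>auto simp: riesz_def abs_mult\<close>)
  have wr: "riesz A (\<lambda>x. w x powr r) y = ennreal (\<integral>x. norm (y - x) powr (-A) * w x powr r \<partial>lborel)" if r: "r \<ge> p0" for r y
    unfolding riesz_def by (rule nn_integral_eq_integral[OF wi[OF r]]) auto
  \<comment> \<open>Absolute values are taken because \<open>v\<close>, to which \<open>F\<close> is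
    applied later, is known to be nonnegative only almost everywhere.\<close>
  define F where "F t = \<bar>t\<bar> powr p - \<bar>t\<bar> powr q" for t :: real
  have [measurable]: "F \<in> borel_measurable borel" unfolding F_def[abs_def] by measurable
  define K where "K = k / c"
  have K: "K > 0" unfolding K_def using ck by simp
  \<comment> \<open>The potential defines the representative at every point. It equals
    \<open>u\<close> almost everywhere by the equation, and changing \<open>w\<close> to
    \<open>v\<close> under the integral then turns the definition into a fixed-point equation valid
    everywhere.\<close>
  define v where "v y = K * (\<integral>x. norm (y - x) powr (-A) * F (w x) \<partial>lborel)" for y
  have [measurable]: "v \<in> borel_measurable borel" unfolding v_def[abs_def] by measurable
  have vsplit: "v y = K * ((\<integral>x. norm (y - x) powr (-A) * w x powr p \<partial>lborel) - (\<integral>x. norm (y - x) powr (-A) * w x powr q \<partial>lborel))" for y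
  proof -
    have "(\<integral>x. norm (y - x) powr (-A) * F (w x) \<partial>lborel) = (\<integral>x. norm (y - x) powr (-A) * w x powr p - norm (y - x) powr (-A) * w x powr q \<partial>lborel)"
      unfolding F_def using w0 by (simp add: right_diff_distrib)
    then show ?thesis unfolding v_def using wi[of p y] wi[of q y] p0 by simp
  qed
  have rpw: "riesz A (\<lambda>x. u x powr r) y = riesz A (\<lambda>x. w x powr r) y" for r y
    by (rule riesz_cong_AE) (use wu in \<open>eventually_elim, simp\<close>)
  have vu: "AE y in lborel. v y = u y"
    using rep
  proof eventually_elim
    case (elim y)
    define P where "P = (\<integral>x. norm (y - x) powr (-A) * w x powr p \<partial>lborel)"
    define Q where "Q = (\<integral>x. norm (y - x) powr (-A) * w x powr q \<partial>lborel)"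
    have PQ: "P \<ge> 0" "Q \<ge> 0" unfolding P_def Q_def by (intro integral_nonneg_AE; simp)+
    have "ennreal (c * u y) + ennreal k * ennreal Q = ennreal k * ennreal P"
      using elim p0 wr[of p y] wr[of q y] unfolding rpw P_def Q_def by simp
    then have "ennreal (c * u y + k * Q) = ennreal (k * P)"
      using ck PQ u0[of y] by (simp add: ennreal_mult)
    then have "c * u y + k * Q = k * P" using ck PQ u0[of y] by (subst (asm) ennreal_inj) auto
    then show ?case unfolding vsplit P_def[symmetric] Q_def[symmetric] K_def using ck by (simp add: field_simps)
  qed
  have vw: "AE y in lborel. v y = w y" using vu wu by eventually_elim simp
  define M' where "M' = max M (K * (M powr p * (C + I) + M powr q * (C + I)))"
  have M': "M' \<ge> 1" "M' \<ge> M" unfolding M'_def using M by auto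
  have vM: "\<bar>v y\<bar> \<le> M'" for y
  proof -
    have b: "0 \<le> (\<integral>x. norm (y - x) powr (-A) * w x powr r \<partial>lborel)" "(\<integral>x. norm (y - x) powr (-A) * w x powr r \<partial>lborel) \<le> M powr r * (C + I)"
      if r: "r \<ge> p0" for r
    proof -
      show "0 \<le> (\<integral>x. norm (y - x) powr (-A) * w x powr r \<partial>lborel)" by (intro integral_nonneg_AE) simp
      show "(\<integral>x. norm (y - x) powr (-A) * w x powr r \<partial>lborel) \<le> M powr r * (C + I)"
        using rw[OF r, of y] C I unfolding wr[OF r] by (subst (asm) ennreal_le_iff) auto
    qed
    have "\<bar>v y\<bar> \<le> K * (M powr p * (C + I) + M powr q * (C + I))"
    proof -
      have tri: "\<bar>X - Y\<bar> \<le> S + T" if "0 \<le> X" "X \<le> S" "0 \<le> Y" "Y \<le> T" for X Y S T :: real using that by linarith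
      have "q \<ge> p0" using p0 by simp
      then show ?thesis unfolding vsplit abs_mult abs_of_pos[OF K] using b p0(2) K by (intro mult_left_mono tri) auto
    qed
    then show ?thesis unfolding M'_def by simp
  qed
  \<comment> \<open>On the range bounded by \<open>M'\<close>, the powers in excess of
    \<open>p0\<close> are bounded by \<open>M' powr (p - p0)\<close> and
    \<open>M' powr (q - p0)\<close>. This is where \<open>p\<close> and \<open>q\<close> being at
    least critical, together with boundedness, reduces both nonlinearities to the critical
    power.\<close>
  define L where "L = p * M' powr (p - p0) + q * M' powr (q - p0)"
  have L: "L > 0" unfolding L_def using p0 M' by (intro add_pos_pos) auto
  have FL: "\<bar>F a - F b\<bar> \<le> L * (\<bar>a\<bar> powr (p0 - 1) + \<bar>b\<bar> powr (p0 - 1)) * \<bar>a - b\<bar>" if ab: "\<bar>a\<bar> \<le> M'" "\<bar>b\<bar> \<le> M'" for a b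
  proof -
    define m where "m = max \<bar>a\<bar> \<bar>b\<bar>"
    have m: "\<bar>a\<bar> \<le> m" "\<bar>b\<bar> \<le> m" "m \<ge> 0" "m \<le> M'" unfolding m_def using ab by auto
    define S where "S = \<bar>a\<bar> powr (p0 - 1) + \<bar>b\<bar> powr (p0 - 1)"
    have S: "m powr (p0 - 1) \<le> S" "S \<ge> 0" unfolding m_def S_def by (auto simp: max_def)
    have d: "\<bar>\<bar>a\<bar> powr r - \<bar>b\<bar> powr r\<bar> \<le> r * M' powr (r - p0) * S * \<bar>a - b\<bar>" if r: "r > 1" "r \<ge> p0" for r
    proof -
      have "m powr (r - 1) = m powr (r - p0) * m powr (p0 - 1)" by (simp add: powr_add[symmetric])
      also have "\<dots> \<le> M' powr (r - p0) * S" using m S r by (intro mult_mono powr_mono2) auto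
      finally have mm: "m powr (r - 1) \<le> M' powr (r - p0) * S" .
      have "\<bar>\<bar>a\<bar> powr r - \<bar>b\<bar> powr r\<bar> \<le> r * m powr (r - 1) * \<bar>\<bar>a\<bar> - \<bar>b\<bar>\<bar>"
        using r m by (intro powr_diff_le) auto
      also have "\<dots> \<le> r * (M' powr (r - p0) * S) * \<bar>a - b\<bar>"
        using r mm S by (intro mult_mono mult_left_mono) auto
      finally show ?thesis by (simp add: mult.assoc)
    qed
    have "\<bar>F a - F b\<bar> \<le> \<bar>\<bar>a\<bar> powr p - \<bar>b\<bar> powr p\<bar> + \<bar>\<bar>a\<bar> powr q - \<bar>b\<bar> powr q\<bar>" unfolding F_def by linarith
    also have "\<dots> \<le> p * M' powr (p - p0) * S * \<bar>a - b\<bar> + q * M' powr (q - p0) * S * \<bar>a - b\<bar>"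
      using p0 by (intro add_mono d) auto
    also have "\<dots> = L * S * \<bar>a - b\<bar>" unfolding L_def by (simp add: algebra_simps)
    finally show ?thesis unfolding S_def .
  qed
  have F0: "F 0 = 0" unfolding F_def by simp
  have veq: "v y = K * (\<integral>x. norm (y - x) powr (-A) * F (v x) \<partial>lborel)" for y
  proof -
    have "(\<integral>x. norm (y - x) powr (-A) * F (w x) \<partial>lborel) = (\<integral>x. norm (y - x) powr (-A) * F (v x) \<partial>lborel)"
      by (rule integral_cong_AE) (measurable, use vw in \<open>eventually_elim, simp\<close>)
    then show ?thesis by (simp only: v_def[of y])
  qed
  have Fv: "\<bar>F (v x)\<bar> \<le> L * \<bar>v x\<bar> powr p0" for x
  proof -
    have "\<bar>F (v x) - F 0\<bar> \<le> L * (\<bar>v x\<bar> powr (p0 - 1) + \<bar>0\<bar> powr (p0 - 1)) * \<bar>v x - 0\<bar>" using vM M' by (intro FL) auto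
    also have "\<dots> = L * (\<bar>v x\<bar> powr (p0 - 1) * \<bar>v x\<bar>)" by simp
    also have "\<bar>v x\<bar> powr (p0 - 1) * \<bar>v x\<bar> = \<bar>v x\<bar> powr p0"
      using powr_add[of "\<bar>v x\<bar>" "p0 - 1" 1] by (cases "v x = 0") auto
    finally show ?thesis by (simp add: F0)
  qed
  have vI: "ennreal \<bar>v y\<bar> \<le> ennreal (K * L) * (\<integral>\<^sup>+x. ennreal (norm (y - x) powr (-A) * \<bar>v x\<bar> powr p0) \<partial>lborel)" for y
  proof -
    have "ennreal \<bar>v y\<bar> = ennreal K * ennreal \<bar>\<integral>x. norm (y - x) powr (-A) * F (v x) \<partial>lborel\<bar>"
      by (subst veq) (use K in \<open>simp add: abs_mult ennreal_mult\<close>)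
    also have "ennreal \<bar>\<integral>x. norm (y - x) powr (-A) * F (v x) \<partial>lborel\<bar> \<le> (\<integral>\<^sup>+x. ennreal \<bar>norm (y - x) powr (-A) * F (v x)\<bar> \<partial>lborel)"
    proof (cases "integrable lborel (\<lambda>x. norm (y - x) powr (-A) * F (v x))")
      case True
      from integral_norm_bound_ennreal[OF True] show ?thesis by simp
    qed (simp add: not_integrable_integral_eq)
    also have "\<dots> \<le> (\<integral>\<^sup>+x. ennreal L * ennreal (norm (y - x) powr (-A) * \<bar>v x\<bar> powr p0) \<partial>lborel)"
    proof (rule nn_integral_mono)
      fix x
      have "\<bar>norm (y - x) powr (-A) * F (v x)\<bar> \<le> norm (y - x) powr (-A) * (L * \<bar>v x\<bar> powr p0)"
        unfolding abs_mult using Fv[of x] by (intro mult_mono) auto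
      then show "ennreal \<bar>norm (y - x) powr (-A) * F (v x)\<bar> \<le> ennreal L * ennreal (norm (y - x) powr (-A) * \<bar>v x\<bar> powr p0)"
        using L by (simp add: ennreal_mult[symmetric] mult_ac ennreal_leI)
    qed
    also have "\<dots> = ennreal L * (\<integral>\<^sup>+x. ennreal (norm (y - x) powr (-A) * \<bar>v x\<bar> powr p0) \<partial>lborel)"
      by (rule nn_integral_cmult) measurable
    finally show ?thesis using K L by (simp add: ennreal_mult mult.assoc mult_left_mono)
  qed
  have "(\<integral>\<^sup>+x. ennreal (\<bar>v x\<bar> powr al) \<partial>lborel) = (\<integral>\<^sup>+x. ennreal (u x powr al) \<partial>lborel)"
    by (rule nn_integral_cong_AE) (use vu in \<open>eventually_elim, simp add: u0\<close>)
  then have vL: "(\<integral>\<^sup>+x. ennreal (\<bar>v x\<bar> powr al) \<partial>lborel) < \<infinity>" using uL by simp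
  interpret riesz_fixpoint v s "K * L" M' A al p0 F K L
  proof unfold_locales
    show "v y = K * (\<integral>x. norm (y - x) powr (-A) * F (v x) \<partial>lborel)" for y by (rule veq)
  qed (use s A al K L M' vM vL vI FL F0 in \<open>auto simp: p0_def\<close>)
  show ?thesis using vu gradient_decay by blast
qed

section \<open>Verification of the hypotheses for weak solutions\<close>

lemma lebesgue_integral_eq_lborel:
  fixes f g :: "'a::euclidean_space \<Rightarrow> real"
  assumes g: "g \<in> borel_measurable borel" and fg: "AE x in lborel. f x = g x"
  shows "(LINT x|lebesgue. f x) = (LINT x|lborel. g x)"
proof -
  have "(LINT x|lebesgue. f x) = (LINT x|lebesgue. g x)"
    by (rule integral_cong_AE)
       (use lebesgue_measurable_AE_cong[OF g fg] g fg in \<open>auto intro: measurable_completion AE_completion\<close>)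
  also have "\<dots> = (LINT x|lborel. g x)" by (rule integral_completion) (use g in simp)
  finally show ?thesis .
qed

lemma nonneg_borel_representative:
  fixes u :: "'a::euclidean_space \<Rightarrow> real"
  assumes u: "u \<in> borel_measurable lebesgue" and pos: "AE x in lebesgue. u x > 0"
  obtains w where "w \<in> borel_measurable borel" "\<And>x. w x \<ge> 0" "AE x in lborel. w x = u x"
proof -
  obtain u' where u': "u' \<in> borel_measurable lborel" "AE x in lborel. u x = u' x"
    using completion_ex_borel_measurable_real[OF u] by blast
  have [measurable]: "u' \<in> borel_measurable borel" using u'(1) by simp
  have pos': "AE x in lborel. u x > 0" using pos by (simp add: AE_completion_iff)
  show ?thesis
  proof (rule that[of "\<lambda>x. max 0 (u' x)"])
    show "AE x in lborel. max 0 (u' x) = u x" using u'(2) pos' by eventually_elim simp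
  qed simp_all
qed

theorem theorem1p3:
  fixes s p q :: real and u :: "real^'n \<Rightarrow> real"
  assumes "0 < s" and "s < 1"
    and "real CARD('n) > 2 * s"
    and "p \<ge> crit_exp (real CARD('n)) s - 1"
    and "q > (p - 1) * (real CARD('n) / (2 * s)) - 1"
    and "weak_solution s p q u"
  shows "\<exists>v. (AE x in lebesgue. v x = u x) \<and>
    (\<exists>C>0. \<exists>R'>0. \<forall>x. norm x > R' \<longrightarrow>
      (\<exists>D. GDERIV v x :> D \<and> norm D \<le> C * norm x powr (- (real CARD('n) - 2 * s + 1))))"
proof -
  define N where "N = real CARD('n)"
  define A where "A = N - 2 * s"
  define al where "al = crit_exp N s"
  have N: "N = real DIM(real^'n)" "2 * s < N" "N > 0" "A > 0" using assms(1,3) by (auto simp: N_def A_def)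
  have alA: "al = 2 * N / A" by (simp add: al_def crit_exp_def A_def)
  have al2: "al > 2" unfolding alA using N assms(1) by (simp add: A_def field_simps)
  have pal: "p \<ge> al - 1" using assms(4) unfolding al_def N_def .
  have p1: "p > 1" using pal al2 by simp
  have pN: "p * A \<ge> N + 2 * s"
  proof -
    have "(al - 1) * A \<le> p * A" using pal N by (intro mult_right_mono) auto
    also have "(al - 1) * A = N + 2 * s" unfolding alA using N by (simp add: field_simps A_def)
    finally show ?thesis .
  qed
  \<comment> \<open>A rearrangement of \<open>p * A \<ge> N + 2 * s\<close>, that is, of
    \<open>p\<close> being at least critical. It makes the lower bound assumed for \<open>q\<close>
    at least \<open>p\<close>.\<close>
  have "p + 1 \<le> (p - 1) * (N / (2 * s))"
    using pN assms(1) unfolding A_def by (simp add: field_simps)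
  then have pq: "p < q" using assms(5) unfolding N_def by simp
  \<comment> \<open>The convergence condition \<open>s < N / (2 * r)\<close> of
    \<open>riesz_representation\<close> for \<open>r = (p + 1) / p\<close>, the exponent to which
    \<open>w powr p\<close> is integrable.\<close>
  have Nps: "s * (p + 1) < p * N / 2"
  proof -
    have "p * A = p * N - 2 * (s * p)" unfolding A_def by (simp add: algebra_simps)
    then have "p * N \<ge> 2 * (s * p) + N + 2 * s" using pN by simp
    then have "p * N > 2 * (s * p) + 2 * s" using N by linarith
    then show ?thesis by (simp add: algebra_simps)
  qed
  have Nqs: "s * (q + 1) < q * N / 2"
  proof -
    have "(q - p) * s \<le> (q - p) * (N / 2)" using pq N by (intro mult_left_mono) auto
    then show ?thesis using Nps by (simp add: algebra_simps)
  qed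

  have u: "u \<in> Hs_dot s" "u \<in> Lp_space (q + 1)" "AE x in lebesgue. u x > 0"
    and weak: "\<And>h. h \<in> Hs_dot s \<Longrightarrow>
      Hs_form s u h = (LINT x|lebesgue. u x powr p * h x) - (LINT x|lebesgue. u x powr q * h x)"
    using assms(6) unfolding weak_solution_def by auto
  have "u \<in> borel_measurable lebesgue" using u(1) unfolding Hs_dot_def by simp
  then obtain w where w[measurable]: "w \<in> borel_measurable borel" and w0: "\<And>x. w x \<ge> 0" and wu: "AE x in lborel. w x = u x"
    using nonneg_borel_representative[OF _ u(3)] by blast
  note Hf = Hs_dot_finite[OF assms(1,2) N(2)[unfolded N_def] u(1) w wu]
  have wal: "(\<integral>\<^sup>+x. ennreal (w x powr al) \<partial>lborel) < \<infinity>" using Hf(2) w0 unfolding al_def N_def by simp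
  have "(\<integral>\<^sup>+x. ennreal (\<bar>u x\<bar> powr (q + 1)) \<partial>lborel) < \<infinity>"
    by (rule ennpowr_finiteD[of _ "1 / (q + 1)"]) (use u(2) in \<open>simp add: Lp_space_def Lp_norm_eq\<close>)
  moreover have "(\<integral>\<^sup>+x. ennreal (w x powr (q + 1)) \<partial>lborel) = (\<integral>\<^sup>+x. ennreal (\<bar>u x\<bar> powr (q + 1)) \<partial>lborel)"
    by (rule nn_integral_cong_AE) (use wu in \<open>eventually_elim, metis abs_of_nonneg w0\<close>)
  ultimately have wq: "(\<integral>\<^sup>+x. ennreal (w x powr (q + 1)) \<partial>lborel) < \<infinity>" by simp
  \<comment> \<open>The exponent \<open>p + 1\<close> lies between \<open>al\<close> and
    \<open>q + 1\<close>, so its power is dominated by the sum of the other two.\<close>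
  have wp: "(\<integral>\<^sup>+x. ennreal (w x powr (p + 1)) \<partial>lborel) < \<infinity>"
  proof -
    have "ennreal (w x powr (p + 1)) \<le> ennreal (w x powr al) + ennreal (w x powr (q + 1))" for x
    proof (cases "w x \<le> 1")
      case True
      then have "w x powr (p + 1) \<le> w x powr al"
        using w0[of x] pal by (cases "w x = 0") (auto intro!: powr_mono')
      then show ?thesis by (intro add_increasing2 ennreal_leI) auto
    next
      case False
      then have "w x powr (p + 1) \<le> w x powr (q + 1)" using pq by (intro powr_mono) auto
      then show ?thesis by (intro add_increasing ennreal_leI) auto
    qed
    then have "(\<integral>\<^sup>+x. ennreal (w x powr (p + 1)) \<partial>lborel) \<le> (\<integral>\<^sup>+x. ennreal (w x powr al) + ennreal (w x powr (q + 1)) \<partial>lborel)"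
      by (intro nn_integral_mono)
    also have "\<dots> = (\<integral>\<^sup>+x. ennreal (w x powr al) \<partial>lborel) + (\<integral>\<^sup>+x. ennreal (w x powr (q + 1)) \<partial>lborel)"
      by (rule nn_integral_add) measurable
    also have "\<dots> < \<infinity>" using wal wq by simp
    finally show ?thesis .
  qed
  define f where "f = frac_const N s / 2"
  have f: "f > 0" unfolding f_def using frac_const_pos[OF assms(1,2) N(3)] by simp
  have heat_weak: "f * (\<integral>x. (\<integral>y. (w x - w y) * (heat t (x - a) - heat t (y - a)) / norm (x - y) powr (real DIM(real^'n) + 2 * s) \<partial>lborel) \<partial>lborel)
      = (\<integral>x. w x powr p * heat t (x - a) \<partial>lborel) - (\<integral>x. w x powr q * heat t (x - a) \<partial>lborel)" if t: "t > 0" for t and a :: "real^'n"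
  proof -
    define h where "h x = heat t (x - a)" for x
    have [measurable]: "h \<in> borel_measurable borel" unfolding h_def[abs_def] by measurable
    have "h \<in> Hs_dot s"
      unfolding h_def[abs_def] by (rule heat_mem_Hs_dot(1)[OF assms(1,2) N(2)[unfolded N_def] t])
    from weak[OF this] have "Hs_form s u h = (LINT x|lebesgue. u x powr p * h x) - (LINT x|lebesgue. u x powr q * h x)" .
    moreover have "(LINT x|lebesgue. u x powr r * h x) = (\<integral>x. w x powr r * h x \<partial>lborel)" for r
      by (rule lebesgue_integral_eq_lborel) (measurable, use wu in \<open>eventually_elim, simp\<close>)
    moreover have "Hs_form s u h = f * (\<integral>x. (\<integral>y. (w x - w y) * (h x - h y) / norm (x - y) powr (real DIM(real^'n) + 2 * s) \<partial>lborel) \<partial>lborel)"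
      unfolding f_def N_def by (rule Hs_form_eq) (measurable, fact wu)
    ultimately show ?thesis unfolding h_def by simp
  qed
  have wpow: "(\<lambda>x. w x powr r) \<in> borel_measurable borel" for r by measurable
  have pw: "(\<integral>\<^sup>+x. ennreal ((w x powr p) powr ((p + 1) / p)) \<partial>lborel) < \<infinity>"
    using wp p1 by (simp add: powr_powr)
  have qw: "(\<integral>\<^sup>+x. ennreal ((w x powr q) powr ((q + 1) / q)) \<partial>lborel) < \<infinity>"
    using wq p1 pq by (simp add: powr_powr)
  have "s < real DIM(real^'n) / (2 * ((p + 1) / p))" "s < real DIM(real^'n) / (2 * ((q + 1) / q))"
    using Nps Nqs p1 pq unfolding N(1)[symmetric] by (simp_all add: field_simps)
  note exps = this
  have "(p + 1) / p > 1" "(q + 1) / q > 1" "al > 1" using p1 pq al2 by simp_all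
  note exps1 = this
  have AN: "real DIM(real^'n) - 2 * s = A" by (simp add: A_def N_def)
  have sN: "2 * s < real DIM(real^'n)" using N by simp
  obtain c k where ck: "c > 0" "k > 0"
    "AE y in lborel. ennreal (c * w y) + ennreal k * riesz A (\<lambda>x. w x powr q) y = ennreal k * riesz A (\<lambda>x. w x powr p) y"
    "AE y in lborel. riesz A (\<lambda>x. w x powr p) y < \<infinity>"
    by (rule riesz_representation[OF w w0 assms(1,2) sN Hf(1) heat_mem_Hs_dot(2)[OF assms(1,2) N(2)[unfolded N_def]]
          exps1(3) wal wpow powr_ge_zero exps1(1) exps(1) pw wpow powr_ge_zero exps1(2) exps(2) qw f heat_weak, unfolded AN])
  have "\<exists>v. (AE x in lborel. v x = w x) \<and> (\<exists>C>0. \<exists>R>0. \<forall>x. norm x > R \<longrightarrow> (\<exists>D. GDERIV v x :> D \<and> norm D \<le> C * norm x powr (-(A + 1))))"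
    by (rule gradient_decay_of_representation[OF assms(1) sN AN[symmetric] alA[unfolded N(1)] pal pq w w0 wal ck])
  then obtain v where v: "AE x in lborel. v x = w x"
    "\<exists>C>0. \<exists>R>0. \<forall>x. norm x > R \<longrightarrow> (\<exists>D. GDERIV v x :> D \<and> norm D \<le> C * norm x powr (-(A + 1)))" by blast
  have "AE x in lborel. v x = u x" using v(1) wu by eventually_elim simp
  then have "AE x in lebesgue. v x = u x" by (rule AE_completion)
  then show ?thesis using v(2) unfolding A_def N_def by blast
qed

end
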